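(* Let $(X,\mathcal{B},\mu)$ be the standard (non-atomic) probability measure space and let $\mathrm{Aut}(X,\mu)$ be the group of all measure preserving transformations of $X$ (invertible, identified when equal almost everywhere) with the weak topology. Then $\mathrm{Aut}(X,\mu)$ has the automatic continuity property, the small index property, and uncountable cofinality.
   Context: Let $\mathrm{MALG}$ be the measure algebra of sets in $\mathcal{B}$ modulo null sets, with metric $\rho(A,B)=\mu(A\triangle B)$, regarded as a metric structure with this metric, the operation of symmetric difference $\triangle$, and the constant $\emptyset$. The group $\mathrm{Aut}(X,\mu)$ with the weak topology is isomorphic to $\mathrm{Aut}(\mathrm{MALG})$ with the topology of pointwise convergence. A topological group $G$ has: the automatic continuity property if every homomorphism from $G$ into a separable topological group is continuous; the small index property if every subgroup $H\le G$ with $[G:H]<2^{\omega}$ is open in $G$; uncountable cofinality if there is no countably infinite chain $G_1\le G_2\le\ldots\le G$ of proper subgroups of $G$ with $G=\bigcup_k G_k$. *)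

theory Defs
  imports "HOL-Analysis.Analysis" "HOL-Probability.Probability" "HOL-Algebra.Coset"
    "HOL-Library.Equipollence"
begin

section \<open>Standard non-atomic probability spaces\<close>

definition standard_borel :: "'a measure \<Rightarrow> bool" where
  "standard_borel M \<longleftrightarrow>
    (\<exists>S. completely_metrizable_space S \<and> second_countable S \<and>
         space M = topspace S \<and> sets M = sigma_sets (topspace S) {U. openin S U})"

definition nonatomic :: "'a measure \<Rightarrow> bool" where
  "nonatomic M \<longleftrightarrow>
    (\<forall>A\<in>sets M. 0 < emeasure M A \<longrightarrow>
       (\<exists>B\<in>sets M. B \<subseteq> A \<and> 0 < emeasure M B \<and> emeasure M B < emeasure M A))"

definition standard_nonatomic_prob_space :: "'a measure \<Rightarrow> bool" where
  "standard_nonatomic_prob_space M \<longleftrightarrow> prob_space M \<and> standard_borel M \<and> nonatomic M"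


section \<open>The group of measure preserving transformations\<close>

definition measure_preserving :: "'a measure \<Rightarrow> ('a \<Rightarrow> 'a) set" where
  "measure_preserving M = {T \<in> M \<rightarrow>\<^sub>M M. distr M M T = M}"

text \<open>Since transformations are identified when they agree almost everywhere,
  invertibility is also understood modulo null sets.\<close>

definition mp_transformations :: "'a measure \<Rightarrow> ('a \<Rightarrow> 'a) set" where
  "mp_transformations M =
    {T \<in> measure_preserving M.
       \<exists>S\<in>measure_preserving M. (AE x in M. S (T x) = x) \<and> (AE x in M. T (S x) = x)}"

definition ae_eq :: "'a measure \<Rightarrow> (('a \<Rightarrow> 'a) \<times> ('a \<Rightarrow> 'a)) set" where
  "ae_eq M = {(T, S). T \<in> mp_transformations M \<and> S \<in> mp_transformations M \<and>
                      (AE x in M. T x = S x)}"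

definition Aut :: "'a measure \<Rightarrow> ('a \<Rightarrow> 'a) set monoid" where
  "Aut M = \<lparr>carrier = mp_transformations M // ae_eq M,
            monoid.mult = (\<lambda>p q. \<Union>T\<in>p. \<Union>S\<in>q. ae_eq M `` {T \<circ> S}),
            one = ae_eq M `` {id}\<rparr>"

text \<open>The weak topology is the topology of pointwise convergence of the action on the
  measure algebra with the metric \<open>\<rho>(A, B) = \<mu>(A \<triangle> B)\<close>: a subbasis is given by the sets of
  all classes \<open>p\<close> with \<open>\<rho>(p\<^sup>-\<^sup>1 A, B) < e\<close>, where \<open>p\<^sup>-\<^sup>1 A\<close> is the class of the preimage of
  \<open>A\<close> under any representative of \<open>p\<close>. As \<open>\<rho>(p\<^sup>-\<^sup>1 A, B) = \<rho>(A, p B)\<close> and \<open>A\<close> and \<open>B\<close> range over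
  all measurable sets, the same family of sets arises from images. Preimages are used because
  images of measurable sets under a representative need not be measurable.\<close>

definition weak_topology :: "'a measure \<Rightarrow> ('a \<Rightarrow> 'a) set topology" where
  "weak_topology M = topology_generated_by
    {{p \<in> carrier (Aut M). \<forall>T\<in>p. measure M (sym_diff (T -` A \<inter> space M) B) < e} | A B e.
       A \<in> sets M \<and> B \<in> sets M \<and> 0 < e}"


section \<open>Topological groups\<close>

text \<open>No separation axiom is required of a topological group.\<close>

definition topological_group :: "('g, 'm) monoid_scheme \<Rightarrow> 'g topology \<Rightarrow> bool" where
  "topological_group G \<tau> \<longleftrightarrow>
    group G \<and> topspace \<tau> = carrier G \<and>
    continuous_map (prod_topology \<tau> \<tau>) \<tau> (\<lambda>(x, y). x \<otimes>\<^bsub>G\<^esub> y) \<and>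
    continuous_map \<tau> \<tau> (\<lambda>x. inv\<^bsub>G\<^esub> x)"

text \<open>A definition cannot quantify over types; hence the type of the elements of the target group
  is a parameter; a theorem with a free type variable here covers all target groups.\<close>

definition automatic_continuity ::
    "'h itself \<Rightarrow> ('g, 'm) monoid_scheme \<Rightarrow> 'g topology \<Rightarrow> bool" where
  "automatic_continuity _ G \<tau> \<longleftrightarrow>
    (\<forall>(H :: 'h monoid) \<sigma>. topological_group H \<sigma> \<and> separable_space \<sigma> \<longrightarrow>
       (\<forall>f\<in>hom G H. continuous_map \<tau> \<sigma> f))"

definition small_index_property :: "('g, 'm) monoid_scheme \<Rightarrow> 'g topology \<Rightarrow> bool" where
  "small_index_property G \<tau> \<longleftrightarrow>
    (\<forall>H. subgroup H G \<and> rcosets\<^bsub>G\<^esub> H \<prec> (UNIV :: nat set set) \<longrightarrow> openin \<tau> H)"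

definition uncountable_cofinality :: "('g, 'm) monoid_scheme \<Rightarrow> bool" where
  "uncountable_cofinality G \<longleftrightarrow>
    \<not> (\<exists>K :: nat \<Rightarrow> 'g set.
         (\<forall>n. subgroup (K n) G \<and> K n \<noteq> carrier G) \<and>
         (\<forall>n. K n \<subseteq> K (Suc n)) \<and> carrier G = (\<Union>n. K n))"

end

theory Submission
  imports Defs
begin

text \<open>
  A standard non-atomic probability space is isomorphic, up to null sets, to the unit interval
  (\<open>isomorphic_to_unit_interval\<close>), and its transformations modulo null sets are the automorphisms
  of the measure algebra, with the weak topology becoming pointwise convergence (locale
  \<open>standard_space\<close>). The work is done for automorphisms of an abstract probability algebra; this
  group is written additively, and \<open>nfold W n\<close> is the set of sums of \<open>n\<close> elements of \<open>W\<close>.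

  The first half handles automorphisms of small support. Call an increasing sequence of symmetric
  sets \<open>W n\<close> large if every family of automorphisms indexed by the infinite binary sequences has
  two distinct members whose difference lies in some \<open>W n\<close>. Subgroups of index less than the
  continuum, increasing chains of subgroups that exhaust the group, and sets \<open>- W + W\<close> where
  countably many translates of \<open>W\<close> cover the group all give large sequences. Independent choices
  on countably many disjoint elements produce such families, and a diagonal argument shows that
  some \<open>W n\<close> realises every automorphism of one piece (\<open>extension_of_piece\<close>). Hence the commutators
  of automorphisms supported on some fixed \<open>b\<close> are short products of elements of \<open>W n\<close>; elements of
  \<open>W n\<close> transport all sufficiently small supports into \<open>b\<close> (\<open>transport_small_sets\<close>); and an
  automorphism of small support is a sum of two commutators on a support three times as large
  (\<open>two_commutators\<close>). So all automorphisms of small support lie in \<open>nfold (W n) 20\<close>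
  (\<open>small_supports_in_nfold\<close>). As they generate the whole group (\<open>generated_by_small_supports\<close>),
  a large sequence of subgroups reaches the whole group. This yields the small index property and
  uncountable cofinality.

  For automatic continuity, small supports do not suffice, because an automorphism that is close
  to the identity in the weak topology may move every point. It differs by small supports from
  an automorphism that fixes all dyadic cells of some level and preserves the countable algebra
  of dyadic elements (\<open>partition_correction\<close>, \<open>uniformly_near_Fix\<close>). The automorphisms that
  preserve the dyadic algebra form a Polish group \<open>Gam\<close> for the topology in which the pointwise
  stabilisers \<open>Fix n\<close> of the level \<open>n\<close> cells are a basis at the identity. This group has ample
  generics: there are tuples, built by density and matched by a back-and-forth argument, such that
  two generic one-step extensions which are close to the identity are conjugate by a small
  element commuting with the tuple. By a category argument a symmetric set with countably many
  translates covering \<open>Gam\<close> contains a neighbourhood of the identity in its sixfold sum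
  (\<open>neighbourhood_in_nfold\<close>). Both parts together show that if countably many translates of a
  symmetric set \<open>W\<close> cover the automorphism group, then \<open>nfold W 92\<close> contains a weak neighbourhood
  of the identity (\<open>weak_neighbourhood_in_nfold\<close>). A homomorphism to a separable group yields such
  sets from arbitrarily small neighbourhoods in the target, so it is continuous.
\<close>

no_notation Order.top ("\<top>\<index>") and Order.bottom ("\<bottom>\<index>")
  and Lattice.join (infixl "\<squnion>\<index>" 65) and Lattice.meet (infixl "\<sqinter>\<index>" 70)
unbundle lattice_syntax

section \<open>Probability algebras\<close>

text \<open>Completeness of the metric replaces closure under countable joins: a monotone sequence is Cauchy
  because its measures are bounded, so all countable joins exist and the measure is countably
  additive.\<close>

class prob_algebra = boolean_algebra + complete_space +
  fixes mu :: "'a \<Rightarrow> real"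
  assumes mu_nonneg: "0 \<le> mu a"
    and mu_top: "mu \<top> = 1"
    and mu_sup: "a \<sqinter> b = \<bottom> \<Longrightarrow> mu (a \<squnion> b) = mu a + mu b"
    and dist_mu: "dist a b = mu ((a - b) \<squnion> (b - a))"

lemma inf_bot_mono: "c \<sqinter> d = \<bottom> \<Longrightarrow> a \<le> c \<Longrightarrow> b \<le> d \<Longrightarrow> a \<sqinter> b = (\<bottom>::'a::bounded_lattice)"
  using inf_mono[of a c b d] by (simp add: le_bot)

lemma mu_bot [simp]: "mu (\<bottom>::'a::prob_algebra) = 0"
  using mu_sup[of "\<bottom>::'a" "\<bottom>"] by simp

lemma mu_split: "mu (a::'a::prob_algebra) = mu (a \<sqinter> b) + mu (a - b)"
proof -
  have "(a \<sqinter> b) \<sqinter> (a - b) = \<bottom>" "(a \<sqinter> b) \<squnion> (a - b) = a"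
    by (simp_all add: diff_eq inf_sup_distrib1[symmetric] inf.left_commute inf.commute inf.assoc)
  then show ?thesis using mu_sup by metis
qed

lemma mu_mono: "a \<le> b \<Longrightarrow> mu (a::'a::prob_algebra) \<le> mu b"
  using mu_split[of b a] mu_nonneg[of "b - a"] by (simp add: inf.absorb2)

lemma mu_diff: "a \<le> b \<Longrightarrow> mu (b - a) = mu b - mu (a::'a::prob_algebra)"
  using mu_split[of b a] by (simp add: inf.absorb2)

lemma mu_compl: "mu (- a) = 1 - mu (a::'a::prob_algebra)"
  using mu_split[of \<top> a] by (simp add: mu_top diff_eq)

lemma mu_le1: "mu (a::'a::prob_algebra) \<le> 1"
  using mu_mono[of a \<top>] by (simp add: mu_top)

lemma mu_sup_le: "mu (a \<squnion> b) \<le> mu a + mu (b::'a::prob_algebra)"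
proof -
  have "a \<squnion> b = a \<squnion> (b - a)" by (simp add: diff_eq sup_inf_distrib1)
  moreover have "a \<sqinter> (b - a) = \<bottom>" by (simp add: diff_eq inf.left_commute)
  ultimately have "mu (a \<squnion> b) = mu a + mu (b - a)" using mu_sup by metis
  also have "mu (b - a) \<le> mu b" by (rule mu_mono) (simp add: diff_eq)
  finally show ?thesis by simp
qed

lemma dist_bot: "dist (a::'a::prob_algebra) \<bottom> = mu a"
  by (simp add: dist_mu diff_eq)

lemma mu_eq_0_iff [simp]: "mu (a::'a::prob_algebra) = 0 \<longleftrightarrow> a = \<bottom>"
  using dist_eq_0_iff[of a \<bottom>] by (simp add: dist_bot)

lemma mu_pos_iff [simp]: "0 < mu (a::'a::prob_algebra) \<longleftrightarrow> a \<noteq> \<bottom>"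
  using mu_nonneg[of a] mu_eq_0_iff[of a] by linarith

lemma diff_bot_iff: "(a::'a::boolean_algebra) - b = \<bottom> \<longleftrightarrow> a \<le> b"
  by (simp add: diff_eq inf_shunt)

lemma le_by_mu: "mu ((a::'a::prob_algebra) - b) = 0 \<Longrightarrow> a \<le> b"
  by (simp add: diff_bot_iff)

lemma mu_eq_le_imp_eq: "a \<le> b \<Longrightarrow> mu (a::'a::prob_algebra) = mu b \<Longrightarrow> a = b"
  using mu_diff[of a b] le_by_mu[of b a] by (auto intro: antisym)

lemma dist_le: "a \<le> b \<Longrightarrow> dist a b = mu b - mu (a::'a::prob_algebra)"
  unfolding dist_mu using mu_diff[of a b] by (simp add: diff_bot_iff[THEN iffD2])

lemma dist_mono_diff: "mu (a - b) + mu (b - a) = dist a (b::'a::prob_algebra)"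
  unfolding dist_mu by (rule mu_sup[symmetric]) (simp add: diff_eq inf.left_commute inf.commute inf.assoc)

lemma mu_dist: "\<bar>mu a - mu b\<bar> \<le> dist a (b::'a::prob_algebra)"
  using mu_split[of a b] mu_split[of b a] dist_mono_diff[of a b] mu_nonneg[of "a - b"] mu_nonneg[of "b - a"]
  by (simp add: inf.commute)

lemma dist_inf: "dist (a \<sqinter> c) (b \<sqinter> c) \<le> dist a (b::'a::prob_algebra)"
proof -
  have "(a \<sqinter> c) - (b \<sqinter> c) \<le> a - b" "(b \<sqinter> c) - (a \<sqinter> c) \<le> b - a"
    by (simp_all add: diff_eq inf_sup_distrib1 inf_sup_distrib2 le_infI1 inf.assoc le_infI2)
  then show ?thesis unfolding dist_mu by (intro mu_mono sup_mono)
qed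

lemma dist_compl: "dist (- a) (- b) = dist a (b::'a::prob_algebra)"
  by (simp add: dist_mu diff_eq inf.commute sup.commute)

lemma dist_sup: "dist (a \<squnion> c) (b \<squnion> d) \<le> dist a b + dist c (d::'a::prob_algebra)"
proof -
  have 1: "dist (a \<squnion> c) (b \<squnion> c) \<le> dist a b" for a b c :: 'a
    using dist_inf[of "-a" "-c" "-b"] by (metis compl_sup dist_compl)
  show ?thesis
    using dist_triangle[of "a \<squnion> c" "b \<squnion> d" "b \<squnion> c"] 1[of a c b] 1[of c b d]
    by (simp add: sup.commute)
qed

lemma tendsto_sup_pa: "f \<longlonglongrightarrow> (a::'a::prob_algebra) \<Longrightarrow> g \<longlonglongrightarrow> b \<Longrightarrow> (\<lambda>n. f n \<squnion> g n) \<longlonglongrightarrow> a \<squnion> b"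
proof -
  assume f: "f \<longlonglongrightarrow> a" and g: "g \<longlonglongrightarrow> b"
  have "(\<lambda>n. dist (f n) a + dist (g n) b) \<longlonglongrightarrow> 0"
    by (rule tendsto_add_zero[OF tendsto_dist_iff[THEN iffD1, OF f] tendsto_dist_iff[THEN iffD1, OF g]])
  then have "(\<lambda>n. dist (f n \<squnion> g n) (a \<squnion> b)) \<longlonglongrightarrow> 0"
    by (rule Lim_null_comparison[rotated]) (simp add: dist_sup)
  then show ?thesis by (rule tendsto_dist_iff[THEN iffD2])
qed

lemma tendsto_compl_pa: "f \<longlonglongrightarrow> (a::'a::prob_algebra) \<Longrightarrow> (\<lambda>n. - f n) \<longlonglongrightarrow> - a"
  by (subst tendsto_dist_iff, subst (asm) tendsto_dist_iff) (simp add: dist_compl)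

lemma tendsto_inf_pa: "f \<longlonglongrightarrow> (a::'a::prob_algebra) \<Longrightarrow> g \<longlonglongrightarrow> b \<Longrightarrow> (\<lambda>n. f n \<sqinter> g n) \<longlonglongrightarrow> a \<sqinter> b"
  using tendsto_compl_pa[OF tendsto_sup_pa[OF tendsto_compl_pa tendsto_compl_pa], of f a g b] by simp

lemma tendsto_diff_pa: "f \<longlonglongrightarrow> (a::'a::prob_algebra) \<Longrightarrow> g \<longlonglongrightarrow> b \<Longrightarrow> (\<lambda>n. f n - g n) \<longlonglongrightarrow> a - b"
  unfolding diff_eq by (intro tendsto_inf_pa tendsto_compl_pa)

lemma tendsto_mu: "f \<longlonglongrightarrow> (a::'a::prob_algebra) \<Longrightarrow> (\<lambda>n. mu (f n)) \<longlonglongrightarrow> mu a"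
  using tendsto_dist[OF _ tendsto_const, of f a sequentially \<bottom>] by (simp add: dist_bot)

lemma LIMSEQ_le_pa:
  assumes "f \<longlonglongrightarrow> (a::'a::prob_algebra)" "g \<longlonglongrightarrow> b" "\<And>n. f n \<le> g n" shows "a \<le> b"
proof -
  have "(\<lambda>n. f n - g n) \<longlonglongrightarrow> a - b" using assms by (intro tendsto_diff_pa)
  moreover have "(\<lambda>n. f n - g n) = (\<lambda>n. \<bottom>)" using assms(3) by (simp add: diff_bot_iff fun_eq_iff)
  ultimately have "a - b = \<bottom>" using LIMSEQ_unique tendsto_const by metis
  then show ?thesis by (simp add: diff_bot_iff)
qed

primrec pjoin :: "(nat \<Rightarrow> 'a::prob_algebra) \<Rightarrow> nat \<Rightarrow> 'a" where
  "pjoin a 0 = \<bottom>"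
| "pjoin a (Suc n) = pjoin a n \<squnion> a n"

text \<open>The limit of the partial joins is their least upper bound, because the order is closed in the
  metric.\<close>

definition cjoin :: "(nat \<Rightarrow> 'a::prob_algebra) \<Rightarrow> 'a" where
  "cjoin a = lim (pjoin a)"

lemma incseq_convergent_pa:
  assumes "incseq (s :: nat \<Rightarrow> 'a::prob_algebra)"
  shows "convergent s"
proof -
  have "Cauchy s"
  proof (rule metric_CauchyI)
    fix e :: real assume "0 < e"
    have "incseq (\<lambda>n. mu (s n))" using assms by (auto simp: incseq_def intro: mu_mono)
    then obtain l where l: "(\<lambda>n. mu (s n)) \<longlonglongrightarrow> l" "\<forall>n. mu (s n) \<le> l"
      using incseq_convergent[of "\<lambda>n. mu (s n)" 1] mu_le1 by auto
    from LIMSEQ_D[OF l(1) \<open>0 < e\<close>] obtain N where N: "\<And>n. n \<ge> N \<Longrightarrow> \<bar>mu (s n) - l\<bar> < e"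
      by auto
    have *: "dist (s m) (s n) < e" if "N \<le> m" "m \<le> n" for m n
    proof -
      have "dist (s m) (s n) = mu (s n) - mu (s m)" using assms that by (intro dist_le) (simp add: incseq_def)
      also have "\<dots> \<le> l - mu (s m)" using l(2) by simp
      also have "\<dots> < e" using N[of m] that by simp
      finally show ?thesis .
    qed
    show "\<exists>M. \<forall>m\<ge>M. \<forall>n\<ge>M. dist (s m) (s n) < e"
      using * by (metis dist_commute linear)
  qed
  then show ?thesis by (rule Cauchy_convergent)
qed

lemma incseq_pjoin: "incseq (pjoin a)"
  by (intro incseq_SucI) simp

lemma pjoin_tendsto: "pjoin a \<longlonglongrightarrow> cjoin a"
  unfolding cjoin_def using incseq_convergent_pa[OF incseq_pjoin] by (simp add: convergent_LIMSEQ_iff)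

lemma pjoin_le_cjoin: "pjoin a n \<le> cjoin a"
proof (rule LIMSEQ_le_pa[OF tendsto_const LIMSEQ_ignore_initial_segment[OF pjoin_tendsto]])
  show "pjoin a n \<le> pjoin a (m + n)" for m using incseq_pjoin[of a] by (simp add: incseq_def)
qed

lemma cjoin_upper: "a i \<le> cjoin a"
  using pjoin_le_cjoin[of a "Suc i"] by (simp add: le_sup_iff)

lemma cjoin_least: "(\<And>i. a i \<le> u) \<Longrightarrow> cjoin a \<le> u"
proof (rule LIMSEQ_le_pa[OF pjoin_tendsto tendsto_const])
  assume u: "\<And>i. a i \<le> u"
  show "pjoin a n \<le> u" for n by (induction n) (auto simp: u)
qed

lemma cjoin_disjoint: "(\<And>i. a i \<sqinter> c = \<bottom>) \<Longrightarrow> cjoin a \<sqinter> c = \<bottom>"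
  using cjoin_least[of a "- c"] by (simp add: inf_shunt)

lemma cjoin_mono: "(\<And>i. a i \<le> b i) \<Longrightarrow> cjoin a \<le> cjoin b"
  by (meson cjoin_least cjoin_upper order_trans)

lemma inf_cjoin: "c \<sqinter> cjoin a = cjoin (\<lambda>i. c \<sqinter> a i)"
proof (rule antisym)
  have "a i \<le> - c \<squnion> cjoin (\<lambda>i. c \<sqinter> a i)" for i
    using cjoin_upper[of "\<lambda>i. c \<sqinter> a i" i] by (simp add: shunt1[symmetric] inf.commute)
  then have "cjoin a \<le> - c \<squnion> cjoin (\<lambda>i. c \<sqinter> a i)" by (rule cjoin_least)
  then show "c \<sqinter> cjoin a \<le> cjoin (\<lambda>i. c \<sqinter> a i)" by (simp add: shunt1[symmetric] inf.commute)
  show "cjoin (\<lambda>i. c \<sqinter> a i) \<le> c \<sqinter> cjoin a"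
    by (intro cjoin_least inf_mono order_refl cjoin_upper)
qed

lemma cjoin_single: "(\<And>i. i \<noteq> j \<Longrightarrow> a i = \<bottom>) \<Longrightarrow> cjoin a = a j"
  by (rule antisym[OF cjoin_least cjoin_upper]) (metis bot.extremum order_refl)

definition disjseq :: "(nat \<Rightarrow> 'a::prob_algebra) \<Rightarrow> bool" where
  "disjseq a \<longleftrightarrow> (\<forall>i j. i \<noteq> j \<longrightarrow> a i \<sqinter> a j = \<bottom>)"

lemma disjseqD: "disjseq a \<Longrightarrow> i \<noteq> j \<Longrightarrow> a i \<sqinter> a j = \<bottom>"
  by (auto simp: disjseq_def)

lemma pjoin_disjoint: "(\<And>i. i < n \<Longrightarrow> a i \<sqinter> c = \<bottom>) \<Longrightarrow> pjoin a n \<sqinter> c = \<bottom>"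
  by (induction n) (auto simp: inf_sup_distrib2)

lemma mu_pjoin: "disjseq a \<Longrightarrow> mu (pjoin a n) = (\<Sum>i<n. mu (a i))"
  by (induction n) (auto simp: mu_sup pjoin_disjoint disjseq_def)

lemma mu_cjoin: "disjseq a \<Longrightarrow> (\<lambda>i. mu (a i)) sums mu (cjoin a)"
  unfolding sums_def using tendsto_mu[OF pjoin_tendsto, of a] by (simp add: mu_pjoin)

lemma mu_cjoin_le:
  assumes "summable b" "\<And>i. mu (a i) \<le> b i" shows "mu (cjoin a) \<le> suminf b"
proof (rule LIMSEQ_le_const2[OF tendsto_mu[OF pjoin_tendsto]])
  have b0: "0 \<le> b i" for i using assms(2)[of i] mu_nonneg[of "a i"] by linarith
  have "mu (pjoin a n) \<le> (\<Sum>i<n. b i)" for n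
  proof (induction n)
    case (Suc n)
    then show ?case using mu_sup_le[of "pjoin a n" "a n"] assms(2)[of n] by simp
  qed simp
  also have "(\<Sum>i<n. b i) \<le> suminf b" for n using assms(1) b0 by (intro sum_le_suminf) auto
  finally show "\<exists>N. \<forall>n\<ge>N. mu (pjoin a n) \<le> suminf b" by blast
qed

section \<open>Automorphisms\<close>

text \<open>Composition is written additively, although it is not commutative, in order to use the class
  of additively written groups: \<open>g + h\<close> applies \<open>h\<close> first.\<close>

typedef (overloaded) 'a maut = "{f :: 'a::prob_algebra \<Rightarrow> 'a. bij f \<and> (\<forall>a b. f a \<le> f b \<longleftrightarrow> a \<le> b) \<and> (\<forall>a. mu (f a) = mu a)}"
  morphisms act Maut
  by (rule exI[of _ id]) simp

setup_lifting type_definition_maut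

instantiation maut :: (prob_algebra) group_add
begin

lift_definition zero_maut :: "'a maut" is "\<lambda>x. x" by (simp add: bij_id[unfolded id_def])

lift_definition plus_maut :: "'a maut \<Rightarrow> 'a maut \<Rightarrow> 'a maut" is "\<lambda>f g x. f (g x)"
  using bij_comp[unfolded comp_def] by auto

lift_definition uminus_maut :: "'a maut \<Rightarrow> 'a maut" is "inv_into UNIV"
  by (metis bij_imp_bij_inv bij_inv_eq_iff)

definition minus_maut :: "'a maut \<Rightarrow> 'a maut \<Rightarrow> 'a maut" where "minus_maut f g = f + - g"

instance
proof
  fix a b c :: "'a maut"
  show "a + b + c = a + (b + c)" by transfer simp
  show "0 + a = a" by transfer simp
  show "a + 0 = a" by transfer simp
  show "- a + a = 0" by transfer (auto simp: bij_is_inj)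
  show "a + - b = a - b" by (simp add: minus_maut_def)
qed
end

lemma act_0 [simp]: "act 0 a = a" by transfer simp
lemma act_plus: "act (g + h) a = act g (act h a)" by transfer simp
lemma act_minus1 [simp]: "act (- g) (act g a) = a" by (simp add: act_plus[symmetric])
lemma act_minus2 [simp]: "act g (act (- g) a) = a" by (simp add: act_plus[symmetric])
lemma act_le_iff [simp]: "act g a \<le> act g b \<longleftrightarrow> a \<le> b" by transfer simp
lemma act_mu [simp]: "mu (act g a) = mu a" by transfer simp
lemma act_eq_iff [simp]: "act g a = act g b \<longleftrightarrow> a = b" by (metis act_minus1)
lemma act_eq_swap: "act g a = b \<longleftrightarrow> a = act (- g) b" by (metis act_minus1 act_minus2)
lemma act_le_swap: "act g a \<le> b \<longleftrightarrow> a \<le> act (- g) b" by (metis act_le_iff act_minus1 act_minus2)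
lemma maut_eqI: "(\<And>a. act g a = act h a) \<Longrightarrow> g = h"
  using act_inject by blast

lemma act_sup: "act g (a \<squnion> b) = act g a \<squnion> act g b"
proof (rule antisym)
  have "a \<squnion> b \<le> act (- g) (act g a \<squnion> act g b)"
    by (intro le_supI act_le_swap[THEN iffD1]) simp_all
  then show "act g (a \<squnion> b) \<le> act g a \<squnion> act g b" by (rule act_le_swap[THEN iffD2])
qed (simp add: le_supI)

lemma act_inf: "act g (a \<sqinter> b) = act g a \<sqinter> act g b"
proof (rule antisym)
  have "act (- g) (act g a \<sqinter> act g b) \<le> a \<sqinter> b" by (simp add: act_le_swap)
  then have "act g (act (- g) (act g a \<sqinter> act g b)) \<le> act g (a \<sqinter> b)" by (simp only: act_le_iff)
  then show "act g a \<sqinter> act g b \<le> act g (a \<sqinter> b)" by simp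
qed simp

lemma act_bot [simp]: "act g \<bottom> = \<bottom>" by (metis act_mu mu_bot mu_eq_0_iff)
lemma act_bot_iff [simp]: "act g a = \<bottom> \<longleftrightarrow> a = \<bottom>" by (metis act_bot act_eq_iff)
lemma act_top [simp]: "act g \<top> = \<top>" by (metis act_le_iff act_minus2 top.extremum top.extremum_unique)
lemma act_compl: "act g (- a) = - act g a"
  by (rule compl_unique[symmetric]) (simp_all add: act_inf[symmetric] act_sup[symmetric])
lemma act_diff: "act g (a - b) = act g a - act g b" by (simp add: diff_eq act_inf act_compl)
lemma act_dist [simp]: "dist (act g a) (act g b) = dist a b"
  by (simp add: dist_mu act_diff[symmetric] act_sup[symmetric])

lemma act_cjoin: "act g (cjoin a) = cjoin (\<lambda>i. act g (a i))"
proof (rule antisym)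
  have "cjoin a \<le> act (- g) (cjoin (\<lambda>i. act g (a i)))"
    by (intro cjoin_least act_le_swap[THEN iffD1]) (rule cjoin_upper)
  then show "act g (cjoin a) \<le> cjoin (\<lambda>i. act g (a i))" by (simp add: act_le_swap)
  show "cjoin (\<lambda>i. act g (a i)) \<le> act g (cjoin a)" by (intro cjoin_least) (simp add: cjoin_upper)
qed

lemma mautI:
  assumes "\<And>a b. a \<le> b \<Longrightarrow> f a \<le> f b" "\<And>a b. a \<le> b \<Longrightarrow> f' a \<le> f' b"
    "\<And>a. f' (f a) = a" "\<And>a. f (f' a) = a" "\<And>a. mu (f a) = mu a"
  obtains g :: "'a::prob_algebra maut" where "act g = f" "act (- g) = f'"
proof -
  have "bij f" by (rule o_bij[of f']) (auto simp: assms fun_eq_iff)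
  moreover have "f a \<le> f b \<longleftrightarrow> a \<le> b" for a b using assms by metis
  ultimately have "act (Maut f) = f" using assms by (intro Maut_inverse) auto
  moreover from this have "act (- Maut f) = f'" by (metis act_minus1 assms(4) ext)
  ultimately show thesis using that by blast
qed

text \<open>The images of a partition have the same total measure as the partition; being disjoint, they
  cover the whole algebra, so that the pieces of the inverse maps can be assembled as well.\<close>

lemma glue:
  fixes a :: "nat \<Rightarrow> 'a::prob_algebra"
  assumes a: "disjseq a" "cjoin a = \<top>" and b: "disjseq (\<lambda>i. act (g i) (a i))"
  obtains h where "\<And>i c. c \<le> a i \<Longrightarrow> act h c = act (g i) c"
proof -
  let ?b = "\<lambda>i. act (g i) (a i)"
  have "mu (cjoin ?b) = mu (cjoin a)"
    using mu_cjoin[OF a(1)] mu_cjoin[OF b] by (simp add: sums_iff)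
  then have jb: "cjoin ?b = \<top>" using a(2) by (intro mu_eq_le_imp_eq) (auto simp: mu_top)
  define f where "f c = cjoin (\<lambda>i. act (g i) (c \<sqinter> a i))" for c
  define f' where "f' c = cjoin (\<lambda>i. act (- g i) (c \<sqinter> ?b i))" for c
  have piece: "cjoin (\<lambda>i. act (k i) (c \<sqinter> u i)) \<sqinter> act (k j) (u j) = act (k j) (c \<sqinter> u j)"
    if "disjseq (\<lambda>i. act (k i) (u i))" for c :: 'a and u and k :: "nat \<Rightarrow> 'a maut" and j
  proof -
    have "cjoin (\<lambda>i. act (k i) (c \<sqinter> u i)) \<sqinter> act (k j) (u j) = cjoin (\<lambda>i. act (k j) (u j) \<sqinter> act (k i) (c \<sqinter> u i))"
      by (simp add: inf.commute inf_cjoin)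
    also have "\<dots> = act (k j) (u j) \<sqinter> act (k j) (c \<sqinter> u j)"
    proof (rule cjoin_single)
      fix i assume "i \<noteq> j"
      then have "act (k i) (u i) \<sqinter> act (k j) (u j) = \<bottom>" using that by (simp add: disjseq_def)
      then show "act (k j) (u j) \<sqinter> act (k i) (c \<sqinter> u i) = \<bottom>"
        by (simp add: act_inf inf.left_commute inf.commute inf.assoc)
    qed
    also have "\<dots> = act (k j) (c \<sqinter> u j)" by (simp add: act_inf inf.absorb2)
    finally show ?thesis .
  qed
  have fa: "f c \<sqinter> ?b j = act (g j) (c \<sqinter> a j)" for c j
    unfolding f_def by (rule piece[OF b])
  have fb: "f' c \<sqinter> a j = act (- g j) (c \<sqinter> ?b j)" for c j
    unfolding f'_def using piece[of "\<lambda>i. - g i" ?b c j] a(1) by simp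
  have "f' (f c) = c" for c
    unfolding f'_def[of "f c"] fa by (simp add: inf_cjoin[symmetric] a(2))
  moreover have "f (f' c) = c" for c
    unfolding f_def[of "f' c"] fb by (simp add: inf_cjoin[symmetric] jb)
  moreover have "f c \<le> f d" "f' c \<le> f' d" if "c \<le> d" for c d
    unfolding f_def f'_def using that by (auto intro!: cjoin_mono le_infI1)
  moreover have "mu (f c) = mu c" for c
  proof -
    have "disjseq (\<lambda>i. act (g i) (c \<sqinter> a i))" "disjseq (\<lambda>i. c \<sqinter> a i)"
      using a(1) b unfolding disjseq_def act_inf
      by (metis (no_types, lifting) inf.assoc inf.left_commute inf_bot_right)+
    from mu_cjoin[OF this(1)] mu_cjoin[OF this(2)] show ?thesis
      unfolding f_def by (simp add: sums_iff inf_cjoin[symmetric] a(2))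
  qed
  ultimately obtain h where h: "act h = f" using mautI[of f f'] by metis
  show thesis
  proof (rule that[of h])
    fix i c assume c: "c \<le> a i"
    have "act (g k) (c \<sqinter> a k) = \<bottom>" if "k \<noteq> i" for k
      using c disjseqD[OF a(1) that] by (simp add: inf.absorb_iff1) (metis inf.assoc inf.commute inf_bot_right)
    then have "f c = act (g i) (c \<sqinter> a i)" unfolding f_def by (rule cjoin_single)
    then show "act h c = act (g i) c" using c by (simp add: h inf.absorb1)
  qed
qed

definition supported :: "'a::prob_algebra \<Rightarrow> 'a maut \<Rightarrow> bool" where
  "supported s g \<longleftrightarrow> (\<forall>b. b \<sqinter> s = \<bottom> \<longrightarrow> act g b = b)"

lemma supportedD: "supported s g \<Longrightarrow> b \<sqinter> s = \<bottom> \<Longrightarrow> act g b = b"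
  by (simp add: supported_def)

lemma supported_0 [simp]: "supported s 0" by (simp add: supported_def)
lemma supported_top [simp]: "supported \<top> g" by (simp add: supported_def)

lemma supported_plus: "supported s g \<Longrightarrow> supported s h \<Longrightarrow> supported s (g + h)"
  by (simp add: supported_def act_plus)

lemma supported_uminus: "supported s g \<Longrightarrow> supported s (- g)"
  by (metis supported_def act_minus1)

lemma supported_mono: "supported s g \<Longrightarrow> s \<le> t \<Longrightarrow> supported t g"
  by (auto simp: supported_def dest: inf_bot_mono[OF _ order_refl])

lemma supported_act: "supported s g \<Longrightarrow> act g s = s"
  using supportedD[of s g "- s"] by (simp add: act_compl)

lemma supported_act_le: "supported s g \<Longrightarrow> b \<le> s \<Longrightarrow> act g b \<le> s"
  by (metis act_le_iff supported_act)

lemma supported_conj: "supported s g \<Longrightarrow> supported (act h s) (h + g - h)"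
  unfolding supported_def
proof (intro allI impI)
  fix b assume g: "\<forall>b. b \<sqinter> s = \<bottom> \<longrightarrow> act g b = b" and "b \<sqinter> act h s = \<bottom>"
  then have "act (- h) b \<sqinter> s = \<bottom>" by (metis act_bot act_inf act_minus1)
  then show "act (h + g - h) b = b" using g by (simp add: act_plus diff_conv_add_uminus del: add_uminus_conv_diff)
qed

lemma supported_eqI:
  assumes "supported s g" "supported s h" "\<And>b. b \<le> s \<Longrightarrow> act g b = act h b" shows "g = h"
proof (rule maut_eqI)
  fix b
  have b: "b = (b \<sqinter> s) \<squnion> (b - s)" by (simp add: diff_eq inf_sup_distrib1[symmetric])
  have "act g (b - s) = b - s" "act h (b - s) = b - s"
    using assms by (auto intro!: supportedD[of s] simp: diff_eq inf.assoc)
  then show "act g b = act h b" using assms(3)[of "b \<sqinter> s"] b act_sup by (metis inf.cobounded2)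
qed

lemma supported_commute:
  assumes "supported s g" "supported t h" "s \<sqinter> t = \<bottom>" shows "g + h = h + g"
proof (rule supported_eqI[of "s \<squnion> t"])
  have st: "s \<le> s \<squnion> t" "t \<le> s \<squnion> t" by auto
  show "supported (s \<squnion> t) (g + h)" "supported (s \<squnion> t) (h + g)"
    using assms st by (meson supported_mono supported_plus)+
  fix b assume "b \<le> s \<squnion> t"
  then have b: "b = (b \<sqinter> s) \<squnion> (b \<sqinter> t)" by (simp add: inf.absorb1 inf_sup_distrib1[symmetric])
  have 1: "c \<le> s \<Longrightarrow> act h c = c" for c
    using assms by (auto intro!: supportedD[of t] intro: inf_bot_mono)
  have 2: "c \<le> t \<Longrightarrow> act g c = c" for c
    using assms by (auto intro!: supportedD[of s] intro: inf_bot_mono[of t s] simp: inf.commute)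
  have 3: "act g (b \<sqinter> s) \<le> s" "act h (b \<sqinter> t) \<le> t"
    using assms by (auto intro: supported_act_le)
  have "act (g + h) (b \<sqinter> s) = act (h + g) (b \<sqinter> s)" "act (g + h) (b \<sqinter> t) = act (h + g) (b \<sqinter> t)"
    using 1 2 3 by (auto simp: act_plus)
  then show "act (g + h) b = act (h + g) b" using b act_sup by metis
qed

lemma tendsto_act: "f \<longlonglongrightarrow> a \<Longrightarrow> (\<lambda>n. act g (f n)) \<longlonglongrightarrow> act g a"
  by (subst tendsto_dist_iff, subst (asm) tendsto_dist_iff) simp

lemma incseq_le_pa:
  assumes "incseq (s :: nat \<Rightarrow> 'a::prob_algebra)" "s \<longlonglongrightarrow> l" shows "s n \<le> l"
  by (rule LIMSEQ_le_pa[OF tendsto_const LIMSEQ_ignore_initial_segment[OF assms(2), of n]])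
    (use assms(1) in \<open>auto simp: incseq_def\<close>)

text \<open>An exhaustion argument in place of Zorn's lemma: each step gains at least half of the measure
  that can still be gained, so nothing can be added to the limit.\<close>

lemma maximal_element:
  fixes P :: "'a::prob_algebra \<Rightarrow> bool"
  assumes "P \<bottom>" and lim: "\<And>s l. incseq s \<Longrightarrow> (\<And>n. P (s n)) \<Longrightarrow> s \<longlonglongrightarrow> l \<Longrightarrow> P l"
  obtains m where "P m" "\<And>x. P x \<Longrightarrow> m \<le> x \<Longrightarrow> x = m"
proof -
  have step: "\<exists>y. P y \<and> x \<le> y \<and> (\<forall>z. P z \<and> x \<le> z \<longrightarrow> mu z \<le> 2 * mu y - mu x)" if "P x" for x
  proof -
    define A where "A = mu ` {z. P z \<and> x \<le> z}"
    have ne: "A \<noteq> {}" "mu x \<in> A" and bdd: "bdd_above A" unfolding A_def using that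
      by (auto intro!: bdd_aboveI[of _ 1] mu_le1)
    show ?thesis
    proof (cases "Sup A = mu x")
      case True
      then have "mu z \<le> 2 * mu x - mu x" if "P z" "x \<le> z" for z
        using cSup_upper[OF _ bdd, of "mu z"] that by (simp add: A_def)
      then show ?thesis using \<open>P x\<close> by blast
    next
      case False
      then have "mu x < Sup A" using cSup_upper[OF ne(2) bdd] by simp
      then have "(mu x + Sup A) / 2 < Sup A" by simp
      then obtain v where "v \<in> A" "(mu x + Sup A) / 2 < v"
        using less_cSup_iff[OF ne(1) bdd] by blast
      then obtain y where y: "P y" "x \<le> y" "(mu x + Sup A) / 2 < mu y"
        unfolding A_def by blast
      have "mu z \<le> 2 * mu y - mu x" if "P z" "x \<le> z" for z
        using cSup_upper[OF _ bdd, of "mu z"] that y(3) by (simp add: A_def)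
      then show ?thesis using y by blast
    qed
  qed
  have "\<exists>s. \<forall>n. P (s n) \<and> (s n \<le> s (Suc n) \<and> (\<forall>z. P z \<and> s n \<le> z \<longrightarrow> mu z \<le> 2 * mu (s (Suc n)) - mu (s n)))"
    by (rule dependent_nat_choice) (use assms(1) step in auto)
  then obtain s where s: "\<And>n. P (s n)" "\<And>n. s n \<le> s (Suc n)"
    "\<And>n z. P z \<Longrightarrow> s n \<le> z \<Longrightarrow> mu z \<le> 2 * mu (s (Suc n)) - mu (s n)" by blast
  have inc: "incseq s" by (rule incseq_SucI) (rule s(2))
  obtain l where l: "s \<longlonglongrightarrow> l" using incseq_convergent_pa[OF inc] by (auto simp: convergent_def)
  show thesis
  proof (rule that[of l])
    show "P l" using lim[OF inc s(1) l] .
    fix x assume x: "P x" "l \<le> x"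
    have "(\<lambda>n. 2 * mu (s (Suc n)) - mu (s n)) \<longlonglongrightarrow> 2 * mu l - mu l"
      using tendsto_mu[OF l] tendsto_mu[OF LIMSEQ_Suc[OF l]] by (intro tendsto_intros)
    then have "mu x \<le> 2 * mu l - mu l"
    proof (rule LIMSEQ_le_const)
      show "\<exists>N. \<forall>n\<ge>N. mu x \<le> 2 * mu (s (Suc n)) - mu (s n)"
        using s(3)[OF x(1)] incseq_le_pa[OF inc l] x(2) by (meson order_trans)
    qed
    then show "x = l" using mu_mono[OF x(2)] by (intro mu_eq_le_imp_eq[OF x(2), symmetric]) simp
  qed
qed

lemma glue3:
  assumes d: "p \<sqinter> q = \<bottom>" "p \<sqinter> r = \<bottom>" "q \<sqinter> r = \<bottom>" "p \<squnion> q \<squnion> r = (\<top>::'a::prob_algebra)"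
    and i: "act g p \<sqinter> act h q = \<bottom>" "act g p \<sqinter> act k r = \<bottom>" "act h q \<sqinter> act k r = \<bottom>"
  obtains f where "\<And>c. c \<le> p \<Longrightarrow> act f c = act g c" "\<And>c. c \<le> q \<Longrightarrow> act f c = act h c"
    "\<And>c. c \<le> r \<Longrightarrow> act f c = act k c"
proof -
  define a where "a = (\<lambda>i::nat. if i = 0 then p else if i = 1 then q else if i = 2 then r else \<bottom>)"
  define e where "e = (\<lambda>i::nat. if i = 0 then g else if i = 1 then h else if i = 2 then k else 0)"
  have a: "disjseq a" unfolding disjseq_def a_def using d by (auto simp: inf.commute)
  have t: "cjoin a = \<top>"
    using cjoin_upper[of a 0] cjoin_upper[of a 1] cjoin_upper[of a 2] d(4)
    by (intro top.extremum_uniqueI) (auto simp: a_def le_sup_iff simp flip: d(4))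
  have b: "disjseq (\<lambda>i. act (e i) (a i))" unfolding disjseq_def a_def e_def using i by (auto simp: inf.commute)
  from glue[OF a t b] obtain f where f: "\<And>i c. c \<le> a i \<Longrightarrow> act f c = act (e i) c" by metis
  show thesis using f[of _ 0] f[of _ 1] f[of _ 2] by (intro that[of f]) (auto simp: a_def e_def)
qed

lemma compl_disjoint: "a \<le> b \<Longrightarrow> - b \<sqinter> a = (\<bottom>::'a::boolean_algebra)"
  by (metis compl_le_compl_iff inf_shunt)

lemma supported_le_bot: "supported s g \<Longrightarrow> t \<sqinter> s = \<bottom> \<Longrightarrow> c \<le> t \<Longrightarrow> act g c = c"
  by (rule supportedD) (auto intro: inf_bot_mono)

lemma swap_along:
  fixes g :: "'a::prob_algebra maut"
  assumes "p \<sqinter> act g p = \<bottom>"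
  obtains k where "supported (p \<squnion> act g p) k" "\<And>c. c \<le> p \<Longrightarrow> act k c = act g c"
    "\<And>c. c \<le> act g p \<Longrightarrow> act k c = act (- g) c" "k + k = 0"
proof -
  let ?q = "act g p" and ?r = "- (p \<squnion> act g p)"
  have c: "p \<sqinter> ?q = \<bottom>" "p \<sqinter> ?r = \<bottom>" "?q \<sqinter> ?r = \<bottom>" "p \<squnion> ?q \<squnion> ?r = \<top>"
    by (rule assms) (simp_all only: inf_shunt double_compl sup_ge1 sup_ge2 sup_compl_top)
  obtain k where k: "\<And>c. c \<le> p \<Longrightarrow> act k c = act g c" "\<And>c. c \<le> ?q \<Longrightarrow> act k c = act (- g) c"
    "\<And>c. c \<le> ?r \<Longrightarrow> act k c = act 0 c"
    using c by (rule glue3[of p ?q ?r g "- g" 0]) (use c in \<open>auto simp: inf.commute\<close>)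
  have s: "supported (p \<squnion> ?q) k"
    unfolding supported_def using k(3) by (auto simp: inf_shunt)
  have "k + k = 0"
  proof (rule supported_eqI[OF supported_plus[OF s s]])
    fix b assume "b \<le> p \<squnion> ?q"
    then have b: "b = (b \<sqinter> p) \<squnion> (b \<sqinter> ?q)" by (simp add: inf.absorb1 inf_sup_distrib1[symmetric])
    have "act k (b \<sqinter> p) = act g (b \<sqinter> p)" "act k (act g (b \<sqinter> p)) = b \<sqinter> p"
      using k(1)[of "b \<sqinter> p"] k(2)[of "act g (b \<sqinter> p)"] by auto
    moreover have "act k (b \<sqinter> ?q) = act (- g) (b \<sqinter> ?q)" "act k (act (- g) (b \<sqinter> ?q)) = b \<sqinter> ?q"
      using k(2)[of "b \<sqinter> ?q"] k(1)[of "act (- g) (b \<sqinter> ?q)"] by (auto simp: act_le_swap)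
    ultimately have "act (k + k) ((b \<sqinter> p) \<squnion> (b \<sqinter> ?q)) = (b \<sqinter> p) \<squnion> (b \<sqinter> ?q)"
      by (simp add: act_sup act_plus)
    then show "act (k + k) b = act 0 b" using b by simp
  qed simp
  then show thesis using that s k by blast
qed

lemma involution_neg: "k + k = 0 \<Longrightarrow> - k = (k::'a::group_add)"
  by (simp add: eq_neg_iff_add_eq_0 minus_equation_iff neg_eq_iff_add_eq_0)

lemma disjoint_glue:
  assumes "disjseq a" "\<And>i. supported (a i) (g i)"
  obtains h where "supported (cjoin a) h" "\<And>i c. c \<le> a i \<Longrightarrow> act h c = act (g i) c"
proof -
  define a' where "a' = case_nat (- cjoin a) a"
  define g' where "g' = case_nat 0 g"
  have d: "disjseq a'" unfolding disjseq_def
  proof (intro allI impI)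
    fix i j :: nat assume "i \<noteq> j"
    have *: "- cjoin a \<sqinter> a n = \<bottom>" "a n \<sqinter> - cjoin a = \<bottom>" for n
      using cjoin_upper[of a n] by (simp_all add: inf_shunt inf.commute)
    show "a' i \<sqinter> a' j = \<bottom>" using \<open>i \<noteq> j\<close> disjseqD[OF assms(1)] *
      by (auto simp: a'_def split: nat.split)
  qed
  have "- cjoin a \<le> cjoin a'" using cjoin_upper[of a' 0] by (simp add: a'_def)
  moreover have "cjoin a \<le> cjoin a'" using cjoin_upper[of a' "Suc n" for n] by (intro cjoin_least) (simp add: a'_def)
  ultimately have t: "cjoin a' = \<top>" by (metis sup_compl_top sup.bounded_iff top.extremum_uniqueI)
  have "(\<lambda>i. act (g' i) (a' i)) = a'"
    using assms(2) by (auto simp: a'_def g'_def supported_act split: nat.split)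
  with glue[OF d t, of g'] d obtain h where h: "\<And>i c. c \<le> a' i \<Longrightarrow> act h c = act (g' i) c" by metis
  show thesis
  proof (rule that[of h])
    show "supported (cjoin a) h" unfolding supported_def using h[of _ 0] by (auto simp: a'_def g'_def inf_shunt)
    show "act h c = act (g i) c" if "c \<le> a i" for i c using h[of c "Suc i"] that by (simp add: a'_def g'_def)
  qed
qed

lemma supported_cjoin_eqI:
  assumes "supported (cjoin a) g" "supported (cjoin a) h" "\<And>i c. c \<le> a i \<Longrightarrow> act g c = act h c"
  shows "g = h"
proof (rule supported_eqI[OF assms(1,2)])
  fix b assume "b \<le> cjoin a"
  then have b: "b = cjoin (\<lambda>i. b \<sqinter> a i)" by (simp add: inf_cjoin[symmetric] inf.absorb1)
  have "act g (cjoin (\<lambda>i. b \<sqinter> a i)) = act h (cjoin (\<lambda>i. b \<sqinter> a i))"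
    unfolding act_cjoin using assms(3)[OF inf.cobounded2] by simp
  then show "act g b = act h b" using b by simp
qed

text \<open>An element that is not fixed contains a nonzero part which leaves it, and this part is moved off
  itself.\<close>

lemma fixed_or_moved:
  assumes "\<not> (\<forall>c\<le>q. act g c = c)"
  obtains b where "b \<le> q" "b \<noteq> \<bottom>" "b \<sqinter> act g b = (\<bottom>::'a::prob_algebra)"
proof -
  obtain c where c: "c \<le> q" "act g c \<noteq> c" using assms by blast
  define b where "b = c - act g c"
  have "b \<noteq> \<bottom>"
  proof
    assume "b = \<bottom>"
    then have "c \<le> act g c" by (simp add: b_def diff_bot_iff)
    then show False using mu_eq_le_imp_eq[of c "act g c"] c(2) by simp
  qed
  moreover have "b \<sqinter> act g b = \<bottom>"
    by (rule inf_bot_mono[of "- act g c" "act g c"]) (auto simp: b_def diff_eq)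
  moreover have "b \<le> q" using c(1) by (simp add: b_def diff_eq le_infI1)
  ultimately show thesis using that by blast
qed

text \<open>Let \<open>p\<close> be maximal among the elements disjoint from their image under \<open>g\<close>. Then \<open>g\<close> fixes
  everything outside \<open>p\<close>, its image and its preimage. If \<open>k\<close> exchanges \<open>p\<close> with \<open>act g p\<close> along
  \<open>g\<close>, then \<open>k + g\<close> is the identity on \<open>p\<close> too. Its support \<open>t\<close> has measure at most
  \<open>2 * mu p\<close> and at most \<open>mu s - mu p\<close>; the weighted mean of these bounds gives two thirds.\<close>

lemma split_involution:
  fixes g :: "'a::prob_algebra maut"
  assumes "supported s g"
  obtains p k t where "p \<sqinter> act k p = \<bottom>" "supported (p \<squnion> act k p) k" "p \<squnion> act k p \<le> s" "k + k = 0"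
    "supported t (k + g)" "t \<le> s" "mu t \<le> 2/3 * mu s"
proof -
  obtain p where p: "p \<sqinter> act g p = \<bottom>" and max: "\<And>x. x \<sqinter> act g x = \<bottom> \<Longrightarrow> p \<le> x \<Longrightarrow> x = p"
  proof (rule maximal_element[of "\<lambda>p. p \<sqinter> act g p = \<bottom>"])
    fix x and l assume "incseq x" "\<And>n. x n \<sqinter> act g (x n) = \<bottom>" "x \<longlonglongrightarrow> l"
    then show "l \<sqinter> act g l = \<bottom>"
      using LIMSEQ_unique[OF tendsto_inf_pa[OF _ tendsto_act], of x l x l g \<bottom>] by simp
  qed auto
  have ps: "p \<le> s"
  proof -
    have "act g (p - s) = p - s" using assms by (intro supportedD) (auto simp: diff_eq inf.assoc)
    moreover have "act g (p - s) \<le> act g p" by (simp add: diff_eq)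
    moreover have "p - s \<le> p" by (simp add: diff_eq)
    ultimately have "p - s \<le> p \<sqinter> act g p" by simp
    then have "p - s \<le> \<bottom>" unfolding p .
    then have "p - s = \<bottom>" by (rule le_bot)
    then show ?thesis unfolding diff_bot_iff .
  qed
  obtain k where k: "supported (p \<squnion> act g p) k" "\<And>c. c \<le> p \<Longrightarrow> act k c = act g c"
    "\<And>c. c \<le> act g p \<Longrightarrow> act k c = act (- g) c" "k + k = 0"
    by (rule swap_along[OF p]) blast
  have kp: "act k p = act g p" using k(2) by simp
  have gs: "act g p \<le> s" "act (- g) p \<le> s"
    using ps assms by (auto intro!: supported_act_le supported_uminus)
  define t where "t = (act g p \<squnion> act (- g) p) - p"
  define q where "q = - (p \<squnion> (act g p \<squnion> act (- g) p))"
  have q: "q \<sqinter> p = \<bottom>" "q \<sqinter> act g p = \<bottom>" "q \<sqinter> act (- g) p = \<bottom>"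
    unfolding q_def
    by (rule compl_disjoint[OF sup_ge1] compl_disjoint[OF le_supI2[OF sup_ge1]]
        compl_disjoint[OF le_supI2[OF sup_ge2]])+
  have fix_q: "act g c = c" if "c \<le> q" for c
  proof (rule ccontr)
    assume "act g c \<noteq> c"
    then have "\<not> (\<forall>c\<le>q. act g c = c)" using that by blast
    then obtain b where b: "b \<le> q" "b \<noteq> \<bottom>" "b \<sqinter> act g b = \<bottom>" by (rule fixed_or_moved)
    have b': "b \<sqinter> p = \<bottom>" "b \<sqinter> act g p = \<bottom>" "b \<sqinter> act (- g) p = \<bottom>"
      using b(1) q by (auto intro: inf_bot_mono)
    have "act g (b \<sqinter> act (- g) p) = \<bottom>" using b'(3) by simp
    then have "act g b \<sqinter> p = \<bottom>" by (simp add: act_inf)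
    then have "(p \<squnion> b) \<sqinter> act g (p \<squnion> b) = \<bottom>"
      using b b' p by (simp add: act_sup inf_sup_distrib1 inf_sup_distrib2 inf.commute)
    then have "p \<squnion> b = p" using max by simp
    then have "b \<le> p" by (metis sup.cobounded2)
    then show False using b'(1) b(2) by (simp add: inf.absorb1)
  qed
  have "supported t (k + g)" unfolding supported_def
  proof (intro allI impI)
    fix b assume bt: "b \<sqinter> t = \<bottom>"
    have b: "b = (b \<sqinter> p) \<squnion> (b - p)" by (simp add: diff_eq inf_sup_distrib1[symmetric])
    have "act (k + g) (b \<sqinter> p) = b \<sqinter> p" using k(3)[of "act g (b \<sqinter> p)"] by (simp add: act_plus)
    moreover have "b - p \<le> q"
    proof -
      have "(b - p) \<sqinter> (act g p \<squnion> act (- g) p) = \<bottom>" using bt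
        by (simp add: t_def diff_eq inf.assoc inf.left_commute inf.commute)
      then show ?thesis by (simp add: q_def inf_shunt diff_eq)
    qed
    then have "act (k + g) (b - p) = b - p"
      using fix_q[of "b - p"] supported_le_bot[OF k(1), of q "b - p"] q
      by (simp add: act_plus inf_sup_distrib1)
    ultimately show "act (k + g) b = b" using b act_sup by metis
  qed
  moreover have "t \<le> s" using gs by (simp add: t_def diff_eq le_infI1)
  moreover have "mu t \<le> 2/3 * mu s"
  proof -
    have "mu t \<le> mu (act g p \<squnion> act (- g) p)" by (rule mu_mono) (simp add: t_def diff_eq)
    also have "\<dots> \<le> 2 * mu p" using mu_sup_le[of "act g p" "act (- g) p"] by simp
    finally have "mu t \<le> 2 * mu p" .
    moreover have "mu t \<le> mu (s - p)"
      using gs by (intro mu_mono) (simp add: t_def diff_eq le_infI1)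
    then have "mu t \<le> mu s - mu p" using mu_diff[OF ps] by simp
    ultimately show ?thesis by linarith
  qed
  ultimately show thesis
    using that[of p k t] p k(1,4) ps gs unfolding kp by simp
qed

text \<open>The two properties of a non-atomic measure algebra that are used below; the parameter \<open>T\<close> only
  fixes the type.\<close>

locale homogeneous_algebra =
  fixes T :: "'a::prob_algebra itself"
  assumes divisible: "0 \<le> r \<Longrightarrow> r \<le> mu (a::'a) \<Longrightarrow> \<exists>b\<le>a. mu b = r"
    and homogeneous: "mu (a::'a) = mu b \<Longrightarrow> \<exists>g. act g a = b"
begin

lemma disjoint_pieces:
  assumes "summable r" "\<And>i. 0 \<le> r i" "suminf r \<le> mu (a::'a)"
  obtains t where "disjseq t" "\<And>i. t i \<le> a" "\<And>i. mu (t i) = r i"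
proof -
  have "\<exists>e. \<forall>n. (e n \<le> a \<and> mu (e n) = (\<Sum>i<n. r i)) \<and> e n \<le> e (Suc n)"
  proof (rule dependent_nat_choice)
    show "\<exists>x\<le>a. mu x = (\<Sum>i<0. r i)" by (intro exI[of _ \<bottom>]) simp
    fix x n assume x: "x \<le> a \<and> mu x = (\<Sum>i<n. r i)"
    have "(\<Sum>i<Suc n. r i) \<le> suminf r" using assms by (intro sum_le_suminf) auto
    then have "r n \<le> mu (a - x)" using x assms(3) mu_diff[of x a] by simp
    then obtain b where b: "b \<le> a - x" "mu b = r n" using divisible assms(2) by blast
    then have "x \<sqinter> b = \<bottom>" "b \<le> a" by (auto simp: diff_eq inf_shunt compl_le_swap1)
    then show "\<exists>y. (y \<le> a \<and> mu y = (\<Sum>i<Suc n. r i)) \<and> x \<le> y"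
      using x b(2) by (intro exI[of _ "x \<squnion> b"]) (auto simp: mu_sup)
  qed
  then obtain e where e: "\<And>n. e n \<le> a" "\<And>n. mu (e n) = (\<Sum>i<n. r i)" "\<And>n. e n \<le> e (Suc n)" by blast
  have inc: "m \<le> n \<Longrightarrow> e m \<le> e n" for m n using incseq_SucI[of e, OF e(3)] by (simp add: incseq_def)
  define t where "t n = e (Suc n) - e n" for n
  have *: "t i \<sqinter> t j = \<bottom>" if "i < j" for i j
    by (rule inf_bot_mono[of "e j" "- e j"]) (use inc[of "Suc i" j] that in \<open>auto simp: t_def diff_eq le_infI1\<close>)
  then have "disjseq t" unfolding disjseq_def by (metis inf.commute nat_neq_iff)
  moreover have "mu (t n) = r n" for n using mu_diff[OF e(3)] e(2) by (simp add: t_def)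
  moreover have "t n \<le> a" for n using e(1) by (simp add: t_def diff_eq le_infI1)
  ultimately show thesis using that by blast
qed

lemma swap:
  assumes "p \<sqinter> q = (\<bottom>::'a)" "mu p = mu q"
  obtains k where "act k p = q" "supported (p \<squnion> q) k" "k + k = 0"
proof -
  obtain g where g: "act g p = q" using homogeneous assms(2) by blast
  have "p \<sqinter> act g p = \<bottom>" using assms(1) g by simp
  then obtain k where "supported (p \<squnion> act g p) k" "\<And>c. c \<le> p \<Longrightarrow> act k c = act g c" "k + k = 0"
    by (rule swap_along) blast
  then show thesis using that[of k] g by simp
qed

end

section \<open>Products of elements of a large set\<close>

primrec nfold :: "'g::group_add set \<Rightarrow> nat \<Rightarrow> 'g set" where
  "nfold W 0 = {0}"
| "nfold W (Suc n) = {a + b | a b. a \<in> W \<and> b \<in> nfold W n}"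

lemma nfold_1: "w \<in> W \<Longrightarrow> w \<in> nfold W 1"
  by force

lemma nfold_add: "a \<in> nfold W m \<Longrightarrow> b \<in> nfold W n \<Longrightarrow> a + b \<in> nfold W (m + n)"
proof (induction m arbitrary: a)
  case (Suc m)
  then obtain x y where "a = x + y" "x \<in> W" "y \<in> nfold W m" by auto
  moreover from this have "y + b \<in> nfold W (m + n)" using Suc by blast
  ultimately have "\<exists>a' b'. a + b = a' + b' \<and> a' \<in> W \<and> b' \<in> nfold W (m + n)"
    by (metis add.assoc)
  then show ?case by simp
qed simp

lemma nfold_mono: "W \<subseteq> V \<Longrightarrow> nfold W n \<subseteq> nfold V n"
  by (induction n) auto

lemma nfold_uminus:
  assumes "\<And>w. w \<in> W \<Longrightarrow> - w \<in> W" shows "a \<in> nfold W n \<Longrightarrow> - a \<in> nfold W n"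
proof (induction n arbitrary: a)
  case (Suc n)
  then obtain x y where "a = x + y" "x \<in> W" "y \<in> nfold W n" by auto
  then have "- y + - x \<in> nfold W (n + 1)" using Suc assms by (intro nfold_add nfold_1) auto
  then show ?case using \<open>a = x + y\<close> by (simp only: minus_add Suc_eq_plus1)
qed simp

lemma nfold_nfold: "nfold (nfold W m) n \<subseteq> nfold W (n * m)"
proof (induction n)
  case (Suc n)
  then show ?case using nfold_add[of _ W m _ "n * m"] by auto
qed simp

lemma nfold_subgroup:
  assumes "0 \<in> H" "\<And>a b. a \<in> H \<Longrightarrow> b \<in> H \<Longrightarrow> a + b \<in> H" shows "nfold H n \<subseteq> H"
  using assms by (induction n) auto

text \<open>The index sequences are functions to \<open>bool\<close>, so that a family of continuum many elements of the
  group cannot be separated by the sets \<open>W n\<close>.\<close>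

definition large :: "(nat \<Rightarrow> 'g::group_add set) \<Rightarrow> bool" where
  "large W \<longleftrightarrow> (\<forall>n. 0 \<in> W n) \<and> (\<forall>n. \<forall>w\<in>W n. - w \<in> W n) \<and> (\<forall>n. W n \<subseteq> W (Suc n)) \<and>
     (\<forall>t :: (nat \<Rightarrow> bool) \<Rightarrow> 'g. \<exists>\<alpha> \<beta> n. \<alpha> \<noteq> \<beta> \<and> - t \<alpha> + t \<beta> \<in> W n)"

lemma large_mono: "large W \<Longrightarrow> m \<le> n \<Longrightarrow> W m \<subseteq> W n"
  using lift_Suc_mono_le[of W m n] by (auto simp: large_def)

lemma large_uminus: "large W \<Longrightarrow> w \<in> W n \<Longrightarrow> - w \<in> W n"
  by (simp add: large_def)

lemma large_pair:
  fixes t :: "(nat \<Rightarrow> bool) \<Rightarrow> 'g::group_add"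
  assumes "large W"
  obtains \<alpha> \<beta> n where "\<alpha> \<noteq> \<beta>" "- t \<alpha> + t \<beta> \<in> W n"
proof -
  have "\<forall>t :: (nat \<Rightarrow> bool) \<Rightarrow> 'g. \<exists>\<alpha> \<beta> n. \<alpha> \<noteq> \<beta> \<and> - t \<alpha> + t \<beta> \<in> W n"
    using assms unfolding large_def by (elim conjE)
  from spec[OF this, of t] show thesis using that by blast
qed

section \<open>Small supports\<close>

lemma cjoin_disjoint': "(\<And>i. c \<sqinter> a i = \<bottom>) \<Longrightarrow> c \<sqinter> cjoin a = \<bottom>"
  using cjoin_disjoint[of a c] by (simp add: inf.commute)

text \<open>If every \<open>n\<close> had an automorphism \<open>h n\<close> of \<open>a n\<close> with no extension in \<open>W n\<close>, glue for each binary
  sequence \<open>\<alpha>\<close> those \<open>h j\<close> for which \<open>\<alpha>\<close> is true at the first component of \<open>j\<close>, read as a pair.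
  Two sequences that differ at \<open>i\<close> have a difference that extends \<open>h j\<close>, up to sign, for the
  infinitely many \<open>j\<close> whose first component is \<open>i\<close>, and \<open>W j\<close> contains that difference for large
  \<open>j\<close>.\<close>

lemma extension_of_piece:
  fixes W :: "nat \<Rightarrow> 'a::prob_algebra maut set"
  assumes W: "large W" and a: "disjseq a"
  obtains n where "N \<le> n"
    "\<And>h. supported (a n) h \<Longrightarrow> \<exists>w\<in>W n. supported (cjoin a) w \<and> (\<forall>c\<le>a n. act w c = act h c)"
proof (rule ccontr)
  assume "\<not> thesis"
  have "\<exists>h. supported (a n) h \<and> (N \<le> n \<longrightarrow> (\<forall>w\<in>W n. supported (cjoin a) w \<longrightarrow> (\<exists>c\<le>a n. act w c \<noteq> act h c)))" for n
  proof (cases "N \<le> n")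
    case True
    show ?thesis
    proof (rule ccontr)
      assume "\<not> ?thesis"
      then have "\<exists>w\<in>W n. supported (cjoin a) w \<and> (\<forall>c\<le>a n. act w c = act h c)" if "supported (a n) h" for h
        using that by blast
      then show False using \<open>\<not> thesis\<close> that[OF True] by blast
    qed
  qed (auto intro: exI[of _ 0])
  then have "\<forall>n. \<exists>h. supported (a n) h \<and> (N \<le> n \<longrightarrow> (\<forall>w\<in>W n. supported (cjoin a) w \<longrightarrow> (\<exists>c\<le>a n. act w c \<noteq> act h c)))" ..
  from choice[OF this] obtain h where h: "\<And>n. supported (a n) (h n)"
    "\<And>n w. N \<le> n \<Longrightarrow> w \<in> W n \<Longrightarrow> supported (cjoin a) w \<Longrightarrow> \<exists>c\<le>a n. act w c \<noteq> act (h n) c" by blast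
  have "\<exists>u. supported (cjoin a) u \<and> (\<forall>i. \<forall>c\<le>a i. act u c = act (if \<alpha> (fst (prod_decode i)) then h i else 0) c)" for \<alpha>
    by (rule disjoint_glue[OF a, of "\<lambda>i. if \<alpha> (fst (prod_decode i)) then h i else 0"]) (use h(1) in auto)
  then obtain t where t: "\<And>\<alpha>. supported (cjoin a) (t \<alpha>)"
    "\<And>\<alpha> i c. c \<le> a i \<Longrightarrow> act (t \<alpha>) c = act (if \<alpha> (fst (prod_decode i)) then h i else 0) c" by metis
  obtain \<alpha> \<beta> n where *: "\<alpha> \<noteq> \<beta>" "- t \<alpha> + t \<beta> \<in> W n" by (rule large_pair[OF W])
  obtain i where i: "\<alpha> i \<noteq> \<beta> i" using *(1) by blast
  define j where "j = prod_encode (i, max n N)"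
  have j: "fst (prod_decode j) = i" "n \<le> j" "N \<le> j"
    using le_prod_encode_2[of "max n N" i] by (auto simp: j_def)
  have False if "\<beta> i" "\<not> \<alpha> i" "- t \<alpha> + t \<beta> \<in> W j" for \<alpha> \<beta>
  proof -
    have "supported (cjoin a) (- t \<alpha> + t \<beta>)" using t(1) by (intro supported_plus supported_uminus)
    with h(2)[OF j(3) that(3)] obtain c where c: "c \<le> a j" "act (- t \<alpha> + t \<beta>) c \<noteq> act (h j) c" by blast
    have "act (h j) c \<le> a j" using c(1) h(1) by (rule supported_act_le[rotated])
    then have "act (t \<alpha>) (act (h j) c) = act (h j) c" using t(2)[of "act (h j) c" j \<alpha>] that j(1) by simp
    then have "act (- t \<alpha>) (act (h j) c) = act (h j) c" by (metis act_minus1)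
    moreover have "act (t \<beta>) c = act (h j) c" using t(2)[OF c(1), of \<beta>] that j(1) by simp
    ultimately show False using c(2) by (simp add: act_plus)
  qed
  moreover have "- t \<alpha> + t \<beta> \<in> W j" using *(2) large_mono[OF W j(2)] by blast
  moreover from this have "- t \<beta> + t \<alpha> \<in> W j" using large_uminus[OF W] by (metis minus_add minus_minus)
  ultimately show False using i by blast
qed

text \<open>The parts of \<open>u\<close> and \<open>v\<close> outside \<open>b\<close> have disjoint supports, so they cancel in the commutator.
  Therefore extensions that are not controlled outside \<open>b\<close> can be used to compute commutators.\<close>

lemma commutator_cong:
  assumes g: "supported b g" and h: "supported b h"
    and u: "supported (b \<squnion> d) u" "\<And>c. c \<le> b \<Longrightarrow> act u c = act g c"
    and v: "supported (b \<squnion> e) v" "\<And>c. c \<le> b \<Longrightarrow> act v c = act h c"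
    and disj: "b \<sqinter> d = \<bottom>" "b \<sqinter> e = \<bottom>" "d \<sqinter> e = (\<bottom> :: 'a::prob_algebra)"
  shows "u + v - u - v = g + h - g - h"
proof -
  have rest: "supported d (- g + u)"
    if g: "supported b g" and u: "supported (b \<squnion> d) u" "\<And>c. c \<le> b \<Longrightarrow> act u c = act g c" for g u d
    unfolding supported_def
  proof (intro allI impI)
    fix c assume c: "c \<sqinter> d = \<bottom>"
    have s: "c = (c \<sqinter> b) \<squnion> (c - b)" by (simp add: diff_eq inf_sup_distrib1[symmetric])
    have "act (- g + u) (c \<sqinter> b) = c \<sqinter> b" using u(2)[of "c \<sqinter> b"] by (simp add: act_plus)
    moreover have "(c - b) \<sqinter> b = \<bottom>" "(c - b) \<sqinter> d = \<bottom>"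
      using inf_bot_mono[OF c, of "c - b" d] by (auto simp: diff_eq inf.assoc)
    then have "act (- g + u) (c - b) = c - b"
      using supportedD[OF supported_uminus[OF g], of "c - b"] supportedD[OF u(1), of "c - b"]
      by (simp add: act_plus inf_sup_distrib1)
    ultimately show "act (- g + u) c = c" using s act_sup by metis
  qed
  define u' v' where "u' = - g + u" and "v' = - h + v"
  have u': "supported d u'" and v': "supported e v'"
    unfolding u'_def v'_def using rest[OF g u] rest[OF h v] by auto
  have e: "u = g + u'" "v = h + v'" by (simp_all add: u'_def v'_def add.assoc[symmetric])
  have c: "u' + h = h + u'" "u' + v' = v' + u'" "v' + g = g + v'"
    using supported_commute[OF u' h] supported_commute[OF u' v'] supported_commute[OF v' g] disj
    by (simp_all add: inf.commute)
  have "u + v = (g + h) + (u' + v')" unfolding e using c(1) by (metis add.assoc)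
  moreover have "v + u = (h + g) + (u' + v')" unfolding e using c(2,3) by (metis add.assoc)
  ultimately have "(u + v) - (v + u) = (g + h) - (h + g)"
    by (simp add: diff_conv_add_uminus minus_add add.assoc del: add_uminus_conv_diff)
  then show ?thesis by (simp add: diff_conv_add_uminus minus_add add.assoc del: add_uminus_conv_diff)
qed

lemma supported_cjoin_pieces:
  assumes h: "supported (cjoin t) h" "\<And>i c. c \<le> t i \<Longrightarrow> act h c = act (x i) c"
    and x: "\<And>i. supported (a i) (x i)"
  shows "supported (cjoin a) h"
  unfolding supported_def
proof (intro allI impI)
  fix b assume b: "b \<sqinter> cjoin a = \<bottom>"
  have s: "b = (b - cjoin t) \<squnion> cjoin (\<lambda>i. b \<sqinter> t i)"
    by (simp add: diff_eq inf_sup_distrib1[symmetric] inf_cjoin[symmetric])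
  have "act h (b - cjoin t) = b - cjoin t"
    by (rule supportedD[OF h(1)]) (simp add: diff_eq inf.assoc)
  moreover have "act h (b \<sqinter> t i) = b \<sqinter> t i" for i
    using supportedD[OF x, of "b \<sqinter> t i" i] h(2)[of "b \<sqinter> t i" i] inf_bot_mono[OF b, of "b \<sqinter> t i" "a i"]
    by (simp add: cjoin_upper)
  ultimately have "act h ((b - cjoin t) \<squnion> cjoin (\<lambda>i. b \<sqinter> t i)) = (b - cjoin t) \<squnion> cjoin (\<lambda>i. b \<sqinter> t i)"
    by (simp add: act_sup act_cjoin)
  then show "act h b = b" using s by simp
qed

text \<open>The number with the first \<open>i\<close> binary digits of \<open>\<alpha>\<close>, which names one of \<open>2 ^ i\<close> copies.\<close>

fun label :: "(nat \<Rightarrow> bool) \<Rightarrow> nat \<Rightarrow> nat" where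
  "label \<alpha> 0 = 0"
| "label \<alpha> (Suc i) = 2 * label \<alpha> i + of_bool (\<alpha> i)"

lemma label_less: "label \<alpha> i < 2 ^ i"
  by (induction i) (auto simp: of_bool_def)

lemma label_inj: "label \<alpha> i = label \<beta> i \<Longrightarrow> k < i \<Longrightarrow> \<alpha> k = \<beta> k"
proof (induction i)
  case (Suc i)
  have "label \<alpha> i = label \<beta> i" "\<alpha> i = \<beta> i"
    using Suc(2) by (cases "\<alpha> i"; cases "\<beta> i"; simp; presburger)+
  then show ?case using Suc by (cases "k = i") auto
qed simp

lemma involution_restrict:
  fixes k :: "'a::prob_algebra maut"
  assumes k: "p \<sqinter> act k p = \<bottom>" "k + k = 0" and q: "q \<le> p"
  obtains x where "supported (q \<squnion> act k q) x" "\<And>c. c \<le> q \<squnion> act k q \<Longrightarrow> act x c = act k c" "x + x = 0"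
proof -
  have "q \<sqinter> act k q = \<bottom>" by (rule inf_bot_mono[OF k(1) q]) (use q in simp)
  then obtain x where x: "supported (q \<squnion> act k q) x" "\<And>c. c \<le> q \<Longrightarrow> act x c = act k c"
    "\<And>c. c \<le> act k q \<Longrightarrow> act x c = act (- k) c" "x + x = 0" by (rule swap_along) blast
  have "act x c = act k c" if "c \<le> q \<squnion> act k q" for c
  proof -
    have c: "c = (c \<sqinter> q) \<squnion> (c \<sqinter> act k q)" using that by (simp add: inf.absorb1 inf_sup_distrib1[symmetric])
    have "act x ((c \<sqinter> q) \<squnion> (c \<sqinter> act k q)) = act k ((c \<sqinter> q) \<squnion> (c \<sqinter> act k q))"
      unfolding act_sup using x(2)[of "c \<sqinter> q"] x(3)[of "c \<sqinter> act k q"] involution_neg[OF k(2)] by simp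
    then show ?thesis using c by simp
  qed
  then show thesis using that x(1,4) by blast
qed

lemma involution_split:
  fixes k :: "'a::prob_algebra maut"
  assumes pk: "p \<sqinter> act k p = \<bottom>" and ks: "supported (p \<squnion> act k p) k" and kk: "k + k = 0"
    and p: "p1 \<sqinter> p2 = \<bottom>" "p1 \<squnion> p2 = p"
    and x: "supported (p1 \<squnion> act k p1) x" "\<And>c. c \<le> p1 \<squnion> act k p1 \<Longrightarrow> act x c = act k c"
    and y: "supported (p2 \<squnion> act k p2) y" "\<And>c. c \<le> p2 \<squnion> act k p2 \<Longrightarrow> act y c = act k c"
  shows "k = x + y"
proof -
  let ?q1 = "p1 \<squnion> act k p1" and ?q2 = "p2 \<squnion> act k p2"
  have q: "?q1 \<squnion> ?q2 = p \<squnion> act k p"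
    unfolding p(2)[symmetric] act_sup by (simp add: ac_simps)
  have le: "p1 \<le> p" "p2 \<le> p" using p(2) by auto
  have "p2 \<sqinter> act k p1 = \<bottom>" "p1 \<sqinter> act k p2 = \<bottom>"
    using inf_bot_mono[OF pk le(2), of "act k p1"] inf_bot_mono[OF pk le(1), of "act k p2"] le by simp_all
  moreover have "act k p1 \<sqinter> act k p2 = \<bottom>" using p(1) by (simp flip: act_inf)
  ultimately have q12: "?q1 \<sqinter> ?q2 = \<bottom>"
    using p(1) by (simp add: inf_sup_distrib1 inf_sup_distrib2 inf.commute)
  have kq2: "act k ?q2 = ?q2" using act_plus[of k k] kk by (simp add: act_sup sup.commute flip: act_plus)
  show ?thesis
  proof (rule supported_eqI[OF ks])
    show "supported (p \<squnion> act k p) (x + y)"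
      by (intro supported_plus supported_mono[OF x(1)] supported_mono[OF y(1)]) (simp_all flip: q)
    fix b assume "b \<le> p \<squnion> act k p"
    then have b: "b = (b \<sqinter> ?q1) \<squnion> (b \<sqinter> ?q2)" unfolding q[symmetric] by (simp add: inf.absorb1 flip: inf_sup_distrib1)
    have "act (x + y) (b \<sqinter> ?q1) = act k (b \<sqinter> ?q1)"
      using supported_le_bot[OF y(1) q12, of "b \<sqinter> ?q1"] x(2)[of "b \<sqinter> ?q1"] by (simp add: act_plus)
    moreover have "act (x + y) (b \<sqinter> ?q2) = act k (b \<sqinter> ?q2)"
    proof -
      have "act k (b \<sqinter> ?q2) \<le> ?q2" by (metis act_le_iff inf.cobounded2 kq2)
      moreover have "?q2 \<sqinter> ?q1 = \<bottom>" using q12 by (simp only: inf.commute)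
      ultimately show ?thesis
        using supported_le_bot[OF x(1), of ?q2 "act k (b \<sqinter> ?q2)"] y(2)[of "b \<sqinter> ?q2"] by (simp add: act_plus)
    qed
    ultimately show "act k b = act (x + y) b" using b act_sup by metis
  qed
qed

context homogeneous_algebra
begin

text \<open>Choose \<open>E\<close> on which \<open>W n\<close> realises every automorphism, an element \<open>y\<close> of half its measure and,
  inside \<open>y\<close>, a piece \<open>b\<close> whose automorphisms extend to elements of \<open>W n\<close> supported on \<open>y\<close>. Two
  automorphisms of \<open>b\<close> are extended by elements of \<open>W n\<close>, one of them after conjugation by an
  element of \<open>W n\<close> that moves \<open>y\<close> except for \<open>b\<close> off itself; by \<open>commutator_cong\<close> the commutator
  does not change. One factor is a single element and the other a conjugate of length three,
  which gives \<open>1 + 3 + 1 + 3 = 8\<close>.\<close>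

lemma commutators_in_nfold:
  fixes W :: "nat \<Rightarrow> 'a maut set"
  assumes W: "large W"
  obtains n b where "b \<noteq> \<bottom>"
    "\<And>g h. supported b g \<Longrightarrow> supported b h \<Longrightarrow> g + h - g - h \<in> nfold (W n) 8"
proof -
  have half: "summable (\<lambda>i. x * (1/2)^i)" "suminf (\<lambda>i. x * (1/2)^i) = 2 * x" for x :: real
    using sums_mult[OF geometric_sums[of "1/2::real"], of x] by (auto simp: sums_iff)
  obtain e where e: "disjseq e" "\<And>i. mu (e i :: 'a) = 1/2 * (1/2)^i"
    using disjoint_pieces[of "\<lambda>i. 1/2 * (1/2)^i" \<top>] half[of "1/2"] by (auto simp: mu_top)
  obtain n0 where n0: "\<And>h. supported (e n0) h \<Longrightarrow> \<exists>w\<in>W n0. supported (cjoin e) w \<and> (\<forall>c\<le>e n0. act w c = act h c)"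
    by (rule extension_of_piece[OF W e(1), of 0]) blast
  define E where "E = e n0"
  have E: "mu E > 0" unfolding E_def e(2) by simp
  have "suminf (\<lambda>i. mu E / 4 * (1/2)^i) \<le> mu E" unfolding half(2) using E by linarith
  from disjoint_pieces[OF half(1) _ this]
  obtain f where f: "disjseq f" "\<And>i. f i \<le> E" "\<And>i. mu (f i) = mu E / 4 * (1/2)^i"
    using mu_nonneg[of E] by auto
  define y where "y = cjoin f"
  have yE: "y \<le> E" unfolding y_def using f(2) by (rule cjoin_least)
  have "(\<lambda>i. mu E / 4 * (1/2)^i) sums mu y"
    using mu_cjoin[OF f(1)] unfolding f(3) y_def .
  then have mu_y: "mu y = mu E / 2" using half(2)[of "mu E / 4"] by (simp add: sums_iff)
  obtain n where n: "n0 \<le> n"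
    "\<And>h. supported (f n) h \<Longrightarrow> \<exists>w\<in>W n. supported y w \<and> (\<forall>c\<le>f n. act w c = act h c)"
    using extension_of_piece[OF W f(1), of n0] unfolding y_def by blast
  define b where "b = f n"
  have by_: "b \<le> y" unfolding b_def y_def by (rule cjoin_upper)
  have "0 < mu b" unfolding b_def f(3) using E by (intro mult_pos_pos) auto
  then have b0: "b \<noteq> \<bottom>" by simp
  define d where "d = y - b"
  have y_eq: "b \<squnion> d = y" "b \<sqinter> d = \<bottom>" using by_ by (auto simp: d_def diff_eq sup_inf_distrib1 sup.absorb2 inf.left_commute)
  have "mu d \<le> mu (E - y)" using mu_mono[of d y] mu_diff[OF yE] mu_y unfolding d_def by (simp add: diff_eq)
  then obtain d' where d': "d' \<le> E - y" "mu d' = mu d" using divisible[OF mu_nonneg] by blast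
  have d'y: "d' \<sqinter> y = \<bottom>" using d'(1) by (simp add: diff_eq inf_shunt)
  have d'd: "d \<sqinter> d' = \<bottom>" "b \<sqinter> d' = \<bottom>"
    using inf_bot_mono[OF d'y order_refl] by_ by (auto simp: d_def diff_eq inf.commute[of _ d'] le_infI1)
  obtain k where k: "act k d = d'" "supported (d \<squnion> d') k"
    using swap[OF d'd(1)] d'(2) by metis
  have dE: "d \<squnion> d' \<le> E" using d'(1) yE by (auto simp: d_def diff_eq intro: le_infI1)
  obtain w where w: "w \<in> W n0" "\<And>c. c \<le> E \<Longrightarrow> act w c = act k c"
    using n0[of k] supported_mono[OF k(2) dE] unfolding E_def by blast
  have wn: "w \<in> W n" using w(1) large_mono[OF W n(1)] by blast
  have kb: "act k c = c" if "c \<le> b" for c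
    by (rule supported_le_bot[OF k(2) _ that]) (use y_eq d'd in \<open>simp add: inf_sup_distrib1\<close>)
  have wb: "act w c = c" "act (- w) c = c" if "c \<le> b" for c
  proof -
    show "act w c = c" using w(2)[of c] kb[OF that] that by_ yE by simp
    then show "act (- w) c = c" by (metis act_minus1)
  qed
  have wy: "act w y = b \<squnion> d'"
    using w(2)[OF yE] kb[of b] k(1) by (simp add: act_sup flip: y_eq(1))
  show thesis
  proof (rule that[OF b0])
    fix g h assume g: "supported b g" and h: "supported b h"
    obtain u where u: "u \<in> W n" "supported y u" "\<And>c. c \<le> b \<Longrightarrow> act u c = act g c"
      using n(2)[of g] g unfolding b_def by blast
    obtain v where v: "v \<in> W n" "supported y v" "\<And>c. c \<le> b \<Longrightarrow> act v c = act h c"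
      using n(2)[of h] h unfolding b_def by blast
    define v' where "v' = w + v - w"
    have v's: "supported (b \<squnion> d') v'" using supported_conj[OF v(2), of w] wy by (simp add: v'_def)
    have v'h: "act v' c = act h c" if "c \<le> b" for c
      using wb[OF that] v(3)[OF that] wb[OF supported_act_le[OF h that]]
      by (simp add: v'_def act_plus diff_conv_add_uminus del: add_uminus_conv_diff)
    have "u + v' - u - v' = g + h - g - h"
      by (rule commutator_cong[OF g h _ u(3) v's v'h]) (use u(2) y_eq d'd in auto)
    moreover have "v' \<in> nfold (W n) 3"
      using nfold_add[OF nfold_add[OF nfold_1[OF wn] nfold_1[OF v(1)]] nfold_1[OF large_uminus[OF W wn]]]
      unfolding v'_def diff_conv_add_uminus by (simp only: one_add_one numeral_eq_Suc add_Suc_right add_Suc add_0 One_nat_def pred_numeral_simps BitM.simps)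
    then have "u + v' + - u + - v' \<in> nfold (W n) (1 + 3 + 1 + 3)"
      by (intro nfold_add nfold_1 nfold_uminus u(1) large_uminus[OF W])
    ultimately show "g + h - g - h \<in> nfold (W n) 8" by simp
  qed
qed

text \<open>Otherwise there are \<open>s i\<close> of rapidly decreasing measure which \<open>W (N + i)\<close> does not carry into
  \<open>b\<close>. Their tail joins \<open>U i\<close> have differences \<open>R i\<close> so small that \<open>2 ^ i\<close> disjoint copies of
  every \<open>R i\<close> fit into \<open>b - U 0\<close>. For a binary sequence \<open>\<alpha>\<close> exchange each \<open>R i\<close> with the copy
  labelled by the first \<open>i\<close> digits of \<open>\<alpha>\<close>. If \<open>\<alpha>\<close> and \<open>\<beta>\<close> differ, the labels differ from some
  index on, and the difference of the two exchanges carries the tail joins, hence some forbidden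
  \<open>s i\<close>, into \<open>b\<close>.\<close>

lemma transport_small_sets:
  fixes W :: "nat \<Rightarrow> 'a maut set"
  assumes W: "large W" and b: "b \<noteq> \<bottom>"
  obtains n \<delta> where "N \<le> n" "0 < \<delta>" "\<And>s. mu s < \<delta> \<Longrightarrow> \<exists>w\<in>W n. act w s \<le> b"
proof (rule ccontr)
  assume not: "\<not> thesis"
  define c where "c = mu b / 4"
  have c: "c > 0" using b by (simp add: c_def)
  have "\<exists>s. mu s < c * (1/4)^i \<and> (\<forall>w\<in>W (N + i). \<not> act w s \<le> b)" for i
    using not that[of "N + i" "c * (1/4)^i"] c by fastforce
  then obtain s where s: "\<And>i. mu (s i) < c * (1/4)^i" "\<And>i w. w \<in> W (N + i) \<Longrightarrow> \<not> act w (s i) \<le> b"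
    by metis
  define U where "U i = cjoin (\<lambda>j. s (i + j))" for i
  have quart: "summable (\<lambda>j. x * (1/4)^j)" "suminf (\<lambda>j. x * (1/4)^j) = 4/3 * x" for x :: real
    using sums_mult[OF geometric_sums[of "1/4::real"], of x] by (auto simp: sums_iff)
  have mu_U: "mu (U i) \<le> 4/3 * c * (1/4)^i" for i
  proof -
    have "mu (U i) \<le> (\<Sum>j. (c * (1/4)^i) * (1/4)^j)"
      unfolding U_def using less_imp_le[OF s(1), of "i + j" for j]
      by (intro mu_cjoin_le quart) (simp add: power_add mult.assoc)
    then show ?thesis using quart(2)[of "c * (1/4)^i"] by simp
  qed
  have U_Suc: "U (Suc i) \<le> U i" for i
    unfolding U_def using cjoin_upper[of "\<lambda>j. s (i + j)" "Suc j" for j] by (intro cjoin_least) simp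
  have U_anti: "i \<le> j \<Longrightarrow> U j \<le> U i" for i j by (rule lift_Suc_antimono_le[of U, OF U_Suc])
  have s_U: "s i \<le> U i" for i unfolding U_def using cjoin_upper[of "\<lambda>j. s (i + j)" 0] by simp
  define R where "R i = U i - U (Suc i)" for i
  have RU: "R i \<le> U i" "R i \<le> U 0" "R i \<sqinter> U (Suc i) = \<bottom>" for i
    using U_anti[of 0 i] by (auto simp: R_def diff_eq le_infI1 inf.assoc)
  have R_disj: "R i \<sqinter> R j = \<bottom>" if "i \<noteq> j" for i j
  proof -
    have "R i \<sqinter> R j = \<bottom>" if "i < j" for i j
      by (rule inf_bot_mono[OF RU(3)[of i] order_refl]) (rule order_trans[OF RU(1)[of j] U_anti[OF Suc_leI[OF that]]])
    then show ?thesis using that by (metis inf.commute nat_neq_iff)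
  qed
  have mu_R: "2^i * mu (R i) \<le> 4/3 * c * (1/2)^i" for i
  proof -
    have "2^i * mu (R i) \<le> 2^i * (4/3 * c * (1/4)^i)"
      using mu_mono[OF RU(1)[of i]] mu_U[of i] by (intro mult_left_mono) auto
    also have "\<dots> = 4/3 * c * (2^i * (1/4)^i)" by (simp only: mult_ac)
    also have "2^i * (1/4)^i = (1/2::real)^i" by (simp flip: power_mult_distrib)
    finally show ?thesis .
  qed
  have half: "summable (\<lambda>j. x * (1/2)^j)" "suminf (\<lambda>j. x * (1/2)^j) = 2 * x" for x :: real
    using sums_mult[OF geometric_sums[of "1/2::real"], of x] by (auto simp: sums_iff)
  have summ: "summable (\<lambda>i. 2^i * mu (R i))"
    by (rule summable_comparison_test_ev[OF always_eventually half(1)[of "4/3 * c"]])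
      (use mu_R in \<open>simp add: abs_mult mu_nonneg\<close>)
  have "(\<Sum>i. 2^i * mu (R i)) \<le> (\<Sum>i. 4/3 * c * (1/2)^i)" by (rule suminf_le[OF mu_R summ half(1)])
  also have "\<dots> = 8/3 * c" by (simp only: half(2))
  also have "\<dots> \<le> mu b - mu (U 0)" using mu_U[of 0] by (simp add: c_def)
  also have "\<dots> \<le> mu (b - U 0)" using mu_split[of b "U 0"] mu_mono[of "b \<sqinter> U 0" "U 0"] by simp
  finally have fits: "(\<Sum>i. 2^i * mu (R i)) \<le> mu (b - U 0)" .
  have "0 \<le> 2^i * mu (R i)" for i by (simp add: mu_nonneg)
  from disjoint_pieces[OF summ this fits]
  obtain P where P: "disjseq P" "\<And>i. P i \<le> b - U 0" "\<And>i. mu (P i) = 2^i * mu (R i)" by blast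
  have "\<exists>Q. disjseq Q \<and> (\<forall>\<sigma>. Q \<sigma> \<le> P i) \<and> (\<forall>\<sigma><2^i. mu (Q \<sigma>) = mu (R i))" for i
  proof -
    define r where "r \<sigma> = (if \<sigma> \<in> {..<2^i} then mu (R i) else 0)" for \<sigma> :: nat
    have "r sums (\<Sum>\<sigma>\<in>{..<2^i :: nat}. mu (R i))" unfolding r_def by (rule sums_If_finite_set) simp
    then have "summable r" "suminf r \<le> mu (P i)" by (auto simp: sums_iff P(3))
    moreover have "0 \<le> r \<sigma>" for \<sigma> by (simp add: r_def mu_nonneg)
    ultimately obtain Q where "disjseq Q" "\<And>\<sigma>. Q \<sigma> \<le> P i" "\<And>\<sigma>. mu (Q \<sigma>) = r \<sigma>"
      using disjoint_pieces[of r "P i"] by blast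
    then show ?thesis by (auto simp: r_def intro!: exI[of _ Q])
  qed
  then obtain Q where Q: "\<And>i. disjseq (Q i)" "\<And>i \<sigma>. Q i \<sigma> \<le> P i" "\<And>i \<sigma>. \<sigma> < 2^i \<Longrightarrow> mu (Q i \<sigma>) = mu (R i)"
    by metis
  have Qb: "Q i \<sigma> \<le> b" for i \<sigma> using order_trans[OF Q(2) P(2), of i \<sigma>] by (simp add: diff_eq)
  have RQ: "R i \<sqinter> Q j \<sigma> = \<bottom>" for i j \<sigma>
  proof -
    have "Q j \<sigma> \<le> b - U 0" using Q(2) P(2) order_trans by blast
    then have "Q j \<sigma> \<le> - U 0" by (simp add: diff_eq)
    then have "U 0 \<sqinter> Q j \<sigma> = \<bottom>" unfolding inf_shunt by (rule compl_le_swap1)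
    then show ?thesis using RU(2) by (rule inf_bot_mono) simp
  qed
  have QQ: "Q i \<sigma> \<sqinter> Q j \<tau> = \<bottom>" if "i \<noteq> j \<or> \<sigma> \<noteq> \<tau>" for i j \<sigma> \<tau>
  proof (cases "i = j")
    case True
    then show ?thesis using that disjseqD[OF Q(1)] by blast
  next
    case False
    show ?thesis by (rule inf_bot_mono[OF disjseqD[OF P(1) False] Q(2) Q(2)])
  qed
  have "\<forall>i \<sigma>. \<exists>k. \<sigma> < 2^i \<longrightarrow> act k (R i) = Q i \<sigma> \<and> supported (R i \<squnion> Q i \<sigma>) k"
    using swap[OF RQ] Q(3) by metis
  then obtain k where k: "\<And>i \<sigma>. \<sigma> < 2^i \<Longrightarrow> act (k i \<sigma>) (R i) = Q i \<sigma>"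
    "\<And>i \<sigma>. \<sigma> < 2^i \<Longrightarrow> supported (R i \<squnion> Q i \<sigma>) (k i \<sigma>)" by metis
  define a where "a \<alpha> i = R i \<squnion> Q i (label \<alpha> i)" for \<alpha> i
  have a: "disjseq (a \<alpha>)" for \<alpha>
    unfolding disjseq_def a_def using R_disj RQ QQ
    by (auto simp: inf_sup_distrib1 inf_sup_distrib2 inf.commute)
  have "\<exists>u. supported (cjoin (a \<alpha>)) u \<and> (\<forall>i. \<forall>c\<le>a \<alpha> i. act u c = act (k i (label \<alpha> i)) c)" for \<alpha>
    using disjoint_glue[OF a[of \<alpha>], of "\<lambda>i. k i (label \<alpha> i)"] k(2)[OF label_less] unfolding a_def by metis
  then obtain t where t: "\<And>\<alpha>. supported (cjoin (a \<alpha>)) (t \<alpha>)"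
    "\<And>\<alpha> i c. c \<le> a \<alpha> i \<Longrightarrow> act (t \<alpha>) c = act (k i (label \<alpha> i)) c" by metis
  obtain \<alpha> \<beta> m where *: "\<alpha> \<noteq> \<beta>" "- t \<alpha> + t \<beta> \<in> W m" by (rule large_pair[OF W])
  define w where "w = - t \<alpha> + t \<beta>"
  obtain l where l: "\<alpha> l \<noteq> \<beta> l" using *(1) by blast
  define i where "i = max (Suc l) m"
  have wR: "act w (R j) \<le> b" if "i \<le> j" for j
  proof -
    have ne: "label \<beta> j \<noteq> label \<alpha> j" using label_inj[of \<alpha> j \<beta> l] l that by (auto simp: i_def)
    have "act (t \<beta>) (R j) = Q j (label \<beta> j)"
      using t(2)[of "R j" \<beta> j] k(1)[OF label_less] by (simp add: a_def)
    moreover have "Q j (label \<beta> j) \<sqinter> a \<alpha> n = \<bottom>" for n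
      using RQ[of n j "label \<beta> j"] QQ[of j n "label \<beta> j" "label \<alpha> n"] ne
      by (cases "n = j") (auto simp: a_def inf_sup_distrib1 inf.commute)
    then have "Q j (label \<beta> j) \<sqinter> cjoin (a \<alpha>) = \<bottom>"
      using cjoin_disjoint[of "a \<alpha>" "Q j (label \<beta> j)"] by (simp add: inf.commute)
    then have "act (- t \<alpha>) (Q j (label \<beta> j)) = Q j (label \<beta> j)"
      by (rule supportedD[OF supported_uminus[OF t(1)]])
    ultimately show ?thesis using Qb by (simp add: w_def act_plus)
  qed
  have "act w (U i) \<le> b \<squnion> act w (U (i + n))" for n
  proof (induction n)
    case (Suc n)
    have "U (i + n) \<le> R (i + n) \<squnion> U (i + Suc n)" by (simp add: R_def diff_eq sup_inf_distrib2)
    then have "act w (U (i + n)) \<le> act w (R (i + n)) \<squnion> act w (U (i + Suc n))" by (simp flip: act_sup)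
    also have "\<dots> \<le> b \<squnion> act w (U (i + Suc n))" using wR[of "i + n"] by (simp add: le_supI1)
    finally show ?case using Suc by (meson le_sup_iff order_trans sup.cobounded1)
  qed simp
  then have small: "mu (act w (U i) - b) \<le> 4/3 * c * (1/4)^(i + n)" for n
  proof -
    have "act w (U i) - b \<le> act w (U (i + n))"
      using \<open>act w (U i) \<le> b \<squnion> act w (U (i + n))\<close> by (simp add: diff_eq shunt2 sup.commute)
    from mu_mono[OF this] mu_U[of "i + n"] show ?thesis by simp
  qed
  have "(\<lambda>n. 4/3 * c * (1/4)^(i + n)) \<longlonglongrightarrow> 4/3 * c * 0"
    by (intro tendsto_mult tendsto_const) (simp add: power_add LIMSEQ_power_zero tendsto_mult_right_zero)
  then have "mu (act w (U i) - b) \<le> 4/3 * c * 0" by (rule LIMSEQ_le_const) (use small in blast)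
  then have "mu (act w (U i) - b) = 0" using mu_nonneg[of "act w (U i) - b"] by simp
  then have "act w (U i) \<le> b" by (rule le_by_mu)
  then have "act w (s i) \<le> b" using s_U[of i] by (meson act_le_iff order_trans)
  moreover have "w \<in> W (N + i)" 
    using *(2) large_mono[OF W trans_le_add2[OF max.cobounded2]] unfolding w_def i_def by blast
  ultimately show False using s(2) by blast
qed

text \<open>Halve \<open>p\<close> and exchange the halves, by \<open>c0\<close> on \<open>p\<close> and by its conjugate on the image. The
  involution \<open>k\<close> is the product of its restrictions to the two halves, which are conjugate under
  that exchange.\<close>

lemma involution_is_commutator:
  fixes k :: "'a maut"
  assumes pk: "p \<sqinter> act k p = \<bottom>" and ks: "supported (p \<squnion> act k p) k" and kk: "k + k = 0"
  obtains x y where "supported (p \<squnion> act k p) x" "supported (p \<squnion> act k p) y" "k = x + y - x - y"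
proof -
  obtain p1 where p1: "p1 \<le> p" "mu p1 = mu p / 2" using divisible[of "mu p / 2" p] mu_nonneg[of p] by auto
  define p2 where "p2 = p - p1"
  have p: "p1 \<sqinter> p2 = \<bottom>" "p1 \<squnion> p2 = p" "mu p1 = mu p2"
    using p1 mu_diff[OF p1(1)] by (auto simp: p2_def diff_eq sup_inf_distrib1 sup.absorb2 inf.left_commute)
  obtain c0 where c0: "act c0 p1 = p2" "supported p c0" "c0 + c0 = 0"
    using swap[OF p(1,3)] p(2) by metis
  define c1 where "c1 = k + c0 - k"
  have c1: "supported (act k p) c1" unfolding c1_def by (rule supported_conj[OF c0(2)])
  define c where "c = c0 + c1"
  have nk: "- k = k" by (rule involution_neg[OF kk])
  have comm: "c0 + c1 = c1 + c0" by (rule supported_commute[OF c0(2) c1 pk])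
  have c1': "c1 = k + (c0 + k)"
    unfolding c1_def using nk by (simp add: add.assoc diff_conv_add_uminus del: add_uminus_conv_diff)
  have "k + c1 = c0 + k" "k + c0 = c1 + k"
    unfolding c1' using kk by (metis add.assoc add_0, metis add.assoc add_0_right)
  then have kc: "k + c = c + k"
    unfolding c_def using comm by (metis add.assoc)
  have cs: "supported (p \<squnion> act k p) c"
    unfolding c_def using c0(2) c1 by (auto intro!: supported_plus intro: supported_mono)
  let ?q1 = "p1 \<squnion> act k p1" and ?q2 = "p2 \<squnion> act k p2"
  obtain x where x: "supported ?q1 x" "\<And>d. d \<le> ?q1 \<Longrightarrow> act x d = act k d" "x + x = 0"
    by (rule involution_restrict[OF pk kk p1(1)]) blast
  have "act c p1 = p2" using c1 p1(1) pk c0(1)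
    by (simp add: c_def act_plus supported_le_bot[OF c1])
  moreover have "act c (act k p1) = act k (act c p1)" using kc by (metis act_plus)
  ultimately have cq: "act c ?q1 = ?q2" by (simp add: act_sup)
  define y where "y = c + x - c"
  have ys: "supported ?q2 y" using supported_conj[OF x(1), of c] cq by (simp add: y_def)
  have yk: "act y d = act k d" if "d \<le> ?q2" for d
  proof -
    have "act (- c) d \<le> ?q1" using that cq by (simp add: act_le_swap)
    then have "act y d = act c (act k (act (- c) d))"
      using x(2) by (simp add: y_def act_plus diff_conv_add_uminus del: add_uminus_conv_diff)
    also have "\<dots> = act (c + k) (act (- c) d)" by (simp add: act_plus)
    also have "\<dots> = act k d" unfolding kc[symmetric] by (simp add: act_plus)
    finally show ?thesis .
  qed
  have q1: "?q1 \<le> p \<squnion> act k p" using p1(1) by (simp add: le_supI1 le_supI2)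
  have "k = x + y"
    by (rule involution_split[OF pk ks kk p(1,2) x(1,2) ys yk])
  also have "x + y = x + c - x - c"
    using involution_neg[OF x(3)] by (simp add: y_def add.assoc diff_conv_add_uminus del: add_uminus_conv_diff)
  finally have "k = x + c - x - c" .
  moreover have "supported (p \<squnion> act k p) x" by (rule supported_mono[OF x(1) q1])
  ultimately show thesis using that cs by blast
qed

text \<open>Repeated use of \<open>split_involution\<close> writes \<open>g\<close> as an infinite product of involutions \<open>K n\<close> and
  remainders \<open>G n\<close> with \<open>G (Suc n) = K n + G n\<close> whose supports \<open>S n\<close> shrink geometrically, so
  that disjoint copies of all \<open>S n\<close> have total measure at most three times that of \<open>s\<close>. On these
  copies \<open>Phi\<close> acts by the conjugates of \<open>G n\<close> and \<open>Psi\<close> by those of \<open>G (Suc n)\<close>, and they differ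
  by the involution \<open>I\<close> glued from the \<open>K n\<close>. On the other hand \<open>Phi\<close> is \<open>g\<close> together with a
  shifted copy \<open>bb + Psi - bb\<close>. Comparing the two expressions leaves an involution and one
  commutator, and the involution is itself a commutator.\<close>

lemma two_commutators:
  fixes g :: "'a maut"
  assumes g: "supported s g" and ms: "3 * mu s \<le> 1"
  obtains u x y z v where "mu u \<le> 3 * mu s" "supported u x" "supported u y" "supported u z" "supported u v"
    "g = (x + y - x - y) + (z + v - z - v)"
proof -
  define R where "R = (\<lambda>(g :: 'a maut, s) (g', s'). \<exists>p k. p \<sqinter> act k p = \<bottom> \<and> supported (p \<squnion> act k p) k \<and>
    p \<squnion> act k p \<le> s \<and> k + k = 0 \<and> g' = k + g \<and> s' \<le> s \<and> mu s' \<le> 2/3 * mu s)"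
  have "\<exists>f. f 0 = (g, s) \<and> (\<forall>n. supported (snd (f n)) (fst (f n)) \<and> R (f n) (f (Suc n)))"
  proof -
    have "\<exists>y. supported (snd y) (fst y) \<and> R x y" if "supported (snd x) (fst x)" for x :: "'a maut \<times> 'a"
    proof -
      obtain h r where x: "x = (h, r)" by (cases x)
      with that have "supported r h" by simp
      from split_involution[OF this] obtain p k t where
        "p \<sqinter> act k p = \<bottom>" "supported (p \<squnion> act k p) k" "p \<squnion> act k p \<le> r" "k + k = 0"
        "supported t (k + h)" "t \<le> r" "mu t \<le> 2/3 * mu r" by blast
      then show ?thesis unfolding R_def x by (intro exI[of _ "(k + h, t)"]) auto
    qed
    then show ?thesis
      using dependent_nat_choice[of "\<lambda>n f. supported (snd f) (fst f) \<and> (n = 0 \<longrightarrow> f = (g, s))" "\<lambda>n. R"] g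
      by (metis fst_conv snd_conv nat.distinct(1))
  qed
  then obtain f where f: "f 0 = (g, s)" "\<And>n. supported (snd (f n)) (fst (f n))" "\<And>n. R (f n) (f (Suc n))" by blast
  define G where "G n = fst (f n)" for n
  define S where "S n = snd (f n)" for n
  have G0: "G 0 = g" "S 0 = s" and GS: "supported (S n) (G n)" for n using f by (auto simp: G_def S_def)
  have "\<exists>p k. p \<sqinter> act k p = \<bottom> \<and> supported (p \<squnion> act k p) k \<and> p \<squnion> act k p \<le> S n \<and> k + k = 0 \<and>
      G (Suc n) = k + G n \<and> S (Suc n) \<le> S n \<and> mu (S (Suc n)) \<le> 2/3 * mu (S n)" for n
    using f(3)[of n] by (simp add: R_def G_def S_def case_prod_beta)
  then obtain P K where PK: "\<And>n. P n \<sqinter> act (K n) (P n) = \<bottom>" "\<And>n. supported (P n \<squnion> act (K n) (P n)) (K n)"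
    "\<And>n. P n \<squnion> act (K n) (P n) \<le> S n" "\<And>n. K n + K n = 0" "\<And>n. G (Suc n) = K n + G n"
    "\<And>n. S (Suc n) \<le> S n" "\<And>n. mu (S (Suc n)) \<le> 2/3 * mu (S n)" by metis
  have muS: "mu (S n) \<le> mu s * (2/3)^n" for n
  proof (induction n)
    case (Suc n)
    then show ?case using PK(7)[of n] by simp
  qed (simp add: G0)
  have geo: "summable (\<lambda>j. x * (2/3)^j)" "suminf (\<lambda>j. x * (2/3)^j) = 3 * x" for x :: real
    using sums_mult[OF geometric_sums[of "2/3::real"], of x] by (auto simp: sums_iff)
  have summ: "summable (\<lambda>n. mu (S n))"
    by (rule summable_comparison_test_ev[OF always_eventually geo(1)[of "mu s"]])
      (use muS in \<open>simp add: mu_nonneg\<close>)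
  have sumS: "(\<Sum>n. mu (S n)) \<le> 3 * mu s"
    using suminf_le[OF muS summ geo(1)] by (simp only: geo(2))
  have tail: "(\<Sum>n. mu (S (Suc n))) = (\<Sum>n. mu (S n)) - mu s"
    using suminf_split_head[OF summ] by (simp add: G0)
  have "(\<Sum>n. mu (S (Suc n))) \<le> mu (- s)" unfolding tail mu_compl using sumS ms by linarith
  from disjoint_pieces[OF summable_Suc_iff[THEN iffD2, OF summ] mu_nonneg this]
  obtain t' where t': "disjseq t'" "\<And>i. t' i \<le> - s" "\<And>i. mu (t' i) = mu (S (Suc i))" by blast
  define t where "t = case_nat s t'"
  have t: "disjseq t"
    unfolding disjseq_def t_def using disjseqD[OF t'(1)] t'(2)
    by (auto split: nat.split simp: inf_shunt inf.commute) (metis inf.commute inf_shunt compl_le_swap1)+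
  have mut: "mu (t i) = mu (S i)" for i using t'(3) by (auto simp: t_def G0 split: nat.split)
  have "\<exists>th. th 0 = 0 \<and> (\<forall>i. act (th i) (S i) = t i)"
  proof -
    have "\<exists>h. act h (S i) = t i \<and> (i = 0 \<longrightarrow> h = 0)" for i
      using homogeneous[of "S i" "t i"] mut[of i] by (cases i) (auto simp: t_def G0)
    then show ?thesis by metis
  qed
  then obtain th where th: "th 0 = 0" "\<And>i. act (th i) (S i) = t i" by blast
  define U where "U = cjoin t"
  have muU: "mu U = (\<Sum>n. mu (S n))" using mu_cjoin[OF t] by (simp add: sums_iff mut U_def)
  let ?cj = "\<lambda>i h. th i + h - th i"
  have cj_act: "act (?cj i h) c = act (th i) (act h (act (- th i) c))" for i h c
    by (simp add: act_plus diff_conv_add_uminus del: add_uminus_conv_diff)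
  have cj_le: "act (- th i) c \<le> S i" if "c \<le> t i" for i c
    using that by (simp flip: th(2)) (simp add: act_le_swap)
  have cjs: "supported (t i) (?cj i h)" if "supported (S i) h" for i h
    using supported_conj[OF that, of "th i"] th(2) by simp
  have GS1: "supported (S i) (G (Suc i))" for i by (rule supported_mono[OF GS PK(6)])
  have KS: "supported (S i) (K i)" for i by (rule supported_mono[OF PK(2,3)])
  obtain Phi where Phi: "supported U Phi" "\<And>i c. c \<le> t i \<Longrightarrow> act Phi c = act (?cj i (G i)) c"
    unfolding U_def by (rule disjoint_glue[OF t cjs[OF GS]]) blast
  obtain Psi where Psi: "supported U Psi" "\<And>i c. c \<le> t i \<Longrightarrow> act Psi c = act (?cj i (G (Suc i))) c"
    unfolding U_def by (rule disjoint_glue[OF t cjs[OF GS1]]) blast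
  obtain I where I: "supported U I" "\<And>i c. c \<le> t i \<Longrightarrow> act I c = act (?cj i (K i)) c"
    unfolding U_def by (rule disjoint_glue[OF t cjs[OF KS]]) blast
  have KG: "K i + G (Suc i) = G i" for i using PK(4,5) by (simp flip: add.assoc)
  have IPsi: "Phi = I + Psi"
  proof (rule supported_cjoin_eqI)
    show "supported (cjoin t) Phi" "supported (cjoin t) (I + Psi)"
      using Phi(1) I(1) Psi(1) by (auto simp flip: U_def intro: supported_plus)
    fix i c assume c: "c \<le> t i"
    have "act Psi c \<le> t i" using Psi(2)[OF c] supported_act_le[OF cjs[OF GS1] c] by simp
    then have "act (I + Psi) c = act (?cj i (K i)) (act (?cj i (G (Suc i))) c)"
      using I(2) Psi(2)[OF c] by (simp add: act_plus)
    also have "\<dots> = act (th i) (act (K i + G (Suc i)) (act (- th i) c))" by (simp only: cj_act act_minus1 act_plus)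
    also have "\<dots> = act Phi c" using Phi(2)[OF c] by (simp add: KG cj_act)
    finally show "act Phi c = act (I + Psi) c" by simp
  qed
  obtain x y where xy: "supported U x" "supported U y" "I = x + y - x - y"
  proof -
    define p where "p = cjoin (\<lambda>i. act (th i) (P i))"
    have PS: "P i \<le> S i" "act (K i) (P i) \<le> S i" for i using PK(3)[of i] by auto
    have Pt: "act (th i) (P i) \<le> t i" "act (th i) (act (K i) (P i)) \<le> t i" for i
      using PS[of i] by (simp_all flip: th(2))
    have Ip: "act I p = cjoin (\<lambda>i. act (th i) (act (K i) (P i)))"
      unfolding p_def act_cjoin using I(2)[OF Pt(1)] by (simp add: cj_act)
    have "p \<sqinter> act I p = \<bottom>"
    proof -
      have "act (th i) (P i) \<sqinter> act (th j) (act (K j) (P j)) = \<bottom>" for i j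
      proof (cases "i = j")
        case True
        then show ?thesis using PK(1) by (simp flip: act_inf)
      next
        case False
        show ?thesis by (rule inf_bot_mono[OF disjseqD[OF t False] Pt])
      qed
      then show ?thesis unfolding Ip unfolding p_def
        by (intro cjoin_disjoint cjoin_disjoint')
    qed
    moreover have "supported (p \<squnion> act I p) I"
    proof -
      have "supported (cjoin (\<lambda>i. act (th i) (P i \<squnion> act (K i) (P i)))) I"
        by (rule supported_cjoin_pieces[OF I(1)[unfolded U_def] I(2)]) (auto intro: supported_conj PK(2))
      moreover have "act (th i) (P i \<squnion> act (K i) (P i)) \<le> p \<squnion> act I p" for i
        using cjoin_upper[of "\<lambda>i. act (th i) (P i)" i] cjoin_upper[of "\<lambda>i. act (th i) (act (K i) (P i))" i]
        unfolding Ip by (simp add: act_sup p_def le_supI1 le_supI2)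
      ultimately show ?thesis by (meson cjoin_least supported_mono)
    qed
    moreover have "I + I = 0"
    proof (rule supported_cjoin_eqI)
      show "supported (cjoin t) (I + I)" "supported (cjoin t) 0" using I(1) by (auto simp: U_def intro: supported_plus)
      fix i c assume c: "c \<le> t i"
      have "act I c \<le> t i" using I(2)[OF c] supported_act_le[OF cjs[OF KS] c] by simp
      then have "act (I + I) c = act (th i) (act (K i + K i) (act (- th i) c))"
        using I(2) c by (simp add: act_plus cj_act)
      then show "act (I + I) c = act 0 c" by (simp add: PK(4))
    qed
    ultimately obtain x y where "supported (p \<squnion> act I p) x" "supported (p \<squnion> act I p) y" "I = x + y - x - y"
      by (rule involution_is_commutator)
    moreover have "p \<squnion> act I p \<le> U"
    proof -
      have "p \<le> U" unfolding p_def U_def by (rule cjoin_mono[OF Pt(1)])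
      then show ?thesis using supported_act_le[OF I(1)] by simp
    qed
    ultimately show thesis using that supported_mono by blast
  qed
  define A where "A i = act (th i) (S (Suc i))" for i
  have At: "A i \<le> t i" for i unfolding A_def th(2)[symmetric] by (simp add: PK(6))
  have Ad: "disjseq A" unfolding disjseq_def using inf_bot_mono[OF disjseqD[OF t] At At] by blast
  have AU: "cjoin A \<le> U" unfolding U_def by (rule cjoin_mono[OF At])
  define C where "C = U - cjoin A"
  have "mu C = mu s"
    using mu_diff[OF AU] mu_cjoin[OF Ad] tail muU by (simp add: C_def A_def sums_iff)
  then obtain h where h: "act h C = s" using homogeneous by blast
  define a where "a = case_nat (- U) (case_nat C A)"
  define e where "e = case_nat 0 (case_nat h (\<lambda>i. th (Suc i) - th i))"
  have ad: "disjseq a"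
  proof -
    have "C \<sqinter> A i = \<bottom>" for i by (rule inf_bot_mono[of "- cjoin A" "cjoin A"]) (auto simp: C_def diff_eq cjoin_upper)
    moreover have "U \<sqinter> - U = \<bottom>" by simp
    then have "C \<sqinter> - U = \<bottom>" "A i \<sqinter> - U = \<bottom>" for i
      using inf_bot_mono[of U "- U"] order_trans[OF cjoin_upper[of A i] AU]
      by (auto simp: C_def diff_eq)
    ultimately show ?thesis unfolding disjseq_def a_def
      using disjseqD[OF Ad] by (auto split: nat.split simp: inf.commute)
  qed
  have at: "cjoin a = \<top>"
  proof -
    have 1: "- U \<le> cjoin a" "C \<le> cjoin a" "cjoin A \<le> cjoin a"
      using cjoin_upper[of a 0] cjoin_upper[of a 1] cjoin_upper[of a "Suc (Suc i)" for i]
      by (auto simp: a_def intro!: cjoin_least)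
    then have "- U \<squnion> (C \<squnion> cjoin A) \<le> cjoin a" by simp
    moreover have "C \<squnion> cjoin A = U" using AU by (simp add: C_def diff_eq sup_inf_distrib2 sup.absorb1)
    ultimately show ?thesis by (simp add: sup_compl_top top.extremum_unique)
  qed
  have ea: "act (e n) (a n) = (case n of 0 \<Rightarrow> - U | Suc i \<Rightarrow> t i)" for n
  proof -
    have "act (th (Suc i) - th i) (A i) = t (Suc i)" for i
      using th(2)[of "Suc i"] by (simp add: A_def act_plus diff_conv_add_uminus del: add_uminus_conv_diff)
    then show ?thesis by (auto simp: e_def a_def h t_def split: nat.split)
  qed
  have "disjseq (\<lambda>n. act (e n) (a n))"
  proof -
    have "t i \<sqinter> - U = \<bottom>" for i using cjoin_upper[of t i] by (simp add: U_def inf_shunt)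
    then show ?thesis unfolding disjseq_def ea using disjseqD[OF t] by (auto split: nat.split simp: inf.commute)
  qed
  then obtain bb where bb: "\<And>i c. c \<le> a i \<Longrightarrow> act bb c = act (e i) c" using glue[OF ad at] by metis
  have bbU: "supported U bb" unfolding supported_def using bb[of _ 0] by (auto simp: a_def e_def inf_shunt)
  have bbC: "act bb C = s" using bb[of C 1] h by (simp add: a_def e_def)
  have bbA: "act bb c = act (th (Suc i) - th i) c" if "c \<le> A i" for c i
    using bb[of c "Suc (Suc i)"] that by (simp add: a_def e_def)
  have PsiA: "supported (cjoin A) Psi"
    by (rule supported_cjoin_pieces[OF Psi(1)[unfolded U_def] Psi(2)])
      (auto simp: A_def intro: supported_conj GS)
  have gU: "supported U g" using g cjoin_upper[of t 0] by (auto simp: U_def t_def intro: supported_mono)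
  have "Phi = g + (bb + Psi - bb)"
  proof (rule supported_cjoin_eqI)
    show "supported (cjoin t) Phi" "supported (cjoin t) (g + (bb + Psi - bb))"
      using Phi(1) gU supported_plus[OF supported_plus[OF bbU Psi(1)] supported_uminus[OF bbU]]
      by (auto simp flip: U_def intro: supported_plus)
    fix i c assume c: "c \<le> t i"
    have conj: "act (bb + Psi - bb) c = act bb (act Psi (act (- bb) c))"
      by (simp add: act_plus diff_conv_add_uminus del: add_uminus_conv_diff)
    show "act Phi c = act (g + (bb + Psi - bb)) c"
    proof (cases i)
      case 0
      then have "act (- bb) c \<le> C" using c bbC by (simp add: t_def act_le_swap)
      moreover have "C \<sqinter> cjoin A = \<bottom>" by (simp add: C_def diff_eq inf.assoc)
      ultimately have "act Psi (act (- bb) c) = act (- bb) c" by (intro supported_le_bot[OF PsiA])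
      then show ?thesis using Phi(2)[OF c] 0 by (simp add: act_plus[of g] conj th(1) G0)
    next
      case (Suc j)
      have "act (th j - th (Suc j)) c \<le> A j"
        using c th(2)[of "Suc j"] by (simp add: Suc A_def act_plus act_le_swap diff_conv_add_uminus del: add_uminus_conv_diff)
      note le = this
      then have "act bb (act (th j - th (Suc j)) c) = c"
        using bbA by (simp add: act_plus diff_conv_add_uminus del: add_uminus_conv_diff)
      then have inv: "act (- bb) c = act (th j - th (Suc j)) c" by (metis act_minus1)
      have "act Psi (act (- bb) c) = act (th j) (act (G (Suc j)) (act (- th (Suc j)) c))"
        unfolding inv using Psi(2)[OF order_trans[OF le At]] cj_act
        by (simp add: act_plus diff_conv_add_uminus del: add_uminus_conv_diff)
      moreover have "act Psi (act (- bb) c) \<le> A j"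
      proof -
        have "act (G (Suc j)) (act (- th (Suc j)) c) \<le> S (Suc j)"
          using cj_le[of c "Suc j"] c Suc supported_act_le[OF GS] by blast
        then show ?thesis using calculation by (simp add: A_def)
      qed
      ultimately have "act (bb + Psi - bb) c = act (?cj (Suc j) (G (Suc j))) c"
        unfolding conj by (subst bbA) (auto simp: cj_act act_plus diff_conv_add_uminus simp del: add_uminus_conv_diff)
      moreover have "act (?cj (Suc j) (G (Suc j))) c \<le> t (Suc j)"
        using supported_act_le[OF cjs[OF GS]] c Suc by blast
      moreover have "t (Suc j) \<sqinter> s = \<bottom>" using disjseqD[OF t, of "Suc j" 0] by (simp add: t_def)
      ultimately have "act g (act (bb + Psi - bb) c) = act (?cj (Suc j) (G (Suc j))) c"
        using supported_le_bot[OF g] by metis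
      then show ?thesis using Phi(2)[OF c] Suc by (simp add: act_plus[of g])
    qed
  qed
  then have "g = I + Psi - (bb + Psi - bb)" using IPsi by (metis add_diff_cancel)
  then have "g = (x + y - x - y) + (Psi + bb - Psi - bb)"
    using xy(3) by (simp add: add.assoc diff_conv_add_uminus minus_add del: add_uminus_conv_diff)
  then show thesis using that[of U x y Psi bb] muU sumS xy(1,2) Psi(1) bbU by simp
qed

lemma conj_commutator:
  "w + (x + y - x - y) - w = (w + x - w) + (w + y - w) - (w + x - w) - (w + y - (w::'g::group_add))"
  by (simp add: add.assoc diff_conv_add_uminus minus_add del: add_uminus_conv_diff)

text \<open>Transport the common support of the two commutators into \<open>b\<close>; a conjugated commutator has
  length \<open>1 + 8 + 1\<close>.\<close>

theorem small_supports_in_nfold: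
  fixes W :: "nat \<Rightarrow> 'a maut set"
  assumes W: "large W"
  obtains n \<delta> where "0 < \<delta>" "\<And>s g. mu s < \<delta> \<Longrightarrow> supported s g \<Longrightarrow> g \<in> nfold (W n) 20"
proof -
  obtain n0 b where b: "b \<noteq> \<bottom>"
    "\<And>g h. supported b g \<Longrightarrow> supported b h \<Longrightarrow> g + h - g - h \<in> nfold (W n0) 8"
    by (rule commutators_in_nfold[OF W]) blast
  obtain n d where n: "n0 \<le> n" "0 < d" "\<And>s. mu s < d \<Longrightarrow> \<exists>w\<in>W n. act w s \<le> b"
    by (rule transport_small_sets[OF W b(1), of n0]) blast
  show thesis
  proof (rule that[of "min (d/3) (1/3)" n])
    show "0 < min (d/3) (1/3)" using n(2) by simp
    fix s and g :: "'a maut" assume s: "mu s < min (d/3) (1/3)" and g: "supported s g"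
    obtain u x y z v where u: "mu u \<le> 3 * mu s" "supported u x" "supported u y" "supported u z" "supported u v"
      "g = (x + y - x - y) + (z + v - z - v)"
      by (rule two_commutators[OF g]) (use s in auto)
    have "mu u < d" using u(1) s by simp
    then obtain w where w: "w \<in> W n" "act w u \<le> b" using n(3) by blast
    have in10: "x + y - x - y \<in> nfold (W n) 10" if "supported u x" "supported u y" for x y
    proof -
      have "w + (x + y - x - y) - w \<in> nfold (W n0) 8"
        unfolding conj_commutator by (intro b(2) supported_mono[OF supported_conj w(2)] that)
      then have "w + (x + y - x - y) - w \<in> nfold (W n) 8"
        using nfold_mono[OF large_mono[OF W n(1)]] by blast
      then have "- w + (w + (x + y - x - y) - w) + w \<in> nfold (W n) (1 + 8 + 1)"
        using w(1) large_uminus[OF W] by (intro nfold_add nfold_1) auto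
      then show ?thesis by (simp add: add.assoc diff_conv_add_uminus minus_add del: add_uminus_conv_diff)
    qed
    have "g \<in> nfold (W n) (10 + 10)" unfolding u(6) by (intro nfold_add in10 u)
    then show "g \<in> nfold (W n) 20" by simp
  qed
qed

text \<open>Peeling off involutions shrinks the support geometrically, and an involution is the product of
  its restrictions to two halves, so that induction reduces everything to small supports.\<close>

lemma generated_by_small_supports:
  fixes H :: "'a maut set"
  assumes H: "\<And>a b. a \<in> H \<Longrightarrow> b \<in> H \<Longrightarrow> a + b \<in> H" and \<delta>: "0 < \<delta>"
    and small: "\<And>s g. mu s < \<delta> \<Longrightarrow> supported s g \<Longrightarrow> g \<in> H"
  shows "g \<in> H"
proof -
  have inv: "k \<in> H" if "p \<sqinter> act k p = \<bottom>" "supported (p \<squnion> act k p) k" "k + k = 0" "mu p < \<delta> / 2 * 2 ^ j" for p k j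
    using that
  proof (induction j arbitrary: p k)
    case 0
    then have "mu (p \<squnion> act k p) < \<delta>" using mu_sup_le[of p "act k p"] by simp
    then show ?case using small 0 by blast
  next
    case (Suc j)
    obtain p1 where p1: "p1 \<le> p" "mu p1 = mu p / 2" using divisible[of "mu p / 2" p] mu_nonneg[of p] by auto
    define p2 where "p2 = p - p1"
    have p2: "p2 \<le> p" "mu p2 = mu p / 2" using p1 mu_diff[OF p1(1)] by (auto simp: p2_def diff_eq)
    have p: "p1 \<sqinter> p2 = \<bottom>" "p1 \<squnion> p2 = p"
      using p1 by (auto simp: p2_def diff_eq sup_inf_distrib1 sup.absorb2 inf.left_commute)
    have part: "\<exists>x\<in>H. supported (q \<squnion> act k q) x \<and> (\<forall>c\<le>q \<squnion> act k q. act x c = act k c)"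
      if q: "q \<le> p" "mu q = mu p / 2" for q
    proof -
      obtain x where x: "supported (q \<squnion> act k q) x" "\<And>c. c \<le> q \<squnion> act k q \<Longrightarrow> act x c = act k c" "x + x = 0"
        by (rule involution_restrict[OF Suc.prems(1,3) q(1)]) blast
      have xq: "act x q = act k q" by (rule x(2)) simp
      have "q \<sqinter> act k q = \<bottom>" by (rule inf_bot_mono[OF Suc.prems(1)]) (use q in auto)
      then have "x \<in> H" using Suc.IH[of q x] x q(2) Suc.prems(4) xq by simp
      then show ?thesis using x by blast
    qed
    obtain x where x: "x \<in> H" "supported (p1 \<squnion> act k p1) x" "\<And>c. c \<le> p1 \<squnion> act k p1 \<Longrightarrow> act x c = act k c"
      using part[OF p1] by blast
    obtain y where y: "y \<in> H" "supported (p2 \<squnion> act k p2) y" "\<And>c. c \<le> p2 \<squnion> act k p2 \<Longrightarrow> act y c = act k c"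
      using part[OF p2] by blast
    have "k = x + y"
      by (rule involution_split[OF Suc.prems(1-3) p x(2,3) y(2,3)])
    then show ?case using H x(1) y(1) by simp
  qed
  have big: "\<exists>j. mu p < \<delta> / 2 * 2 ^ j" for p :: 'a
    using real_arch_pow[of 2 "mu p * 2 / \<delta>"] \<delta> by (auto simp: field_simps)
  have main: "g \<in> H" if "supported s g" "mu s < \<delta> * (3/2) ^ j" for s g j
    using that
  proof (induction j arbitrary: s g)
    case (Suc j)
    obtain p k t where k: "p \<sqinter> act k p = \<bottom>" "supported (p \<squnion> act k p) k" "p \<squnion> act k p \<le> s" "k + k = 0"
      "supported t (k + g)" "t \<le> s" "mu t \<le> 2/3 * mu s"
      by (rule split_involution[OF Suc.prems(1)]) blast
    have "k + g \<in> H" using Suc.IH[OF k(5)] k(7) Suc.prems(2) by simp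
    moreover have "k \<in> H" using inv[OF k(1,2,4)] big[of p] by blast
    ultimately have "k + (k + g) \<in> H" by (rule H[rotated])
    then show ?case using k(4) by (simp flip: add.assoc)
  qed (use small in auto)
  obtain j where "mu (\<top>::'a) < \<delta> * (3/2) ^ j"
    using real_arch_pow[of "3/2" "1 / \<delta>"] \<delta> by (auto simp: field_simps mu_top)
  then show ?thesis using main[of \<top> g j] by simp
qed

end

section \<open>Groups with generic tuples\<close>

text \<open>The sets \<open>F n\<close> are a basis of neighbourhoods of the identity, consisting of open subgroups;
  \<open>complete\<close> says that sequences which are Cauchy for both uniformities converge.\<close>

locale generic_group =
  fixes Gam :: "'g::group_add set" and F :: "nat \<Rightarrow> 'g set"
  assumes Gam_0: "0 \<in> Gam" and Gam_add: "a \<in> Gam \<Longrightarrow> b \<in> Gam \<Longrightarrow> a + b \<in> Gam"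
    and Gam_uminus: "a \<in> Gam \<Longrightarrow> - a \<in> Gam"
    and F_Gam: "F n \<subseteq> Gam" and F_0: "0 \<in> F n" and F_add: "a \<in> F n \<Longrightarrow> b \<in> F n \<Longrightarrow> a + b \<in> F n"
    and F_uminus: "a \<in> F n \<Longrightarrow> - a \<in> F n" and F_Suc: "F (Suc n) \<subseteq> F n"
    and F_conj: "g \<in> Gam \<Longrightarrow> \<exists>m. \<forall>h\<in>F m. g + h - g \<in> F n"
    and F_Inter: "(\<And>n. h \<in> F n) \<Longrightarrow> h = 0"
    and complete: "(\<And>n. c n \<in> Gam) \<Longrightarrow> (\<And>n. - c n + c (Suc n) \<in> F n) \<Longrightarrow> (\<And>n. c (Suc n) - c n \<in> F n)
      \<Longrightarrow> \<exists>c'\<in>Gam. \<forall>n. - c n + c' \<in> F n \<and> c' - c n \<in> F n"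
begin

definition dense_open :: "'g set \<Rightarrow> bool" where
  "dense_open D \<longleftrightarrow> (\<forall>g\<in>Gam \<inter> D. \<exists>n. \<forall>h\<in>F n. g + h \<in> D) \<and> (\<forall>g\<in>Gam. \<forall>n. \<exists>h\<in>F n. g + h \<in> D)"

lemma F_anti: "m \<le> n \<Longrightarrow> F n \<subseteq> F m"
  by (rule lift_Suc_antimono_le[of F, OF F_Suc])

lemma F_conj_max:
  assumes "g \<in> Gam" obtains m where "k \<le> m" "\<And>h. h \<in> F m \<Longrightarrow> g + h - g \<in> F n"
proof -
  obtain m where "\<forall>h\<in>F m. g + h - g \<in> F n" using F_conj[OF assms] by blast
  then show thesis using that[of "max k m"] F_anti[of m "max k m"] by auto
qed

lemma F_conj_uminus:
  assumes "g \<in> Gam" obtains m where "\<And>h. h \<in> F m \<Longrightarrow> - g + h + g \<in> F n"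
  using F_conj[OF Gam_uminus[OF assms], of n] by auto

lemma dense_open_Int:
  assumes D: "dense_open D" and E: "dense_open E" shows "dense_open (D \<inter> E)"
  unfolding dense_open_def
proof (intro conjI ballI allI)
  fix g assume g: "g \<in> Gam \<inter> (D \<inter> E)"
  then obtain m n where "\<forall>h\<in>F m. g + h \<in> D" "\<forall>h\<in>F n. g + h \<in> E" using D E unfolding dense_open_def by blast
  then show "\<exists>n. \<forall>h\<in>F n. g + h \<in> D \<inter> E"
    using F_anti[of m "max m n"] F_anti[of n "max m n"] by (intro exI[of _ "max m n"]) auto
next
  fix g n assume g: "g \<in> Gam"
  then obtain h where h: "h \<in> F n" "g + h \<in> D" using D unfolding dense_open_def by blast
  have gh: "g + h \<in> Gam" using g h F_Gam Gam_add by blast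
  then obtain m where m: "\<forall>k\<in>F m. g + h + k \<in> D" using D h(2) unfolding dense_open_def by blast
  obtain k where k: "k \<in> F (max m n)" "g + h + k \<in> E" using E gh unfolding dense_open_def by blast
  have "k \<in> F m" "k \<in> F n" using k(1) F_anti[of m "max m n"] F_anti[of n "max m n"] by auto
  then show "\<exists>h\<in>F n. g + h \<in> D \<inter> E"
    using m k(2) F_add[OF h(1)] by (intro bexI[of _ "h + k"]) (auto simp: add.assoc)
qed

lemma dense_open_translate:
  assumes D: "dense_open D" and a: "a \<in> Gam" shows "dense_open {x. a + x \<in> D}"
  unfolding dense_open_def
proof (intro conjI ballI allI)
  fix g assume "g \<in> Gam \<inter> {x. a + x \<in> D}"
  then have "a + g \<in> Gam \<inter> D" using a Gam_add by auto
  then obtain n where "\<forall>h\<in>F n. a + g + h \<in> D" using D unfolding dense_open_def by blast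
  then show "\<exists>n. \<forall>h\<in>F n. g + h \<in> {x. a + x \<in> D}" by (auto simp: add.assoc)
next
  fix g n assume "g \<in> Gam"
  then have "a + g \<in> Gam" using a Gam_add by auto
  then obtain h where "h \<in> F n" "a + g + h \<in> D" using D unfolding dense_open_def by blast
  then show "\<exists>h\<in>F n. g + h \<in> {x. a + x \<in> D}" by (auto simp: add.assoc)
qed

lemma dense_open_conj:
  assumes D: "dense_open D" and y: "y \<in> Gam" shows "dense_open {x. - y + x + y \<in> D}"
  unfolding dense_open_def
proof (intro conjI ballI allI)
  fix g assume "g \<in> Gam \<inter> {x. - y + x + y \<in> D}"
  then have "- y + g + y \<in> Gam \<inter> D" using y Gam_add Gam_uminus by auto
  then obtain n where n: "\<forall>h\<in>F n. - y + g + y + h \<in> D" using D unfolding dense_open_def by blast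
  obtain m where m: "\<And>h. h \<in> F m \<Longrightarrow> - y + h + y \<in> F n" using F_conj_uminus[OF y, of n] by blast
  have "- y + (g + h) + y = - y + g + y + (- y + h + y)" for h by (simp add: add.assoc)
  then show "\<exists>n. \<forall>h\<in>F n. g + h \<in> {x. - y + x + y \<in> D}" using n m by (intro exI[of _ m]) simp
next
  fix g n assume "g \<in> Gam"
  then have g: "- y + g + y \<in> Gam" using y Gam_add Gam_uminus by auto
  obtain m where m: "\<And>h. h \<in> F m \<Longrightarrow> y + h - y \<in> F n" using F_conj[OF y, of n] by blast
  obtain h where h: "h \<in> F m" "- y + g + y + h \<in> D" using D g unfolding dense_open_def by blast
  have "- y + (g + (y + h - y)) + y = - y + g + y + h" by (simp add: add.assoc diff_conv_add_uminus del: add_uminus_conv_diff)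
  then show "\<exists>h\<in>F n. g + h \<in> {x. - y + x + y \<in> D}" using h m by (intro bexI[of _ "y + h - y"]) auto
qed

lemma dense_open_UNIV: "dense_open UNIV"
  using F_0 by (auto simp: dense_open_def)

text \<open>A Baire category argument: if each translate \<open>k n + W\<close> could be avoided, densely often, by
  countably many dense open conditions, then a limit \<open>c'\<close> chosen to meet all of them would lie in
  no \<open>k n + W\<close>. So in some open set one translate meets every countable intersection of dense open
  sets.\<close>

lemma somewhere_comeager_trace:
  fixes k :: "nat \<Rightarrow> 'g"
  assumes cover: "\<And>g. g \<in> Gam \<Longrightarrow> \<exists>n. \<exists>w\<in>W. g = k n + w"
  obtains n u N where "u \<in> Gam"
    "\<And>v M D. v \<in> Gam \<Longrightarrow> - u + v \<in> F N \<Longrightarrow> (\<And>i. dense_open (D i)) \<Longrightarrow>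
      \<exists>h\<in>F M. (\<exists>w\<in>W. v + h = k n + w) \<and> (\<forall>i::nat. v + h \<in> D i)"
proof (rule ccontr)
  assume not: "\<not> thesis"
  note result = that
  have bad: "\<exists>v M D. v \<in> Gam \<and> - u + v \<in> F N \<and> (\<forall>i::nat. dense_open (D i)) \<and>
      (\<forall>h\<in>F M. (\<exists>w\<in>W. v + h = k n + w) \<longrightarrow> (\<exists>i. v + h \<notin> D i))" if "u \<in> Gam" for u n N
    using not result[of u N n, OF that] by blast
  define P where "P = (\<lambda>n::nat. \<lambda>(c, M, E :: nat \<Rightarrow> 'g set). c \<in> Gam \<and> (\<forall>i. dense_open (E i)) \<and> n \<le> M \<and> (\<forall>h\<in>F M. c + h - c \<in> F n))"
  define R where "R = (\<lambda>n::nat. \<lambda>(c, M, E :: nat \<Rightarrow> 'g set) (c', M', E' :: nat \<Rightarrow> 'g set).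
    \<exists>v Mb D. - c + v \<in> F M \<and> (\<forall>h\<in>F Mb. (\<exists>w\<in>W. v + h = k n + w) \<longrightarrow> (\<exists>i. v + h \<notin> D i)) \<and>
      - v + c' \<in> F Mb \<and> M \<le> Mb \<and> Mb \<le> M' \<and> E' = (\<lambda>i. E i \<inter> D i) \<and> (\<forall>i\<le>n. \<forall>h\<in>F M'. c' + h \<in> E' i))"
  have "\<exists>f. \<forall>n. P n (f n) \<and> R n (f n) (f (Suc n))"
  proof (rule dependent_nat_choice)
    show "\<exists>x. P 0 x"
      by (rule exI[of _ "(0, 0, \<lambda>i. UNIV)"]) (auto simp: P_def Gam_0 dense_open_UNIV)
    fix x n assume Px: "P n x"
    obtain c M E where x: "x = (c, M, E)" by (cases x)
    have c: "c \<in> Gam" "\<And>i. dense_open (E i)" using Px by (auto simp: P_def x)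
    obtain v Mb0 D where v0: "v \<in> Gam \<and> - c + v \<in> F M \<and> (\<forall>i::nat. dense_open (D i)) \<and>
      (\<forall>h\<in>F Mb0. (\<exists>w\<in>W. v + h = k n + w) \<longrightarrow> (\<exists>i. v + h \<notin> D i))"
      using bad[OF c(1), of M n] by (elim exE)
    then have v: "v \<in> Gam" "- c + v \<in> F M" "\<And>i. dense_open (D i)"
      "\<And>h. h \<in> F Mb0 \<Longrightarrow> \<exists>w\<in>W. v + h = k n + w \<Longrightarrow> \<exists>i. v + h \<notin> D i" by simp_all
    define Mb where "Mb = max M Mb0"
    define E' where "E' i = E i \<inter> D i" for i
    have dense: "dense_open (\<Inter>i\<le>n. E' i)"
    proof (induction n)
      case 0
      then show ?case by (simp add: E'_def dense_open_Int c v)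
    next
      case (Suc n)
      then show ?case using dense_open_Int[OF dense_open_Int[OF c(2)[of "Suc n"] v(3)[of "Suc n"]] Suc]
        by (simp add: atMost_Suc E'_def)
    qed
    from dense v(1) obtain h where h0: "h \<in> F Mb" "v + h \<in> (\<Inter>i\<le>n. E' i)"
      unfolding dense_open_def by blast
    have c': "v + h \<in> Gam" using v(1) h0(1) F_Gam Gam_add by blast
    from dense c' h0(2) obtain m where "\<forall>l\<in>F m. v + h + l \<in> (\<Inter>i\<le>n. E' i)"
      unfolding dense_open_def by blast
    note h = h0 this
    obtain M' where M': "max (Suc n) (max m Mb) \<le> M'" "\<And>l. l \<in> F M' \<Longrightarrow> v + h + l - (v + h) \<in> F (Suc n)"
      using F_conj_max[OF c'] by metis
    have "P (Suc n) (v + h, M', E')"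
      using c' M' by (auto simp: P_def E'_def dense_open_Int c v)
    moreover have "R n x (v + h, M', E')"
      unfolding R_def x case_prod_conv
    proof (intro exI[of _ v] exI[of _ Mb] exI[of _ D] conjI)
      show "\<forall>h\<in>F Mb. (\<exists>w\<in>W. v + h = k n + w) \<longrightarrow> (\<exists>i. v + h \<notin> D i)"
        using v(4) F_anti[of Mb0 Mb] by (auto simp: Mb_def)
      show "\<forall>i\<le>n. \<forall>l\<in>F M'. v + h + l \<in> E' i" using h(3) F_anti[of m M'] M'(1) by auto
      show "- v + (v + h) \<in> F Mb" using h(1) by simp
    qed (use v(2) M'(1) in \<open>auto simp: Mb_def E'_def\<close>)
    ultimately show "\<exists>y. P (Suc n) y \<and> R n x y" by blast
  qed
  then obtain f where f: "\<And>n. P n (f n)" "\<And>n. R n (f n) (f (Suc n))" by blast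
  define c where "c n = fst (f n)" for n
  define M where "M n = fst (snd (f n))" for n
  define E where "E n = snd (snd (f n))" for n
  have fn: "f n = (c n, M n, E n)" for n by (simp add: c_def M_def E_def)
  have P: "c n \<in> Gam" "n \<le> M n" "\<And>h. h \<in> F (M n) \<Longrightarrow> c n + h - c n \<in> F n" for n
    using f(1)[of n] by (auto simp: P_def fn)
  define Q where "Q n = (\<lambda>(v, Mb, D). - c n + v \<in> F (M n) \<and>
      (\<forall>h\<in>F Mb. (\<exists>w\<in>W. v + h = k n + w) \<longrightarrow> (\<exists>i. v + h \<notin> D i)) \<and>
      - v + c (Suc n) \<in> F Mb \<and> M n \<le> Mb \<and> Mb \<le> M (Suc n) \<and> E (Suc n) = (\<lambda>i. E n i \<inter> D i) \<and>
      (\<forall>i\<le>n. \<forall>h\<in>F (M (Suc n)). c (Suc n) + h \<in> E (Suc n) i))" for n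
  have "\<forall>n. \<exists>y. Q n y"
  proof
    show "\<exists>y. Q n y" for n using f(2)[of n] by (simp add: R_def fn Q_def split_paired_Ex)
  qed
  then obtain y where y: "\<And>n. Q n (y n)" using choice[of Q] by blast
  define v where "v n = fst (y n)" for n
  define Mb where "Mb n = fst (snd (y n))" for n
  define D where "D n = snd (snd (y n))" for n
  have "Q n (v n, Mb n, D n)" for n using y by (simp add: v_def Mb_def D_def)
  then have R: "\<And>n. - c n + v n \<in> F (M n)"
    "\<And>n h. h \<in> F (Mb n) \<Longrightarrow> \<exists>w\<in>W. v n + h = k n + w \<Longrightarrow> \<exists>i. v n + h \<notin> D n i"
    "\<And>n. - v n + c (Suc n) \<in> F (Mb n)" "\<And>n. M n \<le> Mb n" "\<And>n. Mb n \<le> M (Suc n)"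
    "\<And>n. E (Suc n) = (\<lambda>i. E n i \<inter> D n i)"
    "\<And>n i h. i \<le> n \<Longrightarrow> h \<in> F (M (Suc n)) \<Longrightarrow> c (Suc n) + h \<in> E (Suc n) i"
    unfolding Q_def case_prod_conv by blast+
  have Mmono: "m \<le> n \<Longrightarrow> M m \<le> M n" for m n
    using lift_Suc_mono_le[of M m n] order_trans[OF R(4) R(5)] by blast
  have step: "- c n + c (Suc n) \<in> F (M n)" for n
  proof -
    have "(- c n + v n) + (- v n + c (Suc n)) \<in> F (M n)"
      using R(1,3)[of n] F_anti[OF R(4)[of n]] by - (rule F_add; auto)
    then show ?thesis by (simp add: add.assoc)
  qed
  have "- c n + c (Suc n) \<in> F n" "c (Suc n) - c n \<in> F n" for n
  proof -
    show "- c n + c (Suc n) \<in> F n" using step F_anti[OF P(2)] by blast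
    show "c (Suc n) - c n \<in> F n" using P(3)[OF step, of n] by (simp flip: add.assoc)
  qed
  then obtain c' where c': "c' \<in> Gam" "\<And>n. - c n + c' \<in> F n" using complete[of c] P(1) by blast
  have lim: "- c n + c' \<in> F (M n)" for n
  proof -
    have "- c n + c (n + j) \<in> F (M n)" for j
    proof (induction j)
      case (Suc j)
      have "(- c n + c (n + j)) + (- c (n + j) + c (Suc (n + j))) \<in> F (M n)"
        using Suc step[of "n + j"] F_anti[OF Mmono[of n "n + j"]] by - (rule F_add; auto)
      then show ?case by (simp add: add.assoc)
    qed (simp add: F_0)
    from this[of "M n"] have "(- c n + c (n + M n)) + (- c (n + M n) + c') \<in> F (M n)"
      using c'(2)[of "n + M n"] F_anti[of "M n" "n + M n"] by - (rule F_add; auto)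
    then show ?thesis by (simp add: add.assoc)
  qed
  have E_anti: "m \<le> n \<Longrightarrow> E n i \<subseteq> E m i" for m n i
    using lift_Suc_antimono_le[of "\<lambda>n. E n i" m n] R(6) by auto
  have inD: "c' \<in> D n i" for n i
  proof -
    have "c (Suc (max n i)) + (- c (Suc (max n i)) + c') \<in> E (Suc (max n i)) i"
      by (rule R(7)[OF _ lim]) simp
    then have "c' \<in> E (Suc (max n i)) i" by (simp flip: add.assoc)
    then have "c' \<in> E (Suc n) i" using E_anti[of "Suc n" "Suc (max n i)" i] by auto
    then show ?thesis by (simp add: R(6))
  qed
  obtain n w where w: "w \<in> W" "c' = k n + w" using cover[OF c'(1)] by blast
  have "(- v n + c (Suc n)) + (- c (Suc n) + c') \<in> F (Mb n)"
    using R(3) lim[of "Suc n"] F_anti[OF R(5)[of n]] by - (rule F_add; auto)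
  then have "- v n + c' \<in> F (Mb n)" by (simp add: add.assoc)
  from R(2)[OF this] w inD[of n] show False by (simp flip: add.assoc)
qed

text \<open>Inside the open set of \<open>somewhere_comeager_trace\<close>, differences of two points of the same
  translate lie in the double sum, and one of the two points can be fixed while the other ranges
  over a comeager set.\<close>

lemma nfold2_meets_dense:
  fixes k :: "nat \<Rightarrow> 'g"
  assumes cover: "\<And>g. g \<in> Gam \<Longrightarrow> \<exists>n. \<exists>w\<in>W. g = k n + w" and sym: "\<And>w. w \<in> W \<Longrightarrow> - w \<in> W"
    and D: "\<And>i::nat. dense_open (D i)"
  obtains g where "g \<in> F M" "g \<in> nfold W 2" "\<And>i. g \<in> D i"
proof -
  obtain n u N where u: "u \<in> Gam" and hit: "\<And>v M D. v \<in> Gam \<Longrightarrow> - u + v \<in> F N \<Longrightarrow> (\<And>i. dense_open (D i)) \<Longrightarrow>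
      \<exists>h\<in>F M. (\<exists>w\<in>W. v + h = k n + w) \<and> (\<forall>i::nat. v + h \<in> D i)"
    by (rule somewhere_comeager_trace[OF cover]) (assumption, blast)
  obtain h0 w0 where h0: "h0 \<in> F N" "w0 \<in> W" "u + h0 = k n + w0"
    using hit[of u "\<lambda>i. UNIV" N] u F_0 dense_open_UNIV by auto
  define a where "a = u + h0"
  have a: "a \<in> Gam" using u h0(1) F_Gam Gam_add by (auto simp: a_def)
  have au: "- u + a \<in> F N" using h0(1) by (simp add: a_def)
  have "dense_open {x. - a + x \<in> D i}" for i by (rule dense_open_translate[OF D Gam_uminus[OF a]])
  from hit[of a "\<lambda>i. {x. - a + x \<in> D i}" M, OF a au this] obtain h w where h: "h \<in> F M" "w \<in> W" "a + h = k n + w" "\<And>i. h \<in> D i"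
    by (auto simp flip: add.assoc)
  have "h = - a + (a + h)" by (simp flip: add.assoc)
  also have "\<dots> = - w0 + w" unfolding h(3)
    unfolding a_def h0(3) by (simp add: minus_add add.assoc diff_conv_add_uminus del: add_uminus_conv_diff)
  finally have "h = - w0 + w" .
  moreover have "- w0 + w \<in> nfold W (1 + 1)" by (intro nfold_add nfold_1 sym h0 h)
  ultimately show thesis using that h by (simp add: numeral_2_eq_2)
qed

end

text \<open>The form of ample generics that the covering argument needs: generic tuples extend generically,
  and two generic extensions by elements near the identity are conjugate by an element near the
  identity that commutes with the given tuple.\<close>

locale ample_group = generic_group Gam F
  for Gam :: "'g::group_add set" and F :: "nat \<Rightarrow> 'g set" +
  fixes gen :: "'g list \<Rightarrow> bool"
  assumes gen_Nil: "gen []"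
    and gen_dense: "gen xs \<Longrightarrow> set xs \<subseteq> Gam \<Longrightarrow>
      \<exists>D::nat \<Rightarrow> 'g set. (\<forall>i. dense_open (D i)) \<and> (\<forall>g\<in>Gam. (\<forall>i. g \<in> D i) \<longrightarrow> gen (xs @ [g]))"
    and gen_conj: "gen xs \<Longrightarrow> set xs \<subseteq> Gam \<Longrightarrow>
      \<exists>m. \<forall>g\<in>F m. \<forall>f\<in>F m. gen (xs @ [g]) \<longrightarrow> gen (xs @ [f]) \<longrightarrow> (\<exists>c\<in>F n. (\<forall>x\<in>set xs. c + x = x + c) \<and> c + g - c = f)"
begin

text \<open>Suppose no \<open>F N\<close> is contained in \<open>nfold W 6\<close>. Then every neighbourhood of the identity contains
  generic elements whose conjugate by a prescribed element avoids \<open>nfold W 4\<close>, and also generic elements in \<open>nfold W 2\<close>.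
  Conjugating the second kind to the first kind, stage after stage, by elements that commute with
  the earlier choices gives a limit \<open>C\<close>. If \<open>C\<close> lies in \<open>k n + W\<close>, then stage \<open>n\<close> writes an
  element outside \<open>nfold W 4\<close> as a conjugate by an element of \<open>W\<close> of one in \<open>nfold W 2\<close>, which has
  length \<open>1 + 2 + 1\<close>.\<close>

theorem neighbourhood_in_nfold:
  fixes k :: "nat \<Rightarrow> 'g"
  assumes cover: "\<And>g. g \<in> Gam \<Longrightarrow> \<exists>n. \<exists>w\<in>W. g = k n + w" and kG: "\<And>n. k n \<in> Gam"
    and sym: "\<And>w. w \<in> W \<Longrightarrow> - w \<in> W"
  obtains N where "F N \<subseteq> nfold W 6"
proof (rule ccontr)
  assume "\<not> thesis"
  then have notin: "\<exists>z\<in>F N. z \<notin> nfold W 6" for N using that by blast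
  have bad: "\<exists>f\<in>F m. gen (xs @ [f]) \<and> y + f - y \<notin> nfold W 4" if y: "y \<in> Gam" and xs: "gen xs" "set xs \<subseteq> Gam" for y xs m
  proof -
    obtain n1 where n1: "\<And>h. h \<in> F n1 \<Longrightarrow> - y + h + y \<in> F m" using F_conj_uminus[OF y, of m] by blast
    obtain z where z: "z \<in> F n1" "z \<notin> nfold W 6" using notin by blast
    define f0 where "f0 = - y + z + y"
    have f0: "f0 \<in> F m" "f0 \<in> Gam" using n1[OF z(1)] F_Gam by (auto simp: f0_def)
    obtain D where D: "\<And>i::nat. dense_open (D i)" "\<And>g. g \<in> Gam \<Longrightarrow> (\<And>i. g \<in> D i) \<Longrightarrow> gen (xs @ [g])"
      using gen_dense[OF xs] by blast
    have "dense_open {x. - y + x + y \<in> {x. f0 + x \<in> D i}}" for i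
      by (intro dense_open_conj dense_open_translate D y f0)
    then obtain w where w: "w \<in> F n1" "w \<in> nfold W 2" "\<And>i. f0 + (- y + w + y) \<in> D i"
      using nfold2_meets_dense[OF cover sym, of "\<lambda>i. {x. - y + x + y \<in> {x. f0 + x \<in> D i}}" n1] by auto
    define f where "f = f0 + (- y + w + y)"
    have f: "f \<in> F m" unfolding f_def by (intro F_add f0 n1 w)
    have yf: "y + f - y = z + w"
      by (simp add: f_def f0_def add.assoc diff_conv_add_uminus del: add_uminus_conv_diff)
    have "z + w \<notin> nfold W 4"
    proof
      assume "z + w \<in> nfold W 4"
      then have "(z + w) + - w \<in> nfold W (4 + 2)" using w(2) sym by (intro nfold_add nfold_uminus)
      then show False using z(2) by (simp add: add.assoc)
    qed
    moreover have "gen (xs @ [f])" using D(2)[of f] w(3) f F_Gam by (auto simp: f_def)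
    ultimately show ?thesis using f yf by auto
  qed
  define P where "P = (\<lambda>n::nat. \<lambda>(xs, c). gen xs \<and> set xs \<subseteq> Gam \<and> c \<in> Gam)"
  define R where "R = (\<lambda>n. \<lambda>(xs, c) (xs', c'). \<exists>g d. xs' = xs @ [g] \<and> c' = c + d \<and> d \<in> F n \<and> c + d - c \<in> F n \<and>
    g \<in> nfold W 2 \<and> (\<forall>x\<in>set xs. d + x = x + d) \<and> - k n + (c' + g - c') + k n \<notin> nfold W 4)"
  have "\<exists>s. \<forall>n. P n (s n) \<and> R n (s n) (s (Suc n))"
  proof (rule dependent_nat_choice)
    show "\<exists>x. P 0 x" by (rule exI[of _ "([], 0)"]) (auto simp: P_def gen_Nil Gam_0)
    fix s n assume "P n s"
    then obtain xs c where s: "s = (xs, c)" "gen xs" "set xs \<subseteq> Gam" "c \<in> Gam" by (auto simp: P_def)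
    obtain N where N: "n \<le> N" "\<And>h. h \<in> F N \<Longrightarrow> c + h - c \<in> F n" using F_conj_max[OF s(4), where k = n and n = n] by blast
    obtain m where m: "\<And>g f. g \<in> F m \<Longrightarrow> f \<in> F m \<Longrightarrow> gen (xs @ [g]) \<Longrightarrow> gen (xs @ [f]) \<Longrightarrow>
        \<exists>c\<in>F N. (\<forall>x\<in>set xs. c + x = x + c) \<and> c + g - c = f" using gen_conj[OF s(2,3), of N] by blast
    obtain D where D: "\<And>i::nat. dense_open (D i)" "\<And>g. g \<in> Gam \<Longrightarrow> (\<And>i. g \<in> D i) \<Longrightarrow> gen (xs @ [g])"
      using gen_dense[OF s(2,3)] by blast
    obtain g where g: "g \<in> F m" "g \<in> nfold W 2" "\<And>i. g \<in> D i"
      using nfold2_meets_dense[where D = D and M = m, OF cover sym D(1)] by blast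
    have gG: "g \<in> Gam" using g(1) F_Gam by blast
    have gg: "gen (xs @ [g])" using D(2)[OF gG] g(3) by blast
    have y: "- k n + c \<in> Gam" by (intro Gam_add Gam_uminus kG s)
    obtain f where f: "f \<in> F m" "gen (xs @ [f])" "(- k n + c) + f - (- k n + c) \<notin> nfold W 4"
      using bad[OF y s(2,3), of m] by blast
    obtain d where d: "d \<in> F N" "\<And>x. x \<in> set xs \<Longrightarrow> d + x = x + d" "d + g - d = f"
      using m[OF g(1) f(1) gg f(2)] by blast
    have "- k n + (c + d + g - (c + d)) + k n = (- k n + c) + f - (- k n + c)"
      unfolding d(3)[symmetric] by (simp add: add.assoc diff_conv_add_uminus minus_add del: add_uminus_conv_diff)
    moreover have "d \<in> F n" using d(1) F_anti[OF N(1)] by blast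
    ultimately have "R n s (xs @ [g], c + d)"
      unfolding R_def s(1) using d g(2) f(3) N(2) by auto
    moreover have "c + d \<in> Gam" using s(4) d(1) F_Gam Gam_add by blast
    then have "P (Suc n) (xs @ [g], c + d)"
      using gg s(3) gG by (simp add: P_def)
    ultimately show "\<exists>y. P (Suc n) y \<and> R n s y" by blast
  qed
  then obtain s where s: "\<And>n. P n (s n)" "\<And>n. R n (s n) (s (Suc n))" by blast
  define xs where "xs n = fst (s n)" for n
  define c where "c n = snd (s n)" for n
  have sn: "s n = (xs n, c n)" for n by (simp add: xs_def c_def)
  have cG: "c n \<in> Gam" for n using s(1)[of n] by (auto simp: P_def sn)
  have "\<exists>g d. xs (Suc n) = xs n @ [g] \<and> c (Suc n) = c n + d \<and> d \<in> F n \<and> c n + d - c n \<in> F n \<and>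
    g \<in> nfold W 2 \<and> (\<forall>x\<in>set (xs n). d + x = x + d) \<and> - k n + (c (Suc n) + g - c (Suc n)) + k n \<notin> nfold W 4" for n
    using s(2)[of n] by (simp add: R_def sn)
  then obtain g d where R: "\<And>n. xs (Suc n) = xs n @ [g n]" "\<And>n. c (Suc n) = c n + d n" "\<And>n. d n \<in> F n"
    "\<And>n. c n + d n - c n \<in> F n" "\<And>n. g n \<in> nfold W 2" "\<And>n x. x \<in> set (xs n) \<Longrightarrow> d n + x = x + d n"
    "\<And>n. - k n + (c (Suc n) + g n - c (Suc n)) + k n \<notin> nfold W 4" by metis
  have "- c n + c (Suc n) \<in> F n" "c (Suc n) - c n \<in> F n" for n
    using R(2,3,4)[of n] by (simp_all flip: add.assoc)
  then obtain C where C: "C \<in> Gam" "\<And>n. C - c n \<in> F n" using complete[of c] cG by blast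
  obtain n w where w: "w \<in> W" "C = k n + w" using cover[OF C(1)] by blast
  define Z where "Z = c (Suc n) + g n - c (Suc n)"
  have mem: "g n \<in> set (xs (Suc n + j))" for j by (induction j) (auto simp: R(1))
  have Zc: "c (Suc n + j) + g n - c (Suc n + j) = Z" for j
  proof (induction j)
    case (Suc j)
    have "d (Suc n + j) + g n - d (Suc n + j) = g n" using R(6)[OF mem[of j]] by (simp add: add.assoc diff_conv_add_uminus del: add_uminus_conv_diff)
    then have "c (Suc n + j) + (d (Suc n + j) + g n - d (Suc n + j)) - c (Suc n + j) = Z" using Suc by simp
    then show ?case using R(2)[of "Suc n + j"]
      by (simp add: add.assoc diff_conv_add_uminus minus_add del: add_uminus_conv_diff)
  qed (simp add: Z_def)
  have "(C + g n - C) - Z = 0"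
  proof (rule F_Inter)
    fix l
    have "Z \<in> Gam" unfolding Z_def diff_conv_add_uminus
      using s(1)[of "Suc n"] by (intro Gam_add Gam_uminus cG) (auto simp: P_def sn R(1))
    then obtain m where m: "l \<le> m" "\<And>h. h \<in> F m \<Longrightarrow> Z + h - Z \<in> F l"
      using F_conj_max[where k = l and n = l] by blast
    define r where "r = C - c (Suc n + m)"
    have r: "r \<in> F m" using C(2)[of "Suc n + m"] F_anti[of m "Suc n + m"] by (auto simp: r_def)
    have "C + g n - C = r + Z - r"
      unfolding Zc[of m, symmetric] r_def by (simp add: add.assoc diff_conv_add_uminus minus_add del: add_uminus_conv_diff)
    then have "(C + g n - C) - Z = r + (Z + - r - Z)"
      by (simp add: add.assoc diff_conv_add_uminus minus_add del: add_uminus_conv_diff)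
    moreover have "r \<in> F l" using r F_anti[OF m(1)] by blast
    ultimately show "(C + g n - C) - Z \<in> F l" using m(2)[OF F_uminus[OF r]] F_add by metis
  qed
  then have "Z = C + g n - C" by simp
  then have "- k n + Z + k n = w + g n + - w"
    unfolding w(2) by (simp add: add.assoc diff_conv_add_uminus minus_add del: add_uminus_conv_diff)
  moreover have "w + g n + - w \<in> nfold W (1 + 2 + 1)" by (intro nfold_add nfold_1 sym w R(5))
  ultimately show False using R(7)[of n] by (simp add: Z_def eval_nat_numeral del: nfold.simps)
qed

end

section \<open>Dyadic probability algebras\<close>

text \<open>The cells of level \<open>k\<close> correspond to the dyadic intervals of length \<open>1 / 2 ^ k\<close>; indices beyond
  \<open>2 ^ k\<close> give the zero element, so that a level is a sequence as in \<open>disjseq\<close>.\<close>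

locale dyadic_cells =
  fixes cell :: "nat \<Rightarrow> nat \<Rightarrow> 'a::prob_algebra"
  assumes cell_out: "2 ^ k \<le> i \<Longrightarrow> cell k i = \<bottom>"
    and mu_cell: "i < 2 ^ k \<Longrightarrow> mu (cell k i) = 1 / 2 ^ k"
    and cell_disj: "i \<noteq> j \<Longrightarrow> cell k i \<sqinter> cell k j = \<bottom>"
    and cell_split: "cell k i = cell (Suc k) (2 * i) \<squnion> cell (Suc k) (2 * i + 1)"
begin

lemma disjseq_cell: "disjseq (cell k)"
  by (simp add: disjseq_def cell_disj)

lemma cjoin_cell: "cjoin (cell k) = \<top>"
proof -
  have "(\<lambda>i. mu (cell k i)) = (\<lambda>i. if i \<in> {..<2^k} then 1 / 2^k else 0)"
    by (auto simp: mu_cell cell_out not_less fun_eq_iff)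
  moreover have "(\<lambda>i. if i \<in> {..<2^k::nat} then 1 / 2^k else 0::real) sums (\<Sum>i\<in>{..<2^k::nat}. 1 / 2^k)"
    by (rule sums_If_finite_set) simp
  ultimately have "mu (cjoin (cell k)) = 1" using mu_cjoin[OF disjseq_cell, of k] by (simp add: sums_iff)
  then show ?thesis by (intro mu_eq_le_imp_eq) (simp_all add: mu_top)
qed

lemma mu_by_cells: "mu a = (\<Sum>i<2^k. mu (a \<sqinter> cell k i))"
proof -
  have "disjseq (\<lambda>i. a \<sqinter> cell k i)" unfolding disjseq_def
    using inf_bot_mono[OF cell_disj] by (metis inf.cobounded2)
  from mu_cjoin[OF this] have "(\<lambda>i. mu (a \<sqinter> cell k i)) sums mu a" by (simp add: inf_cjoin[symmetric] cjoin_cell)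
  moreover have "(\<lambda>i. mu (a \<sqinter> cell k i)) sums (\<Sum>i<2^k. mu (a \<sqinter> cell k i))"
    by (rule sums_finite) (auto simp: cell_out not_less)
  ultimately show ?thesis by (rule sums_unique2)
qed

lemma cell_le_ancestor: "cell (k + n) j \<le> cell k (j div 2 ^ n)"
proof (induction n arbitrary: j)
  case (Suc n)
  have "j = 2 * (j div 2) \<or> j = 2 * (j div 2) + 1" by presburger
  then have "cell (Suc (k + n)) j \<le> cell (k + n) (j div 2)"
    unfolding cell_split[of "k + n" "j div 2"] by (metis sup.cobounded1 sup.cobounded2)
  also have "\<dots> \<le> cell k (j div 2 div 2 ^ n)" by (rule Suc)
  finally show ?case by (simp add: div_mult2_eq)
qed simp

definition dy :: "nat \<Rightarrow> 'a set" where
  "dy k = {b. \<forall>i. cell k i \<le> b \<or> cell k i \<sqinter> b = \<bottom>}"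

definition Dy :: "'a set" where "Dy = (\<Union>k. dy k)"

lemma dy_Suc: "dy k \<subseteq> dy (Suc k)"
proof (rule subsetI, unfold dy_def, rule CollectI, rule allI)
  fix b i assume b: "b \<in> {b. \<forall>i. cell k i \<le> b \<or> cell k i \<sqinter> b = \<bottom>}"
  have le: "cell (Suc k) i \<le> cell k (i div 2)" using cell_le_ancestor[of k 1 i] by simp
  consider "cell k (i div 2) \<le> b" | "cell k (i div 2) \<sqinter> b = \<bottom>" using b by blast
  then show "cell (Suc k) i \<le> b \<or> cell (Suc k) i \<sqinter> b = \<bottom>"
    using order_trans[OF le] inf_bot_mono[OF _ le order_refl] by cases blast+
qed

lemma dy_mono: "k \<le> l \<Longrightarrow> dy k \<subseteq> dy l"
  by (rule lift_Suc_mono_le[of dy, OF dy_Suc])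

lemma dy_Dy: "a \<in> dy k \<Longrightarrow> a \<in> Dy"
  by (auto simp: Dy_def)

lemma cell_dy: "cell k i \<in> dy k"
proof -
  have "cell k j \<le> cell k i \<or> cell k j \<sqinter> cell k i = \<bottom>" for j
    by (cases "j = i") (auto simp: cell_disj)
  then show ?thesis by (simp add: dy_def)
qed

lemma dy_compl: "a \<in> dy k \<Longrightarrow> - a \<in> dy k"
  unfolding dy_def using inf_shunt[of _ a] inf_shunt[of _ "- a"] by auto

lemma dy_inf:
  assumes "a \<in> dy k" "b \<in> dy k" shows "a \<sqinter> b \<in> dy k"
proof -
  have "cell k i \<le> a \<sqinter> b \<or> cell k i \<sqinter> (a \<sqinter> b) = \<bottom>" for i
  proof (cases "cell k i \<le> a \<and> cell k i \<le> b")
    case False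
    then have "cell k i \<sqinter> a = \<bottom> \<or> cell k i \<sqinter> b = \<bottom>" using assms by (auto simp: dy_def)
    then show ?thesis using inf_bot_mono[of "cell k i" a "cell k i" "a \<sqinter> b"] inf_bot_mono[of "cell k i" b "cell k i" "a \<sqinter> b"]
      by auto
  qed simp
  then show ?thesis by (simp add: dy_def)
qed

lemma dy_cjoin: "(\<And>i. a i \<in> dy k) \<Longrightarrow> cjoin a \<in> dy k"
proof -
  assume a: "\<And>i. a i \<in> dy k"
  have "cell k j \<le> cjoin a \<or> cell k j \<sqinter> cjoin a = \<bottom>" for j
  proof (cases "\<exists>i. cell k j \<le> a i")
    case True
    then show ?thesis using cjoin_upper order_trans by blast
  next
    case False
    then have "cell k j \<sqinter> a i = \<bottom>" for i using a[of i] by (auto simp: dy_def)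
    then show ?thesis using cjoin_disjoint'[of "cell k j" a] by blast
  qed
  then show ?thesis by (simp add: dy_def)
qed

lemma bot_dy: "\<bottom> \<in> dy k" by (simp add: dy_def)

lemma dy_eq_cjoin:
  assumes "a \<in> dy k" shows "a = cjoin (\<lambda>i. if cell k i \<le> a then cell k i else \<bottom>)"
proof -
  have "a = cjoin (\<lambda>i. a \<sqinter> cell k i)" by (simp add: inf_cjoin[symmetric] cjoin_cell)
  moreover have "a \<sqinter> cell k i = (if cell k i \<le> a then cell k i else \<bottom>)" for i
    using assms by (auto simp: dy_def inf.absorb2 inf.commute)
  ultimately show ?thesis by simp
qed

lemma finite_dy: "finite (dy k)"
proof -
  have "a = b" if "a \<in> dy k" "b \<in> dy k" "{i. i < 2^k \<and> cell k i \<le> a} = {i. i < 2^k \<and> cell k i \<le> b}" for a b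
  proof -
    have "cell k i \<le> a \<longleftrightarrow> cell k i \<le> b" for i
      using that(3) cell_out[of k i] by (cases "i < 2^k") auto
    then show ?thesis using dy_eq_cjoin[OF that(1)] dy_eq_cjoin[OF that(2)] by simp
  qed
  then have "inj_on (\<lambda>a. {i. i < 2^k \<and> cell k i \<le> a}) (dy k)" by (auto intro: inj_onI)
  moreover have "finite ((\<lambda>a. {i. i < 2^k \<and> cell k i \<le> a}) ` dy k)"
    by (rule finite_subset[of _ "Pow {..<2^k}"]) auto
  ultimately show ?thesis by (rule finite_imageD[rotated])
qed

lemma countable_Dy: "countable Dy"
  unfolding Dy_def by (intro countable_UN) (auto intro: countable_finite finite_dy)

lemma finite_subset_dy:
  assumes "finite A" "A \<subseteq> Dy" obtains k where "n \<le> k" "A \<subseteq> dy k"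
proof -
  have "\<exists>k\<ge>n. A \<subseteq> dy k" using assms
  proof (induction A rule: finite_induct)
    case (insert a A)
    then obtain k l where "n \<le> k" "A \<subseteq> dy k" "a \<in> dy l" by (auto simp: Dy_def)
    then show ?case using dy_mono[of k "max k l"] dy_mono[of l "max k l"] by (intro exI[of _ "max k l"]) auto
  qed auto
  then show thesis using that by blast
qed

lemma Dy_inf: "a \<in> Dy \<Longrightarrow> b \<in> Dy \<Longrightarrow> a \<sqinter> b \<in> Dy"
proof -
  assume "a \<in> Dy" "b \<in> Dy"
  then have "finite {a, b}" "{a, b} \<subseteq> Dy" by auto
  then obtain l where l: "0 \<le> l" "{a, b} \<subseteq> dy l" by (rule finite_subset_dy)
  then show ?thesis using dy_inf dy_Dy by blast
qed

lemma Dy_compl: "a \<in> Dy \<Longrightarrow> - a \<in> Dy"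
  using dy_compl by (auto simp: Dy_def)

lemma Dy_diff: "a \<in> Dy \<Longrightarrow> b \<in> Dy \<Longrightarrow> a - b \<in> Dy"
  by (simp add: diff_eq Dy_inf Dy_compl)

lemma Dy_sup: "a \<in> Dy \<Longrightarrow> b \<in> Dy \<Longrightarrow> a \<squnion> b \<in> Dy"
  using Dy_compl[OF Dy_inf[OF Dy_compl Dy_compl], of a b] by simp

lemma approx_by_Dy_cjoin:
  assumes a: "\<And>i e. 0 < e \<Longrightarrow> \<exists>b\<in>Dy. dist (a i) b < e" and e: "0 < e"
  shows "\<exists>b\<in>Dy. dist (cjoin a) b < e"
proof -
  have p: "\<exists>b\<in>Dy. dist (pjoin a n) b < e" if "0 < e" for n e
    using that
  proof (induction n arbitrary: e)
    case (Suc n)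
    then have "0 < e / 2" by simp
    obtain b where b: "b \<in> Dy" "dist (pjoin a n) b < e / 2" using Suc.IH[OF \<open>0 < e / 2\<close>] by blast
    obtain c where c: "c \<in> Dy" "dist (a n) c < e / 2" using a[OF \<open>0 < e / 2\<close>] by blast
    have "dist (pjoin a (Suc n)) (b \<squnion> c) < e" using dist_sup[of "pjoin a n" "a n" b c] b(2) c(2) by simp
    then show ?case using Dy_sup[OF b(1) c(1)] by blast
  qed (use dy_Dy[OF bot_dy] in force)
  obtain n where n: "dist (pjoin a n) (cjoin a) < e / 2"
    using metric_LIMSEQ_D[OF pjoin_tendsto, of "e / 2" a] e by auto
  obtain b where b: "b \<in> Dy" "dist (pjoin a n) b < e / 2" using p[of "e / 2" n] e by auto
  have "dist (cjoin a) b < e" using dist_triangle[of "cjoin a" b "pjoin a n"] n b(2) by (simp add: dist_commute)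
  then show ?thesis using b(1) by blast
qed

end

text \<open>The rotations by \<open>1 / 2 ^ l\<close> are the only automorphisms that have to be supplied from outside;
  all others are glued from them.\<close>

locale dyadic_algebra = dyadic_cells cell for cell :: "nat \<Rightarrow> nat \<Rightarrow> 'a::prob_algebra" +
  fixes rot :: "nat \<Rightarrow> 'a maut"
  assumes Dy_dense: "0 < e \<Longrightarrow> \<exists>b\<in>Dy. dist a b < e"
    and rot_cell: "l \<le> k \<Longrightarrow> i < 2 ^ k \<Longrightarrow> act (rot l) (cell k i) = cell k ((i + 2 ^ (k - l)) mod 2 ^ k)"
begin

lemma maut_eq_on_Dy:
  assumes "\<And>a. a \<in> Dy \<Longrightarrow> act g a = act h a" shows "g = h"
proof (rule maut_eqI)
  fix a
  have "dist (act g a) (act h a) < e" if "0 < e" for e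
  proof -
    obtain b where b: "b \<in> Dy" "dist a b < e / 2" using Dy_dense[of "e/2" a] \<open>0 < e\<close> by auto
    have "dist (act g a) (act h a) \<le> dist (act g a) (act g b) + dist (act h b) (act h a)"
      using dist_triangle[of "act g a" "act h a" "act g b"] assms[OF b(1)] by simp
    also have "\<dots> < e" using b(2) by (simp add: dist_commute)
    finally show ?thesis .
  qed
  then show "act g a = act h a" by (metis dist_nz less_irrefl)
qed

text \<open>A maximal part of \<open>a\<close> of measure at most \<open>r\<close> has measure \<open>r\<close>, since otherwise a piece cut out by
  a small cell could be added.\<close>

lemma divisible_dyadic:
  assumes "0 \<le> r" "r \<le> mu (a::'a)" shows "\<exists>b\<le>a. mu b = r"
proof -
  obtain m where m: "m \<le> a \<and> mu m \<le> r" "\<And>x. x \<le> a \<and> mu x \<le> r \<Longrightarrow> m \<le> x \<Longrightarrow> x = m"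
  proof (rule maximal_element[of "\<lambda>b. b \<le> a \<and> mu b \<le> r"])
    fix s :: "nat \<Rightarrow> 'a" and l assume s: "\<And>n. s n \<le> a \<and> mu (s n) \<le> r" "s \<longlonglongrightarrow> l"
    have "l \<le> a" by (rule LIMSEQ_le_pa[OF s(2) tendsto_const]) (use s(1) in blast)
    moreover have "mu l \<le> r" by (rule LIMSEQ_le_const2[OF tendsto_mu[OF s(2)]]) (use s(1) in blast)
    ultimately show "l \<le> a \<and> mu l \<le> r" by blast
  qed (use assms in auto)
  have "mu m = r"
  proof (rule ccontr)
    assume "mu m \<noteq> r"
    then have lt: "0 < r - mu m" using m(1) by simp
    obtain k where k: "1 / 2^k < r - mu m" using real_arch_pow_inv[OF lt, of "1/2"] by (auto simp: power_divide)
    have "mu (a - m) \<noteq> 0" using lt assms(2) mu_diff[of m a] m(1) by simp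
    then have "a - m \<noteq> \<bottom>" by auto
    then have "\<exists>i. (a - m) \<sqinter> cell k i \<noteq> \<bottom>"
      using cjoin_disjoint'[of "a - m" "cell k"] by (auto simp: cjoin_cell)
    then obtain i where i: "(a - m) \<sqinter> cell k i \<noteq> \<bottom>" by blast
    let ?c = "(a - m) \<sqinter> cell k i"
    have "i < 2^k" using i cell_out[of k i] by (cases "i < 2^k") auto
    then have c: "mu ?c \<le> 1 / 2^k" using mu_mono[of ?c "cell k i"] by (simp add: mu_cell)
    have d: "m \<sqinter> ?c = \<bottom>" by (rule inf_bot_mono[of m "- m"]) (auto simp: diff_eq le_infI1)
    have "m \<squnion> ?c \<le> a" using m(1) by (simp add: diff_eq le_infI1)
    moreover have "mu (m \<squnion> ?c) \<le> r" using mu_sup[OF d] c k by simp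
    ultimately have "m \<squnion> ?c = m" using m(2) by simp
    then have "?c \<le> m" by (metis sup.cobounded2)
    then show False using d i by (simp add: inf.absorb2)
  qed
  then show ?thesis using m(1) by blast
qed

text \<open>By density some cell is filled by more than half, and then so is one of the two halves of that
  cell, at every finer level.\<close>

lemma half_dense_cell:
  assumes "a \<noteq> \<bottom>"
  obtains k where "\<And>l. k \<le> l \<Longrightarrow> \<exists>i<2^l. 1/2 * (1 / 2^l) < mu (a \<sqinter> cell l i)"
proof -
  define e where "e = mu a / 3"
  have e: "0 < e" using assms by (simp add: e_def)
  then obtain b k where b: "b \<in> dy k" "dist a b < e" using Dy_dense[OF e, of a] by (auto simp: Dy_def)
  have "\<exists>i<2^k. 1/2 * (1 / 2^k) < mu (a \<sqinter> cell k i)"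
  proof (rule ccontr)
    assume "\<not> ?thesis"
    then have le: "mu (a \<sqinter> cell k i) \<le> 1/2 * (1 / 2^k)" if "i < 2^k" for i using that by (meson not_le)
    have "mu (a \<sqinter> b) = (\<Sum>i<2^k. mu (a \<sqinter> b \<sqinter> cell k i))" by (rule mu_by_cells)
    also have "\<dots> \<le> (\<Sum>i<2^k. 1/2 * mu (b \<sqinter> cell k i))"
    proof (rule sum_mono)
      fix i :: nat assume i: "i \<in> {..<2^k}"
      consider "cell k i \<le> b" | "cell k i \<sqinter> b = \<bottom>" using b(1) by (auto simp: dy_def)
      then show "mu (a \<sqinter> b \<sqinter> cell k i) \<le> 1/2 * mu (b \<sqinter> cell k i)"
      proof cases
        case 1
        then show ?thesis using le[of i] i mu_cell[of i k] by (simp add: inf.absorb2 inf.assoc)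
      next
        case 2
        then show ?thesis by (simp add: inf.assoc inf.commute)
      qed
    qed
    also have "\<dots> = 1/2 * mu b" unfolding sum_distrib_left[symmetric] mu_by_cells[of b k, symmetric] ..
    finally have "mu (a \<sqinter> b) \<le> 1/2 * mu b" .
    moreover have "mu b - mu (a \<sqinter> b) \<le> dist a b"
      using mu_split[of b a] dist_mono_diff[of a b] mu_nonneg[of "a - b"] by (simp add: inf.commute)
    moreover have "mu a - mu b \<le> dist a b" using mu_dist[of a b] by simp
    ultimately show False using b(2) unfolding e_def by linarith
  qed
  moreover have "\<exists>i<2^(Suc l). 1/2 * (1 / 2^(Suc l)) < mu (a \<sqinter> cell (Suc l) i)"
    if half: "\<exists>i<2^l. 1/2 * (1 / 2^l) < mu (a \<sqinter> cell l i)" for l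
  proof -
    obtain i where i: "i < 2^l" "1/2 * (1 / 2^l) < mu (a \<sqinter> cell l i)" using half by blast
    have "mu (a \<sqinter> cell l i) \<le> mu (a \<sqinter> cell (Suc l) (2*i)) + mu (a \<sqinter> cell (Suc l) (2*i+1))"
      unfolding cell_split[of l i] inf_sup_distrib1 by (rule mu_sup_le)
    then have "1/2 * (1 / 2^(Suc l)) < mu (a \<sqinter> cell (Suc l) (2*i)) \<or> 1/2 * (1 / 2^(Suc l)) < mu (a \<sqinter> cell (Suc l) (2*i+1))"
      using i(2) by auto
    moreover have "2*i < 2^(Suc l)" "2*i+1 < 2^(Suc l)" using i(1) by auto
    ultimately show ?thesis by blast
  qed
  ultimately have "\<exists>i<2^(k+n). 1/2 * (1 / 2^(k+n)) < mu (a \<sqinter> cell (k+n) i)" for n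
    by (induction n) auto
  then show thesis using that[of k] by (metis le_Suc_ex)
qed

fun rots :: "nat \<Rightarrow> nat \<Rightarrow> 'a maut" where
  "rots l 0 = 0"
| "rots l (Suc m) = rot l + rots l m"

lemma rots_cell:
  assumes "l \<le> k" "i < 2^k" shows "act (rots l m) (cell k i) = cell k ((i + m * 2^(k-l)) mod 2^k)"
proof (induction m)
  case (Suc m)
  then show ?case using rot_cell[OF assms(1), of "(i + m * 2^(k-l)) mod 2^k"]
    by (simp add: act_plus mod_simps algebra_simps)
qed (use assms in simp)

text \<open>Both elements fill more than half of some cell of a common level, so after rotating one of these
  cells onto the other they meet.\<close>

lemma meeting_rotation:
  assumes "a \<noteq> \<bottom>" "b \<noteq> \<bottom>"
  obtains l m where "act (rots l m) a \<sqinter> b \<noteq> \<bottom>"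
proof -
  obtain k1 where k1: "\<And>l. k1 \<le> l \<Longrightarrow> \<exists>i<2^l. 1/2 * (1 / 2^l) < mu (a \<sqinter> cell l i)"
    by (rule half_dense_cell[OF assms(1)]) blast
  obtain k2 where k2: "\<And>l. k2 \<le> l \<Longrightarrow> \<exists>i<2^l. 1/2 * (1 / 2^l) < mu (b \<sqinter> cell l i)"
    by (rule half_dense_cell[OF assms(2)]) blast
  define l where "l = max k1 k2"
  obtain i j where ij: "i < 2^l" "1/2 * (1 / 2^l) < mu (a \<sqinter> cell l i)" "j < 2^l" "1/2 * (1 / 2^l) < mu (b \<sqinter> cell l j)"
    using k1[of l] k2[of l] by (auto simp: l_def)
  define g where "g = rots l (2^l - i + j)"
  have "act g (cell l i) = cell l ((i + (2^l - i + j)) mod 2^l)"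
    unfolding g_def using rots_cell[of l l i] ij(1) by simp
  also have "(i + (2^l - i + j)) mod 2^l = j" using ij by simp
  finally have g: "act g (cell l i) = cell l j" .
  have "act g a \<sqinter> b \<noteq> \<bottom>"
  proof
    assume 0: "act g a \<sqinter> b = \<bottom>"
    have "act g (a \<sqinter> cell l i) = act g a \<sqinter> cell l j" using g by (simp add: act_inf)
    then have "mu (act g a \<sqinter> cell l j) = mu (a \<sqinter> cell l i)" by (metis act_mu)
    moreover have "(act g a \<sqinter> cell l j) \<sqinter> (b \<sqinter> cell l j) = \<bottom>" by (rule inf_bot_mono[OF 0]) auto
    from mu_sup[OF this] have "mu (act g a \<sqinter> cell l j) + mu (b \<sqinter> cell l j) \<le> mu (cell l j)"
      using mu_mono[of "(act g a \<sqinter> cell l j) \<squnion> (b \<sqinter> cell l j)" "cell l j"] by simp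
    ultimately show False using ij mu_cell[OF ij(3)] by simp
  qed
  then show thesis using that by (simp add: g_def)
qed

text \<open>Go through all rotations, each time matching as much of the remainders as the rotation allows.
  The remainders have equal measure, and nonzero ones would be met by some rotation.\<close>

lemma matching_pieces:
  assumes ab: "mu a = mu (b::'a)"
  obtains A g where "disjseq A" "cjoin A = a" "disjseq (\<lambda>i. act (g i) (A i))" "cjoin (\<lambda>i. act (g i) (A i)) = b"
proof -
  define g where "g n = (case prod_decode n of (l, m) \<Rightarrow> rots l m)" for n
  define s where "s = rec_nat (a, b) (\<lambda>n (x, y). (x - (x \<sqinter> act (- g n) y), y - act (g n) (x \<sqinter> act (- g n) y)))"
  define ra where "ra n = fst (s n)" for n
  define rb where "rb n = snd (s n)" for n
  define A where "A n = ra n \<sqinter> act (- g n) (rb n)" for n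
  let ?B = "\<lambda>n. act (g n) (A n)"
  have r0: "ra 0 = a" "rb 0 = b" by (auto simp: ra_def rb_def s_def)
  have rS: "ra (Suc n) = ra n - A n" "rb (Suc n) = rb n - ?B n" for n
    by (auto simp: ra_def rb_def s_def A_def case_prod_beta)
  have Ar: "A n \<le> ra n" "?B n \<le> rb n" for n by (auto simp: A_def act_inf)
  have anti: "ra n \<le> ra m" "rb n \<le> rb m" if "m \<le> n" for m n
    using lift_Suc_antimono_le[of ra m n] lift_Suc_antimono_le[of rb m n] that by (auto simp: rS diff_eq)
  have dj: "disjseq X" if X: "\<And>n. X n \<le> r n" "\<And>n. r (Suc n) = r n - X n" "\<And>m n. m \<le> n \<Longrightarrow> r n \<le> r m" for X r :: "nat \<Rightarrow> 'a"
  proof -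
    have "X i \<sqinter> X j = \<bottom>" if "i < j" for i j
      by (rule inf_bot_mono[of "X i" "- X i"])
        (use order_trans[OF X(1)[of j] X(3)[of "Suc i" j]] that in \<open>auto simp: X(2) diff_eq\<close>)
    then show ?thesis unfolding disjseq_def by (metis inf.commute nat_neq_iff)
  qed
  have dA: "disjseq A" and dB: "disjseq ?B" using dj[of A ra] dj[of ?B rb] Ar rS anti by blast+
  have "A i \<le> a" "?B i \<le> b" for i
    using order_trans[OF Ar(1) anti(1)[of 0 i]] order_trans[OF Ar(2) anti(2)[of 0 i]] r0 by simp_all
  then have Aa: "cjoin A \<le> a" "cjoin ?B \<le> b" by (auto intro!: cjoin_least)
  have rem: "a - cjoin A \<le> ra n" "b - cjoin ?B \<le> rb n" for n
  proof (induction n)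
    case (Suc n)
    {
      case 1
      have "a - cjoin A \<le> - A n" using cjoin_upper[of A n] by (simp add: diff_eq le_infI2)
      then show ?case using Suc(1) by (simp add: rS diff_eq)
    next
      case 2
      have "b - cjoin ?B \<le> - ?B n" using cjoin_upper[of ?B n] by (simp add: diff_eq le_infI2)
      then show ?case using Suc(2) by (simp add: rS diff_eq)
    }
  qed (simp_all add: r0 diff_eq)
  have "mu (cjoin A) = mu (cjoin ?B)" using mu_cjoin[OF dA] mu_cjoin[OF dB] by (simp add: sums_iff)
  then have eq: "mu (a - cjoin A) = mu (b - cjoin ?B)" using mu_diff[OF Aa(1)] mu_diff[OF Aa(2)] ab by simp
  have "a - cjoin A = \<bottom>"
  proof (rule ccontr)
    assume ne: "a - cjoin A \<noteq> \<bottom>"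
    then have "b - cjoin ?B \<noteq> \<bottom>" using eq mu_eq_0_iff by metis
    with ne obtain l m where lm: "act (rots l m) (a - cjoin A) \<sqinter> (b - cjoin ?B) \<noteq> \<bottom>" by (rule meeting_rotation)
    define n where "n = prod_encode (l, m)"
    have gn: "g n = rots l m" by (simp add: g_def n_def)
    let ?x = "(a - cjoin A) \<sqinter> act (- g n) (b - cjoin ?B)"
    have "act (g n) ?x \<noteq> \<bottom>" using lm by (simp add: act_inf gn)
    then have "?x \<noteq> \<bottom>" by simp
    moreover have "?x \<le> ra n \<sqinter> act (- g n) (rb n)" by (intro inf_mono) (simp_all add: rem)
    then have "?x \<le> A n" by (simp only: A_def)
    moreover have "?x \<sqinter> A n = \<bottom>"
      by (rule inf_bot_mono[of "- cjoin A" "cjoin A"]) (auto simp: diff_eq cjoin_upper le_infI1)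
    ultimately show False by (simp add: inf.absorb1)
  qed
  moreover from this eq have "b - cjoin ?B = \<bottom>" using mu_eq_0_iff mu_bot by metis
  ultimately have "cjoin A = a" "cjoin ?B = b" using Aa by (auto simp: diff_bot_iff intro: antisym)
  then show thesis using that dA dB by blast
qed

lemma homogeneous_dyadic:
  assumes "mu (a::'a) = mu b" shows "\<exists>g. act g a = b"
proof -
  obtain A g where A: "disjseq A" "cjoin A = a" "disjseq (\<lambda>i. act (g i) (A i))" "cjoin (\<lambda>i. act (g i) (A i)) = b"
    by (rule matching_pieces[OF assms])
  have "mu (- a) = mu (- b)" using assms by (simp add: mu_compl)
  then obtain C h where C: "disjseq C" "cjoin C = - a" "disjseq (\<lambda>i. act (h i) (C i))" "cjoin (\<lambda>i. act (h i) (C i)) = - b"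
    by (rule matching_pieces)
  define E where "E n = (if even n then A (n div 2) else C (n div 2))" for n
  define k where "k n = (if even n then g (n div 2) else h (n div 2))" for n
  have inter: "disjseq (\<lambda>n. if even n then X (n div 2) else Y (n div 2))"
    if "disjseq X" "disjseq Y" "cjoin X = x" "cjoin Y = - x" for X Y and x :: 'a
  proof -
    have "X i \<sqinter> Y j = \<bottom>" "Y j \<sqinter> X i = \<bottom>" for i j
      using inf_bot_mono[of x "- x" "X i" "Y j"] cjoin_upper[of X i] cjoin_upper[of Y j] that(3,4)
      by (auto simp: inf.commute)
    moreover have "i div 2 \<noteq> j div 2" if "i \<noteq> j" "even i = even j" for i j :: nat using that by presburger
    ultimately show ?thesis unfolding disjseq_def using disjseqD[OF that(1)] disjseqD[OF that(2)] by auto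
  qed
  have "disjseq E" unfolding E_def by (rule inter[OF A(1) C(1) A(2) C(2)])
  moreover have "cjoin E = \<top>"
  proof -
    have "A i \<le> cjoin E" "C i \<le> cjoin E" for i
      using cjoin_upper[of E "2 * i"] cjoin_upper[of E "2 * i + 1"] by (auto simp: E_def)
    then have "a \<squnion> - a \<le> cjoin E" using A(2) C(2) cjoin_least[of A] cjoin_least[of C] by (metis le_sup_iff)
    then show ?thesis by (simp add: top.extremum_unique)
  qed
  moreover have "disjseq (\<lambda>n. act (k n) (E n))"
  proof -
    have "(\<lambda>n. act (k n) (E n)) = (\<lambda>n. if even n then act (g (n div 2)) (A (n div 2)) else act (h (n div 2)) (C (n div 2)))"
      by (auto simp: k_def E_def)
    then show ?thesis using inter[OF A(3) C(3) A(4) C(4)] by simp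
  qed
  ultimately obtain f where f: "\<And>n c. c \<le> E n \<Longrightarrow> act f c = act (k n) c" using glue by metis
  have "act f (A i) = act (g i) (A i)" for i using f[of "A i" "2 * i"] by (simp add: E_def k_def)
  then have "act f a = b" using A(2,4) act_cjoin[of f A] by simp
  then show ?thesis by blast
qed

sublocale homogeneous_algebra "TYPE('a)"
  by unfold_locales (use divisible_dyadic homogeneous_dyadic in auto)

text \<open>The automorphisms that induce an automorphism of the countable algebra \<open>Dy\<close>.\<close>

definition Gam :: "'a maut set" where
  "Gam = {g. \<forall>a\<in>Dy. act g a \<in> Dy \<and> act (- g) a \<in> Dy}"

definition Fix :: "nat \<Rightarrow> 'a maut set" where
  "Fix n = {g\<in>Gam. \<forall>a\<in>dy n. act g a = a}"

lemma GamD: "g \<in> Gam \<Longrightarrow> a \<in> Dy \<Longrightarrow> act g a \<in> Dy" "g \<in> Gam \<Longrightarrow> a \<in> Dy \<Longrightarrow> act (- g) a \<in> Dy"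
  by (auto simp: Gam_def)

lemma FixI: "g \<in> Gam \<Longrightarrow> (\<And>i. act g (cell n i) = cell n i) \<Longrightarrow> g \<in> Fix n"
proof -
  assume g: "g \<in> Gam" "\<And>i. act g (cell n i) = cell n i"
  have "act g a = a" if "a \<in> dy n" for a
  proof -
    have "act g (cjoin (\<lambda>i. if cell n i \<le> a then cell n i else \<bottom>)) = cjoin (\<lambda>i. if cell n i \<le> a then cell n i else \<bottom>)"
      unfolding act_cjoin by (intro arg_cong[of _ _ cjoin]) (auto simp: g(2))
    then show ?thesis using dy_eq_cjoin[OF that] by simp
  qed
  then show ?thesis using g(1) by (simp add: Fix_def)
qed

lemma Gam_by_levels:
  assumes "\<And>l. n \<le> l \<Longrightarrow> \<forall>i. \<exists>j. act g (cell l i) = cell l j" shows "g \<in> Gam"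
proof -
  have maps: "act g a \<in> dy l" if "n \<le> l" "a \<in> dy l" for a l
  proof -
    have eq: "act g a = cjoin (\<lambda>i. act g (if cell l i \<le> a then cell l i else \<bottom>))"
      unfolding act_cjoin[symmetric] by (rule arg_cong[OF dy_eq_cjoin[OF that(2)]])
    note lev = assms[OF that(1)]
    have "act g (if cell l i \<le> a then cell l i else \<bottom>) \<in> dy l" for i
    proof (cases "cell l i \<le> a")
      case True
      obtain j where "act g (cell l i) = cell l j" using lev by blast
      then show ?thesis using True cell_dy by simp
    qed (simp add: bot_dy)
    then show ?thesis unfolding eq by (rule dy_cjoin)
  qed
  have surj: "act g ` dy l = dy l" if "n \<le> l" for l
    using maps[OF that] by (intro endo_inj_surj finite_dy) (auto intro: inj_onI)
  have bwd: "act (- g) a \<in> dy l" if "n \<le> l" "a \<in> dy l" for a l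
    using surj[OF that(1)] that(2) by (metis act_minus1 imageE)
  have "\<exists>l\<ge>n. a \<in> dy l" if "a \<in> Dy" for a
    using that dy_mono unfolding Dy_def by (metis UN_E max.cobounded1 max.cobounded2 subsetD)
  then show ?thesis unfolding Gam_def using maps bwd dy_Dy by blast
qed

lemma permuting_automorphism:
  assumes p: "bij_betw p {..<2^k} {..<2^k}"
  obtains g where "g \<in> Gam" "\<And>i. i < 2^k \<Longrightarrow> act g (cell k i) = cell k (p i)"
proof -
  define r where "r i = (if i < 2^k then rots k (2^k - i + p i) else 0)" for i
  have rc: "act (r i) (cell l j) = cell l ((j + (2^k - i + p i) * 2^(l-k)) mod 2^l)" if "k \<le> l" "j < 2^l" "i < 2^k" for i j l
    using that by (simp add: r_def rots_cell)
  have ri: "act (r i) (cell k i) = cell k (p i)" if "i < 2^k" for i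
    using rc[of k i i] that bij_betwE[OF p] by simp
  have out: "act (r i) (cell k i) = \<bottom>" if "\<not> i < 2^k" for i using that cell_out[of k i] by simp
  have "disjseq (\<lambda>i. act (r i) (cell k i))"
    unfolding disjseq_def
  proof (intro allI impI)
    fix i j :: nat assume "i \<noteq> j"
    show "act (r i) (cell k i) \<sqinter> act (r j) (cell k j) = \<bottom>"
    proof (cases "i < 2^k \<and> j < 2^k")
      case True
      then have "p i \<noteq> p j" using \<open>i \<noteq> j\<close> p by (auto simp: bij_betw_def inj_on_def)
      then show ?thesis using True by (simp add: ri cell_disj)
    next
      case False
      then show ?thesis using out by auto
    qed
  qed
  from glue[OF disjseq_cell cjoin_cell this] obtain g where g: "\<And>i c. c \<le> cell k i \<Longrightarrow> act g c = act (r i) c" by metis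
  have "g \<in> Gam"
  proof (rule Gam_by_levels)
    fix l assume l: "k \<le> l"
    have "\<exists>j. act g (cell l i) = cell l j" for i
    proof (cases "i < 2^l")
      case True
      have "cell l i \<le> cell k (i div 2^(l-k))" using cell_le_ancestor[of k "l-k" i] l by simp
      moreover have "i div 2^(l-k) < 2^k" using True l by (simp add: less_mult_imp_div_less flip: power_add)
      ultimately show ?thesis using g rc[OF l True] by auto
    next
      case False
      then show ?thesis using cell_out[of l i] by (metis act_bot not_less)
    qed
    then show "\<forall>i. \<exists>j. act g (cell l i) = cell l j" by blast
  qed
  then show thesis using that[of g] g[OF order_refl] ri by metis
qed

text \<open>Convergence of the inverses as well makes the limit invertible.\<close>

lemma maut_limit:
  fixes c :: "nat \<Rightarrow> 'a maut"
  assumes "\<And>b. Cauchy (\<lambda>n. act (c n) b)" "\<And>b. Cauchy (\<lambda>n. act (- c n) b)"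
  obtains g where "\<And>b. (\<lambda>n. act (c n) b) \<longlonglongrightarrow> act g b" "\<And>b. (\<lambda>n. act (- c n) b) \<longlonglongrightarrow> act (- g) b"
proof -
  define f where "f b = lim (\<lambda>n. act (c n) b)" for b
  define f' where "f' b = lim (\<lambda>n. act (- c n) b)" for b
  have f: "(\<lambda>n. act (c n) b) \<longlonglongrightarrow> f b" "(\<lambda>n. act (- c n) b) \<longlonglongrightarrow> f' b" for b
    using assms[THEN Cauchy_convergent] by (auto simp: f_def f'_def convergent_LIMSEQ_iff)
  have inv: "u (v b) = b"
    if u: "\<And>b. (\<lambda>n. act (d n) b) \<longlonglongrightarrow> u b" and v: "\<And>b. (\<lambda>n. act (- d n) b) \<longlonglongrightarrow> v b" for u v and d :: "nat \<Rightarrow> 'a maut" and b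
  proof -
    have "(\<lambda>n. dist (act (d n) (v b)) (u (v b))) \<longlonglongrightarrow> 0" "(\<lambda>n. dist (act (- d n) b) (v b)) \<longlonglongrightarrow> 0"
      using u[of "v b"] v[of b] by (auto simp: tendsto_dist_iff[symmetric])
    from tendsto_add_zero[OF this]
    have "(\<lambda>n. dist (act (d n) (v b)) (u (v b)) + dist (act (- d n) b) (v b)) \<longlonglongrightarrow> 0" .
    moreover have "dist b (u (v b)) \<le> dist (act (d n) (v b)) (u (v b)) + dist (act (- d n) b) (v b)" for n
      using dist_triangle[of b "u (v b)" "act (d n) (v b)"] act_dist[of "d n" "act (- d n) b" "v b"] by simp
    ultimately have "dist b (u (v b)) \<le> 0" by (intro LIMSEQ_le_const) auto
    then show ?thesis by simp
  qed
  have mono: "f a \<le> f b" "f' a \<le> f' b" if "a \<le> b" for a b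
    using LIMSEQ_le_pa[OF f(1) f(1), of a b] LIMSEQ_le_pa[OF f(2) f(2), of a b] that by auto
  have "mu (f a) = mu a" for a
    using LIMSEQ_unique[OF tendsto_mu[OF f(1), of a]] by simp
  moreover have "f' (f a) = a" for a by (rule inv[of "\<lambda>n. - c n"]) (use f in auto)
  moreover have "f (f' a) = a" for a by (rule inv[of c]) (use f in auto)
  ultimately obtain g where "act g = f" "act (- g) = f'" using mautI[of f f'] mono by metis
  then show thesis using that f by metis
qed

lemma Cauchy_by_Dy:
  assumes "\<And>a. a \<in> Dy \<Longrightarrow> \<exists>N. \<forall>n\<ge>N. act (c n) a = act (c N) a" shows "Cauchy (\<lambda>n. act (c n) b)"
proof (rule metric_CauchyI)
  fix e :: real assume "0 < e"
  then obtain a where a: "a \<in> Dy" "dist b a < e / 2" using Dy_dense[of "e/2" b] by auto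
  obtain N where N: "\<And>n. N \<le> n \<Longrightarrow> act (c n) a = act (c N) a" using assms[OF a(1)] by blast
  have "dist (act (c m) b) (act (c n) b) < e" if "N \<le> m" "N \<le> n" for m n
  proof -
    have "act (c m) a = act (c n) a" using N that by metis
    then have "dist (act (c m) b) (act (c n) b) \<le> dist (act (c m) b) (act (c m) a) + dist (act (c n) a) (act (c n) b)"
      using dist_triangle[of "act (c m) b" "act (c n) b" "act (c m) a"] by simp
    also have "\<dots> < e" using a(2) by (simp add: dist_commute)
    finally show ?thesis .
  qed
  then show "\<exists>M. \<forall>m\<ge>M. \<forall>n\<ge>M. dist (act (c m) b) (act (c n) b) < e" by blast
qed

lemma limit_on_Dy:
  fixes c :: "nat \<Rightarrow> 'a maut"
  assumes 1: "\<And>a. a \<in> Dy \<Longrightarrow> \<exists>N. \<forall>n\<ge>N. act (c n) a = act (c N) a"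
    and 2: "\<And>a. a \<in> Dy \<Longrightarrow> \<exists>N. \<forall>n\<ge>N. act (- c n) a = act (- c N) a"
  shows "\<exists>g. (\<forall>b. (\<lambda>n. act (c n) b) \<longlonglongrightarrow> act g b) \<and>
    (\<forall>a N. (\<forall>n\<ge>N. act (c n) a = act (c N) a) \<longrightarrow> act g a = act (c N) a) \<and>
    (\<forall>a N. (\<forall>n\<ge>N. act (- c n) a = act (- c N) a) \<longrightarrow> act (- g) a = act (- c N) a)"
proof -
  obtain g where g: "\<And>b. (\<lambda>n. act (c n) b) \<longlonglongrightarrow> act g b" "\<And>b. (\<lambda>n. act (- c n) b) \<longlonglongrightarrow> act (- g) b"
    using maut_limit[of c] Cauchy_by_Dy[of c] Cauchy_by_Dy[of "\<lambda>n. - c n"] 1 2 by metis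
  have ev: "l = x" if "f \<longlonglongrightarrow> l" "\<And>n. N \<le> n \<Longrightarrow> f n = x" for f :: "nat \<Rightarrow> 'a" and l x N
  proof -
    have "eventually (\<lambda>n. f n = x) sequentially" using that(2) eventually_sequentially by blast
    then have "f \<longlonglongrightarrow> x" by (rule tendsto_eventually)
    then show ?thesis using LIMSEQ_unique that(1) by blast
  qed
  have "act g a = act (c N) a" if "\<forall>n\<ge>N. act (c n) a = act (c N) a" for a N
    using ev[OF g(1)] that by blast
  moreover have "act (- g) a = act (- c N) a" if "\<forall>n\<ge>N. act (- c n) a = act (- c N) a" for a N
    using ev[OF g(2)] that by blast
  ultimately show ?thesis using g(1) by blast
qed

lemma Gam_limit:
  fixes c :: "nat \<Rightarrow> 'a maut"
  assumes G: "\<And>n. c n \<in> Gam"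
    and 1: "\<And>a. a \<in> Dy \<Longrightarrow> \<exists>N. \<forall>n\<ge>N. act (c n) a = act (c N) a"
    and 2: "\<And>a. a \<in> Dy \<Longrightarrow> \<exists>N. \<forall>n\<ge>N. act (- c n) a = act (- c N) a"
  shows "\<exists>g\<in>Gam. (\<forall>a N. (\<forall>n\<ge>N. act (c n) a = act (c N) a) \<longrightarrow> act g a = act (c N) a) \<and>
    (\<forall>a N. (\<forall>n\<ge>N. act (- c n) a = act (- c N) a) \<longrightarrow> act (- g) a = act (- c N) a)"
proof -
  obtain g where g: "\<forall>a N. (\<forall>n\<ge>N. act (c n) a = act (c N) a) \<longrightarrow> act g a = act (c N) a"
    "\<forall>a N. (\<forall>n\<ge>N. act (- c n) a = act (- c N) a) \<longrightarrow> act (- g) a = act (- c N) a"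
    using limit_on_Dy[of c] 1 2 by blast
  have "act g a \<in> Dy \<and> act (- g) a \<in> Dy" if "a \<in> Dy" for a
    using 1[OF that] 2[OF that] g GamD[OF G that] by metis
  then have "g \<in> Gam" by (simp add: Gam_def)
  then show ?thesis using g by blast
qed

end

section \<open>Generic tuples of dyadic automorphisms\<close>

text \<open>Two partitions of a finite set with equal block sizes are carried to each other by a bijection;
  every rearrangement of cells below comes from this.\<close>

lemma matching_bijection:
  fixes A B :: "'i \<Rightarrow> 'x set"
  assumes A: "disjoint_family_on A I" "(\<Union>i\<in>I. A i) = X" and B: "disjoint_family_on B I" "(\<Union>i\<in>I. B i) = X"
    and X: "finite X" and card: "\<And>i. i \<in> I \<Longrightarrow> card (A i) = card (B i)"
  obtains p where "bij_betw p X X" "\<And>i x. i \<in> I \<Longrightarrow> x \<in> A i \<Longrightarrow> p x \<in> B i"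
proof -
  have fin: "finite (A i)" "finite (B i)" if "i \<in> I" for i
    using that finite_subset[OF _ X, of "A i"] finite_subset[OF _ X, of "B i"]
    using A(2) B(2) by blast+
  then have "\<exists>f. bij_betw f (A i) (B i)" if "i \<in> I" for i
    using finite_same_card_bij card that by blast
  then obtain f where f: "\<And>i. i \<in> I \<Longrightarrow> bij_betw (f i) (A i) (B i)" by metis
  define p where "p x = f (SOME i. i \<in> I \<and> x \<in> A i) x" for x
  have px: "p x = f i x" if "i \<in> I" "x \<in> A i" for i x
  proof -
    have "(SOME i. i \<in> I \<and> x \<in> A i) = i"
      using that A(1) by (intro some_equality) (auto simp: disjoint_family_on_def)
    then show ?thesis by (simp add: p_def)
  qed
  have "bij_betw p (A i) (B i)" if "i \<in> I" for i
    using f[OF that] px[OF that] bij_betw_cong[of "A i" p "f i" "B i"] by simp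
  then have "bij_betw p (\<Union>i\<in>I. A i) (\<Union>i\<in>I. B i)"
    by (rule bij_betw_UNION_disjoint[OF B(1)])
  moreover have "p x \<in> B i" if "i \<in> I" "x \<in> A i" for i x
    using px[OF that] f[OF that(1)] that(2) by (simp add: bij_betw_apply)
  ultimately show thesis using that A(2) B(2) by simp
qed

context dyadic_algebra
begin

text \<open>An ordered partition of the unit into \<open>2 ^ n\<close> dyadic elements of equal measure, extended by zero.
  Frames are the images of the cells of a level under \<open>Gam\<close>.\<close>

definition frame :: "nat \<Rightarrow> (nat \<Rightarrow> 'a) \<Rightarrow> bool" where
  "frame n e \<longleftrightarrow> disjseq e \<and> (\<forall>i. e i \<in> Dy) \<and> (\<forall>i<2^n. mu (e i) = 1 / 2^n) \<and> (\<forall>i. 2^n \<le> i \<longrightarrow> e i = \<bottom>)"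

lemma frameD:
  assumes "frame n e"
  shows "disjseq e" "e i \<in> Dy" "i < 2^n \<Longrightarrow> mu (e i) = 1 / 2^n" "2^n \<le> i \<Longrightarrow> e i = \<bottom>"
  using assms by (auto simp: frame_def)

lemma frame_cell: "frame k (cell k)"
  by (simp add: frame_def disjseq_cell dy_Dy[OF cell_dy] mu_cell cell_out)

lemma cjoin_frame:
  assumes "frame n e" shows "cjoin e = \<top>"
proof -
  have "(\<lambda>i. mu (e i)) = (\<lambda>i. if i \<in> {..<2^n} then 1 / 2^n else 0)"
    using frameD[OF assms] by (auto simp: not_less fun_eq_iff)
  moreover have "(\<lambda>i. if i \<in> {..<2^n::nat} then 1 / 2^n else 0::real) sums (\<Sum>i\<in>{..<2^n::nat}. 1 / 2^n)"
    by (rule sums_If_finite_set) simp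
  ultimately have "mu (cjoin e) = 1" using mu_cjoin[OF frameD(1)[OF assms]] by (simp add: sums_iff)
  then show ?thesis by (intro mu_eq_le_imp_eq) (simp_all add: mu_top)
qed

lemma frame_ne_bot: "frame n e \<Longrightarrow> i < 2^n \<Longrightarrow> e i \<noteq> \<bottom>"
  using frameD(3)[of n e i] mu_bot by fastforce

lemma frame_eq_iff: "frame n e \<Longrightarrow> i < 2^n \<Longrightarrow> e i \<le> e j \<Longrightarrow> i = j"
  using disjseqD[OF frameD(1), of n e i j] frame_ne_bot[of n e i] by (metis inf.absorb1)

lemma frame_levels:
  assumes "frame n e" obtains k where "m \<le> k" "\<And>i. e i \<in> dy k"
proof -
  have "finite (e ` {..<2^n})" "e ` {..<2^n} \<subseteq> Dy" using frameD(2)[OF assms] by auto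
  then obtain k where k: "m \<le> k" "e ` {..<2^n} \<subseteq> dy k" by (rule finite_subset_dy)
  have "e i \<in> dy k" for i using k(2) frameD(4)[OF assms, of i] bot_dy by (cases "i < 2^n") auto
  then show thesis using that k(1) by blast
qed

definition adapted :: "(nat \<Rightarrow> 'a) \<Rightarrow> 'a \<Rightarrow> bool" where
  "adapted e a \<longleftrightarrow> (\<forall>p. e p \<le> a \<or> e p \<sqinter> a = \<bottom>)"

lemma act_le_by_frame:
  assumes "frame n e" "adapted e a" "\<And>p. p < 2^n \<Longrightarrow> e p \<le> a \<Longrightarrow> act g (e p) \<le> b"
  shows "act g a \<le> b"
proof -
  have "a = cjoin (\<lambda>p. a \<sqinter> e p)" by (simp add: inf_cjoin[symmetric] cjoin_frame[OF assms(1)])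
  also have "\<dots> \<le> act (- g) b"
  proof (rule cjoin_least)
    fix p
    show "a \<sqinter> e p \<le> act (- g) b"
    proof (cases "p < 2^n \<and> e p \<le> a")
      case True
      then show ?thesis using assms(3)[of p] by (simp add: inf.absorb2 act_le_swap)
    next
      case False
      then have "a \<sqinter> e p = \<bottom>" using assms(2) frameD(4)[OF assms(1), of p]
        by (auto simp: adapted_def inf.commute not_less)
      then show ?thesis by simp
    qed
  qed
  finally show ?thesis by (simp add: act_le_swap)
qed

lemma mu_adapted:
  assumes "frame n e" "adapted e a" shows "mu a = card {p. p < 2^n \<and> e p \<le> a} / 2^n"
proof -
  have "disjseq (\<lambda>i. a \<sqinter> e i)" unfolding disjseq_def
    using inf_bot_mono[OF disjseqD[OF frameD(1)[OF assms(1)]]] by (metis inf.cobounded2)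
  from mu_cjoin[OF this] have "(\<lambda>i. mu (a \<sqinter> e i)) sums mu a"
    by (simp add: inf_cjoin[symmetric] cjoin_frame[OF assms(1)])
  moreover have "(\<lambda>i. mu (a \<sqinter> e i)) = (\<lambda>i. if i \<in> {p. p < 2^n \<and> e p \<le> a} then 1 / 2^n else 0)"
  proof
    fix i
    show "mu (a \<sqinter> e i) = (if i \<in> {p. p < 2^n \<and> e p \<le> a} then 1 / 2^n else 0)"
      using assms(2) frameD(3,4)[OF assms(1), of i]
      by (cases "e i \<le> a") (auto simp: adapted_def inf.absorb2 inf.commute not_less)
  qed
  moreover have "(\<lambda>i. if i \<in> {p. p < 2^n \<and> e p \<le> a} then 1 / 2^n else 0::real) sums (\<Sum>i\<in>{p. p < 2^n \<and> e p \<le> a}. 1 / 2^n)"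
    by (rule sums_If_finite_set) simp
  ultimately show ?thesis using sums_unique2 by fastforce
qed

definition resolves :: "(nat \<Rightarrow> 'a) \<Rightarrow> nat \<Rightarrow> bool" where
  "resolves e l \<longleftrightarrow> (\<forall>a\<in>dy l. adapted e a)"

lemma resolves_cell: "resolves (cell k) k"
  by (simp add: resolves_def adapted_def dy_def)

lemma resolves_mono: "resolves e l \<Longrightarrow> k \<le> l \<Longrightarrow> resolves e k"
  using dy_mono by (auto simp: resolves_def)

lemma resolves_level: assumes "frame n e" "resolves e l" shows "l \<le> n"
proof -
  have ad: "adapted e (cell l 0)" using assms(2) cell_dy by (auto simp: resolves_def)
  have "mu (cell l 0) = 1 / 2^l" by (rule mu_cell) simp
  moreover define c where "c = card {p. p < 2^n \<and> e p \<le> cell l 0}"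
  ultimately have c: "real c = 2^n / 2^l"
    using mu_adapted[OF assms(1) ad] by (simp add: field_simps)
  then have "c \<noteq> 0" by (intro notI) simp
  then have "1 \<le> real c" by simp
  then have "(2::real)^l \<le> 2^n" unfolding c by (simp add: field_simps)
  then show ?thesis by simp
qed

lemma Fix_by_frame:
  assumes "g \<in> Gam" "frame n e" "resolves e l" "\<And>p. p < 2^n \<Longrightarrow> act g (e p) = e p" shows "g \<in> Fix l"
proof -
  have "act g a = a" if "a \<in> dy l" for a
  proof (rule mu_eq_le_imp_eq)
    show "act g a \<le> a" 
      by (rule act_le_by_frame[OF assms(2)]) (use assms(3,4) that in \<open>auto simp: resolves_def\<close>)
  qed simp
  then show ?thesis using assms(1) by (simp add: Fix_def)
qed

lemma card_frame_fibre:
  assumes e: "frame n e" and f: "frame m f" "\<And>i. adapted f (e i)" and i: "i < 2^n" and "n \<le> m"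
  shows "card {p. p < 2^m \<and> f p \<le> e i} = 2^(m-n)"
proof -
  have "real (card {p. p < 2^m \<and> f p \<le> e i}) = 2^m / 2^n"
    using mu_adapted[OF f(1) f(2)[of i]] frameD(3)[OF e i] by (simp add: field_simps)
  also have "\<dots> = 2^(m-n)" using \<open>n \<le> m\<close> by (simp add: power_diff)
  also have "\<dots> = real (2^(m-n))" by simp
  finally show ?thesis by (simp only: of_nat_eq_iff)
qed

lemma frame_fibres:
  assumes e: "frame n e" and f: "frame m f" "\<And>i. adapted f (e i)"
  shows "disjoint_family_on (\<lambda>i. {p. p < 2^m \<and> f p \<le> e i}) {..<2^n}"
    and "(\<Union>i\<in>{..<2^n}. {p. p < 2^m \<and> f p \<le> e i}) = {..<2^m}"
proof -
  have "i = j" if "p < 2^m" "f p \<le> e i" "f p \<le> e j" for p i j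
  proof (rule ccontr)
    assume "i \<noteq> j"
    then have "e i \<sqinter> e j = \<bottom>" using disjseqD[OF frameD(1)[OF e]] by blast
    then have "f p \<sqinter> f p = \<bottom>" using inf_bot_mono that by blast
    then show False using frame_ne_bot[OF f(1) that(1)] by simp
  qed
  then show "disjoint_family_on (\<lambda>i. {p. p < 2^m \<and> f p \<le> e i}) {..<2^n}"
    unfolding disjoint_family_on_def by blast
  have "\<exists>i<2^n. f p \<le> e i" if "p < 2^m" for p
  proof (rule ccontr)
    assume no: "\<not> (\<exists>i<2^n. f p \<le> e i)"
    have "f p \<sqinter> e i = \<bottom>" for i
    proof (cases "i < 2^n")
      case True
      then show ?thesis using no f(2)[of i] by (auto simp: adapted_def)
    next
      case False
      then show ?thesis using frameD(4)[OF e, of i] by simp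
    qed
    then have "f p = \<bottom>" using cjoin_disjoint'[of "f p" e] cjoin_frame[OF e] by simp
    then show False using frame_ne_bot[OF f(1) that] by simp
  qed
  then show "(\<Union>i\<in>{..<2^n}. {p. p < 2^m \<and> f p \<le> e i}) = {..<2^m}" by auto
qed

lemma frames_isomorphic:
  assumes e: "frame n e" and f: "frame n f"
  obtains g where "g \<in> Gam" "\<And>i. act g (e i) = f i"
proof -
  obtain k0 where k0: "n \<le> k0" "\<And>i. e i \<in> dy k0" using frame_levels[OF e, where m = n] by blast
  obtain k where k: "k0 \<le> k" "\<And>i. f i \<in> dy k" using frame_levels[OF f, where m = k0] by blast
  have ad: "adapted (cell k) (e i)" "adapted (cell k) (f i)" for i
    using resolves_cell[of k] k0(2) k dy_mono[OF k(1)] by (auto simp: resolves_def)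
  have nk: "n \<le> k" using k0(1) k(1) by simp
  obtain p where p: "bij_betw p {..<2^k} {..<2^k}"
    "\<And>i x. i \<in> {..<2^n} \<Longrightarrow> x \<in> {p. p < 2^k \<and> cell k p \<le> e i} \<Longrightarrow> p x \<in> {p. p < 2^k \<and> cell k p \<le> f i}"
    by (rule matching_bijection[OF frame_fibres[OF e frame_cell ad(1)] frame_fibres[OF f frame_cell ad(2)]])
      (simp_all add: card_frame_fibre[OF e frame_cell ad(1) _ nk] card_frame_fibre[OF f frame_cell ad(2) _ nk])
  obtain g where g: "g \<in> Gam" "\<And>i. i < 2^k \<Longrightarrow> act g (cell k i) = cell k (p i)"
    by (rule permuting_automorphism[OF p(1)]) blast
  have "act g (e i) = f i" for i
  proof (cases "i < 2^n")
    case True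
    show ?thesis
    proof (rule mu_eq_le_imp_eq)
      show "act g (e i) \<le> f i"
        by (rule act_le_by_frame[OF frame_cell ad(1)]) (use p(2)[of i] True g(2) in auto)
      show "mu (act g (e i)) = mu (f i)" using frameD(3)[OF e True] frameD(3)[OF f True] by simp
    qed
  next
    case False
    then show ?thesis using frameD(4)[OF e, of i] frameD(4)[OF f, of i] by simp
  qed
  then show thesis using that g(1) by blast
qed

text \<open>The order matters: the refinement of piece \<open>i\<close> of \<open>e\<close> consists of the block of consecutive pieces
  of \<open>f\<close> whose quotient by \<open>2 ^ (m - n)\<close> is \<open>i\<close>.\<close>

definition refines :: "nat \<Rightarrow> (nat \<Rightarrow> 'a) \<Rightarrow> nat \<Rightarrow> (nat \<Rightarrow> 'a) \<Rightarrow> bool" where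
  "refines n e m f \<longleftrightarrow> n \<le> m \<and> (\<forall>p<2^m. f p \<le> e (p div 2^(m-n)))"

lemma div_less_pow: "n \<le> m \<Longrightarrow> p < 2^m \<Longrightarrow> p div 2^(m-n) < (2::nat)^n"
  by (simp add: less_mult_imp_div_less flip: power_add)

lemma refines_adapted:
  assumes e: "frame n e" and f: "frame m f" and r: "refines n e m f" shows "adapted f (e i)"
  unfolding adapted_def
proof
  fix p
  show "f p \<le> e i \<or> f p \<sqinter> e i = \<bottom>"
  proof (cases "p < 2^m")
    case True
    then have le: "f p \<le> e (p div 2^(m-n))" using r by (simp add: refines_def)
    show ?thesis
    proof (cases "p div 2^(m-n) = i")
      case False
      have "f p \<sqinter> e i = \<bottom>" by (rule inf_bot_mono[OF disjseqD[OF frameD(1)[OF e] False] le order_refl])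
      then show ?thesis ..
    qed (use le in simp)
  qed (use frameD(4)[OF f, of p] in simp)
qed

lemma refines_le_iff:
  assumes e: "frame n e" and f: "frame m f" and r: "refines n e m f" and p: "p < 2^m" "f p \<le> e i"
  shows "p div 2^(m-n) = i"
proof (rule ccontr)
  assume ne: "p div 2^(m-n) \<noteq> i"
  have "f p \<sqinter> f p = \<bottom>"
    by (rule inf_bot_mono[OF disjseqD[OF frameD(1)[OF e] ne]]) (use r p in \<open>auto simp: refines_def\<close>)
  then show False using frame_ne_bot[OF f p(1)] by simp
qed

lemma refines_trans:
  assumes "refines n e m f" "refines m f k h" shows "refines n e k h"
proof -
  have "h p \<le> e (p div 2^(k-n))" if "p < 2^k" for p
  proof -
    have "h p \<le> f (p div 2^(k-m))" using assms(2) that by (simp add: refines_def)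
    also have "\<dots> \<le> e (p div 2^(k-m) div 2^(m-n))"
      using assms that div_less_pow[of m k p] by (simp add: refines_def)
    also have "p div 2^(k-m) div 2^(m-n) = p div 2^(k-n)"
      using assms by (simp add: refines_def div_mult2_eq[symmetric] power_add[symmetric])
    finally show ?thesis .
  qed
  then show ?thesis using assms by (auto simp: refines_def)
qed

lemma refines_refl: "refines n e n e" by (simp add: refines_def)

lemma resolves_refines:
  assumes "resolves e l" "refines n e m f" "frame m f" shows "resolves f l"
  unfolding resolves_def adapted_def
proof (intro ballI allI)
  fix a p assume "a \<in> dy l"
  then have cell: "e (p div 2^(m-n)) \<le> a \<or> e (p div 2^(m-n)) \<sqinter> a = \<bottom>" using assms(1) by (auto simp: resolves_def adapted_def)
  have le: "f p \<le> e (p div 2^(m-n))"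
    using assms(2) frameD(4)[OF assms(3), of p] by (cases "p < 2^m") (auto simp: refines_def)
  show "f p \<le> a \<or> f p \<sqinter> a = \<bottom>"
    using cell order_trans[OF le] inf_bot_mono[OF _ le order_refl] by (elim disjE) simp_all
qed

definition moves :: "'a maut \<Rightarrow> nat \<Rightarrow> (nat \<Rightarrow> 'a) \<Rightarrow> (nat \<Rightarrow> nat) \<Rightarrow> bool" where
  "moves g n e s \<longleftrightarrow> (\<forall>i<2^n. s i < 2^n \<and> act g (e i) = e (s i))"

text \<open>The combinatorial counterpart of refinement: the permutation \<open>t\<close> of \<open>2 ^ m\<close> indices induces \<open>s\<close> on
  the \<open>2 ^ n\<close> blocks.\<close>

definition lifts :: "nat \<Rightarrow> (nat \<Rightarrow> nat) \<Rightarrow> nat \<Rightarrow> (nat \<Rightarrow> nat) \<Rightarrow> bool" where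
  "lifts n s m t \<longleftrightarrow> (\<forall>p<2^m. t p < 2^m \<and> t p div 2^(m-n) = s (p div 2^(m-n))) \<and> inj_on t {..<2^m}"

lemma movesI_le:
  assumes "frame n e" "\<And>i. i < 2^n \<Longrightarrow> s i < 2^n \<and> act g (e i) \<le> e (s i)" shows "moves g n e s"
  unfolding moves_def
proof (intro allI impI conjI)
  fix i :: nat assume i: "i < 2^n"
  show "s i < 2^n" using assms(2)[OF i] by blast
  then show "act g (e i) = e (s i)"
    using assms(2)[OF i] frameD(3)[OF assms(1) i] frameD(3)[OF assms(1), of "s i"]
    by (intro mu_eq_le_imp_eq) simp_all
qed

lemma moves_inj: assumes "frame n e" "moves g n e s" shows "inj_on s {..<2^n}"
proof (rule inj_onI)
  fix i j assume ij: "i \<in> {..<2^n}" "j \<in> {..<2^n}" "s i = s j"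
  then have "act g (e i) = act g (e j)" using assms(2) by (simp add: moves_def)
  then show "i = j" using frame_eq_iff[OF assms(1), of i j] ij by simp
qed

lemma moves_lifts:
  assumes e: "frame n e" and f: "frame m f" and r: "refines n e m f" and s: "moves g n e s" and t: "moves g m f t"
  shows "lifts n s m t"
  unfolding lifts_def
proof (intro conjI allI impI)
  fix p :: nat assume p: "p < 2^m"
  show tp: "t p < 2^m" using t p by (simp add: moves_def)
  have i: "p div 2^(m-n) < 2^n" using r p div_less_pow by (simp add: refines_def)
  have "f p \<le> e (p div 2^(m-n))" using r p by (simp add: refines_def)
  then have le: "act g (f p) \<le> act g (e (p div 2^(m-n)))" by simp
  have "act g (f p) = f (t p)" "act g (e (p div 2^(m-n))) = e (s (p div 2^(m-n)))"
    using s t p i by (simp_all add: moves_def)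
  with le have "f (t p) \<le> e (s (p div 2^(m-n)))" by metis
  then show "t p div 2^(m-n) = s (p div 2^(m-n))" by (rule refines_le_iff[OF e f r tp])
qed (rule moves_inj[OF f t])

definition acts :: "'a maut list \<Rightarrow> nat \<Rightarrow> (nat \<Rightarrow> 'a) \<Rightarrow> (nat \<Rightarrow> nat \<Rightarrow> nat) \<Rightarrow> bool" where
  "acts xs n e \<sigma> \<longleftrightarrow> (\<forall>j<length xs. moves (xs ! j) n e (\<sigma> j))"

text \<open>Whenever a tuple permutes a frame, every abstract finite extension of that permutation action is
  realised by a refinement of the frame. This makes generic tuples universal, as in a Fraisse
  limit.\<close>

definition extensible :: "'a maut list \<Rightarrow> bool" where
  "extensible xs \<longleftrightarrow> (\<forall>n e \<sigma> m \<tau>. frame n e \<longrightarrow> acts xs n e \<sigma> \<longrightarrow> n \<le> m \<longrightarrow> (\<forall>j<length xs. lifts n (\<sigma> j) m (\<tau> j)) \<longrightarrow>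
     (\<exists>f. frame m f \<and> refines n e m f \<and> acts xs m f \<tau>))"

definition locally_finite :: "'a maut list \<Rightarrow> bool" where
  "locally_finite xs \<longleftrightarrow> (\<forall>l. \<exists>n e \<sigma>. frame n e \<and> acts xs n e \<sigma> \<and> resolves e l)"

definition gen :: "'a maut list \<Rightarrow> bool" where
  "gen xs \<longleftrightarrow> extensible xs \<and> locally_finite xs"

lemma block_fibres:
  assumes "n \<le> m"
  shows "disjoint_family_on (\<lambda>i. {p::nat. p < 2^m \<and> p div 2^(m-n) = i}) {..<2^n}"
    and "(\<Union>i\<in>{..<2^n}. {p::nat. p < 2^m \<and> p div 2^(m-n) = i}) = {..<2^m :: nat}"
    and "i < 2^n \<Longrightarrow> card {p::nat. p < 2^m \<and> p div 2^(m-n) = i} = 2^(m-n)"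
proof -
  show "disjoint_family_on (\<lambda>i. {p::nat. p < 2^m \<and> p div 2^(m-n) = i}) {..<2^n}"
    by (auto simp: disjoint_family_on_def)
  show "(\<Union>i\<in>{..<2^n}. {p::nat. p < 2^m \<and> p div 2^(m-n) = i}) = {..<2^m :: nat}"
    using div_less_pow[OF assms] by auto
  assume i: "i < 2^n"
  have "{p::nat. p < 2^m \<and> p div 2^(m-n) = i} = {i * 2^(m-n) ..< i * 2^(m-n) + 2^(m-n)}" (is "?L = ?R")
  proof
    show "?L \<subseteq> ?R"
      using dividend_less_div_times[of "2^(m-n)"] by (auto simp: div_times_less_eq_dividend add.commute)
    have "i * 2^(m-n) + 2^(m-n) = (i + 1) * 2^(m-n)" by simp
    also have "\<dots> \<le> 2^n * 2^(m-n)" using i by (intro mult_right_mono) auto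
    also have "\<dots> = 2^m" using assms by (simp flip: power_add)
    finally show "?R \<subseteq> ?L" by (auto intro!: div_nat_eqI simp: algebra_simps)
  qed
  then show "card {p::nat. p < 2^m \<and> p div 2^(m-n) = i} = 2^(m-n)" by simp
qed

text \<open>The invariant frame \<open>f\<close> is fine enough to split every piece of \<open>e\<close>, so renumbering it block by
  block makes it a refinement in the ordered sense.\<close>

lemma resolving_refinement:
  assumes e: "frame n e" and k: "\<And>i. e i \<in> dy k"
    and f: "frame m f" "acts xs m f \<tau>" "resolves f k"
  obtains h \<rho> where "frame m h" "refines n e m h" "acts xs m h \<rho>" "resolves h k"
proof -
  have ad: "adapted f (e i)" for i using f(3) k by (auto simp: resolves_def)
  have nm: "n \<le> m"
  proof -
    define c where "c = card {p. p < 2^m \<and> f p \<le> e 0}"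
    have c: "real c = 2^m / 2^n"
      using mu_adapted[OF f(1) ad[of 0]] frameD(3)[OF e, of 0] by (simp add: field_simps c_def)
    then have "c \<noteq> 0" by (intro notI) simp
    then have "1 \<le> real c" by simp
    then have "(2::real)^n \<le> 2^m" unfolding c by (simp add: field_simps)
    then show ?thesis by simp
  qed
  obtain p where p: "bij_betw p {..<2^m} {..<2^m}"
    "\<And>i x. i \<in> {..<2^n} \<Longrightarrow> x \<in> {p. p < 2^m \<and> p div 2^(m-n) = i} \<Longrightarrow> p x \<in> {p. p < 2^m \<and> f p \<le> e i}"
    by (rule matching_bijection[OF block_fibres(1,2)[OF nm] frame_fibres[OF e f(1) ad]])
      (simp_all add: card_frame_fibre[OF e f(1) ad _ nm] block_fibres(3)[OF nm])
  have pl: "p x < 2^m" if "x < 2^m" for x using p(1) that by (auto simp: bij_betw_def)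
  define h where "h x = (if x < 2^m then f (p x) else \<bottom>)" for x
  have "frame m h"
    unfolding frame_def disjseq_def
  proof (intro conjI allI impI)
    fix i j :: nat assume "i \<noteq> j"
    then have "p i \<noteq> p j" if "i < 2^m" "j < 2^m" using p(1) that by (auto simp: bij_betw_def inj_on_def)
    then show "h i \<sqinter> h j = \<bottom>" using disjseqD[OF frameD(1)[OF f(1)]] by (auto simp: h_def)
  qed (use frameD[OF f(1)] pl bot_dy dy_Dy in \<open>auto simp: h_def\<close>)
  moreover have "refines n e m h"
    using p(2) div_less_pow[OF nm] nm by (auto simp: refines_def h_def)
  moreover have "acts xs m h (\<lambda>j x. inv_into {..<2^m} p (\<tau> j (p x)))"
    unfolding acts_def moves_def
  proof (intro allI impI)
    fix j and x :: nat assume j: "j < length xs" and x: "x < 2^m"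
    have t: "\<tau> j (p x) < 2^m" "act (xs ! j) (f (p x)) = f (\<tau> j (p x))"
      using f(2) j pl[OF x] by (auto simp: acts_def moves_def)
    then have "\<tau> j (p x) \<in> p ` {..<2^m}" using p(1) by (simp add: bij_betw_def)
    from inv_into_into[OF this] f_inv_into_f[OF this]
    show "inv_into {..<2^m} p (\<tau> j (p x)) < 2^m \<and> act (xs ! j) (h x) = h (inv_into {..<2^m} p (\<tau> j (p x)))"
      using t x by (simp add: h_def)
  qed
  moreover have "resolves h k" using f(3) by (auto simp: resolves_def adapted_def h_def)
  ultimately show thesis using that by blast
qed

text \<open>Joining the pieces of a fine frame along a map \<open>\<kappa>\<close> of the indices; if the fibres of \<open>\<kappa>\<close> have
  equal size, this is again a frame.\<close>

definition merge :: "nat \<Rightarrow> (nat \<Rightarrow> 'a) \<Rightarrow> (nat \<Rightarrow> nat) \<Rightarrow> nat \<Rightarrow> 'a" where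
  "merge m f \<kappa> q = cjoin (\<lambda>p. if p < 2^m \<and> \<kappa> p = q then f p else \<bottom>)"

lemma merge_upper: "p < 2^m \<Longrightarrow> f p \<le> merge m f \<kappa> (\<kappa> p)"
  unfolding merge_def using cjoin_upper[of "\<lambda>x. if x < 2^m \<and> \<kappa> x = \<kappa> p then f x else \<bottom>" p] by simp

lemma merge_least: "(\<And>p. p < 2^m \<Longrightarrow> \<kappa> p = q \<Longrightarrow> f p \<le> u) \<Longrightarrow> merge m f \<kappa> q \<le> u"
  unfolding merge_def by (rule cjoin_least) simp

lemma frame_merge:
  assumes f: "frame m f" and nm: "n \<le> m" and \<kappa>: "\<And>p. p < 2^m \<Longrightarrow> \<kappa> p < 2^n"
    and card: "\<And>q. q < 2^n \<Longrightarrow> card {p. p < 2^m \<and> \<kappa> p = q} = 2^(m-n)"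
  shows "frame n (merge m f \<kappa>)"
  unfolding frame_def
proof (intro conjI allI impI)
  have dis: "f p \<sqinter> f p' = \<bottom>" if "p \<noteq> p'" for p p' using disjseqD[OF frameD(1)[OF f] that] .
  show "disjseq (merge m f \<kappa>)"
    unfolding disjseq_def merge_def
    by (intro allI impI cjoin_disjoint cjoin_disjoint') (auto intro!: dis)
  obtain k where "\<And>i. f i \<in> dy k" by (rule frame_levels[OF f, of 0]) blast
  then show "merge m f \<kappa> q \<in> Dy" for q unfolding merge_def by (intro dy_Dy[of _ k] dy_cjoin) (simp add: bot_dy)
  show "merge m f \<kappa> q = \<bottom>" if "2^n \<le> q" for q
  proof -
    have "merge m f \<kappa> q \<le> \<bottom>" by (rule merge_least) (use \<kappa> that in fastforce)
    then show ?thesis by (rule le_bot)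
  qed
  fix q :: nat assume q: "q < 2^n"
  have ad: "adapted f (merge m f \<kappa> q)" unfolding adapted_def
  proof
    fix p
    show "f p \<le> merge m f \<kappa> q \<or> f p \<sqinter> merge m f \<kappa> q = \<bottom>"
    proof (cases "p < 2^m \<and> \<kappa> p = q")
      case True
      then show ?thesis using merge_upper by blast
    next
      case False
      have "f p \<sqinter> merge m f \<kappa> q = \<bottom>" unfolding merge_def
        by (rule cjoin_disjoint') (use False in \<open>auto intro!: dis simp: not_less frameD(4)[OF f]\<close>)
      then show ?thesis ..
    qed
  qed
  have "{p. p < 2^m \<and> f p \<le> merge m f \<kappa> q} = {p. p < 2^m \<and> \<kappa> p = q}"
  proof -
    have "\<kappa> p = q" if "p < 2^m" "f p \<le> merge m f \<kappa> q" for p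
    proof (rule ccontr)
      assume "\<kappa> p \<noteq> q"
      then have "f p \<sqinter> merge m f \<kappa> q = \<bottom>" unfolding merge_def
        by (intro cjoin_disjoint') (use \<open>\<kappa> p \<noteq> q\<close> in \<open>auto intro!: dis\<close>)
      then show False using that frame_ne_bot[OF f that(1)] by (simp add: inf.absorb1)
    qed
    then show ?thesis by (intro Collect_cong) (metis merge_upper)
  qed
  then have "mu (merge m f \<kappa> q) = 2^(m-n) / 2^m"
    using mu_adapted[OF f ad] card[OF q] by simp
  also have "\<dots> = 1 / 2^n" using nm by (simp add: power_diff)
  finally show "mu (merge m f \<kappa> q) = 1 / 2^n" .
qed

lemma moves_merge:
  assumes f: "frame n (merge m f \<kappa>)" and g: "\<And>p. p < 2^m \<Longrightarrow> t p < 2^m \<and> act g (f p) = f (t p)"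
    and s: "\<And>p. p < 2^m \<Longrightarrow> \<kappa> (t p) = s (\<kappa> p)" and sn: "\<And>q. q < 2^n \<Longrightarrow> s q < 2^n"
  shows "moves g n (merge m f \<kappa>) s"
proof (rule movesI_le[OF f], rule conjI)
  fix q :: nat assume q: "q < 2^n"
  show "s q < 2^n" by (rule sn[OF q])
  have "merge m f \<kappa> q \<le> act (- g) (merge m f \<kappa> (s q))"
  proof (rule merge_least)
    fix p assume p: "p < 2^m" "\<kappa> p = q"
    then have "act g (f p) \<le> merge m f \<kappa> (s q)" using g[OF p(1)] s[OF p(1)] merge_upper[of "t p" m f \<kappa>] by simp
    then show "f p \<le> act (- g) (merge m f \<kappa> (s q))" by (simp add: act_le_swap)
  qed
  then show "act g (merge m f \<kappa> q) \<le> merge m f \<kappa> (s q)" by (simp add: act_le_swap)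
qed

lemma generic_Nil: "gen []"
proof -
  have L: "locally_finite []" unfolding locally_finite_def acts_def using frame_cell resolves_cell by auto
  have "\<exists>f. frame m f \<and> refines n e m f" if e: "frame n e" and nm: "n \<le> m" for n e m
  proof -
    obtain k where k: "m \<le> k" "\<And>i. e i \<in> dy k" using frame_levels[OF e, where m = m] by blast
    obtain h \<rho> where h: "frame k h" "refines n e k h"
      by (rule resolving_refinement[OF e k(2) frame_cell, of "[]"]) (auto simp: acts_def resolves_cell)
    let ?\<kappa> = "\<lambda>p. p div 2^(k-m)"
    have fm: "frame m (merge k h ?\<kappa>)"
      by (rule frame_merge[OF h(1) k(1)]) (use div_less_pow[OF k(1)] block_fibres(3)[OF k(1)] in auto)
    have "merge k h ?\<kappa> q \<le> e (q div 2^(m-n))" for q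
    proof (rule merge_least)
      fix p assume p: "p < 2^k" "p div 2^(k-m) = q"
      have "h p \<le> e (p div 2^(k-n))" using h(2) p(1) by (simp add: refines_def)
      also have "p div 2^(k-n) = q div 2^(m-n)"
        unfolding p(2)[symmetric] using nm k(1) by (simp add: div_mult2_eq[symmetric] power_add[symmetric])
      finally show "h p \<le> e (q div 2^(m-n))" .
    qed
    then show ?thesis using fm nm by (intro exI[of _ "merge k h ?\<kappa>"]) (simp add: refines_def)
  qed
  then show ?thesis using L by (simp add: gen_def extensible_def acts_def)
qed

lemma zero_in_Gam: "0 \<in> Gam" by (simp add: Gam_def)

lemma plus_in_Gam: "g \<in> Gam \<Longrightarrow> h \<in> Gam \<Longrightarrow> g + h \<in> Gam"
  by (simp add: Gam_def minus_add act_plus del: add_uminus_conv_diff)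

lemma uminus_in_Gam: "g \<in> Gam \<Longrightarrow> - g \<in> Gam" by (simp add: Gam_def)

lemma FixD: "g \<in> Fix n \<Longrightarrow> a \<in> dy n \<Longrightarrow> act g a = a" "g \<in> Fix n \<Longrightarrow> g \<in> Gam"
  by (auto simp: Fix_def)

lemma FixD': "g \<in> Fix n \<Longrightarrow> a \<in> dy n \<Longrightarrow> act (- g) a = a"
  by (metis FixD(1) act_minus1)

lemma Gam_image_level:
  assumes "g \<in> Gam" obtains k where "n \<le> k" "\<And>a. a \<in> dy n \<Longrightarrow> act g a \<in> dy k"
proof -
  have "finite (act g ` dy n)" "act g ` dy n \<subseteq> Dy" using finite_dy GamD(1)[OF assms] dy_Dy by auto
  then obtain k where "n \<le> k" "act g ` dy n \<subseteq> dy k" by (rule finite_subset_dy)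
  then show thesis using that by blast
qed

sublocale generic_group Gam Fix
proof
  show "0 \<in> Gam" by (rule zero_in_Gam)
  show "a + b \<in> Gam" if "a \<in> Gam" "b \<in> Gam" for a b using plus_in_Gam that .
  show "- a \<in> Gam" if "a \<in> Gam" for a using uminus_in_Gam that .
  show "Fix n \<subseteq> Gam" for n by (auto simp: Fix_def)
  show "0 \<in> Fix n" for n by (simp add: Fix_def zero_in_Gam)
  show "a + b \<in> Fix n" if "a \<in> Fix n" "b \<in> Fix n" for a b n
    using that plus_in_Gam by (simp add: Fix_def act_plus)
  show "- a \<in> Fix n" if "a \<in> Fix n" for a n
    using that FixD'[OF that] uminus_in_Gam by (simp add: Fix_def)
  show "Fix (Suc n) \<subseteq> Fix n" for n using dy_Suc by (auto simp: Fix_def)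
  show "\<exists>m. \<forall>h\<in>Fix m. g + h - g \<in> Fix n" if g: "g \<in> Gam" for g n
  proof -
    obtain k where k: "\<And>a. a \<in> dy n \<Longrightarrow> act (- g) a \<in> dy k"
      using Gam_image_level[OF uminus_in_Gam[OF g], of n] by blast
    have "g + h - g \<in> Fix n" if h: "h \<in> Fix k" for h
    proof -
      have "g + h + - g \<in> Gam" using g FixD(2)[OF h] by (intro plus_in_Gam uminus_in_Gam)
      moreover have "act (g + h + - g) a = a" if "a \<in> dy n" for a
        using FixD(1)[OF h k[OF that]] by (simp add: act_plus del: add_uminus_conv_diff)
      ultimately show ?thesis by (simp add: Fix_def)
    qed
    then show ?thesis by blast
  qed
  show "h = 0" if "\<And>n. h \<in> Fix n" for h
  proof (rule maut_eq_on_Dy)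
    fix a assume "a \<in> Dy"
    then show "act h a = act 0 a" using FixD(1)[OF that] by (auto simp: Dy_def)
  qed
  show "\<exists>c'\<in>Gam. \<forall>n. - c n + c' \<in> Fix n \<and> c' - c n \<in> Fix n"
    if c: "\<And>n. c n \<in> Gam" and 1: "\<And>n. - c n + c (Suc n) \<in> Fix n" and 2: "\<And>n. c (Suc n) - c n \<in> Fix n" for c
  proof -
    have s1: "act (c (Suc m)) a = act (c m) a" if "a \<in> dy m" for m a
      using FixD(1)[OF 1 that] by (simp add: act_plus act_eq_swap[of "- c m", simplified])
    have s2: "act (- c (Suc m)) a = act (- c m) a" if "a \<in> dy m" for m a
    proof -
      have "- (c (Suc m) - c m) = c m - c (Suc m)" by (simp add: diff_conv_add_uminus minus_add del: add_uminus_conv_diff)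
      then have "act (c m) (act (- c (Suc m)) a) = a"
        using FixD'[OF 2 that] by (simp add: act_plus diff_conv_add_uminus del: add_uminus_conv_diff)
      then show ?thesis by (metis act_minus1)
    qed
    have st: "act (c m) a = act (c n) a" "act (- c m) a = act (- c n) a" if "n \<le> m" "a \<in> dy n" for m n a
      using that(1)
    proof (induction m rule: dec_induct)
      case (step m)
      { case 1 then show ?case using step s1[of a m] that(2) dy_mono[of n m] by auto
      next case 2 then show ?case using step s2[of a m] that(2) dy_mono[of n m] by auto }
    qed auto
    have ex: "\<exists>N. \<forall>n\<ge>N. act (c n) a = act (c N) a" "\<exists>N. \<forall>n\<ge>N. act (- c n) a = act (- c N) a" if "a \<in> Dy" for a
      using that st unfolding Dy_def by blast+
    obtain g where g: "g \<in> Gam" "\<And>a N. \<forall>n\<ge>N. act (c n) a = act (c N) a \<Longrightarrow> act g a = act (c N) a"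
      "\<And>a N. \<forall>n\<ge>N. act (- c n) a = act (- c N) a \<Longrightarrow> act (- g) a = act (- c N) a"
      using Gam_limit[OF c ex] by metis
    have "- c n + g \<in> Fix n" for n
    proof -
      have "act (- c n + g) a = a" if "a \<in> dy n" for a
      proof -
        have "act g a = act (c n) a" using g(2)[of n a] st(1)[OF _ that] by blast
        then show ?thesis by (simp add: act_plus)
      qed
      then show ?thesis using plus_in_Gam[OF uminus_in_Gam[OF c] g(1)] by (simp add: Fix_def)
    qed
    moreover have "g - c n \<in> Fix n" for n
    proof -
      have "act (g + - c n) a = a" if "a \<in> dy n" for a
      proof -
        have "act (- g) a = act (- c n) a" using g(3)[of n a] st(2)[OF _ that] by blast
        then show ?thesis by (metis act_plus act_minus2)
      qed
      then show ?thesis using plus_in_Gam[OF g(1) uminus_in_Gam[OF c]] by (simp add: Fix_def)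
    qed
    ultimately show ?thesis using g(1) by blast
  qed
qed

lemma moves_shift:
  assumes "h \<in> Fix N" "\<And>i. e i \<in> dy N" shows "moves (g + h) n e s \<longleftrightarrow> moves g n e s"
  using FixD(1)[OF assms(1,2)] by (simp add: moves_def act_plus)

lemma acts_append: "acts (xs @ [g]) n e \<sigma> \<longleftrightarrow> acts xs n e \<sigma> \<and> moves g n e (\<sigma> (length xs))"
  unfolding acts_def by (auto simp: nth_append less_Suc_eq)

definition fin_set :: "'a maut list \<Rightarrow> nat \<Rightarrow> 'a maut set" where
  "fin_set xs l = {g. \<exists>n e \<sigma>. frame n e \<and> acts (xs @ [g]) n e \<sigma> \<and> resolves e l}"

text \<open>Given \<open>g\<close>, take a frame invariant under the tuple and finer than the cells involved and their
  images, and permute its pieces in a way compatible with \<open>g\<close> on these cells. The new automorphism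
  agrees with \<open>g\<close> to the given precision and leaves the frame invariant.\<close>

lemma dense_fin_set:
  assumes L: "locally_finite xs" and xs: "set xs \<subseteq> Gam" shows "dense_open (fin_set xs l)"
  unfolding dense_open_def
proof (intro conjI ballI allI)
  fix g assume "g \<in> Gam \<inter> fin_set xs l"
  then obtain n e \<sigma> where e: "frame n e" "acts (xs @ [g]) n e \<sigma>" "resolves e l" by (auto simp: fin_set_def)
  obtain k where k: "\<And>i. e i \<in> dy k" using frame_levels[OF e(1), where m = 0] by blast
  have "g + h \<in> fin_set xs l" if "h \<in> Fix k" for h
    using e moves_shift[where e = e, OF that k] unfolding fin_set_def acts_append by blast
  then show "\<exists>n. \<forall>h\<in>Fix n. g + h \<in> fin_set xs l" by blast
next
  fix g N assume g: "g \<in> Gam"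
  obtain k where k: "max N l \<le> k" "\<And>a. a \<in> dy (max N l) \<Longrightarrow> act g a \<in> dy k"
    using Gam_image_level[OF g, where n = "max N l"] by blast
  obtain n e \<sigma> where e: "frame n e" "acts xs n e \<sigma>" "resolves e k" using L unfolding locally_finite_def by blast
  define M where "M = max N l"
  have ad: "adapted e (cell M i)" "adapted e (act g (cell M i))" for i
    using e(3) k cell_dy[of M i] dy_mono[OF k(1)] by (auto simp: resolves_def M_def)
  have fr: "frame M (\<lambda>i. act g (cell M i))"
    using frameD[OF frame_cell[of M]] GamD(1)[OF g]
    by (auto simp: frame_def disjseq_def simp flip: act_inf)
  have Mn: "M \<le> n" using resolves_level[OF e(1,3)] k(1) by (simp add: M_def)
  obtain p where p: "bij_betw p {..<2^n} {..<2^n}"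
    "\<And>i x. i \<in> {..<2^M} \<Longrightarrow> x \<in> {p. p < 2^n \<and> e p \<le> cell M i} \<Longrightarrow> p x \<in> {p. p < 2^n \<and> e p \<le> act g (cell M i)}"
    by (rule matching_bijection[OF frame_fibres[OF frame_cell e(1) ad(1)] frame_fibres[OF fr e(1) ad(2)]])
      (simp_all add: card_frame_fibre[OF frame_cell e(1) ad(1) _ Mn] card_frame_fibre[OF fr e(1) ad(2) _ Mn])
  define f where "f i = (if i < 2^n then e (p i) else \<bottom>)" for i
  have pl: "p x < 2^n" if "x < 2^n" for x using p(1) that by (auto simp: bij_betw_def)
  have "frame n f"
    unfolding frame_def disjseq_def
  proof (intro conjI allI impI)
    fix i j :: nat assume "i \<noteq> j"
    then have "p i \<noteq> p j" if "i < 2^n" "j < 2^n" using p(1) that by (auto simp: bij_betw_def inj_on_def)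
    then show "f i \<sqinter> f j = \<bottom>" using disjseqD[OF frameD(1)[OF e(1)]] by (auto simp: f_def)
  qed (use frameD[OF e(1)] pl bot_dy dy_Dy in \<open>auto simp: f_def\<close>)
  then obtain g' where g': "g' \<in> Gam" "\<And>i. act g' (e i) = f i" using frames_isomorphic[OF e(1)] by blast
  have "act (- g + g') (cell M i) = cell M i" for i
  proof (cases "i < 2^M")
    case True
    have "act g' (cell M i) \<le> act g (cell M i)"
      by (rule act_le_by_frame[OF e(1) ad(1)]) (use p(2)[of i] True g'(2) in \<open>auto simp: f_def\<close>)
    then have "act g' (cell M i) = act g (cell M i)" by (intro mu_eq_le_imp_eq) simp_all
    then show ?thesis by (simp add: act_plus)
  next
    case False
    then show ?thesis using cell_out[of M i] by simp
  qed
  then have "- g + g' \<in> Fix M" by (intro FixI plus_in_Gam uminus_in_Gam g g')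
  then have "- g + g' \<in> Fix N" using F_anti[of N M] by (auto simp: M_def)
  moreover have "moves g' n e p" using g'(2) pl by (simp add: moves_def f_def)
  then have "acts (xs @ [g']) n e (\<sigma>(length xs := p))"
    using e(2) by (auto simp: acts_def nth_append less_Suc_eq)
  then have "g + (- g + g') \<in> fin_set xs l"
    using e(1) resolves_mono[OF e(3)] k(1) by (auto simp: fin_set_def simp flip: add.assoc)
  ultimately show "\<exists>h\<in>Fix N. g + h \<in> fin_set xs l" by blast
qed

definition ext_set :: "'a maut list \<Rightarrow> nat \<Rightarrow> (nat \<Rightarrow> 'a) \<Rightarrow> (nat \<Rightarrow> nat \<Rightarrow> nat) \<Rightarrow> nat \<Rightarrow> (nat \<Rightarrow> nat \<Rightarrow> nat) \<Rightarrow> 'a maut set" where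
  "ext_set xs n e \<sigma> m \<tau> = {g. frame n e \<longrightarrow> acts (xs @ [g]) n e \<sigma> \<longrightarrow> n \<le> m \<longrightarrow>
     (\<forall>j\<le>length xs. lifts n (\<sigma> j) m (\<tau> j)) \<longrightarrow> (\<exists>f. frame m f \<and> refines n e m f \<and> acts (xs @ [g]) m f \<tau>)}"

lemma open_ext_set:
  assumes "g \<in> ext_set xs n e \<sigma> m \<tau>" shows "\<exists>N. \<forall>h\<in>Fix N. g + h \<in> ext_set xs n e \<sigma> m \<tau>"
proof (cases "frame n e \<and> acts (xs @ [g]) n e \<sigma> \<and> n \<le> m \<and> (\<forall>j\<le>length xs. lifts n (\<sigma> j) m (\<tau> j))")
  case True
  then obtain f where f: "frame m f" "refines n e m f" "acts (xs @ [g]) m f \<tau>" using assms by (auto simp: ext_set_def)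
  obtain k where k: "\<And>i. f i \<in> dy k" using frame_levels[OF f(1), where m = 0] by blast
  have "g + h \<in> ext_set xs n e \<sigma> m \<tau>" if "h \<in> Fix k" for h
    using f moves_shift[where e = f, OF that k] by (auto simp: ext_set_def acts_append)
  then show ?thesis by blast
next
  case False
  show ?thesis
  proof (cases "frame n e")
    case e: True
    obtain k where k: "\<And>i. e i \<in> dy k" using frame_levels[OF e, where m = 0] by blast
    have "g + h \<in> ext_set xs n e \<sigma> m \<tau>" if "h \<in> Fix k" for h
      using False e moves_shift[where e = e, OF that k] by (auto simp: ext_set_def acts_append)
    then show ?thesis by blast
  qed (auto simp: ext_set_def)
qed

text \<open>If \<open>g\<close> acts on \<open>e\<close> as prescribed, refine \<open>e\<close> to an invariant frame \<open>d\<close> on which \<open>g\<close> is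
  determined to the required precision. The action on \<open>d\<close> and the desired action \<open>\<tau>\<close> both extend the
  action on \<open>e\<close>; their amalgam over \<open>e\<close> is realised for the tuple by extensibility, and the last
  component serves to redefine \<open>g\<close> below the precision of \<open>d\<close>.\<close>

lemma dense_ext_set:
  assumes gx: "gen xs" and xs: "set xs \<subseteq> Gam" and g: "g \<in> Gam"
  shows "\<exists>h\<in>Fix N. g + h \<in> ext_set xs n e \<sigma> m \<tau>"
proof (cases "frame n e \<and> n \<le> m \<and> (\<forall>j\<le>length xs. lifts n (\<sigma> j) m (\<tau> j))")
  case False
  then have "g + 0 \<in> ext_set xs n e \<sigma> m \<tau>" by (auto simp: ext_set_def)
  then show ?thesis using F_0 by blast
next
  case True
  then have e: "frame n e" and nm: "n \<le> m" and li: "\<And>j. j \<le> length xs \<Longrightarrow> lifts n (\<sigma> j) m (\<tau> j)" by auto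
  obtain k where k: "N \<le> k" "\<And>i. e i \<in> dy k" using frame_levels[OF e, where m = N] by blast
  have "dense_open (fin_set xs k)" using gx xs by (intro dense_fin_set) (auto simp: gen_def)
  then obtain h1 where h1: "h1 \<in> Fix N" "g + h1 \<in> fin_set xs k" using g unfolding dense_open_def by blast
  define g1 where "g1 = g + h1"
  have g1: "g1 \<in> Gam" unfolding g1_def using g h1(1) FixD(2) plus_in_Gam by blast
  obtain n0 d0 \<delta>0 where d0: "frame n0 d0" "acts (xs @ [g1]) n0 d0 \<delta>0" "resolves d0 k"
    using h1(2) by (auto simp: fin_set_def g1_def)
  show ?thesis
  proof (cases "acts (xs @ [g1]) n e \<sigma>")
    case False
    then have "g + h1 \<in> ext_set xs n e \<sigma> m \<tau>" by (auto simp: ext_set_def g1_def)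
    then show ?thesis using h1(1) by blast
  next
    case acts: True
    obtain nd d \<delta> where d: "frame nd d" "refines n e nd d" "acts (xs @ [g1]) nd d \<delta>" "resolves d k"
      by (rule resolving_refinement[OF e k(2) d0])
    have nnd: "n \<le> nd" using d(2) by (simp add: refines_def)
    define D M r where "D = (2::nat)^(nd-n)" and "M = (2::nat)^(m-n)" and "r = nd + (m - n)"
    have Mpos: "0 < M" "0 < D" by (simp_all add: M_def D_def)
    have pw: "2^r = 2^nd * M" "2^nd = 2^n * D" "2^m = 2^n * M" "2^(r-nd) = M" "2^(r-m) = D"
      using nm nnd by (simp_all add: r_def M_def D_def flip: power_add)
    \<comment> \<open>A piece \<open>p\<close> of the amalgam is a pair of a piece \<open>p div M\<close> of \<open>d\<close> and an offset \<open>p mod M\<close>; \<open>\<kappa> p\<close> is the piece of the \<open>\<tau>\<close>-frame with the same block of \<open>e\<close> and the same offset, and \<open>\<rho>\<close> projects to \<open>\<delta>\<close> and to \<open>\<tau>\<close>.\<close>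
    define \<kappa> where "\<kappa> p = (p div M div D) * M + p mod M" for p
    define \<rho> where "\<rho> j p = \<delta> j (p div M) * M + \<tau> j (\<kappa> p) mod M" for j p
    have pM: "p div M < 2^nd" "p div M div D < 2^n" if "p < 2^r" for p
      using that unfolding pw by (simp_all add: less_mult_imp_div_less)
    have \<kappa>: "\<kappa> p < 2^m" "\<kappa> p div M = p div M div D" "\<kappa> p mod M = p mod M" if "p < 2^r" for p
    proof -
      have "\<kappa> p < (p div M div D + 1) * M" using Mpos by (simp add: \<kappa>_def)
      also have "\<dots> \<le> 2^n * M" using pM(2)[OF that] by (intro mult_right_mono) auto
      finally show "\<kappa> p < 2^m" by (simp add: pw)
      show "\<kappa> p div M = p div M div D" "\<kappa> p mod M = p mod M" using Mpos by (simp_all add: \<kappa>_def)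
    qed
    have mv: "moves x nd d (\<delta> j)" "lifts n (\<sigma> j) nd (\<delta> j)" if "j \<le> length xs" "x = (xs @ [g1]) ! j" for j x
    proof -
      show "moves x nd d (\<delta> j)" using d(3) that by (auto simp: acts_def)
      moreover have "moves x n e (\<sigma> j)" using acts that by (auto simp: acts_def)
      ultimately show "lifts n (\<sigma> j) nd (\<delta> j)" by (intro moves_lifts[OF e d(1,2)])
    qed
    have \<delta>j: "\<delta> j q < 2^nd" "\<delta> j q div D = \<sigma> j (q div D)" if "j \<le> length xs" "q < 2^nd" for j q
      using mv(2)[OF that(1) refl] that(2) by (auto simp: lifts_def D_def)
    have \<tau>j: "\<tau> j q < 2^m" "\<tau> j q div M = \<sigma> j (q div M)" if "j \<le> length xs" "q < 2^m" for j q
      using li[OF that(1)] that(2) by (auto simp: lifts_def M_def)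
    have \<rho>1: "\<rho> j p < 2^r" "\<rho> j p div M = \<delta> j (p div M)" "\<rho> j p mod M = \<tau> j (\<kappa> p) mod M" if "j \<le> length xs" "p < 2^r" for j p
    proof -
      have "\<rho> j p < (\<delta> j (p div M) + 1) * M" using Mpos by (simp add: \<rho>_def)
      also have "\<dots> \<le> 2^nd * M" using \<delta>j(1)[OF that(1) pM(1)[OF that(2)]] by (intro mult_right_mono) auto
      finally show "\<rho> j p < 2^r" by (simp add: pw)
      show "\<rho> j p div M = \<delta> j (p div M)" "\<rho> j p mod M = \<tau> j (\<kappa> p) mod M" using Mpos by (simp_all add: \<rho>_def)
    qed
    have \<kappa>\<rho>: "\<kappa> (\<rho> j p) = \<tau> j (\<kappa> p)" if "j \<le> length xs" "p < 2^r" for j p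
    proof -
      have "\<kappa> (\<rho> j p) = \<sigma> j (p div M div D) * M + \<tau> j (\<kappa> p) mod M"
        unfolding \<kappa>_def[of "\<rho> j p"] \<rho>1(2,3)[OF that] by (simp add: \<delta>j(2)[OF that(1) pM(1)[OF that(2)]])
      also have "\<sigma> j (p div M div D) = \<tau> j (\<kappa> p) div M"
        using \<tau>j(2)[OF that(1) \<kappa>(1)[OF that(2)]] \<kappa>(2)[OF that(2)] by simp
      finally show ?thesis by simp
    qed
    have inj: "inj_on (\<rho> j) {..<2^r}" if j: "j \<le> length xs" for j
    proof (rule inj_onI)
      fix p q assume "p \<in> {..<2^r}" "q \<in> {..<2^r}" and eq: "\<rho> j p = \<rho> j q"
      then have p: "p < 2^r" and q: "q < 2^r" by auto
      have "\<delta> j (p div M) = \<delta> j (q div M)" using \<rho>1(2)[OF j p] \<rho>1(2)[OF j q] eq by simp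
      then have 1: "p div M = q div M"
        using mv(2)[OF j refl] pM(1)[OF p] pM(1)[OF q] by (auto simp: lifts_def inj_on_def)
      have "\<tau> j (\<kappa> p) = \<tau> j (\<kappa> q)" using \<kappa>\<rho>[OF j p] \<kappa>\<rho>[OF j q] eq by simp
      then have "\<kappa> p = \<kappa> q" using li[OF j] \<kappa>(1)[OF p] \<kappa>(1)[OF q] by (auto simp: lifts_def inj_on_def)
      then have "p mod M = q mod M" using \<kappa>(3)[OF p] \<kappa>(3)[OF q] by simp
      with 1 show "p = q" by (metis div_mult_mod_eq)
    qed
    have "lifts nd (\<delta> j) r (\<rho> j)" if "j \<le> length xs" for j
      using \<rho>1[OF that] inj[OF that] by (simp add: lifts_def pw)
    moreover have "acts xs nd d \<delta>" using d(3) by (simp add: acts_append)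
    moreover have "extensible xs" using gx by (simp add: gen_def)
    ultimately obtain f where f: "frame r f" "refines nd d r f" "acts xs r f \<rho>"
      using d(1) unfolding extensible_def r_def by (metis le_add1 less_imp_le)
    let ?s = "\<rho> (length xs)"
    define f' where "f' p = (if p < 2^r then f (?s p) else \<bottom>)" for p
    have "frame r f'"
      unfolding frame_def disjseq_def
    proof (intro conjI allI impI)
      fix i j :: nat assume "i \<noteq> j"
      then have "?s i \<noteq> ?s j" if "i < 2^r" "j < 2^r" using inj[of "length xs"] that by (auto simp: inj_on_def)
      then show "f' i \<sqinter> f' j = \<bottom>" using disjseqD[OF frameD(1)[OF f(1)]] by (auto simp: f'_def)
    qed (use frameD[OF f(1)] \<rho>1(1)[of "length xs"] bot_dy dy_Dy in \<open>auto simp: f'_def\<close>)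
    then obtain g2 where g2: "g2 \<in> Gam" "\<And>p. act g2 (f p) = f' p" using frames_isomorphic[OF f(1)] by blast
    have mv2: "moves g2 r f ?s" using g2(2) \<rho>1(1)[of "length xs"] by (simp add: moves_def f'_def)
    have "act g2 (d q) = act g1 (d q)" if q: "q < 2^nd" for q
    proof -
      have "act g1 (d q) = d (\<delta> (length xs) q)" using mv(1)[of "length xs" g1] q by (simp add: moves_def)
      moreover have "act g2 (d q) = d (\<delta> (length xs) q)"
      proof (rule mu_eq_le_imp_eq)
        show "act g2 (d q) \<le> d (\<delta> (length xs) q)"
        proof (rule act_le_by_frame[OF f(1) refines_adapted[OF d(1) f(1,2)]])
          fix p assume p: "p < 2^r" "f p \<le> d q"
          then have "p div M = q" using refines_le_iff[OF d(1) f(1,2)] by (simp add: pw)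
          moreover have "f (?s p) \<le> d (?s p div M)"
            using f(2) \<rho>1(1)[of "length xs" p] p(1) by (simp add: refines_def pw)
          ultimately show "act g2 (f p) \<le> d (\<delta> (length xs) q)"
            using g2(2) p(1) \<rho>1(2)[of "length xs" p] by (simp add: f'_def)
        qed
        show "mu (act g2 (d q)) = mu (d (\<delta> (length xs) q))"
          using frameD(3)[OF d(1)] q \<delta>j(1)[of "length xs" q] by simp
      qed
      ultimately show ?thesis by simp
    qed
    then have "- g1 + g2 \<in> Fix k"
      using g1 g2(1) by (intro Fix_by_frame[OF _ d(1,4)] plus_in_Gam uminus_in_Gam) (simp_all add: act_plus)
    then have "- g1 + g2 \<in> Fix N" using F_anti[OF k(1)] by blast
    then have h: "h1 + (- g1 + g2) \<in> Fix N" by (rule F_add[OF h1(1)])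
    have gh: "g + (h1 + (- g1 + g2)) = g2" by (simp add: g1_def minus_add add.assoc diff_conv_add_uminus del: add_uminus_conv_diff)
    have rm: "m \<le> r" using nnd nm by (simp add: r_def)
    have fm: "frame m (merge r f \<kappa>)"
    proof (rule frame_merge[OF f(1) rm \<kappa>(1)])
      fix q :: nat assume q: "q < 2^m"
      have "bij_betw (\<lambda>t. ((q div M) * D + t) * M + q mod M) {..<D} {p. p < 2^r \<and> \<kappa> p = q}"
      proof (rule bij_betw_byWitness[where f' = "\<lambda>p. p div M mod D"])
        show "\<forall>t\<in>{..<D}. (((q div M) * D + t) * M + q mod M) div M mod D = t" using Mpos by simp
        show "\<forall>p\<in>{p. p < 2^r \<and> \<kappa> p = q}. ((q div M) * D + p div M mod D) * M + q mod M = p"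
          using \<kappa>(2,3) by auto
        show "(\<lambda>p. p div M mod D) ` {p. p < 2^r \<and> \<kappa> p = q} \<subseteq> {..<D}" using Mpos by auto
        show "(\<lambda>t. ((q div M) * D + t) * M + q mod M) ` {..<D} \<subseteq> {p. p < 2^r \<and> \<kappa> p = q}"
        proof safe
          fix t assume t: "t < D"
          let ?p = "((q div M) * D + t) * M + q mod M"
          have qM: "q div M < 2^n" using q by (simp add: pw less_mult_imp_div_less)
          have "?p < ((q div M) * D + t + 1) * M" using Mpos by simp
          also have "\<dots> \<le> ((q div M) * D + D) * M" using t by (intro mult_right_mono) auto
          also have "\<dots> = (q div M + 1) * D * M" by simp
          also have "\<dots> \<le> 2^n * D * M" using qM by (intro mult_right_mono) auto
          finally show "?p < 2^r" by (simp add: pw)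
          show "\<kappa> ?p = q" using t Mpos by (simp add: \<kappa>_def)
        qed
      qed
      from bij_betw_same_card[OF this] show "card {p. p < 2^r \<and> \<kappa> p = q} = 2^(r-m)" by (simp add: pw)
    qed
    have "refines n e m (merge r f \<kappa>)"
      unfolding refines_def
    proof (intro conjI allI impI nm)
      fix q :: nat
      show "merge r f \<kappa> q \<le> e (q div 2^(m-n))"
      proof (rule merge_least)
        fix p assume p: "p < 2^r" "\<kappa> p = q"
        have "f p \<le> d (p div M)" using f(2) p(1) by (simp add: refines_def pw)
        also have "\<dots> \<le> e (p div M div D)" using d(2) pM(1)[OF p(1)] by (simp add: refines_def D_def)
        also have "p div M div D = q div 2^(m-n)" using \<kappa>(2)[OF p(1)] p(2) by (simp add: M_def)
        finally show "f p \<le> e (q div 2^(m-n))" .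
      qed
    qed
    moreover have "acts (xs @ [g2]) m (merge r f \<kappa>) \<tau>"
      unfolding acts_def
    proof (intro allI impI)
      fix j assume "j < length (xs @ [g2])"
      then have j: "j \<le> length xs" by simp
      have "moves ((xs @ [g2]) ! j) r f (\<rho> j)"
        using f(3) mv2 j by (cases "j = length xs") (auto simp: acts_def nth_append)
      then show "moves ((xs @ [g2]) ! j) m (merge r f \<kappa>) (\<tau> j)"
        using \<kappa>\<rho>[OF j] \<tau>j(1)[OF j] by (intro moves_merge[OF fm, where t = "\<rho> j"]) (auto simp: moves_def)
    qed
    ultimately have "g2 \<in> ext_set xs n e \<sigma> m \<tau>" using fm by (auto simp: ext_set_def)
    then show ?thesis using h gh by metis
  qed
qed

end

context dyadic_algebra
begin

lemma acts_cong:
  assumes "\<And>j i. j < length xs \<Longrightarrow> i < 2^n \<Longrightarrow> \<sigma> j i = \<tau> j i" shows "acts xs n e \<sigma> \<longleftrightarrow> acts xs n e \<tau>"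
  unfolding acts_def moves_def using assms by auto

lemma lifts_cong:
  assumes "\<And>i. i < 2^n \<Longrightarrow> s i = s' i" "\<And>i. i < 2^m \<Longrightarrow> t i = t' i" "n \<le> m"
  shows "lifts n s m t \<longleftrightarrow> lifts n s' m t'"
proof -
  have "inj_on t {..<2^m} \<longleftrightarrow> inj_on t' {..<2^m}" by (rule inj_on_cong) (use assms(2) in auto)
  moreover have "t p < 2^m \<and> t p div 2^(m-n) = s (p div 2^(m-n)) \<longleftrightarrow> t' p < 2^m \<and> t' p div 2^(m-n) = s' (p div 2^(m-n))"
    if "p < 2^m" for p using assms(1)[OF div_less_pow[OF assms(3) that]] assms(2)[OF that] by simp
  ultimately show ?thesis by (auto simp: lifts_def)
qed

text \<open>Finite lists stand for the finitely supported parameters of the conditions \<open>ext_set\<close>, which are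
  thereby countable in number.\<close>

definition table :: "'x \<Rightarrow> 'x list \<Rightarrow> nat \<Rightarrow> 'x" where
  "table d L i = (if i < length L then L ! i else d)"

lemma dense_open_ext_set:
  assumes "gen xs" "set xs \<subseteq> Gam" shows "dense_open (ext_set xs n e \<sigma> m \<tau>)"
  unfolding dense_open_def
proof (intro conjI ballI allI)
  fix g assume "g \<in> Gam \<inter> ext_set xs n e \<sigma> m \<tau>"
  then show "\<exists>N. \<forall>h\<in>Fix N. g + h \<in> ext_set xs n e \<sigma> m \<tau>" using open_ext_set by blast
next
  fix g N assume "g \<in> Gam"
  then show "\<exists>h\<in>Fix N. g + h \<in> ext_set xs n e \<sigma> m \<tau>" by (rule dense_ext_set[OF assms])
qed

lemma generic_dense:
  assumes xs: "gen xs" "set xs \<subseteq> Gam"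
  shows "\<exists>D::nat \<Rightarrow> 'a maut set. (\<forall>i. dense_open (D i)) \<and> (\<forall>g\<in>Gam. (\<forall>i. g \<in> D i) \<longrightarrow> gen (xs @ [g]))"
proof -
  define X where "X = (\<lambda>(n, E, A, m, B). ext_set xs n (table \<bottom> E) (\<lambda>j. table 0 (table [] A j)) m (\<lambda>j. table 0 (table [] B j))) `
    (UNIV \<times> lists Dy \<times> (UNIV :: nat list list set) \<times> UNIV \<times> (UNIV :: nat list list set))"
  have "countable ((UNIV::nat set) \<times> lists Dy \<times> (UNIV :: nat list list set) \<times> (UNIV::nat set) \<times> (UNIV :: nat list list set))"
    by (intro countable_SIGMA countable_lists countable_Dy countableI_type)
  then have "countable X" unfolding X_def by (rule countable_image)
  define \<D> where "\<D> = range (fin_set xs) \<union> X"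
  have \<D>: "countable \<D>" "\<D> \<noteq> {}" unfolding \<D>_def using \<open>countable X\<close> by (auto intro: countableI_type)
  have do: "dense_open D" if "D \<in> \<D>" for D
    using that dense_open_ext_set[OF xs] dense_fin_set[of xs] xs by (auto simp: \<D>_def X_def gen_def)
  have "gen (xs @ [g])" if "\<And>D. D \<in> \<D> \<Longrightarrow> g \<in> D" for g
  proof -
    have "g \<in> fin_set xs l" for l using that by (auto simp: \<D>_def)
    then have "locally_finite (xs @ [g])" by (auto simp: locally_finite_def fin_set_def)
    moreover have "extensible (xs @ [g])"
      unfolding extensible_def
    proof (intro allI impI)
      fix n e \<sigma> m \<tau>
      assume e: "frame n e" and a: "acts (xs @ [g]) n e \<sigma>" and nm: "n \<le> m"
        and li: "\<forall>j<length (xs @ [g]). lifts n (\<sigma> j) m (\<tau> j)"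
      define T where "T \<rho> k = map (\<lambda>j. map (\<rho> j) [0..<2^k]) [0..<Suc (length xs)]" for \<rho> :: "nat \<Rightarrow> nat \<Rightarrow> nat" and k :: nat
      have T: "table 0 (table [] (T \<rho> k) j) i = \<rho> j i" if "j \<le> length xs" "i < 2^k" for \<rho> k j i
        using that by (simp add: T_def table_def del: upt_Suc)
      have "table \<bottom> (map e [0..<2^n]) = e"
        using frameD(4)[OF e] by (auto simp: table_def fun_eq_iff)
      moreover have "map e [0..<2^n] \<in> lists Dy" using frameD(2)[OF e] by auto
      ultimately have "ext_set xs n e (\<lambda>j. table 0 (table [] (T \<sigma> n) j)) m (\<lambda>j. table 0 (table [] (T \<tau> m) j)) \<in> X"
        unfolding X_def by (intro image_eqI[where x = "(n, map e [0..<2^n], T \<sigma> n, m, T \<tau> m)"]) auto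
      then have "g \<in> ext_set xs n e (\<lambda>j. table 0 (table [] (T \<sigma> n) j)) m (\<lambda>j. table 0 (table [] (T \<tau> m) j))"
        using that by (auto simp: \<D>_def)
      moreover have "acts (xs @ [g]) n e (\<lambda>j. table 0 (table [] (T \<sigma> n) j))"
        using a acts_cong[of "xs @ [g]" n "\<lambda>j. table 0 (table [] (T \<sigma> n) j)" \<sigma> e] T[of _ _ n \<sigma>] by simp
      moreover have "lifts n (table 0 (table [] (T \<sigma> n) j)) m (table 0 (table [] (T \<tau> m) j))" if "j \<le> length xs" for j
        using li that lifts_cong[of n "table 0 (table [] (T \<sigma> n) j)" "\<sigma> j" m "table 0 (table [] (T \<tau> m) j)" "\<tau> j"]
          T[of j _ n \<sigma>] T[of j _ m \<tau>] nm by simp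
      ultimately obtain f where f: "frame m f" "refines n e m f" "acts (xs @ [g]) m f (\<lambda>j. table 0 (table [] (T \<tau> m) j))"
        using e nm unfolding ext_set_def by blast
      then have "acts (xs @ [g]) m f \<tau>"
        using acts_cong[of "xs @ [g]" m "\<lambda>j. table 0 (table [] (T \<tau> m) j)" \<tau> f] T[of _ _ m \<tau>] by simp
      then show "\<exists>f. frame m f \<and> refines n e m f \<and> acts (xs @ [g]) m f \<tau>" using f by blast
    qed
    ultimately show ?thesis by (simp add: gen_def)
  qed
  then show ?thesis
    using do \<D> by (intro exI[of _ "from_nat_into \<D>"]) (metis from_nat_into from_nat_into_surj)
qed

lemma common_refinement:
  assumes xs: "gen xs" and ys: "gen ys" and len: "length ys = length xs"
    and e: "frame n e" "acts xs n e \<sigma>" and f: "frame n f" "acts ys n f \<sigma>"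
  shows "\<exists>m e' f' \<tau>. frame m e' \<and> acts xs m e' \<tau> \<and> frame m f' \<and> acts ys m f' \<tau> \<and>
    refines n e m e' \<and> refines n f m f' \<and> resolves e' t"
proof -
  obtain k where k: "t \<le> k" "\<And>i. e i \<in> dy k" using frame_levels[OF e(1), where m = t] by blast
  obtain m0 e0 \<tau>0 where e0: "frame m0 e0" "acts xs m0 e0 \<tau>0" "resolves e0 k"
    using xs unfolding gen_def locally_finite_def by blast
  obtain m h \<rho> where h: "frame m0 h" "refines n e m0 h" "acts xs m0 h \<rho>" "resolves h k"
    by (rule resolving_refinement[OF e(1) k(2) e0])
  have "lifts n (\<sigma> j) m0 (\<rho> j)" if "j < length xs" for j
    using moves_lifts[OF e(1) h(1,2)] e(2) h(3) that by (auto simp: acts_def)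
  then have "\<forall>j<length ys. lifts n (\<sigma> j) m0 (\<rho> j)" using len by simp
  moreover have "n \<le> m0" using h(2) by (simp add: refines_def)
  ultimately obtain f' where "frame m0 f'" "refines n f m0 f'" "acts ys m0 f' \<rho>"
    using ys f unfolding gen_def extensible_def by blast
  then show ?thesis using h resolves_mono[OF h(4) k(1)] by blast
qed

text \<open>Refine alternately on both sides: local finiteness makes one frame resolve the next level of
  cells, and extensibility provides the matching frame on the other side. The automorphisms
  matching the frames converge in \<open>Gam\<close> to an automorphism that intertwines the tuples.\<close>

lemma back_and_forth:
  assumes xs: "gen xs" and ys: "gen ys" and len: "length ys = length xs"
    and e: "frame n e" "acts xs n e \<sigma>" and f: "frame n f" "acts ys n f \<sigma>"
  shows "\<exists>c\<in>Gam. (\<forall>i. act c (e i) = f i) \<and> (\<forall>j<length xs. c + xs ! j = ys ! j + c)"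
proof -
  define P where "P = (\<lambda>t::nat. \<lambda>(m, e', f', \<tau>). frame m e' \<and> acts xs m e' \<tau> \<and> frame m f' \<and> acts ys m f' \<tau> \<and>
    (t = 0 \<longrightarrow> (m, e', f', \<tau>) = (n, e, f, \<sigma>)))"
  define R where "R = (\<lambda>t. \<lambda>(m, e', f', \<tau>::nat \<Rightarrow> nat \<Rightarrow> nat) (m2, e2, f2, \<tau>2::nat \<Rightarrow> nat \<Rightarrow> nat).
    refines m e' m2 e2 \<and> refines m f' m2 f2 \<and> resolves e2 t \<and> resolves f2 t)"
  have "\<exists>s. \<forall>t. P t (s t) \<and> R t (s t) (s (Suc t))"
  proof (rule dependent_nat_choice)
    show "\<exists>x. P 0 x" by (rule exI[of _ "(n, e, f, \<sigma>)"]) (simp add: P_def e f)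
    fix s t assume "P t s"
    then obtain m e1 f1 \<tau> where s: "s = (m, e1, f1, \<tau>)" "frame m e1" "acts xs m e1 \<tau>" "frame m f1" "acts ys m f1 \<tau>"
      by (auto simp: P_def)
    obtain m2 e2 f2 \<tau>2 where 2: "frame m2 e2" "acts xs m2 e2 \<tau>2" "frame m2 f2" "acts ys m2 f2 \<tau>2"
      "refines m e1 m2 e2" "refines m f1 m2 f2" "resolves e2 t"
      using common_refinement[OF xs ys len s(2-5), of t] by blast
    obtain m3 e3 f3 \<tau>3 where 3: "frame m3 e3" "acts xs m3 e3 \<tau>3" "frame m3 f3" "acts ys m3 f3 \<tau>3"
      "refines m2 e2 m3 e3" "refines m2 f2 m3 f3" "resolves f3 t"
      using common_refinement[OF ys xs len[symmetric] 2(3,4,1,2), of t] by blast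
    have "R t s (m3, e3, f3, \<tau>3)"
      using 2 3 refines_trans[OF 2(5) 3(5)] refines_trans[OF 2(6) 3(6)] resolves_refines[OF 2(7) 3(5) 3(1)] by (simp add: R_def s(1))
    moreover have "P (Suc t) (m3, e3, f3, \<tau>3)" using 3 by (simp add: P_def)
    ultimately show "\<exists>y. P (Suc t) y \<and> R t s y" by blast
  qed
  then obtain s where s: "\<And>t. P t (s t)" "\<And>t. R t (s t) (s (Suc t))" by blast
  define m E F \<tau> where "m = fst \<circ> s" and "E = fst \<circ> (snd \<circ> s)" and "F = fst \<circ> (snd \<circ> (snd \<circ> s))"
    and "\<tau> = snd \<circ> (snd \<circ> (snd \<circ> s))"
  then have st: "s t = (m t, E t, F t, \<tau> t)" for t by simp
  have E: "frame (m t) (E t)" "acts xs (m t) (E t) (\<tau> t)" and F: "frame (m t) (F t)" "acts ys (m t) (F t) (\<tau> t)" for t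
    using s(1)[of t] by (auto simp: P_def st)
  have start: "m 0 = n" "E 0 = e" "F 0 = f" "\<tau> 0 = \<sigma>" using s(1)[of 0] by (auto simp: P_def st)
  have res: "resolves (E (Suc t)) t" "resolves (F (Suc t)) t" for t using s(2)[of t] by (auto simp: R_def st)
  have ref: "refines (m t) (E t) (m u) (E u) \<and> refines (m t) (F t) (m u) (F u)" if "t \<le> u" for t u
    using that
  proof (induction u rule: dec_induct)
    case base
    show ?case by (simp add: refines_refl)
  next
    case (step u)
    then show ?case using s(2)[of u] refines_trans unfolding R_def st case_prod_conv by blast
  qed
  have "\<exists>g\<in>Gam. \<forall>i. act g (E t i) = F t i" for t using frames_isomorphic[OF E(1) F(1)] by metis
  then obtain c where c: "\<And>t. c t \<in> Gam" "\<And>t i. act (c t) (E t i) = F t i" by metis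
  have cE: "act (c u) (E t i) = F t i" if "t \<le> u" for t u i
  proof (cases "i < 2^m t")
    case True
    have r: "refines (m t) (E t) (m u) (E u)" "refines (m t) (F t) (m u) (F u)" using ref[OF that] by auto
    show ?thesis
    proof (rule mu_eq_le_imp_eq)
      show "act (c u) (E t i) \<le> F t i"
      proof (rule act_le_by_frame[OF E(1) refines_adapted[OF E(1) E(1) r(1)]])
        fix p assume p: "p < 2^m u" "E u p \<le> E t i"
        have "F u p \<le> F t (p div 2^(m u - m t))" using r(2) p(1) by (simp add: refines_def)
        then show "act (c u) (E u p) \<le> F t i" using refines_le_iff[OF E(1) E(1) r(1) p] c(2) by simp
      qed
    qed (use frameD(3)[OF E(1) True] frameD(3)[OF F(1) True] in simp)
  next
    case False
    then show ?thesis using frameD(4)[OF E(1), of t i] frameD(4)[OF F(1), of t i] by simp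
  qed
  have cF: "act (- c u) (F t i) = E t i" if "t \<le> u" for t u i
    using cE[OF that, of i] by (metis act_minus1)
  have s1: "\<forall>u\<ge>Suc t. act (c u) a = act (c (Suc t)) a" if "a \<in> dy t" for t a
  proof (intro allI impI)
    fix u assume u: "Suc t \<le> u"
    have ad: "adapted (E (Suc t)) a" using res(1) that by (simp add: resolves_def)
    show "act (c u) a = act (c (Suc t)) a"
    proof (rule mu_eq_le_imp_eq)
      show "act (c u) a \<le> act (c (Suc t)) a"
        by (rule act_le_by_frame[OF E(1) ad]) (simp add: cE[OF u] c(2)[symmetric])
    qed simp
  qed
  have s2: "\<forall>u\<ge>Suc t. act (- c u) a = act (- c (Suc t)) a" if "a \<in> dy t" for t a
  proof (intro allI impI)
    fix u assume u: "Suc t \<le> u"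
    have ad: "adapted (F (Suc t)) a" using res(2) that by (simp add: resolves_def)
    show "act (- c u) a = act (- c (Suc t)) a"
    proof (rule mu_eq_le_imp_eq)
      show "act (- c u) a \<le> act (- c (Suc t)) a"
        by (rule act_le_by_frame[OF F(1) ad]) (simp add: cF[OF u] cF[OF order_refl, symmetric])
    qed simp
  qed
  have "\<exists>N. \<forall>n\<ge>N. act (c n) a = act (c N) a" "\<exists>N. \<forall>n\<ge>N. act (- c n) a = act (- c N) a" if "a \<in> Dy" for a
    using that s1 s2 unfolding Dy_def by blast+
  from Gam_limit[OF c(1) this] obtain g where g: "g \<in> Gam"
    "\<And>a N. \<forall>n\<ge>N. act (c n) a = act (c N) a \<Longrightarrow> act g a = act (c N) a" by blast
  have gE: "act g (E t i) = F t i" for t i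
    using g(2)[of t "E t i"] cE[of t _ i] by simp
  have "g + xs ! j = ys ! j + g" if j: "j < length xs" for j
  proof (rule maut_eq_on_Dy)
    fix a assume "a \<in> Dy"
    then obtain t where t: "a \<in> dy t" by (auto simp: Dy_def)
    have ad: "adapted (E (Suc t)) a" using res(1) t by (simp add: resolves_def)
    show "act (g + xs ! j) a = act (ys ! j + g) a"
    proof (rule mu_eq_le_imp_eq)
      show "act (g + xs ! j) a \<le> act (ys ! j + g) a"
      proof (rule act_le_by_frame[OF E(1) ad])
        fix p assume p: "p < 2^m (Suc t)" "E (Suc t) p \<le> a"
        have "act (xs ! j) (E (Suc t) p) = E (Suc t) (\<tau> (Suc t) j p)" "act (ys ! j) (F (Suc t) p) = F (Suc t) (\<tau> (Suc t) j p)"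
          using E(2)[of "Suc t"] F(2)[of "Suc t"] j p(1) len by (auto simp: acts_def moves_def)
        then have "act (g + xs ! j) (E (Suc t) p) = act (ys ! j + g) (E (Suc t) p)" by (simp add: act_plus gE)
        then show "act (g + xs ! j) (E (Suc t) p) \<le> act (ys ! j + g) a" using p(2) by simp
      qed
    qed simp
  qed
  then show ?thesis using g(1) gE[of 0] start by auto
qed

text \<open>An element near the identity fixes a frame that is invariant under the tuple, so both extended
  tuples act on this frame by the same permutations and the back-and-forth argument can start from
  it.\<close>

lemma generic_conj:
  assumes xs: "gen xs" "set xs \<subseteq> Gam"
  shows "\<exists>m. \<forall>g\<in>Fix m. \<forall>f\<in>Fix m. gen (xs @ [g]) \<longrightarrow> gen (xs @ [f]) \<longrightarrow>
    (\<exists>c\<in>Fix n. (\<forall>x\<in>set xs. c + x = x + c) \<and> c + g - c = f)"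
proof -
  obtain m e \<sigma> where e: "frame m e" "acts xs m e \<sigma>" "resolves e n"
    using xs(1) unfolding gen_def locally_finite_def by blast
  obtain K where K: "\<And>i. e i \<in> dy K" using frame_levels[OF e(1), where m = 0] by blast
  have "\<exists>c\<in>Fix n. (\<forall>x\<in>set xs. c + x = x + c) \<and> c + g - c = f"
    if g: "g \<in> Fix K" "gen (xs @ [g])" and f: "f \<in> Fix K" "gen (xs @ [f])" for g f
  proof -
    have a: "acts (xs @ [h]) m e (\<sigma>(length xs := id))" if "h \<in> Fix K" for h
      using e(2) FixD(1)[OF that K] by (auto simp: acts_def moves_def nth_append less_Suc_eq)
    obtain c where c: "c \<in> Gam" "\<And>i. act c (e i) = e i"
      "\<And>j. j < length (xs @ [g]) \<Longrightarrow> c + (xs @ [g]) ! j = (xs @ [f]) ! j + c"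
      using back_and_forth[OF g(2) f(2) _ e(1) a[OF g(1)] e(1) a[OF f(1)]] by auto
    have "c + x = x + c" if x: "x \<in> set xs" for x
    proof -
      obtain j where "j < length xs" "x = xs ! j" using x unfolding in_set_conv_nth by metis
      then show ?thesis using c(3)[of j] by (simp add: nth_append)
    qed
    moreover have "c + g = f + c" using c(3)[of "length xs"] by simp
    then have "c + g - c = f" by (simp add: add.assoc)
    moreover have "c \<in> Fix n" using Fix_by_frame[OF c(1) e(1,3)] c(2) by blast
    ultimately show ?thesis by blast
  qed
  then show ?thesis by blast
qed

sublocale ample_group Gam Fix gen
  by unfold_locales (rule generic_Nil, erule (1) generic_dense, erule (1) generic_conj)

end

section \<open>Weak neighbourhoods\<close>

definition interleave :: "(nat \<Rightarrow> 'x) \<Rightarrow> (nat \<Rightarrow> 'x) \<Rightarrow> nat \<Rightarrow> 'x" where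
  "interleave x y j = (if even j then x (j div 2) else y (j div 2))"

lemma interleave_even [simp]: "interleave x y (2 * i) = x i"
  and interleave_odd [simp]: "interleave x y (Suc (2 * i)) = y i"
  by (simp_all add: interleave_def)

lemma all_interleave: "(\<forall>j. P j (interleave x y j)) \<longleftrightarrow> (\<forall>i. P (2 * i) (x i) \<and> P (Suc (2 * i)) (y i))"
proof
  assume r: "\<forall>i. P (2 * i) (x i) \<and> P (Suc (2 * i)) (y i)"
  show "\<forall>j. P j (interleave x y j)"
  proof
    fix j
    have "j = 2 * (j div 2) \<or> j = Suc (2 * (j div 2))" by presburger
    then show "P j (interleave x y j)" using r interleave_even[of x y] interleave_odd[of x y] by metis
  qed
qed (metis interleave_even interleave_odd)

lemma sup_diff: "x \<le> e \<Longrightarrow> x \<squnion> (e - x) = (e::'a::boolean_algebra)"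
  by (simp add: diff_eq sup_inf_distrib1 sup.absorb2)

lemma interleave_partition:
  fixes e :: "nat \<Rightarrow> 'a::prob_algebra"
  assumes e: "disjseq e" and x: "\<And>i. x i \<le> e i"
  shows "disjseq (interleave x (\<lambda>i. e i - x i))" "cjoin (interleave x (\<lambda>i. e i - x i)) = cjoin e"
proof -
  let ?p = "interleave x (\<lambda>i. e i - x i)"
  have le: "?p j \<le> e (j div 2)" for j using x by (auto simp: interleave_def diff_eq le_infI1)
  show "disjseq ?p" unfolding disjseq_def
  proof (intro allI impI)
    fix i j :: nat assume ij: "i \<noteq> j"
    show "?p i \<sqinter> ?p j = \<bottom>"
    proof (cases "i div 2 = j div 2")
      case True
      then have "even i \<noteq> even j" using ij by presburger
      moreover have "x k \<sqinter> (e k - x k) = \<bottom>" for k by (simp add: diff_eq inf.left_commute)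
      ultimately show ?thesis using True by (auto simp: interleave_def inf.commute)
    next
      case False
      show ?thesis by (rule inf_bot_mono[OF disjseqD[OF e False] le le])
    qed
  qed
  show "cjoin ?p = cjoin e"
  proof (rule antisym)
    show "cjoin ?p \<le> cjoin e" proof (rule cjoin_least)
      show "?p j \<le> cjoin e" for j using le[of j] cjoin_upper[of e "j div 2"] by (rule order_trans)
    qed
    have "e i \<le> cjoin ?p" for i
    proof -
      have "x i \<squnion> (e i - x i) \<le> cjoin ?p"
        using cjoin_upper[of ?p "2 * i"] cjoin_upper[of ?p "Suc (2 * i)"] by simp
      then show ?thesis using sup_diff[OF x] by simp
    qed
    then show "cjoin e \<le> cjoin ?p" by (rule cjoin_least)
  qed
qed

lemma cantor_pigeonhole: "\<exists>\<alpha> \<beta>. \<alpha> \<noteq> \<beta> \<and> f \<alpha> = (f \<beta> :: nat)" for f :: "(nat \<Rightarrow> bool) \<Rightarrow> nat"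
proof (rule ccontr)
  assume "\<not> ?thesis"
  then have "inj f" by (auto simp: inj_def)
  define \<alpha> where "\<alpha> n = (\<not> inv_into UNIV f n n)" for n
  have "inv_into UNIV f (f \<alpha>) = \<alpha>" using \<open>inj f\<close> by simp
  then show False using \<alpha>_def[of "f \<alpha>"] by auto
qed

context homogeneous_algebra
begin

text \<open>Keep the common parts of \<open>a i\<close> and \<open>b i\<close> fixed and match the differences, which have equal
  measure, by homogeneity.\<close>

lemma partition_correction:
  fixes a b :: "nat \<Rightarrow> 'a"
  assumes a: "disjseq a" "cjoin a = \<top>" and b: "disjseq b" "cjoin b = \<top>"
    and m: "\<And>i. mu (a i) = mu (b i)" and d: "summable \<delta>" "\<And>i. dist (a i) (b i) \<le> \<delta> i"
  shows "\<exists>r s. supported s r \<and> mu s \<le> suminf \<delta> \<and> (\<forall>i. act r (a i) = b i)"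
proof -
  let ?x = "\<lambda>i. a i \<sqinter> b i"
  let ?p = "interleave ?x (\<lambda>i. a i - ?x i)" and ?q = "interleave ?x (\<lambda>i. b i - ?x i)"
  have "mu (a i - ?x i) = mu (b i - ?x i)" for i using m by (simp add: mu_diff)
  then have "\<forall>i. \<exists>k. act k (a i - ?x i) = b i - ?x i" using homogeneous by blast
  from choice[OF this] obtain k where k: "\<And>i. act (k i) (a i - ?x i) = b i - ?x i" by blast
  have kq: "(\<lambda>j. act (interleave (\<lambda>i. 0) k j) (?p j)) = ?q" by (auto simp: interleave_def k)
  have p: "disjseq ?p" "cjoin ?p = \<top>" "disjseq ?q"
    using interleave_partition[OF a(1), of ?x] interleave_partition[OF b(1), of ?x] a(2) by auto
  have "disjseq (\<lambda>j. act (interleave (\<lambda>i. 0) k j) (?p j))" unfolding kq by (rule p(3))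
  from glue[OF p(1,2) this] obtain r where r: "\<And>j c. c \<le> ?p j \<Longrightarrow> act r c = act (interleave (\<lambda>i. 0) k j) c" by metis
  have r0: "act r c = c" if "c \<le> ?x i" for c i using r[of c "2 * i"] that by simp
  have ra: "act r (a i) = b i" for i
  proof -
    have "act r (?x i \<squnion> (a i - ?x i)) = ?x i \<squnion> (b i - ?x i)"
      using r0[of "?x i" i] r[of "a i - ?x i" "Suc (2 * i)"] k[of i] by (simp add: act_sup)
    then show ?thesis by (simp add: sup_diff)
  qed
  define s where "s = cjoin (\<lambda>i. (a i - b i) \<squnion> (b i - a i))"
  have "supported s r" unfolding supported_def
  proof (intro allI impI)
    fix c assume c: "c \<sqinter> s = \<bottom>"
    have "act r (c \<sqinter> a i) = c \<sqinter> a i" for i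
    proof -
      have "(c \<sqinter> a i) - b i \<le> c \<sqinter> s"
        using cjoin_upper[of "\<lambda>i. (a i - b i) \<squnion> (b i - a i)" i] by (simp add: s_def diff_eq le_infI1 le_infI2 inf.assoc)
      then have "c \<sqinter> a i \<le> b i" unfolding c by (simp add: bot_unique diff_bot_iff)
      then show ?thesis by (intro r0[of _ i]) simp
    qed
    moreover have "c = cjoin (\<lambda>i. c \<sqinter> a i)" by (simp add: inf_cjoin[symmetric] a(2))
    ultimately show "act r c = c" by (metis (no_types, lifting) act_cjoin cjoin_def ext)
  qed
  moreover have "mu s \<le> suminf \<delta>" unfolding s_def using d(2) by (intro mu_cjoin_le[OF d(1)]) (simp add: dist_mu)
  ultimately show ?thesis using ra by blast
qed

text \<open>For subgroups the twentyfold sums stay inside, so the small supports already generate the group.\<close>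

theorem large_subgroup_everything:
  fixes H :: "nat \<Rightarrow> 'a maut set"
  assumes "large H" "\<And>n a b. a \<in> H n \<Longrightarrow> b \<in> H n \<Longrightarrow> a + b \<in> H n"
  shows "\<exists>n. H n = UNIV"
proof -
  obtain n \<delta> where n: "0 < \<delta>" "\<And>s g. mu s < \<delta> \<Longrightarrow> supported s g \<Longrightarrow> g \<in> nfold (H n) 20"
    using small_supports_in_nfold[OF assms(1)] by metis
  have sub: "nfold (H n) 20 \<subseteq> H n" using assms by (intro nfold_subgroup) (auto simp: large_def)
  have "g \<in> H n" for g
    by (rule generated_by_small_supports[of "H n" \<delta>]) (use n assms(2) sub in auto)
  then show ?thesis by blast
qed

end

context dyadic_algebra
begin

lemma dyadic_part:
  assumes Dy: "c \<in> Dy" "w \<in> Dy" "z \<in> Dy" and \<rho>: "mu z \<le> mu w" "mu w - mu z \<le> mu c"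
  shows "\<exists>x\<in>Dy. x \<le> c \<and> mu x = mu w - mu z"
proof -
  have "finite {c, w, z}" "{c, w, z} \<subseteq> Dy" using Dy by auto
  then obtain l where l: "0 \<le> l" "{c, w, z} \<subseteq> dy l" by (rule finite_subset_dy)
  define J where "J u = {p. p < 2^l \<and> cell l p \<le> u}" for u
  have J: "mu u = card (J u) / 2^l" if "u \<in> dy l" for u
    using mu_adapted[OF frame_cell] resolves_cell[of l] that by (auto simp: resolves_def J_def)
  have fin: "finite (J u)" for u by (rule finite_subset[of _ "{..<2^l}"]) (auto simp: J_def)
  have "card (J z) \<le> card (J w)" using \<rho>(1) J l(2) by (simp add: divide_le_cancel)
  moreover have "(real (card (J w)) - card (J z)) / 2^l \<le> card (J c) / 2^l"
    using \<rho>(2) J l(2) by (simp add: diff_divide_distrib)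
  then have "real (card (J w)) - card (J z) \<le> card (J c)" by (simp add: divide_le_cancel)
  ultimately have "card (J w) - card (J z) \<le> card (J c)" by linarith
  then obtain T where T: "T \<subseteq> J c" "card T = card (J w) - card (J z)" by (meson obtain_subset_with_card_n)
  define x where "x = cjoin (\<lambda>i. if i \<in> T then cell l i else \<bottom>)"
  have x: "x \<in> dy l" unfolding x_def by (rule dy_cjoin) (simp add: cell_dy bot_dy)
  have "x \<le> c" unfolding x_def by (rule cjoin_least) (use T(1) in \<open>auto simp: J_def\<close>)
  moreover have "J x = T"
  proof
    show "T \<subseteq> J x"
      using T(1) cjoin_upper[of "\<lambda>i. if i \<in> T then cell l i else \<bottom>"] unfolding x_def J_def
      by (smt (verit) mem_Collect_eq subset_iff)
    show "J x \<subseteq> T"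
    proof
      fix p assume p: "p \<in> J x"
      show "p \<in> T"
      proof (rule ccontr)
        assume "p \<notin> T"
        then have "cell l p \<sqinter> x = \<bottom>" unfolding x_def by (intro cjoin_disjoint') (auto intro: cell_disj)
        then show False using p frame_ne_bot[OF frame_cell, of p l] by (simp add: J_def inf.absorb1)
      qed
    qed
  qed
  then have "mu x = mu w - mu z"
    using J[OF x] J l(2) T(2) \<open>card (J z) \<le> card (J w)\<close> by (simp add: of_nat_diff diff_divide_distrib)
  ultimately show ?thesis using x dy_Dy by blast
qed

lemma dyadic_approximation:
  assumes u: "u \<in> Dy" "a \<le> u" and w: "w \<in> Dy" "mu a = mu w" and e: "0 < e"
  shows "\<exists>d\<in>Dy. d \<le> u \<and> mu d = mu a \<and> dist a d < e"
proof -
  obtain d0 where d0: "d0 \<in> Dy" "dist a d0 < e / 2" using Dy_dense[of "e/2" a] e by auto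
  define d1 where "d1 = d0 \<sqinter> u"
  have d1: "d1 \<in> Dy" "d1 \<le> u" "dist a d1 < e / 2"
    using Dy_inf[OF d0(1) u(1)] dist_inf[of a u d0] d0(2) u(2) by (auto simp: d1_def inf.absorb1)
  have diff: "\<bar>mu a - mu d1\<bar> < e / 2" using mu_dist[of a d1] d1(3) by simp
  show ?thesis
  proof (cases "mu a \<le> mu d1")
    case True
    obtain d where d: "d \<in> Dy" "d \<le> d1" "mu d = mu w"
      using dyadic_part[OF d1(1) w(1) dy_Dy[OF bot_dy]] True w(2) mu_nonneg[of w] by auto
    have "dist a d \<le> dist a d1 + (mu d1 - mu d)" using dist_triangle[of a d d1] dist_le[OF d(2)] by (simp add: dist_commute)
    then have "dist a d < e" using d1(3) diff d(3) w(2) by linarith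
    then show ?thesis using d d1(2) w(2) by (intro bexI[of _ d]) auto
  next
    case False
    have "mu w - mu d1 \<le> mu (u - d1)" using mu_mono[OF u(2)] mu_diff[OF d1(2)] w(2) by simp
    then obtain x where x: "x \<in> Dy" "x \<le> u - d1" "mu x = mu w - mu d1"
      using dyadic_part[OF Dy_diff[OF u(1) d1(1)] w(1) d1(1)] False w(2) by auto
    have dj: "d1 \<sqinter> x = \<bottom>" "x \<le> u" using x(2) by (auto simp: diff_eq inf_shunt compl_le_swap1)
    have mx: "mu (d1 \<squnion> x) = mu a" using mu_sup[OF dj(1)] x(3) w(2) by simp
    have "dist a (d1 \<squnion> x) \<le> dist a d1 + (mu (d1 \<squnion> x) - mu d1)"
      using dist_triangle[of a "d1 \<squnion> x" d1] dist_le[of d1 "d1 \<squnion> x"] by simp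
    then have "dist a (d1 \<squnion> x) < e" using d1(3) diff mx by linarith
    then show ?thesis using mx Dy_sup[OF d1(1) x(1)] d1(2) dj(2) by (intro bexI[of _ "d1 \<squnion> x"]) auto
  qed
qed

text \<open>A finite partition into dyadic elements, written as a sequence that is eventually zero.\<close>

definition dpart :: "(nat \<Rightarrow> 'a) \<Rightarrow> bool" where
  "dpart e \<longleftrightarrow> disjseq e \<and> cjoin e = \<top> \<and> (\<forall>i. e i \<in> Dy) \<and> (\<exists>K. \<forall>i\<ge>K. e i = \<bottom>)"

lemma adapted_Dy:
  assumes "dpart e" "adapted e a" shows "a \<in> Dy"
proof -
  obtain K where K: "\<And>i. K \<le> i \<Longrightarrow> e i = \<bottom>" using assms(1) by (auto simp: dpart_def)
  have "finite (e ` {..<K})" "e ` {..<K} \<subseteq> Dy" using assms(1) by (auto simp: dpart_def)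
  then obtain l where l: "0 \<le> l" "e ` {..<K} \<subseteq> dy l" by (rule finite_subset_dy)
  have "a = cjoin (\<lambda>i. a \<sqinter> e i)" using assms(1) by (simp add: inf_cjoin[symmetric] dpart_def)
  moreover have "a \<sqinter> e i \<in> dy l" for i
  proof (cases "i < K \<and> e i \<le> a")
    case True
    then show ?thesis using l(2) by (auto simp: inf.absorb2)
  next
    case False
    then have "a \<sqinter> e i = \<bottom>" using assms(2) K[of i] by (auto simp: adapted_def inf.commute not_less)
    then show ?thesis by (simp add: bot_dy)
  qed
  ultimately show ?thesis using dy_cjoin dy_Dy by metis
qed

lemma dpart_act: "dpart e \<Longrightarrow> (\<And>i. act g (e i) \<in> Dy) \<Longrightarrow> dpart (\<lambda>i. act g (e i))"
  by (auto simp: dpart_def disjseq_def act_cjoin[symmetric] simp flip: act_inf)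

lemma adapted_act: "adapted (\<lambda>i. act g (e i)) a \<longleftrightarrow> adapted e (act (- g) a)"
proof -
  have "act g x \<sqinter> a = \<bottom> \<longleftrightarrow> x \<sqinter> act (- g) a = \<bottom>" for x
    using act_bot_iff[of "- g" "act g x \<sqinter> a"] by (simp add: act_inf)
  then show ?thesis by (simp add: adapted_def act_le_swap)
qed

text \<open>Split every piece \<open>e i\<close> by \<open>v\<close>; the image of the part inside \<open>v\<close> is close to a dyadic element of the
  same measure inside \<open>act g (e i)\<close>. Moving the image there is a correction of small support that
  does not affect the images of the pieces themselves.\<close>

lemma adjoin_dyadic:
  assumes e: "dpart e" and g: "\<And>i. act g (e i) \<in> Dy" and v: "v \<in> Dy" and \<epsilon>: "0 < \<epsilon>"
  shows "\<exists>r s e'. supported s r \<and> mu s < \<epsilon> \<and> dpart e' \<and> (\<forall>i. act (r + g) (e' i) \<in> Dy) \<and>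
    (\<forall>a. adapted e a \<longrightarrow> adapted e' a \<and> act (r + g) a = act g a) \<and> adapted e' v"
proof -
  have ed: "disjseq e" "cjoin e = \<top>" "\<And>i. e i \<in> Dy" using e by (auto simp: dpart_def)
  define x where "x i = e i \<sqinter> v" for i
  have x: "x i \<le> e i" "x i \<in> Dy" for i using Dy_inf[OF ed(3) v] by (auto simp: x_def)
  let ?\<delta> = "\<lambda>j::nat. \<epsilon> / 2 * ((1/2) ^ Suc j)"
  have "\<exists>d\<in>Dy. d \<le> act g (e i) \<and> mu d = mu (act g (x i)) \<and> dist (act g (x i)) d < ?\<delta> (Suc (2 * i))" for i
    by (rule dyadic_approximation[OF g _ x(2)[of i]]) (use x(1) \<epsilon> in auto)
  then obtain d where d: "\<And>i. d i \<in> Dy" "\<And>i. d i \<le> act g (e i)" "\<And>i. mu (d i) = mu (act g (x i))"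
    "\<And>i. dist (act g (x i)) (d i) < ?\<delta> (Suc (2 * i))" by metis
  define e' where "e' = interleave x (\<lambda>i. e i - x i)"
  define b where "b = interleave d (\<lambda>i. act g (e i) - d i)"
  have e'1: "disjseq e'" "cjoin e' = \<top>" using interleave_partition[OF ed(1) x(1)] ed(2) by (auto simp: e'_def)
  have ge: "disjseq (\<lambda>i. act g (e i))" "cjoin (\<lambda>i. act g (e i)) = \<top>"
    using ed by (auto simp: disjseq_def act_cjoin[symmetric] simp flip: act_inf)
  have b1: "disjseq b" "cjoin b = \<top>" using interleave_partition[OF ge(1) d(2)] ge(2) by (auto simp: b_def)
  have bD: "b j \<in> Dy" for j using d(1) Dy_diff[OF g d(1)] by (auto simp: b_def interleave_def)
  have e'D: "e' j \<in> Dy" for j using x(2) Dy_diff[OF ed(3) x(2)] by (auto simp: e'_def interleave_def)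
  have mb: "\<forall>j. mu (act g (e' j)) = mu (b j)"
    unfolding e'_def all_interleave[where P = "\<lambda>j y. mu (act g y) = mu (b j)"]
    using d(3) x(1) by (simp add: b_def mu_diff[OF x(1)] mu_diff[OF d(2)])
  have dd: "\<forall>j. dist (act g (e' j)) (b j) \<le> ?\<delta> j"
    unfolding e'_def all_interleave[where P = "\<lambda>j y. dist (act g y) (b j) \<le> ?\<delta> j"]
  proof (intro allI conjI)
    fix i
    have "?\<delta> (Suc (2 * i)) \<le> ?\<delta> (2 * i)" using \<epsilon> by simp
    then show "dist (act g (x i)) (b (2 * i)) \<le> ?\<delta> (2 * i)" using d(4)[of i] by (simp add: b_def)
    have "dist (- act g (x i) \<sqinter> act g (e i)) (- d i \<sqinter> act g (e i)) \<le> dist (act g (x i)) (d i)"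
      using dist_inf[of "- act g (x i)" "act g (e i)" "- d i"] by (simp add: dist_compl)
    moreover have "act g (e i - x i) = - act g (x i) \<sqinter> act g (e i)" "b (Suc (2 * i)) = - d i \<sqinter> act g (e i)"
      by (simp_all add: b_def act_inf act_compl diff_eq inf.commute)
    ultimately show "dist (act g (e i - x i)) (b (Suc (2 * i))) \<le> ?\<delta> (Suc (2 * i))"
      using d(4)[of i] by (metis less_imp_le order_trans)
  qed
  have sm: "?\<delta> sums (\<epsilon> / 2)"
    using sums_mult[OF power_half_series, of "\<epsilon> / 2"] by simp
  obtain r s where r: "supported s r" "mu s \<le> suminf ?\<delta>" "\<And>j. act r (act g (e' j)) = b j"
    using partition_correction[of "\<lambda>j. act g (e' j)" b ?\<delta>] b1 e'1 mb dd sums_summable[OF sm]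
    by (auto simp: disjseq_def act_cjoin[symmetric] simp flip: act_inf)
  have re: "act (r + g) (e i) = act g (e i)" for i
  proof -
    have "act (r + g) (x i) = d i" "act (r + g) (e i - x i) = act g (e i) - d i"
      using r(3)[of "2 * i"] r(3)[of "Suc (2 * i)"] by (simp_all add: act_plus e'_def b_def)
    then have "act (r + g) (x i \<squnion> (e i - x i)) = d i \<squnion> (act g (e i) - d i)" by (simp only: act_sup)
    then show ?thesis by (simp add: sup_diff x(1) d(2))
  qed
  have keep: "adapted e' a \<and> act (r + g) a = act g a" if a: "adapted e a" for a
  proof
    have le: "e' j \<le> e (j div 2)" for j using x(1) by (auto simp: e'_def interleave_def diff_eq le_infI1)
    show "adapted e' a" unfolding adapted_def
    proof
      fix j
      show "e' j \<le> a \<or> e' j \<sqinter> a = \<bottom>"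
        using a order_trans[OF le[of j]] inf_bot_mono[OF _ le[of j] order_refl, of a] by (metis adapted_def)
    qed
    have "act (r + g) (a \<sqinter> e i) = act g (a \<sqinter> e i)" for i
    proof (cases "e i \<le> a")
      case False
      then have "a \<sqinter> e i = \<bottom>" using a by (auto simp: adapted_def inf.commute)
      then show ?thesis by simp
    qed (simp add: inf.absorb2 re)
    then have "cjoin (\<lambda>i. act (r + g) (a \<sqinter> e i)) = cjoin (\<lambda>i. act g (a \<sqinter> e i))" by simp
    then show "act (r + g) a = act g a"
      by (simp add: act_cjoin[symmetric] inf_cjoin[symmetric] ed(2))
  qed
  have "adapted e' v" unfolding adapted_def
    by (auto simp: e'_def interleave_def x_def diff_eq inf_sup_distrib1 inf.assoc inf.left_commute inf.commute)
  moreover have "dpart e'"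
  proof -
    obtain K where K: "\<And>i. K \<le> i \<Longrightarrow> e i = \<bottom>" using e by (auto simp: dpart_def)
    have "e' j = \<bottom>" if "2 * K \<le> j" for j
      using K[of "j div 2"] x(1)[of "j div 2"] that by (auto simp: e'_def interleave_def le_bot diff_eq)
    then show ?thesis using e'1 e'D by (auto simp: dpart_def)
  qed
  moreover have "act (r + g) (e' i) \<in> Dy" for i using r(3) bD by (simp add: act_plus)
  moreover have "mu s < \<epsilon>" using r(2) sm \<epsilon> by (simp add: sums_iff)
  ultimately show ?thesis using r(1) keep by blast
qed

text \<open>Apply the one-sided step to \<open>g\<close> and then to the inverse. A correction on the right of the inverse
  becomes, after conjugation, one of the same size on the left of \<open>g\<close>.\<close>

lemma adjoin_dyadic_both:
  assumes e: "dpart e" and g: "\<And>i. act g (e i) \<in> Dy" and v: "v \<in> Dy" and \<epsilon>: "0 < \<epsilon>"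
  shows "\<exists>r s e'. supported s r \<and> mu s < \<epsilon> \<and> dpart e' \<and> (\<forall>i. act (r + g) (e' i) \<in> Dy) \<and>
    (\<forall>a. adapted e a \<longrightarrow> adapted e' a \<and> act (r + g) a = act g a) \<and> adapted e' v \<and> adapted e' (act (- (r + g)) v)"
proof -
  obtain r s e1 where r: "supported s r" "mu s < \<epsilon> / 2" "dpart e1" "\<And>i. act (r + g) (e1 i) \<in> Dy"
    "\<And>a. adapted e a \<Longrightarrow> adapted e1 a \<and> act (r + g) a = act g a" "adapted e1 v"
    using adjoin_dyadic[OF e g v, of "\<epsilon> / 2"] \<epsilon> by (auto simp: dpart_def)
  define g1 where "g1 = r + g"
  define f where "f = (\<lambda>i. act g1 (e1 i))"
  have f: "dpart f" "\<And>i. act (- g1) (f i) \<in> Dy"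
    using dpart_act[OF r(3,4)] r(3) by (auto simp: f_def g1_def dpart_def)
  obtain q t f' where q: "supported t q" "mu t < \<epsilon> / 2" "dpart f'" "\<And>i. act (q + - g1) (f' i) \<in> Dy"
    "\<And>a. adapted f a \<Longrightarrow> adapted f' a \<and> act (q + - g1) a = act (- g1) a" "adapted f' v"
    using adjoin_dyadic[OF f v, of "\<epsilon> / 2"] \<epsilon> by (auto simp: dpart_def)
  define r' where "r' = (g1 + - q + - g1) + r"
  define e' where "e' = (\<lambda>i. act (q + - g1) (f' i))"
  have rg: "r' + g = - (q + - g1)"
    by (simp add: r'_def g1_def add.assoc minus_add)
  have "supported (act g1 t) (g1 + - q + - g1)"
    using supported_conj[OF supported_uminus[OF q(1)], of g1] by simp
  then have "supported (act g1 t \<squnion> s) r'"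
    unfolding r'_def by (rule supported_plus[OF supported_mono supported_mono[OF r(1)]]) auto
  moreover have "mu (act g1 t \<squnion> s) < \<epsilon>" using mu_sup_le[of "act g1 t" s] r(2) q(2) by simp
  moreover have "dpart e'" unfolding e'_def by (rule dpart_act[OF q(3,4)])
  moreover have "act (r' + g) (e' i) \<in> Dy" for i
  proof -
    have "act (r' + g) (e' i) = f' i" unfolding rg e'_def by (rule act_minus1)
    then show ?thesis using q(3) by (simp add: dpart_def)
  qed
  moreover have "adapted e' (act (- (r' + g)) v)"
  proof -
    have "act (- (q + - g1)) (act (- (- (q + - g1))) v) = v" by (rule act_minus2)
    then show ?thesis using q(6) unfolding rg e'_def adapted_act by (simp only:)
  qed
  moreover have trans: "adapted e' a \<and> act (r' + g) a = act g1 a" if "adapted e1 a" for a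
  proof -
    have "adapted f (act g1 a)" unfolding f_def adapted_act using that by simp
    from q(5)[OF this] have 1: "adapted f' (act g1 a)" "act (q + - g1) (act g1 a) = a" by auto
    then have 2: "act (- (q + - g1)) a = act g1 a" by (metis act_minus1)
    then show ?thesis unfolding e'_def adapted_act rg using 1(1) by simp
  qed
  moreover have "adapted e' a \<and> act (r' + g) a = act g a" if "adapted e a" for a
    using r(5)[OF that] trans[of a] by (simp add: g1_def)
  ultimately show ?thesis using r(6) by blast
qed

text \<open>Enumerate the dyadic elements and correct one after the other so that it has dyadic image and
  preimage, with supports of measures summing up to less than \<open>\<epsilon>\<close>. Later corrections do not affect
  the values reached before, so the corrected automorphisms converge to an element of \<open>Gam\<close>.\<close>

theorem uniformly_near_Fix:
  assumes h: "\<And>i. act h (cell N i) = cell N i" and \<epsilon>: "0 < \<epsilon>"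
  shows "\<exists>\<gamma>\<in>Fix N. \<exists>r s. supported s r \<and> mu s < \<epsilon> \<and> \<gamma> = r + h"
proof -
  define v where "v = from_nat_into Dy"
  have Dne: "Dy \<noteq> {}" using dy_Dy[OF bot_dy] by blast
  have v: "v n \<in> Dy" for n unfolding v_def by (rule from_nat_into[OF Dne])
  have v_surj: "\<exists>n. a = v n" if "a \<in> Dy" for a
    using from_nat_into_surj[OF countable_Dy that] by (auto simp: v_def)
  define \<delta> where "\<delta> n = \<epsilon> / 2 * (1/2) ^ Suc n" for n
  have \<delta>: "0 < \<delta> n" for n using \<epsilon> by (simp add: \<delta>_def)
  define P where "P = (\<lambda>n::nat. \<lambda>(g, e). dpart e \<and> (\<forall>i. act g (e i) \<in> Dy) \<and> (n = 0 \<longrightarrow> (g, e) = (h, cell N)))"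
  define R where "R = (\<lambda>n. \<lambda>(g, e) (g', e'). (\<exists>r s. supported s r \<and> mu s < \<delta> n \<and> g' = r + g) \<and>
    (\<forall>a. adapted e a \<longrightarrow> adapted e' a \<and> act g' a = act g a) \<and> adapted e' (v n) \<and> adapted e' (act (- g') (v n)))"
  have "\<exists>S. \<forall>n. P n (S n) \<and> R n (S n) (S (Suc n))"
  proof (rule dependent_nat_choice)
    have "dpart (cell N)"
      using disjseq_cell cjoin_cell dy_Dy[OF cell_dy] cell_out[of N] unfolding dpart_def by blast
    then show "\<exists>x. P 0 x" by (intro exI[of _ "(h, cell N)"]) (simp add: P_def h dy_Dy[OF cell_dy])
    fix S n assume "P n S"
    then obtain g e where S: "S = (g, e)" "dpart e" "\<And>i. act g (e i) \<in> Dy" by (auto simp: P_def)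
    obtain r s e' where "supported s r" "mu s < \<delta> n" "dpart e'" "\<And>i. act (r + g) (e' i) \<in> Dy"
      "\<And>a. adapted e a \<Longrightarrow> adapted e' a \<and> act (r + g) a = act g a" "adapted e' (v n)" "adapted e' (act (- (r + g)) (v n))"
      using adjoin_dyadic_both[OF S(2,3) v \<delta>, of n n] by metis
    then show "\<exists>y. P (Suc n) y \<and> R n S y"
      by (intro exI[of _ "(r + g, e')"]) (auto simp: P_def R_def S(1))
  qed
  then obtain S where S: "\<And>n. P n (S n)" "\<And>n. R n (S n) (S (Suc n))" by blast
  define g e where "g = fst \<circ> S" and "e = snd \<circ> S"
  then have Sn: "S n = (g n, e n)" for n by simp
  have e: "dpart (e n)" "\<And>i. act (g n) (e n i) \<in> Dy" for n using S(1)[of n] by (auto simp: P_def Sn)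
  have start: "g 0 = h" "e 0 = cell N" using S(1)[of 0] by (auto simp: P_def Sn)
  have Rn: "\<exists>r s. supported s r \<and> mu s < \<delta> n \<and> g (Suc n) = r + g n"
    "adapted (e n) a \<Longrightarrow> adapted (e (Suc n)) a \<and> act (g (Suc n)) a = act (g n) a"
    "adapted (e (Suc n)) (v n)" "adapted (e (Suc n)) (act (- g (Suc n)) (v n))" for n a
    using S(2)[of n] by (auto simp: R_def Sn)
  have later: "adapted (e n) a \<and> act (g n) a = act (g m) a" if "m \<le> n" "adapted (e m) a" for m n a
    using that(1) by (induction n rule: dec_induct) (use that(2) Rn(2) in auto)
  have fwd: "\<forall>n\<ge>Suc m. act (g n) (v m) = act (g (Suc m)) (v m)" for m
    using later[OF _ Rn(3)[of m]] by blast
  have bwd: "\<forall>n\<ge>Suc m. act (- g n) (v m) = act (- g (Suc m)) (v m)" for m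
  proof (intro allI impI)
    fix n assume "Suc m \<le> n"
    then have "act (g n) (act (- g (Suc m)) (v m)) = v m" using later[OF _ Rn(4)[of m]] by simp
    then show "act (- g n) (v m) = act (- g (Suc m)) (v m)" by (metis act_minus1)
  qed
  have "\<exists>N. \<forall>n\<ge>N. act (g n) a = act (g N) a" "\<exists>N. \<forall>n\<ge>N. act (- g n) a = act (- g N) a" if "a \<in> Dy" for a
    using v_surj[OF that] fwd bwd by blast+
  from limit_on_Dy[OF this] obtain \<gamma> where \<gamma>: "\<And>b. (\<lambda>n. act (g n) b) \<longlonglongrightarrow> act \<gamma> b"
    "\<And>a N. \<forall>n\<ge>N. act (g n) a = act (g N) a \<Longrightarrow> act \<gamma> a = act (g N) a"
    "\<And>a N. \<forall>n\<ge>N. act (- g n) a = act (- g N) a \<Longrightarrow> act (- \<gamma>) a = act (- g N) a" by blast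
  have "act \<gamma> a \<in> Dy \<and> act (- \<gamma>) a \<in> Dy" if a: "a \<in> Dy" for a
  proof -
    obtain m where m: "a = v m" using v_surj[OF a] by blast
    have "adapted (\<lambda>i. act (g (Suc m)) (e (Suc m) i)) (act (g (Suc m)) (v m))"
      unfolding adapted_act using Rn(3) by simp
    then have "act (g (Suc m)) (v m) \<in> Dy" by (rule adapted_Dy[OF dpart_act[OF e]])
    moreover have "act (- g (Suc m)) (v m) \<in> Dy" by (rule adapted_Dy[OF e(1) Rn(4)])
    ultimately show ?thesis using \<gamma>(2)[OF fwd] \<gamma>(3)[OF bwd] m by simp
  qed
  then have "\<gamma> \<in> Gam" by (simp add: Gam_def)
  moreover have "act \<gamma> (cell N i) = cell N i" for i
  proof -
    have "adapted (e 0) (cell N i)" unfolding start using resolves_cell[of N] cell_dy by (auto simp: resolves_def)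
    then have "\<forall>n\<ge>0. act (g n) (cell N i) = act (g 0) (cell N i)" using later[of 0] by blast
    from \<gamma>(2)[OF this] show ?thesis by (simp add: start h)
  qed
  ultimately have "\<gamma> \<in> Fix N" by (rule FixI)
  obtain r s where rs: "\<And>n. supported (s n) (r n)" "\<And>n. mu (s n) < \<delta> n" "\<And>n. g (Suc n) = r n + g n"
    using Rn(1) by metis
  have gh: "supported (cjoin s) (g n - h)" for n
  proof (induction n)
    case (Suc n)
    have "supported (cjoin s) (r n)" by (rule supported_mono[OF rs(1) cjoin_upper])
    then have "supported (cjoin s) (r n + (g n - h))" using Suc by (rule supported_plus)
    then show ?case by (simp add: rs(3) add.assoc diff_conv_add_uminus del: add_uminus_conv_diff)
  qed (simp add: start)
  have "supported (cjoin s) (\<gamma> - h)" unfolding supported_def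
  proof (intro allI impI)
    fix b assume b: "b \<sqinter> cjoin s = \<bottom>"
    have "act (g n) (act (- h) b) = b" for n
      using supportedD[OF gh b] by (simp add: act_plus diff_conv_add_uminus del: add_uminus_conv_diff)
    then have "act \<gamma> (act (- h) b) = b" using LIMSEQ_unique[OF \<gamma>(1)[of "act (- h) b"]] by simp
    then show "act (\<gamma> - h) b = b" by (simp add: act_plus diff_conv_add_uminus del: add_uminus_conv_diff)
  qed
  moreover have "\<delta> sums (\<epsilon> / 2)" unfolding \<delta>_def using sums_mult[OF power_half_series, of "\<epsilon> / 2"] by simp
  then have "mu (cjoin s) < \<epsilon>"
    using mu_cjoin_le[of \<delta> s] rs(2) \<epsilon> by (force simp: sums_iff less_imp_le)
  moreover have "\<gamma> = (\<gamma> - h) + h" by simp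
  ultimately show ?thesis using \<open>\<gamma> \<in> Fix N\<close> by blast
qed

text \<open>If \<open>g\<close> nearly fixes the cells of level \<open>N\<close>, one correction of small support makes it fix them, and
  a second one brings it into \<open>Fix N\<close>. The sets \<open>nfold W 2\<close> form a large constant sequence, so each
  correction has length \<open>20 * 2\<close>. Countably many translates of \<open>nfold W 2\<close> by elements of \<open>Gam\<close> cover
  \<open>Gam\<close>, so \<open>Fix N\<close> consists of elements of length \<open>6 * 2\<close>, and \<open>92 = 40 + 40 + 12\<close>.\<close>

theorem weak_neighbourhood_in_nfold:
  fixes k :: "nat \<Rightarrow> 'a maut"
  assumes cover: "\<And>g. \<exists>n. \<exists>w\<in>W. g = k n + w" and sym: "\<And>w. w \<in> W \<Longrightarrow> - w \<in> W"
  shows "\<exists>N \<delta>. 0 < \<delta> \<and> (\<forall>g. (\<forall>i<2^N. dist (act g (cell N i)) (cell N i) < \<delta>) \<longrightarrow> g \<in> nfold W 92)"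
proof -
  have dif: "- g + h \<in> nfold W 2" if "g = k n + w" "h = k n + w'" "w \<in> W" "w' \<in> W" for g h n w w'
  proof -
    have "- w + w' \<in> nfold W (1 + 1)" using that sym by (intro nfold_add nfold_1)
    moreover have "- g + h = - w + w'" using that by (simp add: minus_add add.assoc del: add_uminus_conv_diff)
    ultimately show ?thesis by (simp add: numeral_2_eq_2)
  qed
  have "large (\<lambda>_. nfold W 2)"
    unfolding large_def
  proof (intro conjI allI)
    have "0 \<in> nfold W 2" using cover[of 0] dif[of 0 _ _ 0] by fastforce
    then show "0 \<in> nfold W 2" for n :: nat .
    show "\<exists>\<alpha> \<beta> n. \<alpha> \<noteq> \<beta> \<and> - t \<alpha> + t \<beta> \<in> nfold W 2" for t :: "(nat \<Rightarrow> bool) \<Rightarrow> 'a maut"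
    proof -
      have "\<forall>\<alpha>. \<exists>n. \<exists>w\<in>W. t \<alpha> = k n + w" using cover by blast
      from choice[OF this] obtain f where f: "\<And>\<alpha>. \<exists>w\<in>W. t \<alpha> = k (f \<alpha>) + w" by blast
      obtain \<alpha> \<beta> where "\<alpha> \<noteq> \<beta>" "f \<alpha> = f \<beta>" using cantor_pigeonhole[of f] by blast
      then show ?thesis using f[of \<alpha>] f[of \<beta>] dif by metis
    qed
  qed (use nfold_uminus[OF sym] in auto)
  then obtain \<delta>0 where \<delta>0: "0 < \<delta>0" "\<And>s g. mu s < \<delta>0 \<Longrightarrow> supported s g \<Longrightarrow> g \<in> nfold (nfold W 2) 20"
    using small_supports_in_nfold by metis
  have small: "g \<in> nfold W 40" if "mu s < \<delta>0" "supported s g" for s g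
    using \<delta>0(2)[OF that] nfold_nfold[of W 2 20] by auto
  have "\<exists>c\<in>Gam. \<forall>g\<in>Gam. (\<exists>w\<in>W. g = k n + w) \<longrightarrow> - c + g \<in> nfold W 2" for n
  proof (cases "\<exists>c\<in>Gam. \<exists>w\<in>W. c = k n + w")
    case True
    then show ?thesis using dif by blast
  qed (use zero_in_Gam in blast)
  then obtain c where c: "\<And>n. c n \<in> Gam" "\<And>n g. g \<in> Gam \<Longrightarrow> \<exists>w\<in>W. g = k n + w \<Longrightarrow> - c n + g \<in> nfold W 2" by metis
  have "\<exists>n. \<exists>w\<in>nfold W 2. g = c n + w" if "g \<in> Gam" for g
  proof -
    obtain n where "\<exists>w\<in>W. g = k n + w" using cover by blast
    from c(2)[OF that this] show ?thesis by (intro exI[of _ n] bexI[of _ "- c n + g"]) (auto simp flip: add.assoc)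
  qed
  then obtain N where N: "Fix N \<subseteq> nfold (nfold W 2) 6"
    using neighbourhood_in_nfold[where W = "nfold W 2" and k = c, OF _ c(1) nfold_uminus[OF sym]] by metis
  define \<delta> where "\<delta> = \<delta>0 / 2 ^ Suc N"
  have "g \<in> nfold W 92" if g: "\<forall>i<2^N. dist (act g (cell N i)) (cell N i) < \<delta>" for g
  proof -
    let ?d = "\<lambda>i. if i \<in> {..<2^N} then \<delta> else 0"
    have "?d sums (\<Sum>i\<in>{..<2^N::nat}. \<delta>)" by (rule sums_If_finite_set) simp
    then have d: "?d sums (\<delta>0 / 2)" by (simp add: \<delta>_def)
    have "dist (act g (cell N i)) (cell N i) \<le> ?d i" for i
      using g cell_out[of N i] by (auto simp: less_imp_le not_less)
    moreover have "disjseq (\<lambda>i. act g (cell N i))"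
      using disjseq_cell[of N] by (simp add: disjseq_def flip: act_inf)
    moreover have "cjoin (\<lambda>i. act g (cell N i)) = \<top>" by (simp add: act_cjoin[symmetric] cjoin_cell)
    ultimately obtain r s where r: "supported s r" "mu s \<le> \<delta>0 / 2" "\<And>i. act r (act g (cell N i)) = cell N i"
      using partition_correction[of "\<lambda>i. act g (cell N i)" "cell N" ?d] d disjseq_cell cjoin_cell by (auto simp: sums_iff)
    obtain \<gamma> q t where \<gamma>: "\<gamma> \<in> Fix N" "supported t q" "mu t < \<delta>0" "\<gamma> = q + (r + g)"
      using uniformly_near_Fix[of "r + g" N \<delta>0] r(3) \<delta>0(1) by (auto simp: act_plus)
    have "- r \<in> nfold W 40" using r(1,2) \<delta>0(1) by (intro small[of s] supported_uminus) auto
    moreover have "- q \<in> nfold W 40" using \<gamma>(2,3) by (intro small[of t] supported_uminus) auto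
    moreover have "\<gamma> \<in> nfold W 12" using \<gamma>(1) N nfold_nfold[of W 2 6] by auto
    ultimately have "- r + (- q + \<gamma>) \<in> nfold W (40 + (40 + 12))" by (intro nfold_add)
    moreover have "- r + (- q + \<gamma>) = g" by (simp add: \<gamma>(4) flip: add.assoc)
    ultimately show ?thesis by simp
  qed
  moreover have "0 < \<delta>" using \<delta>0(1) by (simp add: \<delta>_def)
  ultimately show ?thesis by blast
qed

end

section \<open>The measure algebra of the unit interval\<close>

definition uni :: "real measure" where "uni = uniform_measure lborel {0..<1}"

lemma sets_uni [simp, measurable_cong]: "sets uni = sets borel"
  and space_uni [simp]: "space uni = UNIV"
  by (simp_all add: uni_def)

lemma emeasure_uni: "A \<in> sets borel \<Longrightarrow> emeasure uni A = emeasure lborel ({0..<1} \<inter> A)"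
  by (simp add: uni_def divide_ennreal_def)

lemma AE_uni: "{x. P x} \<in> sets borel \<Longrightarrow> (\<And>x. 0 \<le> x \<Longrightarrow> x < 1 \<Longrightarrow> P x) \<Longrightarrow> AE x in uni. P x"
proof -
  assume P: "{x. P x} \<in> sets borel" "\<And>x. 0 \<le> x \<Longrightarrow> x < 1 \<Longrightarrow> P x"
  have m: "- {x. P x} \<in> sets borel" using P(1) by auto
  have "{0..<1} \<inter> - {x. P x} = {}" using P(2) by auto
  then have "emeasure uni (- {x. P x}) = 0" using emeasure_uni[OF m] by simp
  then have "- {x. P x} \<in> null_sets uni" using m by (simp add: null_sets_def)
  then show "AE x in uni. P x" by (rule AE_I') auto
qed

interpretation uni: prob_space uni
  unfolding uni_def by (rule prob_space_uniform_measure) auto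

text \<open>A partial equivalence relation, so that only Borel sets give elements of the quotient.\<close>

definition malg_eq :: "real set \<Rightarrow> real set \<Rightarrow> bool" where
  "malg_eq A B \<longleftrightarrow> A \<in> sets borel \<and> B \<in> sets borel \<and> (AE x in uni. x \<in> A \<longleftrightarrow> x \<in> B)"

quotient_type malg = "real set" / partial: malg_eq morphisms rep_malg cls
proof (rule part_equivpI)
  show "\<exists>A. malg_eq A A" by (rule exI[of _ "{}"]) (simp add: malg_eq_def)
  show "symp malg_eq" by (rule sympI) (auto simp: malg_eq_def elim: eventually_mono)
  show "transp malg_eq"
    by (rule transpI) (auto simp: malg_eq_def elim: eventually_elim2)
qed

instantiation malg :: boolean_algebra
begin
lift_definition bot_malg :: malg is "{}" by (simp add: malg_eq_def)
lift_definition top_malg :: malg is "UNIV" by (simp add: malg_eq_def)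
lift_definition inf_malg :: "malg \<Rightarrow> malg \<Rightarrow> malg" is "(\<inter>)" by (auto simp: malg_eq_def elim: eventually_elim2)
lift_definition sup_malg :: "malg \<Rightarrow> malg \<Rightarrow> malg" is "(\<union>)" by (auto simp: malg_eq_def elim: eventually_elim2)
lift_definition minus_malg :: "malg \<Rightarrow> malg \<Rightarrow> malg" is "(-)" by (auto simp: malg_eq_def elim: eventually_elim2)
lift_definition uminus_malg :: "malg \<Rightarrow> malg" is "uminus" by (auto simp: malg_eq_def elim: eventually_mono)
lift_definition less_eq_malg :: "malg \<Rightarrow> malg \<Rightarrow> bool" is "\<lambda>A B. AE x in uni. x \<in> A \<longrightarrow> x \<in> B"
  by (auto simp: malg_eq_def elim: eventually_elim2[OF _ eventually_conj])
definition less_malg :: "malg \<Rightarrow> malg \<Rightarrow> bool" where "less_malg a b \<longleftrightarrow> a \<le> b \<and> \<not> b \<le> a"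

instance
proof
  fix x y z :: malg
  show "(x < y) = (x \<le> y \<and> \<not> y \<le> x)" by (rule less_malg_def)
  show "x \<le> x" by transfer simp
  show "x \<le> y \<Longrightarrow> y \<le> z \<Longrightarrow> x \<le> z" by transfer (auto elim: eventually_elim2)
  show "x \<le> y \<Longrightarrow> y \<le> x \<Longrightarrow> x = y" by transfer (auto simp: malg_eq_def elim: eventually_elim2)
  show "x \<sqinter> y \<le> x" "x \<sqinter> y \<le> y" by (transfer; simp)+
  show "x \<le> x \<squnion> y" "y \<le> x \<squnion> y" by (transfer; simp)+
  show "x \<le> y \<Longrightarrow> x \<le> z \<Longrightarrow> x \<le> y \<sqinter> z" by transfer (auto elim: eventually_elim2)
  show "y \<le> x \<Longrightarrow> z \<le> x \<Longrightarrow> y \<squnion> z \<le> x" by transfer (auto elim: eventually_elim2)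
  show "\<bottom> \<le> x" "x \<le> \<top>" by (transfer; simp)+
  show "x \<squnion> y \<sqinter> z = (x \<squnion> y) \<sqinter> (x \<squnion> z)" by transfer (auto simp: malg_eq_def)
  show "x \<sqinter> - x = \<bottom>" "x \<squnion> - x = \<top>" by (transfer; simp add: malg_eq_def)+
  show "x - y = x \<sqinter> - y" by transfer (auto simp: malg_eq_def)
qed
end

lift_definition mu_malg :: "malg \<Rightarrow> real" is "measure uni"
  by (rule measure_eq_AE) (auto simp: malg_eq_def)

lemma cls_cases: obtains A where "A \<in> sets borel" "a = cls A"
proof -
  have "malg_eq (rep_malg a) (rep_malg a)" "cls (rep_malg a) = a"
    using Quotient_rep_reflp[OF Quotient_malg] Quotient_abs_rep[OF Quotient_malg] by auto
  then show thesis using that by (metis malg_eq_def)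
qed

lemma cls_eq_iff: "A \<in> sets borel \<Longrightarrow> B \<in> sets borel \<Longrightarrow> cls A = cls B \<longleftrightarrow> (AE x in uni. x \<in> A \<longleftrightarrow> x \<in> B)"
  using Quotient_rel[OF Quotient_malg, of A B] by (auto simp: malg_eq_def)

lemma cls_le_iff: "A \<in> sets borel \<Longrightarrow> B \<in> sets borel \<Longrightarrow> cls A \<le> cls B \<longleftrightarrow> (AE x in uni. x \<in> A \<longrightarrow> x \<in> B)"
  by (rule less_eq_malg.abs_eq) (auto simp: malg_eq_def)

lemma cls_ops:
  assumes "A \<in> sets borel" "B \<in> sets borel"
  shows "cls A \<sqinter> cls B = cls (A \<inter> B)" "cls A \<squnion> cls B = cls (A \<union> B)" "cls A - cls B = cls (A - B)"
    "- cls A = cls (- A)" 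
  using assms by (simp_all add: inf_malg.abs_eq sup_malg.abs_eq minus_malg.abs_eq uminus_malg.abs_eq malg_eq_def)

lemma mu_malg_cls: "A \<in> sets borel \<Longrightarrow> mu_malg (cls A) = measure uni A"
  by (simp add: mu_malg.abs_eq malg_eq_def)

lemma cls_consts: "cls {} = \<bottom>" "cls UNIV = \<top>"
  by (simp_all add: bot_malg_def top_malg_def)

instantiation malg :: metric_space
begin
definition dist_malg :: "malg \<Rightarrow> malg \<Rightarrow> real" where "dist_malg a b = mu_malg ((a - b) \<squnion> (b - a))"
definition uniformity_malg :: "(malg \<times> malg) filter" where
  "uniformity_malg = (INF e\<in>{0 <..}. principal {(x, y). dist x y < e})"
definition open_malg :: "malg set \<Rightarrow> bool" where
  "open_malg U \<longleftrightarrow> (\<forall>x\<in>U. \<forall>\<^sub>F (x', y) in uniformity. x' = x \<longrightarrow> y \<in> U)"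

lemma dist_cls:
  "A \<in> sets borel \<Longrightarrow> B \<in> sets borel \<Longrightarrow> dist (cls A) (cls B) = measure uni (sym_diff A B)"
  by (simp add: dist_malg_def cls_ops mu_malg_cls)

instance
proof
  show "uniformity = (INF e\<in>{0 <..}. principal {(x, y::malg). dist x y < e})" by (rule uniformity_malg_def)
  show "open U = (\<forall>x\<in>U. \<forall>\<^sub>F (x', y) in uniformity. x' = x \<longrightarrow> y \<in> U)" for U :: "malg set" by (rule open_malg_def)
  fix a b c :: malg
  obtain A B C where [measurable]: "A \<in> sets borel" "B \<in> sets borel" "C \<in> sets borel" and abc: "a = cls A" "b = cls B" "c = cls C"
    by (meson cls_cases)
  have "measure uni (sym_diff A B) = 0 \<longleftrightarrow> emeasure uni (sym_diff A B) = 0"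
    by (simp add: uni.emeasure_eq_measure)
  also have "\<dots> \<longleftrightarrow> (AE x in uni. x \<notin> sym_diff A B)"
    by (subst AE_iff_measurable[of "sym_diff A B"]) auto
  also have "\<dots> \<longleftrightarrow> (AE x in uni. x \<in> A \<longleftrightarrow> x \<in> B)" by (intro eventually_cong always_eventually) auto
  finally show "dist a b = 0 \<longleftrightarrow> a = b" unfolding abc by (simp add: dist_cls cls_eq_iff)
  have "measure uni (sym_diff A B) \<le> measure uni (sym_diff A C \<union> sym_diff B C)"
    by (rule uni.finite_measure_mono) auto
  also have "\<dots> \<le> measure uni (sym_diff A C) + measure uni (sym_diff B C)" by (rule measure_Un_le) auto
  finally show "dist a b \<le> dist a c + dist b c" unfolding abc by (simp add: dist_cls)
qed
end

text \<open>A rapidly Cauchy subsequence of sets converges to its limes inferior, because the sum of the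
  remaining symmetric differences bounds the distance.\<close>

instance malg :: complete_space
proof
  fix X :: "nat \<Rightarrow> malg" assume X: "Cauchy X"
  have "\<exists>r. \<forall>k. (\<forall>m\<ge>r k. \<forall>n\<ge>r k. dist (X m) (X n) < (1/2)^k) \<and> r k < r (Suc k)"
  proof (rule dependent_nat_choice)
    have ex: "\<exists>N. \<forall>m\<ge>N. \<forall>n\<ge>N. dist (X m) (X n) < (1/2)^k" for k by (rule metric_CauchyD[OF X]) simp
    show "\<exists>x. \<forall>m\<ge>x. \<forall>n\<ge>x. dist (X m) (X n) < (1/2)^0" by (rule ex)
    show "\<exists>y. (\<forall>m\<ge>y. \<forall>n\<ge>y. dist (X m) (X n) < (1/2)^Suc k) \<and> x < y" for x k
    proof -
      obtain N where "\<forall>m\<ge>N. \<forall>n\<ge>N. dist (X m) (X n) < (1/2)^Suc k" using ex by blast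
      then show ?thesis by (intro exI[of _ "max N (Suc x)"]) auto
    qed
  qed
  then obtain r where r: "\<And>k m n. r k \<le> m \<Longrightarrow> r k \<le> n \<Longrightarrow> dist (X m) (X n) < (1/2)^k" "\<And>k. r k < r (Suc k)" by blast
  have "\<exists>A. A \<in> sets borel \<and> X (r k) = cls A" for k using cls_cases by metis
  then obtain A where A [measurable]: "\<And>k. A k \<in> sets borel" and XA: "\<And>k. X (r k) = cls (A k)" by metis
  define L where "L = {x. \<exists>n. \<forall>k\<ge>n. x \<in> A k}"
  have L [measurable]: "L \<in> sets borel"
  proof -
    have "L = (\<Union>n. \<Inter>k\<in>{n..}. A k)" by (auto simp: L_def)
    then show ?thesis by simp
  qed
  have bound: "dist (X (r n)) (cls L) \<le> 2 * (1/2)^n" for n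
  proof -
    let ?D = "\<lambda>k. sym_diff (A (n + k)) (A (Suc (n + k)))"
    have D: "measure uni (?D k) \<le> (1/2)^n * (1/2)^k" for k
      using r(1)[of "n + k" "r (n + k)" "r (Suc (n + k))"] r(2)[of "n + k"]
      by (simp add: XA dist_cls power_add[symmetric] less_imp_le del: dist_commute)
    have sm: "(\<lambda>k. (1/2)^n * (1/2)^k) sums ((1/2)^n * (2::real))"
      by (rule sums_mult) (use geometric_sums[of "1/2::real"] in simp)
    have sD: "summable (\<lambda>k. measure uni (?D k))"
      by (rule summable_comparison_test'[OF sums_summable[OF sm], where N = 0]) (use D in simp)
    have "sym_diff (A n) L \<subseteq> (\<Union>k. ?D k)"
    proof
      fix x assume x: "x \<in> sym_diff (A n) L"
      show "x \<in> (\<Union>k. ?D k)"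
      proof (rule ccontr)
        assume no: "x \<notin> (\<Union>k. ?D k)"
        have "x \<in> A (n + k) \<longleftrightarrow> x \<in> A n" for k by (induction k) (use no in auto)
        then have eq: "x \<in> A k \<longleftrightarrow> x \<in> A n" if "n \<le> k" for k using that by (metis le_Suc_ex)
        have "x \<in> A (max n m) \<longleftrightarrow> x \<in> A n" for m by (rule eq) simp
        moreover have "x \<in> L" if "x \<in> A n" using eq that by (auto simp: L_def)
        moreover have "\<exists>m. x \<in> A (max n m)" if xL: "x \<in> L"
        proof -
          obtain m where "\<forall>k\<ge>m. x \<in> A k" using xL by (auto simp: L_def)
          then show ?thesis by (intro exI[of _ m]) simp
        qed
        ultimately show False using x by blast
      qed
    qed
    then have "measure uni (sym_diff (A n) L) \<le> measure uni (\<Union>k. ?D k)"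
      by (intro uni.finite_measure_mono) auto
    also have "\<dots> \<le> (\<Sum>k. measure uni (?D k))"
      by (intro uni.finite_measure_subadditive_countably sD) auto
    also have "\<dots> \<le> (1/2)^n * 2"
      using suminf_le[OF D sD sums_summable[OF sm]] sm by (simp add: sums_iff)
    finally show ?thesis by (simp add: XA dist_cls)
  qed
  have "X \<longlonglongrightarrow> cls L"
  proof (rule metric_LIMSEQ_I)
    fix e :: real assume "0 < e"
    then obtain n where n: "(1/2)^n < e / 3" using real_arch_pow_inv[of "e/3" "1/2"] by auto
    have "dist (X m) (cls L) < e" if "r n \<le> m" for m
      using dist_triangle[of "X m" "cls L" "X (r n)"] r(1)[OF that order_refl] bound[of n] n by simp
    then show "\<exists>N. \<forall>m\<ge>N. dist (X m) (cls L) < e" by blast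
  qed
  then show "convergent X" by (auto simp: convergent_def)
qed

instantiation malg :: prob_algebra
begin
definition mu_malg': "mu = mu_malg"
instance
proof
  fix a b :: malg
  obtain A B where [measurable]: "A \<in> sets borel" "B \<in> sets borel" and ab: "a = cls A" "b = cls B"
    by (meson cls_cases)
  show "0 \<le> mu a" by (simp add: ab cls_ops mu_malg_cls mu_malg')
  show "mu (\<top>::malg) = 1" using uni.prob_space by (simp add: cls_consts(2)[symmetric] mu_malg_cls mu_malg')
  show "dist a b = mu (a - b \<squnion> (b - a))" by (simp add: dist_malg_def mu_malg')
  assume "a \<sqinter> b = \<bottom>"
  then have "AE x in uni. \<not> (x \<in> A \<and> x \<in> B)"
    unfolding ab cls_consts(1)[symmetric] by (simp add: cls_ops cls_eq_iff)
  then have "measure uni (A \<union> B) = measure uni A + measure uni B"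
    by (intro measure_Un_AE) (auto simp: uni.fmeasurable_eq_sets)
  then show "mu (a \<squnion> b) = mu a + mu b" by (simp add: ab cls_ops mu_malg_cls mu_malg')
qed
end

lemma mu_cls: "A \<in> sets borel \<Longrightarrow> mu (cls A) = measure uni A"
  by (simp add: mu_malg_cls mu_malg')

lemma cjoin_cls:
  assumes [measurable]: "\<And>i. A i \<in> sets borel" shows "cjoin (\<lambda>i. cls (A i)) = cls (\<Union>i. A i)"
proof (rule antisym)
  show "cjoin (\<lambda>i. cls (A i)) \<le> cls (\<Union>i. A i)"
    by (rule cjoin_least) (auto simp: cls_le_iff)
  obtain U where U [measurable]: "U \<in> sets borel" "cjoin (\<lambda>i. cls (A i)) = cls U" by (rule cls_cases)
  have "AE x in uni. x \<in> A i \<longrightarrow> x \<in> U" for i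
    using cjoin_upper[of "\<lambda>i. cls (A i)" i] by (simp add: U cls_le_iff)
  then have "AE x in uni. \<forall>i. x \<in> A i \<longrightarrow> x \<in> U" unfolding AE_all_countable by blast
  then have "AE x in uni. x \<in> (\<Union>i. A i) \<longrightarrow> x \<in> U" by (rule eventually_mono) auto
  then show "cls (\<Union>i. A i) \<le> cjoin (\<lambda>i. cls (A i))" unfolding U(2) by (simp add: cls_le_iff U(1)) 
qed

lemma maut_of_point_map:
  assumes T [measurable]: "T \<in> borel_measurable borel" "S \<in> borel_measurable borel"
    and d: "distr uni uni T = uni" "distr uni uni S = uni"
    and inv: "AE x in uni. S (T x) = x" "AE x in uni. T (S x) = x"
  shows "\<exists>g. \<forall>A\<in>sets borel. act g (cls A) = cls (T -` A)"
proof -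
  have pull: "AE x in uni. P (T x)" if "distr uni uni T = uni" "T \<in> borel_measurable borel" "AE x in uni. P x" for T P
    using AE_distrD[of T uni uni P] unfolding that(1) using that(2,3) by simp
  define f where "f T a = cls (T -` (SOME A. A \<in> sets borel \<and> a = cls A))" for T and a :: malg
  have f: "f T (cls A) = cls (T -` A)" if "distr uni uni T = uni" and [measurable]: "T \<in> borel_measurable borel" "A \<in> sets borel" for T A
  proof -
    define B where "B = (SOME B. B \<in> sets borel \<and> cls A = cls B)"
    have B: "B \<in> sets borel \<and> cls A = cls B" unfolding B_def by (rule someI[of _ A]) simp
    then have [measurable]: "B \<in> sets borel" and "AE x in uni. x \<in> A \<longleftrightarrow> x \<in> B"
      using cls_eq_iff[of A B] that(3) by auto
    from pull[OF that(1,2) this(2)] have "cls (T -` B) = cls (T -` A)"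
      by (subst cls_eq_iff) (auto elim: eventually_mono intro: measurable_sets_borel[OF that(2)])
    then show ?thesis by (simp only: f_def B_def)
  qed
  have ff: "f S (f T (cls A)) = cls A" "f T (f S (cls A)) = cls A" if [measurable]: "A \<in> sets borel" for A
  proof -
    have m: "T -` A \<in> sets borel" "S -` A \<in> sets borel" by (simp_all add: measurable_sets_borel[OF _ that])
    have "S -` (T -` A) \<in> sets borel" "T -` (S -` A) \<in> sets borel" using m by (simp_all add: measurable_sets_borel[OF T(1)] measurable_sets_borel[OF T(2)])
    then show "f S (f T (cls A)) = cls A" "f T (f S (cls A)) = cls A"
      using inv m by (auto simp: f d cls_eq_iff elim: eventually_mono)
  qed
  have mono: "f T a \<le> f T b" if "a \<le> b" "distr uni uni T = uni" and [measurable]: "T \<in> borel_measurable borel" for T a b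
  proof -
    obtain A B where [measurable]: "A \<in> sets borel" "B \<in> sets borel" and ab: "a = cls A" "b = cls B" by (meson cls_cases)
    have "AE x in uni. x \<in> A \<longrightarrow> x \<in> B" using that(1) by (simp add: ab cls_le_iff)
    from pull[OF that(2,3) this] show ?thesis
      unfolding ab by (simp add: f that) (subst cls_le_iff, auto intro: measurable_sets_borel[OF that(3)])
  qed
  have mf: "mu (f T a) = mu a" for a
  proof -
    obtain A where A [measurable]: "A \<in> sets borel" "a = cls A" by (rule cls_cases)
    have "measure (distr uni uni T) A = measure uni (T -` A)" by (subst measure_distr) auto
    then show ?thesis by (simp add: A(2) f d mu_cls measurable_sets_borel[OF T(1)])
  qed
  have inv1: "f S (f T a) = a" "f T (f S a) = a" for a by (metis ff cls_cases)+
  obtain g where "act g = f T"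
    by (rule mautI[of "f T" "f S"]) (use mono d T inv1 mf in auto)
  then show ?thesis using f[OF d(1) T(1)] by (intro exI[of _ g]) simp
qed

definition cellset :: "nat \<Rightarrow> nat \<Rightarrow> real set" where
  "cellset k i = (if i < 2^k then {i / 2^k ..< (i + 1) / 2^k} else {})"

lemma mem_cellset: "x \<in> cellset k i \<longleftrightarrow> i < 2^k \<and> real i \<le> x * 2^k \<and> x * 2^k < real i + 1"
  by (auto simp: cellset_def field_simps)

lemma cellset_nonneg: "x \<in> cellset k i \<Longrightarrow> 0 \<le> x"
  by (auto simp: cellset_def split: if_splits intro: order_trans[of 0 "real i / 2^k"])

lemma cellset_sets [measurable, simp]: "cellset k i \<in> sets borel"
  by (simp add: cellset_def)

lemma in_cellset:
  assumes "0 \<le> x" "x < 1" obtains i where "i < 2^k" "x \<in> cellset k i"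
proof (rule that)
  have nn: "0 \<le> x * 2^k" and lt: "x * 2^k < 2^k" using assms by simp_all
  have fl: "real (nat \<lfloor>x * 2^k\<rfloor>) = of_int \<lfloor>x * 2^k\<rfloor>" using nn by simp
  have "real (nat \<lfloor>x * 2^k\<rfloor>) \<le> x * 2^k" unfolding fl by (rule of_int_floor_le)
  then have "real (nat \<lfloor>x * 2^k\<rfloor>) < 2^k" using lt by (rule le_less_trans)
  then show lt: "nat \<lfloor>x * 2^k\<rfloor> < 2^k" by (simp only: of_nat_less_numeral_power_cancel_iff)
  show "x \<in> cellset k (nat \<lfloor>x * 2^k\<rfloor>)" unfolding mem_cellset using lt nn fl by linarith
qed

definition ucell :: "nat \<Rightarrow> nat \<Rightarrow> malg" where "ucell k i = cls (cellset k i)"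

lemma cellset_disj: "i \<noteq> j \<Longrightarrow> cellset k i \<inter> cellset k j = {}"
proof -
  have "i = j" if "x \<in> cellset k i" "x \<in> cellset k j" for x
  proof -
    have "real i < real j + 1" "real j < real i + 1" using that unfolding mem_cellset by linarith+
    then show "i = j" by linarith
  qed
  then show "i \<noteq> j \<Longrightarrow> cellset k i \<inter> cellset k j = {}" by blast
qed

lemma measure_cellset: "i < 2^k \<Longrightarrow> measure uni (cellset k i) = 1 / 2^k"
proof -
  assume i: "i < 2^k"
  then have "real (i + 1) \<le> real (2^k)" by (subst of_nat_le_iff) simp
  then have le: "(real i + 1) / 2^k \<le> 1" by (simp add: field_simps)
  have "{0..<1} \<inter> cellset k i = {i / 2^k ..< (i + 1) / 2^k}"
    using i le by (auto simp: cellset_def add.commute intro: order_trans[of 0 "real i / 2^k"])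
  then have "emeasure uni (cellset k i) = ennreal ((real i + 1) / 2^k - i / 2^k)"
    by (simp add: emeasure_uni divide_right_mono)
  also have "(real i + 1) / 2^k - i / 2^k = 1 / 2^k" by (simp add: diff_divide_distrib[symmetric])
  finally show ?thesis by (simp add: measure_def)
qed

interpretation ucells: dyadic_cells ucell
proof
  show "ucell k i = \<bottom>" if "2^k \<le> i" for k i using that by (simp add: ucell_def cellset_def cls_consts)
  show "mu (ucell k i) = 1 / 2^k" if "i < 2^k" for k i using measure_cellset[OF that] by (simp add: ucell_def mu_cls)
  show "ucell k i \<sqinter> ucell k j = \<bottom>" if "i \<noteq> j" for k i j
    using cellset_disj[OF that] by (simp add: ucell_def cls_ops cls_consts)
  have split: "cellset k i = cellset (Suc k) (2 * i) \<union> cellset (Suc k) (2 * i + 1)" for k i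
    by (rule Set.set_eqI) (auto simp: mem_cellset)
  show "ucell k i = ucell (Suc k) (2 * i) \<squnion> ucell (Suc k) (2 * i + 1)" for k i
    unfolding ucell_def cls_ops(2)[OF cellset_sets cellset_sets] by (rule arg_cong[OF split])
qed

text \<open>The classes that can be approximated by dyadic elements are closed under complements and countable
  unions, and they contain the half-lines.\<close>

lemma ucell_Dy_dense:
  assumes "0 < e" shows "\<exists>b\<in>ucells.Dy. dist a b < e"
proof -
  obtain A where A: "A \<in> sets borel" "a = cls A" by (rule cls_cases)
  have "A \<in> sigma_sets UNIV (range lessThan)" using A(1) by (simp add: borel_Iio)
  then have "A \<in> sets borel \<and> (\<forall>e>0. \<exists>b\<in>ucells.Dy. dist (cls A) b < e)"
  proof (induction A rule: sigma_sets.induct)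
    case (Basic A)
    then obtain a where A: "A = {..<a}" by blast
    define a' where "a' = max 0 (min 1 a)"
    have "cls A = cls {0..<a'}" unfolding A
      by (subst cls_eq_iff) (auto intro!: AE_uni simp: a'_def)
    moreover have "\<exists>b\<in>ucells.Dy. dist (cls {0..<a'}) b < e" if e: "0 < e" for e
    proof -
      obtain k where k: "1 / 2^k < e" using real_arch_pow_inv[OF e, of "1/2"] by (auto simp: power_divide)
      define j where "j = nat \<lfloor>a' * 2^k\<rfloor>"
      have j: "real j \<le> a' * 2^k" "a' * 2^k < real j + 1" unfolding j_def a'_def by (simp_all add: floor_correct)
      have "cls {0..<j / 2^k} \<in> ucells.dy k"
      proof -
        have "ucell k i \<le> cls {0..<j / 2^k} \<or> ucell k i \<sqinter> cls {0..<j / 2^k} = \<bottom>" for i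
        proof (cases "i < j")
          case True
          then have "real i + 1 \<le> real j" by linarith
          then have "x \<in> cellset k i \<Longrightarrow> x \<in> {0..<j / 2^k}" for x
            using cellset_nonneg[of x k i] unfolding mem_cellset by (auto simp: field_simps)
          then show ?thesis by (simp add: ucell_def cls_le_iff)
        next
          case False
          then have "real j \<le> real i" by simp
          then have "cellset k i \<inter> {0..<j / 2^k} = {}" by (auto simp: mem_cellset field_simps)
          then show ?thesis by (simp add: ucell_def cls_ops cls_consts)
        qed
        then show ?thesis by (simp add: ucells.dy_def)
      qed
      moreover have "dist (cls {0..<a'}) (cls {0..<j / 2^k}) < e"
      proof -
        have le: "real j / 2^k \<le> a'" "a' \<le> 1" using j(1) by (simp_all add: field_simps a'_def)
        then have "sym_diff {0..<a'} {0..<j / 2^k} = {j / 2^k..<a'}" by (auto intro: order_trans[of 0 "real j / 2^k"])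
        moreover have "{0..<1} \<inter> {j / 2^k..<a'} = {j / 2^k..<a'}" using le by (auto intro: order_trans[of 0 "real j / 2^k"])
        then have "measure uni {j / 2^k..<a'} = a' - j / 2^k" using le by (simp add: measure_def emeasure_uni)
        ultimately have "dist (cls {0..<a'}) (cls {0..<j / 2^k}) = a' - j / 2^k" by (simp add: dist_cls)
        also have "a' < (real j + 1) / 2^k" using j(2) by (simp add: less_divide_eq)
        then have "a' - j / 2^k < 1 / 2^k" by (simp add: add_divide_distrib)
        finally show ?thesis using k by simp
      qed
      ultimately show ?thesis using ucells.dy_Dy by blast
    qed
    ultimately show ?case by (simp add: A)
  next
    case Empty
    then show ?case using ucells.dy_Dy[OF ucells.bot_dy] by (auto simp: cls_consts intro!: bexI[of _ \<bottom>])
  next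
    case (Compl A)
    then have A [measurable]: "A \<in> sets borel" by blast
    have "\<exists>b\<in>ucells.Dy. dist (- cls A) b < e" if e: "0 < e" for e
    proof -
      obtain b where "b \<in> ucells.Dy" "dist (cls A) b < e" using Compl.IH e by blast
      then show ?thesis using ucells.Dy_compl by (intro bexI[of _ "- b"]) (auto simp: dist_compl)
    qed
    then show ?case using A by (simp add: cls_ops Compl_eq_Diff_UNIV[symmetric])
  next
    case (Union A)
    then have A [measurable]: "A i \<in> sets borel" for i by blast
    show ?case using ucells.approx_by_Dy_cjoin[of "\<lambda>i. cls (A i)"] Union.IH by (auto simp: cjoin_cls)
  qed
  then show ?thesis using assms A(2) by blast
qed

subsection \<open>Rotations\<close>

definition shift :: "real \<Rightarrow> real \<Rightarrow> real" where
  "shift h x = (if x < 1 - h then x + h else x + h - 1)"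

lemma shift_measurable [measurable]: "shift h \<in> borel_measurable borel"
  unfolding shift_def by measurable

lemma emeasure_translate: "B \<in> sets borel \<Longrightarrow> emeasure lborel ((+) c -` B) = emeasure lborel (B :: real set)"
  using emeasure_distr[of "(+) c" lborel borel B] by (simp add: lborel_distr_plus)

lemma distr_shift:
  assumes h: "0 \<le> h" "h \<le> 1" shows "distr uni uni (shift h) = uni"
proof (rule measure_eqI)
  fix A assume "A \<in> sets (distr uni uni (shift h))"
  then have [measurable]: "A \<in> sets borel" by simp
  have [measurable]: "shift h -` A \<in> sets borel" "(+) h -` ({h..<1} \<inter> A) \<in> sets borel" "(+) (h - 1) -` ({0..<h} \<inter> A) \<in> sets borel"
    by (intro measurable_sets_borel[of _ borel]; measurable)+
  have "emeasure (distr uni uni (shift h)) A = emeasure uni (shift h -` A)" by (simp add: emeasure_distr)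
  also have "\<dots> = emeasure lborel ({0..<1} \<inter> shift h -` A)" by (simp add: emeasure_uni)
  also have "{0..<1} \<inter> shift h -` A = ((+) h -` ({h..<1} \<inter> A)) \<union> ((+) (h - 1) -` ({0..<h} \<inter> A))"
    using h by (auto simp: shift_def algebra_simps split: if_splits)
  also have "emeasure lborel \<dots> = emeasure lborel ({h..<1} \<inter> A) + emeasure lborel ({0..<h} \<inter> A)"
  proof (subst plus_emeasure[symmetric])
    show "(+) h -` ({h..<1} \<inter> A) \<inter> (+) (h - 1) -` ({0..<h} \<inter> A) = {}" using h by auto
  qed (simp_all add: emeasure_translate del: vimage_Int)
  also have "\<dots> = emeasure lborel (({h..<1} \<inter> A) \<union> ({0..<h} \<inter> A))" by (rule plus_emeasure) auto
  also have "({h..<1} \<inter> A) \<union> ({0..<h} \<inter> A) = {0..<1} \<inter> A" using h by auto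
  finally show "emeasure (distr uni uni (shift h)) A = emeasure uni A" by (simp add: emeasure_uni)
qed simp

lemma shift_inverse: "0 \<le> h \<Longrightarrow> h \<le> 1 \<Longrightarrow> 0 \<le> x \<Longrightarrow> x < 1 \<Longrightarrow> shift (1 - h) (shift h x) = x"
  by (auto simp: shift_def)

lemma shift_cellset:
  assumes x: "x \<in> cellset k p" and j: "j \<le> 2^k" shows "shift (j / 2^k) x \<in> cellset k ((p + j) mod 2^k)"
proof -
  have p: "p < 2^k" "real p \<le> x * 2^k" "x * 2^k < real p + 1" using x by (auto simp: mem_cellset)
  show ?thesis
  proof (cases "p + j < 2^k")
    case True
    then have "real (p + j + 1) \<le> real (2^k)" by (subst of_nat_le_iff) simp
    then have "x * 2^k < 2^k - real j" using p(3) by simp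
    then have "x < 1 - j / 2^k" by (simp add: field_simps)
    then show ?thesis using True p by (simp add: shift_def mem_cellset algebra_simps)
  next
    case False
    then have eq: "(p + j) mod 2^k = p + j - 2^k" using p(1) j by (simp add: mod_if)
    have "real (2^k) \<le> real (p + j)" using False by (subst of_nat_le_iff) simp
    then have "2^k - real j \<le> x * 2^k" using p(2) by simp
    then have "\<not> x < 1 - j / 2^k" by (simp add: field_simps)
    then show ?thesis unfolding eq using False p j by (simp add: shift_def mem_cellset algebra_simps of_nat_diff)
  qed
qed

lemma rotation_exists: "\<exists>g. \<forall>k i. l \<le> k \<longrightarrow> i < 2^k \<longrightarrow> act g (ucell k i) = ucell k ((i + 2^(k - l)) mod 2^k)"
proof -
  define h :: real where "h = 1 / 2^l"
  have h: "0 \<le> h" "h \<le> 1" "0 \<le> 1 - h" "1 - h \<le> 1" by (simp_all add: h_def)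
  have "{x. shift h (shift (1 - h) x) = x} \<in> sets borel" "{x. shift (1 - h) (shift h x) = x} \<in> sets borel"
    by (simp_all add: borel_measurable_eq[of _ borel, simplified])
  then have "AE x in uni. shift h (shift (1 - h) x) = x" "AE x in uni. shift (1 - h) (shift h x) = x"
    using shift_inverse[OF h(1,2)] shift_inverse[OF h(3,4)] by (auto intro!: AE_uni)
  from maut_of_point_map[OF shift_measurable shift_measurable distr_shift[OF h(3,4)] distr_shift[OF h(1,2)] this]
  obtain g where g: "\<And>A. A \<in> sets borel \<Longrightarrow> act g (cls A) = cls (shift (1 - h) -` A)" by blast
  have "act g (ucell k i) = ucell k ((i + 2^(k - l)) mod 2^k)" if lk: "l \<le> k" and i: "i < 2^k" for k i
  proof -
    have m: "shift (1 - h) -` cellset k i \<in> sets borel" by (intro measurable_sets_borel[of _ borel]) auto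
    define c where "c = (2::nat)^(k - l)"
    have c: "c \<le> 2^k" by (simp add: c_def)
    have hc: "1 - h = real (2^k - c) / 2^k" 
    proof -
      have "(2::real)^(k - l) / 2^k = 1 / 2^l" using lk by (simp add: power_diff)
      then show ?thesis by (simp add: h_def c_def of_nat_diff diff_divide_distrib)
    qed
    have "x \<in> shift (1 - h) -` cellset k i \<longleftrightarrow> x \<in> cellset k ((i + c) mod 2^k)" if x: "0 \<le> x" "x < 1" for x
    proof -
      obtain p where p: "p < 2^k" "x \<in> cellset k p" by (rule in_cellset[OF x])
      have sx: "shift (1 - h) x \<in> cellset k ((p + (2^k - c)) mod 2^k)"
        unfolding hc by (rule shift_cellset[OF p(2)]) simp
      have uniq: "y \<in> cellset k a \<Longrightarrow> y \<in> cellset k b \<longleftrightarrow> a = b" for y a b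
        using cellset_disj[of a b k] by auto
      have "(p + (2^k - c)) mod 2^k = i \<longleftrightarrow> p = (i + c) mod 2^k"
      proof
        assume "(p + (2^k - c)) mod 2^k = i"
        then have "(i + c) mod 2^k = ((p + (2^k - c)) mod 2^k + c) mod 2^k" by simp
        also have "\<dots> = (p + 2^k) mod 2^k" using c by (simp add: mod_add_left_eq)
        finally show "p = (i + c) mod 2^k" using p(1) by simp
      next
        assume "p = (i + c) mod 2^k"
        then have "(p + (2^k - c)) mod 2^k = ((i + c) mod 2^k + (2^k - c)) mod 2^k" by simp
        also have "\<dots> = (i + c + (2^k - c)) mod 2^k" by (rule mod_add_left_eq)
        also have "i + c + (2^k - c) = i + 2^k" using c by simp
        finally show "(p + (2^k - c)) mod 2^k = i" using i by simp
      qed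
      then show ?thesis using uniq[OF sx, of i] uniq[OF p(2)] by simp
    qed
    then have "AE x in uni. x \<in> shift (1 - h) -` cellset k i \<longleftrightarrow> x \<in> cellset k ((i + c) mod 2^k)"
      using m by (intro AE_uni) (auto simp: measurable_sets_borel)
    then show ?thesis unfolding ucell_def using m by (simp add: g cls_eq_iff c_def)
  qed
  then show ?thesis by blast
qed

definition urot :: "nat \<Rightarrow> malg maut" where
  "urot l = (SOME g. \<forall>k i. l \<le> k \<longrightarrow> i < 2^k \<longrightarrow> act g (ucell k i) = ucell k ((i + 2^(k - l)) mod 2^k))"

interpretation unit_interval: dyadic_algebra ucell urot
proof
  show "\<exists>b\<in>ucells.Dy. dist a b < e" if "0 < e" for a and e :: real by (rule ucell_Dy_dense[OF that])
  show "act (urot l) (ucell k i) = ucell k ((i + 2^(k - l)) mod 2^k)" if "l \<le> k" "i < 2^k" for l k i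
    using someI_ex[OF rotation_exists[of l]] that unfolding urot_def by blast
qed

section \<open>Standard non-atomic spaces\<close>

abbreviation sequences :: "(nat \<Rightarrow> bool) measure" where
  "sequences \<equiv> PiM UNIV (\<lambda>_. count_space UNIV)"

lemma coordinate_measurable [measurable]: "(\<lambda>\<alpha>. \<alpha> n) \<in> measurable sequences (count_space UNIV)"
  by (rule measurable_component_singleton) simp

lemma measurable_sequencesI: "(\<And>n. Measurable.pred M (\<lambda>x. f x n)) \<Longrightarrow> f \<in> measurable M sequences"
  by (rule measurable_PiM_single') (auto simp: space_PiM)

text \<open>With base four and digits zero and one, carries cannot occur, so the digits can be recovered by
  rounding down.\<close>

definition base4 :: "(nat \<Rightarrow> bool) \<Rightarrow> real" where
  "base4 \<alpha> = (\<Sum>n. of_bool (\<alpha> n) * (1/4) ^ Suc n)"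

definition digit4 :: "real \<Rightarrow> nat \<Rightarrow> bool" where
  "digit4 r n \<longleftrightarrow> \<lfloor>4 ^ Suc n * r\<rfloor> mod 4 = 1"

lemma base4_summable: "summable (\<lambda>n. of_bool (\<alpha> n) * (1/4::real) ^ Suc n)"
  by (rule summable_comparison_test'[OF summable_mult[OF summable_geometric[of "1/4::real"], of "1/4"], where N = 0]) auto

lemma base4_rec: "base4 \<alpha> = (of_bool (\<alpha> 0) + base4 (\<lambda>n. \<alpha> (Suc n))) / 4"
proof -
  have "base4 \<alpha> = of_bool (\<alpha> 0) / 4 + (\<Sum>n. of_bool (\<alpha> (Suc n)) * (1/4) ^ Suc (Suc n))"
    unfolding base4_def using suminf_split_head[OF base4_summable[of \<alpha>]] by simp
  also have "(\<Sum>n. of_bool (\<alpha> (Suc n)) * (1/4::real) ^ Suc (Suc n)) = (\<Sum>n. 1/4 * (of_bool (\<alpha> (Suc n)) * (1/4) ^ Suc n))"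
    by (simp add: mult_ac)
  also have "\<dots> = 1/4 * base4 (\<lambda>n. \<alpha> (Suc n))"
    unfolding base4_def by (rule suminf_mult[OF base4_summable])
  finally show ?thesis by (simp add: add_divide_distrib)
qed

lemma base4_bounds: "0 \<le> base4 \<alpha>" "base4 \<alpha> < 1"
proof -
  show "0 \<le> base4 \<alpha>" unfolding base4_def by (rule suminf_nonneg[OF base4_summable]) simp
  have "(\<lambda>n. 1/4 * (1/4::real) ^ n) sums (1/4 * (1 / (1 - 1/4)))" by (intro sums_mult geometric_sums) simp
  then have s: "summable (\<lambda>n. 1/4 * (1/4::real) ^ n)" "(\<Sum>n. 1/4 * (1/4::real) ^ n) = 1/3" by (simp_all add: sums_iff)
  have "base4 \<alpha> \<le> (\<Sum>n. 1/4 * (1/4) ^ n)" unfolding base4_def by (rule suminf_le[OF _ base4_summable s(1)]) simp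
  then show "base4 \<alpha> < 1" unfolding s(2) by simp
qed

lemma digit4_base4: "digit4 (base4 \<alpha>) = \<alpha>"
proof
  show "digit4 (base4 \<alpha>) n = \<alpha> n" for n
  proof (induction n arbitrary: \<alpha>)
    case 0
    have "\<lfloor>4 * base4 \<alpha>\<rfloor> = of_bool (\<alpha> 0)"
      using base4_bounds[of "\<lambda>n. \<alpha> (Suc n)"] unfolding base4_rec[of \<alpha>] by (simp add: floor_eq_iff)
    then show ?case by (simp add: digit4_def)
  next
    case (Suc n)
    have "4 ^ Suc (Suc n) * base4 \<alpha> = of_int (4 * (4 ^ n * of_bool (\<alpha> 0))) + 4 ^ Suc n * base4 (\<lambda>n. \<alpha> (Suc n))"
      unfolding base4_rec[of \<alpha>] by (simp add: algebra_simps)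
    then have "\<lfloor>4 ^ Suc (Suc n) * base4 \<alpha>\<rfloor> = 4 * (4 ^ n * of_bool (\<alpha> 0)) + \<lfloor>4 ^ Suc n * base4 (\<lambda>n. \<alpha> (Suc n))\<rfloor>"
      by (simp only: floor_add_int[symmetric] add.commute)
    then have "digit4 (base4 \<alpha>) (Suc n) \<longleftrightarrow> digit4 (base4 (\<lambda>n. \<alpha> (Suc n))) n"
      unfolding digit4_def by (simp only: mod_mult_self4)
    then show ?case using Suc by simp
  qed
qed

lemma base4_measurable [measurable]: "base4 \<in> borel_measurable sequences"
  unfolding base4_def by measurable

lemma digit4_measurable [measurable]: "digit4 \<in> measurable borel sequences"
  by (rule measurable_sequencesI) (simp add: digit4_def)

text \<open>A point is determined by the basic open sets that contain it. A set \<open>\<alpha>\<close> of basic open sets arises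
  in this way if it is upward closed, contains sets of arbitrarily small diameter, is directed with
  a uniform margin and has no empty members: choosing points in small members gives a Cauchy
  sequence, and the margin puts its limit into all members. These are countably many conditions, so
  the set of codes is measurable.\<close>

lemma (in Metric_space) base_code:
  assumes comp: mcomplete and U: "\<And>n::nat. openin mtopology (U n)"
    and base: "\<And>W x. openin mtopology W \<Longrightarrow> x \<in> W \<Longrightarrow> \<exists>n. x \<in> U n \<and> U n \<subseteq> W"
  defines "C \<equiv> {\<alpha>. (\<forall>m n. \<alpha> m \<longrightarrow> U m \<subseteq> U n \<longrightarrow> \<alpha> n) \<and> (\<forall>k. \<exists>n. \<alpha> n \<and> (\<forall>x\<in>U n. \<forall>y\<in>U n. d x y < 1 / Suc k)) \<and>
    (\<forall>m n. \<alpha> m \<longrightarrow> \<alpha> n \<longrightarrow> (\<exists>l. \<alpha> l \<and> (\<exists>r>0. \<forall>y\<in>U l. mball y r \<subseteq> U m \<inter> U n))) \<and> (\<forall>n. \<alpha> n \<longrightarrow> U n \<noteq> {})}"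
  shows "x \<in> M \<Longrightarrow> (\<lambda>n. x \<in> U n) \<in> C"
    and "\<alpha> \<in> C \<Longrightarrow> \<exists>!x. x \<in> M \<and> (\<lambda>n. x \<in> U n) = \<alpha>"
proof -
  have UM: "U n \<subseteq> M" for n using openin_subset[OF U] by simp
  have ballU: "\<exists>r>0. mball x r \<subseteq> U n" if "x \<in> U n" for x n using U[of n] that by (auto simp: openin_mtopology)
  have ball_base: "\<exists>n. x \<in> U n \<and> U n \<subseteq> mball x r" if "x \<in> M" "0 < r" for x r
    using base[OF openin_mball, of x x r] that by simp
  { assume x: "x \<in> M"
    have "\<exists>n. x \<in> U n \<and> (\<forall>a\<in>U n. \<forall>b\<in>U n. d a b < 1 / Suc k)" for k
    proof -
      obtain n where n: "x \<in> U n" "U n \<subseteq> mball x (1 / Suc k / 2)" using ball_base[OF x, of "1 / Suc k / 2"] by auto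
      have "d a b < 1 / Suc k" if "a \<in> U n" "b \<in> U n" for a b
      proof -
        have "a \<in> M" "b \<in> M" "d x a < 1 / Suc k / 2" "d x b < 1 / Suc k / 2" using n(2) that by auto
        then show ?thesis using triangle[of a x b] x commute[of a x] by linarith
      qed
      then show ?thesis using n(1) by blast
    qed
    moreover have "\<exists>l. x \<in> U l \<and> (\<exists>r>0. \<forall>y\<in>U l. mball y r \<subseteq> U m \<inter> U n)" if mn: "x \<in> U m" "x \<in> U n" for m n
    proof -
      obtain p q where pq: "0 < p" "mball x p \<subseteq> U m" "0 < q" "mball x q \<subseteq> U n" using ballU[OF mn(1)] ballU[OF mn(2)] by blast
      define r where "r = min p q / 2"
      have r: "0 < r" "2 * r \<le> p" "2 * r \<le> q" using pq by (auto simp: r_def)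
      obtain l where l: "x \<in> U l" "U l \<subseteq> mball x r" using ball_base[OF x r(1)] by blast
      have "mball y r \<subseteq> U m \<inter> U n" if "y \<in> U l" for y
      proof
        fix z assume z: "z \<in> mball y r"
        have "y \<in> M" "d x y < r" using l(2) that by auto
        then have "z \<in> M" "d x z < 2 * r" using z triangle[of x y z] x by auto
        then have "z \<in> mball x p" "z \<in> mball x q" using r x by auto
        then show "z \<in> U m \<inter> U n" using pq by blast
      qed
      then show ?thesis using l(1) r(1) by blast
    qed
    ultimately show "(\<lambda>n. x \<in> U n) \<in> C" unfolding C_def by blast }
  { assume "\<alpha> \<in> C"
    then have up: "\<And>m n. \<alpha> m \<Longrightarrow> U m \<subseteq> U n \<Longrightarrow> \<alpha> n" and small: "\<forall>k. \<exists>n. \<alpha> n \<and> (\<forall>x\<in>U n. \<forall>y\<in>U n. d x y < 1 / Suc k)"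
      and dir: "\<And>m n. \<alpha> m \<Longrightarrow> \<alpha> n \<Longrightarrow> \<exists>l. \<alpha> l \<and> (\<exists>r>0. \<forall>y\<in>U l. mball y r \<subseteq> U m \<inter> U n)"
      and ne: "\<And>n. \<alpha> n \<Longrightarrow> U n \<noteq> {}" unfolding C_def by blast+
    from choice[OF small] obtain N where N: "\<And>k. \<alpha> (N k)" "\<And>k x y. x \<in> U (N k) \<Longrightarrow> y \<in> U (N k) \<Longrightarrow> d x y < 1 / Suc k" by blast
    have meet: "\<exists>z. z \<in> U m \<and> z \<in> U n" if mn: "\<alpha> m" "\<alpha> n" for m n
    proof -
      obtain l r where l: "\<alpha> l" "0 < r" "\<And>y. y \<in> U l \<Longrightarrow> mball y r \<subseteq> U m \<inter> U n" using dir[OF mn] by blast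
      obtain y where y: "y \<in> U l" using ne[OF l(1)] by blast
      then have "y \<in> M" using UM by blast
      then have "y \<in> mball y r" using l(2) by simp
      then show ?thesis using l(3)[OF y] by blast
    qed
    have "\<forall>k. \<exists>y. y \<in> U (N k)" using ne[OF N(1)] by blast
    from choice[OF this] obtain y where y: "\<And>k. y k \<in> U (N k)" by blast
    have yM: "y k \<in> M" for k using y UM by blast
    have near: "d (y j) (y k) < 1 / Suc j + 1 / Suc k" for j k
    proof -
      obtain z where z: "z \<in> U (N j)" "z \<in> U (N k)" using meet[OF N(1) N(1)] by blast
      have "d (y j) z < 1 / Suc j" "d z (y k) < 1 / Suc k" using N(2) z y by auto
      moreover have "z \<in> M" using z UM by blast
      ultimately show ?thesis using triangle[of "y j" z "y k"] yM by fastforce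
    qed
    have "MCauchy y" unfolding MCauchy_def
    proof (intro conjI allI impI)
      show "range y \<subseteq> M" using yM by blast
      fix e :: real assume "0 < e"
      then obtain K where K: "1 / Suc K < e / 2" using nat_approx_posE[of "e/2"] by auto
      have "d (y j) (y k) < e" if "K \<le> j" "K \<le> k" for j k
      proof -
        have "1 / Suc j \<le> 1 / Suc K" "1 / Suc k \<le> 1 / Suc K" using that by (simp_all add: field_simps)
        then show ?thesis using near[of j k] K by linarith
      qed
      then show "\<exists>N. \<forall>n n'. N \<le> n \<longrightarrow> N \<le> n' \<longrightarrow> d (y n) (y n') < e" by blast
    qed
    then obtain x where lim: "limitin mtopology y x sequentially" using comp unfolding mcomplete_def by blast
    have x: "x \<in> M" and ev: "\<And>e. 0 < e \<Longrightarrow> \<exists>K. \<forall>k\<ge>K. y k \<in> M \<and> d (y k) x < e"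
      using lim unfolding limit_metric_sequentially by auto
    have xU: "x \<in> U n" if n: "\<alpha> n" for n
    proof -
      obtain l r where l: "\<alpha> l" "0 < r" "\<And>y. y \<in> U l \<Longrightarrow> mball y r \<subseteq> U n \<inter> U n" using dir[OF n n] by blast
      obtain K where K: "\<And>k. K \<le> k \<Longrightarrow> d (y k) x < r / 2" using ev[of "r / 2"] l(2) by auto
      obtain j where j: "1 / Suc j < r / 2" using nat_approx_posE[of "r/2"] l(2) by auto
      define k where "k = max K j"
      have k: "d (y k) x < r / 2" "1 / Suc k < r / 2"
      proof -
        show "d (y k) x < r / 2" using K by (simp add: k_def)
        have "1 / Suc k \<le> 1 / Suc j" by (simp add: k_def field_simps)
        then show "1 / Suc k < r / 2" using j by linarith
      qed
      obtain z where z: "z \<in> U l" "z \<in> U (N k)" using meet[OF l(1) N(1)] by blast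
      have "z \<in> M" using z UM by blast
      moreover have "d z (y k) < 1 / Suc k" using N(2) z(2) y by blast
      ultimately have "d z x < r" using triangle[of z "y k" x] yM x k by (smt (verit) field_sum_of_halves)
      then show ?thesis using l(3)[OF z(1)] x \<open>z \<in> M\<close> by auto
    qed
    have Ux: "\<alpha> n" if n: "x \<in> U n" for n
    proof -
      obtain r where r: "0 < r" "mball x r \<subseteq> U n" using ballU[OF n] by blast
      obtain k where k: "1 / Suc k < r" using nat_approx_posE[OF r(1)] by auto
      have "U (N k) \<subseteq> mball x r"
      proof
        fix z assume z: "z \<in> U (N k)"
        then have "d x z < 1 / Suc k" using N(2) xU[OF N(1)] by blast
        then show "z \<in> mball x r" using k x z UM by auto
      qed
      then show ?thesis using up[OF N(1)] r(2) by blast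
    qed
    have sep: "x' = x" if x': "x' \<in> M" "(\<lambda>n. x' \<in> U n) = \<alpha>" for x'
    proof (rule ccontr)
      assume "x' \<noteq> x"
      then have "0 < d x x'" using x x'(1) by auto
      then obtain n where n: "x \<in> U n" "U n \<subseteq> mball x (d x x')" using ball_base[OF x] by blast
      have "x' \<in> U n" using Ux[OF n(1)] x'(2) by (auto simp: fun_eq_iff)
      then show False using n(2) by auto
    qed
    have "(\<lambda>n. x \<in> U n) = \<alpha>" using xU Ux by blast
    then show "\<exists>!x. x \<in> M \<and> (\<lambda>n. x \<in> U n) = \<alpha>" using x sep by blast }
qed

lemma standard_borel_coding:
  assumes M: "standard_borel M" and ne: "space M \<noteq> {}"
  obtains f g where "f \<in> measurable M sequences" "g \<in> measurable sequences M" "\<And>x. x \<in> space M \<Longrightarrow> g (f x) = x"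
proof -
  obtain S where S: "completely_metrizable_space S" "second_countable S" "space M = topspace S"
    "sets M = sigma_sets (topspace S) {U. openin S U}" using M by (auto simp: standard_borel_def)
  obtain X d where X: "Metric_space X d" "Metric_space.mcomplete X d" "S = Metric_space.mtopology X d"
    using S(1) by (auto simp: completely_metrizable_space_def)
  interpret Metric_space X d by (rule X(1))
  have XS: "space M = X" using S(3) X(3) by simp
  from S(2)[unfolded second_countable_def] obtain \<B> where B: "countable \<B>" "\<forall>V\<in>\<B>. openin S V"
    "\<forall>W x. openin S W \<and> x \<in> W \<longrightarrow> (\<exists>V\<in>\<B>. x \<in> V \<and> V \<subseteq> W)" by (elim exE conjE)
  have "\<B> \<noteq> {}" using B(3) openin_topspace[of S] ne S(3) by (metis ex_in_conv)
  define U where "U = from_nat_into \<B>"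
  have U: "openin mtopology (U n)" for n using B(2) from_nat_into[OF \<open>\<B> \<noteq> {}\<close>] X(3) by (simp add: U_def)
  have base: "\<exists>n. x \<in> U n \<and> U n \<subseteq> W" if W: "openin mtopology W" "x \<in> W" for W x
  proof -
    obtain V where V: "V \<in> \<B>" "x \<in> V" "V \<subseteq> W" using B(3) W X(3) by metis
    obtain n where "V = U n" using from_nat_into_surj[OF B(1) V(1)] by (auto simp: U_def)
    then show ?thesis using V by blast
  qed
  define C where "C = {\<alpha>. (\<forall>m n. \<alpha> m \<longrightarrow> U m \<subseteq> U n \<longrightarrow> \<alpha> n) \<and> (\<forall>k. \<exists>n. \<alpha> n \<and> (\<forall>x\<in>U n. \<forall>y\<in>U n. d x y < 1 / Suc k)) \<and>
    (\<forall>m n. \<alpha> m \<longrightarrow> \<alpha> n \<longrightarrow> (\<exists>l. \<alpha> l \<and> (\<exists>r>0. \<forall>y\<in>U l. mball y r \<subseteq> U m \<inter> U n))) \<and> (\<forall>n. \<alpha> n \<longrightarrow> U n \<noteq> {})}"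
  have code: "x \<in> X \<Longrightarrow> (\<lambda>n. x \<in> U n) \<in> C" "\<alpha> \<in> C \<Longrightarrow> \<exists>!x. x \<in> X \<and> (\<lambda>n. x \<in> U n) = \<alpha>" for x \<alpha>
    unfolding C_def by (rule base_code[OF X(2)]; use U base in blast)+
  obtain x0 where x0: "x0 \<in> X" using ne XS by blast
  define g where "g \<alpha> = (if \<alpha> \<in> C then (THE x. x \<in> X \<and> (\<lambda>n. x \<in> U n) = \<alpha>) else x0)" for \<alpha>
  have gC: "g \<alpha> \<in> X" "(\<lambda>n. g \<alpha> \<in> U n) = \<alpha>" if "\<alpha> \<in> C" for \<alpha>
    using theI'[OF code(2)[OF that]] that by (simp_all add: g_def)
  have gx: "g (\<lambda>n. x \<in> U n) = x" if "x \<in> X" for x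
    using code(1)[OF that] the1_equality[OF code(2)[OF code(1)[OF that]]] that by (simp add: g_def)
  have [measurable]: "C \<in> sets sequences"
  proof -
    have "Measurable.pred sequences (\<lambda>\<alpha>. \<alpha> \<in> C)" unfolding C_def mem_Collect_eq by measurable
    then show ?thesis by (simp add: pred_def space_PiM)
  qed
  have "(\<lambda>x n. x \<in> U n) \<in> measurable M sequences"
  proof (rule measurable_sequencesI)
    fix n
    have "U n \<in> sets M" unfolding S(4) using U[of n] X(3) by (intro sigma_sets.Basic) simp
    then show "Measurable.pred M (\<lambda>x. x \<in> U n)" by simp
  qed
  moreover have "g \<in> measurable sequences M"
  proof (rule measurable_sigma_sets[OF S(4)])
    show "{U. openin S U} \<subseteq> Pow (topspace S)" using openin_subset by blast
    show "g \<in> space sequences \<rightarrow> topspace S" using gC(1) x0 XS S(3) by (auto simp: g_def[of "_"])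
    fix V assume "V \<in> {U. openin S U}"
    then have V: "V = \<Union> (U ` {n. U n \<subseteq> V})" using base X(3) by blast
    have gU: "g -` U n = {\<alpha>\<in>space sequences. \<alpha> \<in> C \<and> \<alpha> n} \<union> {\<alpha>\<in>space sequences. \<alpha> \<notin> C \<and> x0 \<in> U n}" for n
    proof -
      have "g \<alpha> \<in> U n \<longleftrightarrow> \<alpha> n" if "\<alpha> \<in> C" for \<alpha> using gC(2)[OF that] by (simp add: fun_eq_iff)
      moreover have "g \<alpha> = x0" if "\<alpha> \<notin> C" for \<alpha> using that by (simp add: g_def)
      ultimately show ?thesis by (auto simp: space_PiM)
    qed
    have "g -` U n \<in> sets sequences" for n unfolding gU by measurable
    then have "(\<Union>n\<in>{n. U n \<subseteq> V}. g -` U n) \<in> sets sequences" by (intro sets.countable_UN'') auto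
    moreover have "g -` V \<inter> space sequences = (\<Union>n\<in>{n. U n \<subseteq> V}. g -` U n)" by (subst V) (auto simp: space_PiM)
    ultimately show "g -` V \<inter> space sequences \<in> sets sequences" by simp
  qed
  ultimately show thesis using that[of "\<lambda>x n. x \<in> U n" g] gx XS by simp
qed

lemma nonatomic_singleton:
  assumes "prob_space M" "nonatomic M" "B \<in> sets M" "B \<subseteq> {x}" shows "emeasure M B = 0"
proof (rule ccontr)
  assume "emeasure M B \<noteq> 0"
  then obtain D where D: "D \<in> sets M" "D \<subseteq> B" "0 < emeasure M D" "emeasure M D < emeasure M B"
    using assms(2,3) unfolding nonatomic_def by (metis not_gr_zero)
  then have "D = {} \<or> D = B" using assms(4) by blast
  then show False using D by auto
qed

text \<open>Code the space into the reals and let \<open>F\<close> be the distribution function of the image measure and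
  \<open>q\<close> its quantile function. Without atoms \<open>F\<close> is continuous, so \<open>F (q \<omega>) = \<omega>\<close>; as \<open>q\<close> carries the
  uniform distribution to the image measure, \<open>F\<close> composed with the coding and the decoding composed
  with \<open>q\<close> are inverse to each other almost everywhere.\<close>

theorem isomorphic_to_unit_interval:
  assumes "standard_nonatomic_prob_space M"
  obtains u v where "u \<in> borel_measurable M" "v \<in> measurable borel M" "distr M uni u = uni" "distr uni M v = M"
    "AE x in M. v (u x) = x" "AE x in uni. u (v x) = x"
proof -
  have M: "prob_space M" "standard_borel M" "nonatomic M" using assms by (auto simp: standard_nonatomic_prob_space_def)
  interpret M: prob_space M by (rule M(1))
  obtain f0 g0 where fg0 [measurable]: "f0 \<in> measurable M sequences" "g0 \<in> measurable sequences M" and gf0: "\<And>x. x \<in> space M \<Longrightarrow> g0 (f0 x) = x"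
    using standard_borel_coding[OF M(2) M.not_empty] by metis
  define f where "f x = base4 (f0 x)" for x
  define g where "g r = g0 (digit4 r)" for r
  have f [measurable]: "f \<in> borel_measurable M" and g [measurable]: "g \<in> measurable borel M"
    unfolding f_def g_def by measurable
  have gf: "g (f x) = x" if "x \<in> space M" for x using gf0[OF that] by (simp add: f_def g_def digit4_base4)
  define N where "N = distr M borel f"
  interpret N: prob_space N unfolding N_def by (rule M.prob_space_distr) measurable
  interpret N: cdf_distribution N
    by unfold_locales (simp_all add: N_def)
  have N0: "measure N {r} = 0" for r
  proof -
    have s: "f -` {r} \<inter> space M \<in> sets M" by (rule measurable_sets[OF f]) simp
    have "f -` {r} \<inter> space M \<subseteq> {g r}" using gf by auto
    then have "emeasure M (f -` {r} \<inter> space M) = 0" by (rule nonatomic_singleton[OF M(1,3) s])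
    then show ?thesis by (simp add: N_def measure_def emeasure_distr)
  qed
  define F where "F = cdf N"
  define q where "q \<omega> = (if \<omega> \<in> {0<..<1} then Inf {x. \<omega> \<le> F x} else 0)" for \<omega> :: real
  have F [measurable]: "F \<in> borel_measurable borel" unfolding F_def by (rule N.measurable_C)
  have q [measurable]: "q \<in> borel_measurable borel"
  proof -
    have eq: "{x::real. 0 < x \<and> x < 1} = {0<..<1}" by auto
    show ?thesis using N.measurable_CI unfolding q_def F_def
      by (subst measurable_If_restrict_space_iff) (auto simp: eq)
  qed
  have Fq: "F (q \<omega>) = \<omega>" if \<omega>: "0 < \<omega>" "\<omega> < 1" for \<omega>
  proof (rule antisym)
    have pi: "\<omega> \<le> F x \<longleftrightarrow> q \<omega> \<le> x" for x
      using N.pseudoinverse[OF \<omega>, of x] \<omega> by (simp add: q_def F_def)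
    then show "\<omega> \<le> F (q \<omega>)" by simp
    have "isCont F (q \<omega>)" unfolding F_def N.isCont_cdf by (rule N0)
    then have "(F \<longlongrightarrow> F (q \<omega>)) (at_left (q \<omega>))" by (auto simp: isCont_def filterlim_at_split)
    moreover have "eventually (\<lambda>x. F x \<le> \<omega>) (at_left (q \<omega>))"
      unfolding eventually_at_left_field using pi by (meson less_imp_le linorder_not_le lt_ex)
    ultimately show "F (q \<omega>) \<le> \<omega>" by (rule tendsto_upperbound) simp
  qed
  have AE01: "AE \<omega> in uni. 0 < \<omega> \<and> \<omega> < 1"
  proof -
    have "AE \<omega> in uni. 0 \<le> \<omega> \<and> \<omega> < 1" by (rule AE_uni) auto
    moreover have "emeasure uni {0} = 0" by (simp add: emeasure_uni)
    then have "{0} \<in> null_sets uni" by auto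
    then have "AE \<omega> in uni. \<omega> \<noteq> 0" by (rule AE_I') auto
    ultimately show ?thesis by eventually_elim auto
  qed
  have dq: "distr uni borel q = N"
  proof (rule measure_eqI)
    fix A assume "A \<in> sets (distr uni borel q)"
    then have A [measurable]: "A \<in> sets borel" by simp
    have m: "q -` A \<in> sets borel" by (rule measurable_sets_borel[OF q A])
    have "emeasure (distr uni borel q) A = emeasure uni (q -` A)" by (simp add: emeasure_distr)
    also have "\<dots> = emeasure uni (q -` A \<inter> {0<..<1})"
      using AE01 m by (intro emeasure_eq_AE) (auto elim: eventually_mono)
    also have "\<dots> = emeasure lborel (q -` A \<inter> {0<..<1})"
      using m by (subst emeasure_uni) (auto intro!: arg_cong[where f = "emeasure lborel"])
    also have "\<dots> = emeasure (distr (restrict_space lborel {0<..<1}) borel (\<lambda>\<omega>. Inf {x. \<omega> \<le> F x})) A"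
      unfolding F_def using N.measurable_CI
      by (subst emeasure_distr) (auto simp: space_restrict_space emeasure_restrict_space q_def F_def intro!: arg_cong[where f = "emeasure lborel"])
    also have "\<dots> = emeasure N A" unfolding F_def N.distr_I_eq_M ..
    finally show "emeasure (distr uni borel q) A = emeasure N A" .
  qed (simp add: N_def)
  define u where "u x = F (f x)" for x
  define v where "v \<omega> = g (q \<omega>)" for \<omega>
  have u [measurable]: "u \<in> borel_measurable M" and v [measurable]: "v \<in> measurable borel M"
    unfolding u_def v_def by measurable
  have "AE x in M. f (g (f x)) = f x" using gf by (intro AE_I2) simp
  then have "AE r in N. f (g r) = r" unfolding N_def by (subst AE_distr_iff) auto
  then have "AE r in distr uni borel q. f (g r) = r" unfolding dq .
  then have "AE \<omega> in uni. f (g (q \<omega>)) = q \<omega>" by (rule AE_distrD[rotated]) simp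
  then have uv: "AE \<omega> in uni. u (v \<omega>) = \<omega>" using AE01 by eventually_elim (simp add: u_def v_def Fq)
  have dv: "distr uni M v = M"
  proof -
    have "distr uni M v = distr (distr uni borel q) M g" unfolding v_def by (subst distr_distr) (auto simp: comp_def)
    also have "\<dots> = distr M M (\<lambda>x. g (f x))" unfolding dq N_def by (subst distr_distr) (auto simp: comp_def)
    also have "\<dots> = distr M M (\<lambda>x. x)" by (rule distr_cong) (auto simp: gf)
    finally show ?thesis by simp
  qed
  have du: "distr M uni u = uni"
  proof -
    have "distr M uni u = distr (distr uni M v) uni u" unfolding dv ..
    also have "\<dots> = distr uni uni (\<lambda>\<omega>. u (v \<omega>))" by (subst distr_distr) (auto simp: comp_def)
    also have "\<dots> = distr uni uni (\<lambda>\<omega>. \<omega>)" using uv by (intro distr_cong_AE) auto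
    finally show ?thesis by simp
  qed
  have "AE \<omega> in uni. f (v (u (v \<omega>))) = f (v \<omega>)" using uv by eventually_elim simp
  then have "AE x in distr uni M v. f (v (u x)) = f x" by (subst AE_distr_iff) auto
  then have "AE x in M. f (v (u x)) = f x" unfolding dv .
  moreover have "AE x in M. x \<in> space M \<and> v (u x) \<in> space M"
    using measurable_space[OF v] by (intro AE_I2) auto
  ultimately have "AE x in M. v (u x) = x" by eventually_elim (metis gf)
  then show thesis using that u v du dv uv by blast
qed

section \<open>Transformations and automorphisms of the measure algebra\<close>

lemma AE_eq_by_cls:
  fixes s t :: "real \<Rightarrow> real"
  assumes [measurable]: "s \<in> borel_measurable borel" "t \<in> borel_measurable borel"
    and eq: "\<And>A. A \<in> sets borel \<Longrightarrow> cls (s -` A) = cls (t -` A)"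
  shows "AE \<omega> in uni. s \<omega> = t \<omega>"
proof -
  have "AE \<omega> in uni. s \<omega> \<le> r \<longleftrightarrow> t \<omega> \<le> r" for r :: real
    using eq[of "{..r}"] cls_eq_iff[of "s -` {..r}" "t -` {..r}"] by (simp add: measurable_sets_borel[of _ borel])
  then have "AE \<omega> in uni. \<forall>r\<in>\<rat>. s \<omega> \<le> r \<longleftrightarrow> t \<omega> \<le> r"
    by (simp add: AE_ball_countable countable_rat)
  then show ?thesis
  proof eventually_elim
    case (elim \<omega>)
    have "\<not> s \<omega> < t \<omega>" using elim Rats_dense_in_real[of "s \<omega>" "t \<omega>"] by (meson less_imp_le not_le)
    moreover have "\<not> t \<omega> < s \<omega>" using elim Rats_dense_in_real[of "t \<omega>" "s \<omega>"] by (meson less_imp_le not_le)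
    ultimately show ?case by simp
  qed
qed

text \<open>Choose Borel representatives of the images of the half-lines bounded by rationals \<open>q n\<close>. Each real
  is determined by the sequence of half-lines that contain it, and the representatives give such a
  sequence at every point. The two maps into sequences have corresponding preimages for all
  measurable sets of sequences, because this holds for the coordinates; composing with the infimum
  of the \<open>q n\<close> concerned returns to the reals.\<close>

lemma point_realization:
  obtains \<tau> where "\<tau> \<in> borel_measurable borel" "\<And>A. A \<in> sets borel \<Longrightarrow> cls (\<tau> -` A) = act h (cls A)"
proof -
  define Qs where "Qs = {x \<in> \<rat>. 0 \<le> x \<and> x < (1::real)}"
  have Qs: "countable Qs" "Qs \<noteq> {}" unfolding Qs_def by (auto intro: countable_subset[OF _ countable_rat])
  define q where "q = from_nat_into Qs"
  have q: "0 \<le> q n" "q n < 1" for n using from_nat_into[OF Qs(2), of n] by (auto simp: q_def Qs_def)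
  have "\<exists>E. E \<in> sets borel \<and> act h (cls {..<q n}) = cls E" for n using cls_cases by metis
  then obtain E where E [measurable]: "\<And>n. E n \<in> sets borel" and hE: "\<And>n. act h (cls {..<q n}) = cls (E n)" by metis
  define X where "X \<omega> n \<longleftrightarrow> \<omega> < q n" for \<omega> n
  define Y where "Y \<omega> n \<longleftrightarrow> \<omega> \<in> E n" for \<omega> n
  have X [measurable]: "X \<in> measurable borel sequences" by (rule measurable_sequencesI) (simp add: X_def)
  have Y [measurable]: "Y \<in> measurable borel sequences" by (rule measurable_sequencesI) (simp add: Y_def)
  have pre: "X -` Z \<in> sets borel" "Y -` Z \<in> sets borel" if "Z \<in> sets sequences" for Z
    using measurable_sets[OF X that] measurable_sets[OF Y that] by simp_all
  have YX: "Z \<in> sets sequences \<and> cls (Y -` Z) = act h (cls (X -` Z))" if "Z \<in> sets sequences" for Z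
  proof -
    have "Z \<in> sigma_sets UNIV {{f. f i \<in> A} | i A. A \<in> sets (count_space UNIV)}"
      using that by (simp add: sets_PiM_single PiE_UNIV_domain)
    then show ?thesis
    proof (induction Z rule: sigma_sets.induct)
      case (Basic Z)
      then obtain i A where Z: "Z = {f. f i \<in> (A :: bool set)}" by blast
      have "A = {} \<or> A = {True} \<or> A = {False} \<or> A = UNIV" 
      proof -
        have "A \<in> Pow {False, True}" by auto
        then show ?thesis by (auto simp: Pow_insert UNIV_bool)
      qed
      moreover have "{f. f i} \<in> sets sequences" "{f. \<not> f i} \<in> sets sequences"
        using measurable_sets[OF coordinate_measurable, of "{True}" i] measurable_sets[OF coordinate_measurable, of "{False}" i]
        by (simp_all add: vimage_def space_PiM PiE_UNIV_domain)
      moreover have "X -` {f. f i} = {..<q i}" "X -` {f. \<not> f i} = - {..<q i}" "Y -` {f. f i} = E i" "Y -` {f. \<not> f i} = - E i"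
        by (auto simp: X_def Y_def)
      moreover have "cls (- E i) = act h (cls (- {..<q i}))"
      proof -
        have "cls (- E i) = - cls (E i)" "cls (- {..<q i}) = - cls {..<q i}"
          using cls_ops(4)[OF E E] cls_ops(4)[of "{..<q i}" "{..<q i}"] by simp_all
        then show ?thesis by (simp only: hE act_compl)
      qed
      moreover have "UNIV \<in> sets sequences" using sets.top[of sequences] by (simp add: space_PiM PiE_UNIV_domain)
      ultimately show ?case unfolding Z using hE[of i] by (auto simp: cls_consts)
    next
      case Empty
      then show ?case by (simp add: cls_consts)
    next
      case (Compl Z)
      have "UNIV - Z \<in> sets sequences" using Compl sets.compl_sets[of Z sequences] by (simp add: space_PiM PiE_UNIV_domain)
      moreover have "cls (Y -` (UNIV - Z)) = - cls (Y -` Z)" "cls (X -` (UNIV - Z)) = - cls (X -` Z)"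
      proof -
        have Z: "Z \<in> sets sequences" using Compl.IH by blast
        show "cls (Y -` (UNIV - Z)) = - cls (Y -` Z)" "cls (X -` (UNIV - Z)) = - cls (X -` Z)"
          using cls_ops(4)[OF pre(2)[OF Z] pre(2)[OF Z]] cls_ops(4)[OF pre(1)[OF Z] pre(1)[OF Z]]
          by (simp_all add: vimage_Diff Compl_eq_Diff_UNIV)
      qed
      ultimately show ?case using Compl by (simp add: act_compl)
    next
      case (Union Z)
      then have Z: "Z i \<in> sets sequences" "cls (Y -` Z i) = act h (cls (X -` Z i))" for i by blast+
      have "cls (Y -` (\<Union>i. Z i)) = cjoin (\<lambda>i. cls (Y -` Z i))" "cls (X -` (\<Union>i. Z i)) = cjoin (\<lambda>i. cls (X -` Z i))"
        using pre[OF Z(1)] by (simp_all add: cjoin_cls vimage_UN)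
      then show ?case using Z by (auto simp: act_cjoin)
    qed
  qed
  define val where "val \<alpha> = (INF n. if \<alpha> n then q n else 1)" for \<alpha> :: "nat \<Rightarrow> bool"
  have bdd: "bdd_below (range (\<lambda>n. if \<alpha> n then q n else 1))" for \<alpha> by (rule bdd_belowI[of _ 0]) (use q in auto)
  have val [measurable]: "val \<in> borel_measurable sequences"
    unfolding val_def by (rule borel_measurable_cINF[OF _ _ bdd]) auto
  have valX: "val (X \<omega>) = \<omega>" if w: "0 \<le> \<omega>" "\<omega> < 1" for \<omega>
  proof (rule antisym)
    show "\<omega> \<le> val (X \<omega>)" unfolding val_def by (rule cINF_greatest) (use w in \<open>auto simp: X_def\<close>)
    show "val (X \<omega>) \<le> \<omega>"
    proof (rule dense_ge)
      fix y assume "\<omega> < y"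
      then obtain r where r: "r \<in> \<rat>" "\<omega> < r" "r < min y 1" using Rats_dense_in_real[of \<omega> "min y 1"] w by auto
      then have "r \<in> Qs" using w by (simp add: Qs_def)
      then obtain n where n: "q n = r" using from_nat_into_surj[OF Qs(1)] by (auto simp: q_def)
      have "val (X \<omega>) \<le> (if X \<omega> n then q n else 1)" unfolding val_def by (rule cINF_lower[OF bdd]) simp
      then show "val (X \<omega>) \<le> y" using n r by (simp add: X_def)
    qed
  qed
  show thesis
  proof (rule that[of "\<lambda>\<omega>. val (Y \<omega>)"])
    show "(\<lambda>\<omega>. val (Y \<omega>)) \<in> borel_measurable borel" by measurable
    fix A :: "real set" assume A [measurable]: "A \<in> sets borel"
    have vA: "val -` A \<in> sets sequences" using measurable_sets[OF val A] by (simp add: space_PiM PiE_UNIV_domain)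
    have m: "X -` val -` A \<in> sets borel" by (rule pre(1)[OF vA])
    have "AE \<omega> in uni. \<omega> \<in> X -` val -` A \<longleftrightarrow> \<omega> \<in> A"
    proof (rule AE_uni)
      have "{\<omega>. (\<omega> \<in> X -` val -` A) = (\<omega> \<in> A)} = (X -` val -` A \<inter> A) \<union> (- (X -` val -` A) \<inter> - A)" by auto
      then show "{\<omega>. (\<omega> \<in> X -` val -` A) = (\<omega> \<in> A)} \<in> sets borel" using m A by simp
    qed (simp add: valX)
    then have "cls (X -` val -` A) = cls A" using m A by (simp add: cls_eq_iff)
    then show "cls ((\<lambda>\<omega>. val (Y \<omega>)) -` A) = act h (cls A)" using YX[OF vA] by (simp add: vimage_def)
  qed
qed

text \<open>Here \<open>u\<close> and \<open>v\<close> are isomorphisms modulo null sets between \<open>M\<close> and the unit interval.\<close>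

locale standard_space =
  fixes M :: "'x measure" and u :: "'x \<Rightarrow> real" and v :: "real \<Rightarrow> 'x"
  assumes prob: "prob_space M" and u [measurable]: "u \<in> borel_measurable M" and v [measurable]: "v \<in> measurable borel M"
    and du: "distr M uni u = uni" and dv: "distr uni M v = M"
    and vu: "AE x in M. v (u x) = x" and uv: "AE x in uni. u (v x) = x"
begin

definition coord :: "('x \<Rightarrow> 'x) \<Rightarrow> real \<Rightarrow> real" where "coord T \<omega> = u (T (v \<omega>))"

lemma mpD: assumes "T \<in> mp_transformations M" shows "T \<in> measurable M M" "distr M M T = M"
  using assms by (auto simp: mp_transformations_def measure_preserving_def)

lemma AE_u: "AE \<omega> in uni. P \<omega> \<Longrightarrow> AE x in M. P (u x)"
  using AE_distrD[of u M uni P] unfolding du by simp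

lemma AE_v: "AE x in M. P x \<Longrightarrow> AE \<omega> in uni. P (v \<omega>)"
  using AE_distrD[of v uni M P] unfolding dv by simp

lemma AE_mp: "T \<in> mp_transformations M \<Longrightarrow> AE x in M. P x \<Longrightarrow> AE x in M. P (T x)"
  using AE_distrD[of T M M P] mpD[of T] by metis

lemma mp_inverse:
  assumes "T \<in> mp_transformations M"
  obtains S where "S \<in> mp_transformations M" "AE x in M. S (T x) = x" "AE x in M. T (S x) = x"
  using assms unfolding mp_transformations_def by blast

lemma mpI:
  assumes "T \<in> measurable M M" "distr M M T = M" "S \<in> measurable M M" "distr M M S = M"
    "AE x in M. S (T x) = x" "AE x in M. T (S x) = x"
  shows "T \<in> mp_transformations M"
  using assms unfolding mp_transformations_def measure_preserving_def by blast

lemma coord_measurable: "T \<in> measurable M M \<Longrightarrow> coord T \<in> borel_measurable borel"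
  unfolding coord_def using measurable_compose[OF measurable_compose[OF v] u] by blast

lemma distr_coord:
  assumes "T \<in> mp_transformations M" shows "distr uni uni (coord T) = uni"
proof -
  note [measurable] = mpD(1)[OF assms]
  have "distr uni uni (coord T) = distr (distr (distr uni M v) M T) uni u"
    by (subst distr_distr; (subst distr_distr)?) (auto simp: comp_def coord_def[abs_def])
  then show ?thesis by (simp add: dv mpD(2)[OF assms] du)
qed

lemma coord_comp:
  assumes T: "T \<in> mp_transformations M" and S: "S \<in> mp_transformations M"
  shows "AE \<omega> in uni. coord T (coord S \<omega>) = coord (T \<circ> S) \<omega>"
  using AE_v[OF AE_mp[OF S vu]] by eventually_elim (simp add: coord_def)

lemma coord_cong: "AE x in M. T x = S x \<Longrightarrow> AE \<omega> in uni. coord T \<omega> = coord S \<omega>"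
  using AE_v by (fastforce simp: coord_def elim: eventually_mono)

lemma coord_id: "AE \<omega> in uni. coord id \<omega> = \<omega>"
  using uv by (simp add: coord_def)

text \<open>Taking preimages reverses products; the sign makes \<open>aut\<close> a homomorphism.\<close>

definition aut :: "('x \<Rightarrow> 'x) \<Rightarrow> malg maut" where
  "aut T = (SOME g. \<forall>A\<in>sets borel. act (- g) (cls A) = cls (coord T -` A))"

lemma act_aut:
  assumes T: "T \<in> mp_transformations M" and A: "A \<in> sets borel"
  shows "act (- aut T) (cls A) = cls (coord T -` A)"
proof -
  obtain S where S: "S \<in> mp_transformations M" "AE x in M. S (T x) = x" "AE x in M. T (S x) = x" by (rule mp_inverse[OF T])
  have "AE \<omega> in uni. coord S (coord T \<omega>) = \<omega>"
    using coord_comp[OF S(1) T] coord_cong[of "S \<circ> T" id] S(2) coord_id by (auto elim: eventually_elim2)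
  moreover have "AE \<omega> in uni. coord T (coord S \<omega>) = \<omega>"
    using coord_comp[OF T S(1)] coord_cong[of "T \<circ> S" id] S(3) coord_id by (auto elim: eventually_elim2)
  ultimately obtain g where "\<forall>A\<in>sets borel. act g (cls A) = cls (coord T -` A)"
    using maut_of_point_map[OF coord_measurable coord_measurable distr_coord[OF T] distr_coord[OF S(1)]] mpD(1)[OF T] mpD(1)[OF S(1)] by blast
  then have "\<forall>A\<in>sets borel. act (- (- g)) (cls A) = cls (coord T -` A)" by simp
  from someI[of "\<lambda>g. \<forall>A\<in>sets borel. act (- g) (cls A) = cls (coord T -` A)", OF this] show ?thesis
    unfolding aut_def using A by blast
qed

lemma cls_vimage_cong:
  assumes [measurable]: "s \<in> borel_measurable borel" "t \<in> borel_measurable borel" "A \<in> sets borel"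
    and "AE \<omega> in uni. s \<omega> = t \<omega>"
  shows "cls (s -` A) = cls (t -` A)"
  by (subst cls_eq_iff) (use assms(4) in \<open>auto elim: eventually_mono intro: measurable_sets_borel[of _ borel]\<close>)

lemma aut_eqI: "(\<And>A. A \<in> sets borel \<Longrightarrow> act (- g) (cls A) = act (- h) (cls A)) \<Longrightarrow> g = h"
  for g h :: "malg maut"
proof -
  assume *: "\<And>A. A \<in> sets borel \<Longrightarrow> act (- g) (cls A) = act (- h) (cls A)"
  have "- g = - h" by (rule maut_eqI) (metis * cls_cases)
  then show "g = h" by simp
qed

lemma aut_eq_iff:
  assumes T: "T \<in> mp_transformations M" and S: "S \<in> mp_transformations M"
  shows "aut T = aut S \<longleftrightarrow> (AE x in M. T x = S x)"
proof
  note m = coord_measurable[OF mpD(1)[OF T]] coord_measurable[OF mpD(1)[OF S]]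
  { assume "AE x in M. T x = S x"
    then have "cls (coord T -` A) = cls (coord S -` A)" if "A \<in> sets borel" for A
      using cls_vimage_cong[OF m that] coord_cong by blast
    then show "aut T = aut S" by (intro aut_eqI) (simp add: act_aut T S) }
  assume eq: "aut T = aut S"
  have "AE \<omega> in uni. coord T \<omega> = coord S \<omega>"
    by (rule AE_eq_by_cls[OF m]) (metis act_aut eq S T)
  from AE_u[OF this] vu AE_mp[OF T vu] AE_mp[OF S vu] show "AE x in M. T x = S x"
  proof eventually_elim
    case (elim x)
    then show ?case by (metis coord_def)
  qed
qed

lemma mp_comp:
  assumes T: "T \<in> mp_transformations M" and S: "S \<in> mp_transformations M"
  shows "T \<circ> S \<in> mp_transformations M"
proof -
  obtain T' where T': "T' \<in> mp_transformations M" "AE x in M. T' (T x) = x" "AE x in M. T (T' x) = x" by (rule mp_inverse[OF T])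
  obtain S' where S': "S' \<in> mp_transformations M" "AE x in M. S' (S x) = x" "AE x in M. S (S' x) = x" by (rule mp_inverse[OF S])
  have d: "distr M M (f \<circ> g) = M" if "f \<in> mp_transformations M" "g \<in> mp_transformations M" for f g
    using distr_distr[of f M M g M] mpD[OF that(1)] mpD[OF that(2)] by simp
  show ?thesis
  proof (rule mpI[of _ "S' \<circ> T'"])
    show "AE x in M. (S' \<circ> T') ((T \<circ> S) x) = x" using AE_mp[OF S T'(2)] S'(2) by eventually_elim simp
    show "AE x in M. (T \<circ> S) ((S' \<circ> T') x) = x" using AE_mp[OF T'(1) S'(3)] T'(3) by eventually_elim simp
    show "T \<circ> S \<in> measurable M M" by (rule measurable_comp[OF mpD(1)[OF S] mpD(1)[OF T]])
    show "S' \<circ> T' \<in> measurable M M" by (rule measurable_comp[OF mpD(1)[OF T'(1)] mpD(1)[OF S'(1)]])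
    show "distr M M (T \<circ> S) = M" "distr M M (S' \<circ> T') = M" by (rule d[OF T S] d[OF S'(1) T'(1)])+
  qed
qed

lemma aut_comp:
  assumes T: "T \<in> mp_transformations M" and S: "S \<in> mp_transformations M"
  shows "aut (T \<circ> S) = aut T + aut S"
proof (rule aut_eqI)
  fix A :: "real set" assume A: "A \<in> sets borel"
  note m = coord_measurable[OF mpD(1)[OF T]] coord_measurable[OF mpD(1)[OF S]] coord_measurable[OF mpD(1)[OF mp_comp[OF T S]]]
  have "coord T -` A \<in> sets borel" by (rule measurable_sets_borel[OF m(1) A])
  then have "act (- (aut T + aut S)) (cls A) = cls (coord S -` coord T -` A)"
    by (simp add: minus_add act_plus act_aut T S A del: add_uminus_conv_diff)
  also have "\<dots> = cls ((\<lambda>\<omega>. coord T (coord S \<omega>)) -` A)" by (simp add: vimage_def)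
  also have "\<dots> = cls (coord (T \<circ> S) -` A)"
    using m by (intro cls_vimage_cong A coord_comp T S) (auto intro: measurable_compose)
  finally show "act (- aut (T \<circ> S)) (cls A) = act (- (aut T + aut S)) (cls A)" by (simp add: act_aut mp_comp T S A)
qed

lemma id_mp: "id \<in> mp_transformations M"
  by (rule mpI[of _ id]) (auto simp: id_def)

lemma aut_id: "aut id = 0"
  using aut_comp[OF id_mp id_mp] by (metis add_left_cancel add.right_neutral comp_id)

text \<open>Realise the automorphism and its inverse by point maps on the unit interval and transport these
  to \<open>M\<close>.\<close>

lemma aut_surj: "\<exists>T\<in>mp_transformations M. aut T = g"
proof -
  obtain \<tau> where \<tau>: "\<tau> \<in> borel_measurable borel" "\<And>A. A \<in> sets borel \<Longrightarrow> cls (\<tau> -` A) = act (- g) (cls A)"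
    using point_realization[of "- g"] by metis
  obtain \<tau>' where \<tau>': "\<tau>' \<in> borel_measurable borel" "\<And>A. A \<in> sets borel \<Longrightarrow> cls (\<tau>' -` A) = act g (cls A)"
    using point_realization[of g] by metis
  have inv: "AE \<omega> in uni. s (t \<omega>) = \<omega>"
    if s: "s \<in> borel_measurable borel" "\<And>A. A \<in> sets borel \<Longrightarrow> cls (s -` A) = act (- h) (cls A)"
      and t: "t \<in> borel_measurable borel" "\<And>A. A \<in> sets borel \<Longrightarrow> cls (t -` A) = act h (cls A)" for s t h
  proof (rule AE_eq_by_cls)
    show "(\<lambda>\<omega>. s (t \<omega>)) \<in> borel_measurable borel" using measurable_compose[OF t(1) s(1)] .
    fix A :: "real set" assume A: "A \<in> sets borel"
    have "s -` A \<in> sets borel" by (rule measurable_sets_borel[OF s(1) A])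
    from t(2)[OF this] have "cls (t -` s -` A) = cls A" using s(2)[OF A] by simp
    then show "cls ((\<lambda>\<omega>. s (t \<omega>)) -` A) = cls ((\<lambda>\<omega>. \<omega>) -` A)" by (simp add: vimage_def)
  qed simp
  have dis: "distr uni uni s = uni" if s: "s \<in> borel_measurable borel" "\<And>A. A \<in> sets borel \<Longrightarrow> cls (s -` A) = act h (cls A)" for s h
  proof (rule measure_eqI)
    fix A assume "A \<in> sets (distr uni uni s)"
    then have A: "A \<in> sets borel" by simp
    have m: "s -` A \<in> sets borel" by (rule measurable_sets_borel[OF s(1) A])
    have "measure uni (s -` A) = measure uni A" using arg_cong[OF s(2)[OF A], of mu] m A by (simp add: mu_cls)
    then show "emeasure (distr uni uni s) A = emeasure uni A"
      using s(1) A by (simp add: emeasure_distr uni.emeasure_eq_measure)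
  qed simp
  have lift: "(\<lambda>x. v (s (u x))) \<in> measurable M M" "distr M M (\<lambda>x. v (s (u x))) = M"
    if [measurable]: "s \<in> borel_measurable borel" and "distr uni uni s = uni" for s
  proof -
    show "(\<lambda>x. v (s (u x))) \<in> measurable M M" by measurable
    have "distr M M (\<lambda>x. v (s (u x))) = distr (distr (distr M uni u) uni s) M v"
      by (subst distr_distr; (subst distr_distr)?) (auto simp: comp_def)
    then show "distr M M (\<lambda>x. v (s (u x))) = M" by (simp add: du that(2) dv)
  qed
  have pull: "AE \<omega> in uni. P (s \<omega>)" if "s \<in> borel_measurable borel" "distr uni uni s = uni" "AE \<omega> in uni. P \<omega>" for s P
    using AE_distrD[of s uni uni P] unfolding that(2) using that(1,3) by simp
  have inverse: "AE x in M. v (t (u (v (s (u x))))) = x"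
    if s: "s \<in> borel_measurable borel" "distr uni uni s = uni" and ts: "AE \<omega> in uni. t (s \<omega>) = \<omega>" for s t
    using AE_u[OF pull[OF s uv]] AE_u[OF ts] vu by eventually_elim simp
  define T where "T x = v (\<tau> (u x))" for x
  have d: "distr uni uni \<tau> = uni" "distr uni uni \<tau>' = uni"
    using dis[OF \<tau>] dis[OF \<tau>'] by auto
  have "AE \<omega> in uni. \<tau>' (\<tau> \<omega>) = \<omega>" by (rule inv[of \<tau>' "- g"]) (use \<tau> \<tau>' in auto)
  moreover have "AE \<omega> in uni. \<tau> (\<tau>' \<omega>) = \<omega>" by (rule inv[of \<tau> g]) (use \<tau> \<tau>' in auto)
  ultimately have T: "T \<in> mp_transformations M" unfolding T_def
    by (intro mpI[of _ "\<lambda>x. v (\<tau>' (u x))"] lift inverse \<tau> \<tau>' d)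
  have "aut T = g"
  proof (rule aut_eqI)
    fix A :: "real set" assume A: "A \<in> sets borel"
    have "AE \<omega> in uni. coord T \<omega> = \<tau> \<omega>"
      using uv pull[OF \<tau>(1) d(1) uv] by eventually_elim (simp add: coord_def T_def)
    then have "cls (coord T -` A) = cls (\<tau> -` A)"
      by (intro cls_vimage_cong coord_measurable mpD(1) T \<tau> A)
    then show "act (- aut T) (cls A) = act (- g) (cls A)" by (simp add: act_aut T A \<tau>(2))
  qed
  then show ?thesis using T by blast
qed

lemma aut_dist:
  assumes T: "T \<in> mp_transformations M" and S: "S \<in> mp_transformations M" and A: "A \<in> sets borel"
  shows "dist (act (- aut T) (cls A)) (act (- aut S) (cls A)) =
    measure M (sym_diff (T -` (u -` A \<inter> space M) \<inter> space M) (S -` (u -` A \<inter> space M) \<inter> space M))"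
proof -
  let ?Z = "sym_diff (T -` (u -` A \<inter> space M) \<inter> space M) (S -` (u -` A \<inter> space M) \<inter> space M)"
  have uA: "u -` A \<inter> space M \<in> sets M" by (rule measurable_sets[OF u A])
  have Z: "?Z \<in> sets M"
    using measurable_sets[OF mpD(1)[OF T] uA] measurable_sets[OF mpD(1)[OF S] uA] by auto
  have sp: "v \<omega> \<in> space M" for \<omega> using measurable_space[OF v] by simp
  have spT: "T (v \<omega>) \<in> space M" "S (v \<omega>) \<in> space M" for \<omega>
    using measurable_space[OF mpD(1)[OF T] sp] measurable_space[OF mpD(1)[OF S] sp] by auto
  have "measure M ?Z = measure uni (v -` ?Z)"
    using measure_distr[of v uni M ?Z] Z unfolding dv by simp
  also have "v -` ?Z = sym_diff (coord T -` A) (coord S -` A)" using sp spT by (auto simp: coord_def)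
  finally show ?thesis
    using T S A by (simp add: act_aut dist_cls measurable_sets_borel[OF coord_measurable[OF mpD(1)]])
qed

subsection \<open>The group of classes\<close>

definition rho :: "('x \<Rightarrow> 'x) set \<Rightarrow> malg maut" where "rho p = aut (SOME T. T \<in> p)"

lemma ae_class: "T \<in> mp_transformations M \<Longrightarrow> ae_eq M `` {T} = {S \<in> mp_transformations M. aut S = aut T}"
  using aut_eq_iff by (auto simp: ae_eq_def)

lemma carrier_Aut: "p \<in> carrier (Aut M) \<longleftrightarrow> (\<exists>T\<in>mp_transformations M. p = ae_eq M `` {T})"
  by (auto simp: Aut_def quotient_def)

lemma rho_class: "T \<in> mp_transformations M \<Longrightarrow> rho (ae_eq M `` {T}) = aut T"
proof -
  assume T: "T \<in> mp_transformations M"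
  then have "T \<in> ae_eq M `` {T}" by (simp add: ae_class)
  then have "(SOME S. S \<in> ae_eq M `` {T}) \<in> ae_eq M `` {T}" by (rule someI[of "\<lambda>S. S \<in> ae_eq M `` {T}"])
  then show ?thesis using T by (simp add: rho_def ae_class)
qed

lemma mult_class:
  assumes T: "T \<in> mp_transformations M" and S: "S \<in> mp_transformations M"
  shows "ae_eq M `` {T} \<otimes>\<^bsub>Aut M\<^esub> ae_eq M `` {S} = ae_eq M `` {T \<circ> S}"
proof -
  have UN: "(\<Union>x\<in>A. \<Union>y\<in>B. f x y) = Z" if "a \<in> A" "b \<in> B" "\<And>x y. x \<in> A \<Longrightarrow> y \<in> B \<Longrightarrow> f x y = Z"
    for A B Z a b and f :: "('x \<Rightarrow> 'x) \<Rightarrow> ('x \<Rightarrow> 'x) \<Rightarrow> ('x \<Rightarrow> 'x) set" using that by blast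
  have "ae_eq M `` {T} \<otimes>\<^bsub>Aut M\<^esub> ae_eq M `` {S} = (\<Union>T'\<in>ae_eq M `` {T}. \<Union>S'\<in>ae_eq M `` {S}. ae_eq M `` {T' \<circ> S'})"
    unfolding Aut_def by (simp only: monoid.simps)
  also have "\<dots> = ae_eq M `` {T \<circ> S}"
  proof (rule UN[of T _ S])
    show "T \<in> ae_eq M `` {T}" "S \<in> ae_eq M `` {S}" using T S by (simp_all add: ae_class)
    fix T' S' assume "T' \<in> ae_eq M `` {T}" "S' \<in> ae_eq M `` {S}"
    then show "ae_eq M `` {T' \<circ> S'} = ae_eq M `` {T \<circ> S}"
      using T S by (simp add: ae_class mp_comp aut_comp)
  qed
  finally show ?thesis .
qed

lemma rho_hom:
  assumes "p \<in> carrier (Aut M)" "q \<in> carrier (Aut M)"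
  shows "p \<otimes>\<^bsub>Aut M\<^esub> q \<in> carrier (Aut M)" "rho (p \<otimes>\<^bsub>Aut M\<^esub> q) = rho p + rho q"
proof -
  obtain T S where T: "T \<in> mp_transformations M" "p = ae_eq M `` {T}" and S: "S \<in> mp_transformations M" "q = ae_eq M `` {S}"
    using assms unfolding carrier_Aut by blast
  show "p \<otimes>\<^bsub>Aut M\<^esub> q \<in> carrier (Aut M)" "rho (p \<otimes>\<^bsub>Aut M\<^esub> q) = rho p + rho q"
    using mp_comp[OF T(1) S(1)] unfolding T(2) S(2) mult_class[OF T(1) S(1)]
    by (auto simp: carrier_Aut rho_class T(1) S(1) aut_comp)
qed

lemma rho_one: "\<one>\<^bsub>Aut M\<^esub> \<in> carrier (Aut M)" "rho \<one>\<^bsub>Aut M\<^esub> = 0"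
proof -
  have one: "\<one>\<^bsub>Aut M\<^esub> = ae_eq M `` {id}" by (simp add: Aut_def)
  show "\<one>\<^bsub>Aut M\<^esub> \<in> carrier (Aut M)" "rho \<one>\<^bsub>Aut M\<^esub> = 0"
    unfolding one using id_mp by (auto simp: carrier_Aut rho_class aut_id)
qed

lemma rho_bij: "bij_betw rho (carrier (Aut M)) UNIV"
proof (rule bij_betw_imageI)
  show "inj_on rho (carrier (Aut M))"
  proof (rule inj_onI)
    fix p q assume "p \<in> carrier (Aut M)" "q \<in> carrier (Aut M)" and eq: "rho p = rho q"
    then obtain T S where T: "T \<in> mp_transformations M" "p = ae_eq M `` {T}" and S: "S \<in> mp_transformations M" "q = ae_eq M `` {S}"
      unfolding carrier_Aut by blast
    then have "aut T = aut S" using eq by (simp only: rho_class)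
    then show "p = q" unfolding T(2) S(2) ae_class[OF T(1)] ae_class[OF S(1)] by simp
  qed
  show "rho ` carrier (Aut M) = UNIV"
  proof (intro set_eq_subset[THEN iffD2] conjI subsetI UNIV_I)
    fix g
    obtain T where "T \<in> mp_transformations M" "aut T = g" using aut_surj by blast
    then show "g \<in> rho ` carrier (Aut M)"
      by (intro image_eqI[of _ _ "ae_eq M `` {T}"]) (auto simp: rho_class carrier_Aut)
  qed
qed

lemma rho_inj: "p \<in> carrier (Aut M) \<Longrightarrow> q \<in> carrier (Aut M) \<Longrightarrow> rho p = rho q \<Longrightarrow> p = q"
  using rho_bij by (auto simp: bij_betw_def inj_on_def)

lemma rho_surj: obtains p where "p \<in> carrier (Aut M)" "rho p = g"
proof -
  have "g \<in> rho ` carrier (Aut M)" using bij_betw_imp_surj_on[OF rho_bij] by simp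
  then show thesis using that by blast
qed

lemma group_Aut: "group (Aut M)"
proof (rule groupI)
  fix x assume x: "x \<in> carrier (Aut M)"
  show "\<one>\<^bsub>Aut M\<^esub> \<otimes>\<^bsub>Aut M\<^esub> x = x" by (rule rho_inj) (simp_all add: rho_hom rho_one x)
  obtain y where "y \<in> carrier (Aut M)" "rho y = - rho x" by (rule rho_surj)
  then show "\<exists>y\<in>carrier (Aut M). y \<otimes>\<^bsub>Aut M\<^esub> x = \<one>\<^bsub>Aut M\<^esub>"
    by (intro bexI[of _ y] rho_inj) (simp_all add: rho_hom rho_one x)
next
  fix x y z assume "x \<in> carrier (Aut M)" "y \<in> carrier (Aut M)" "z \<in> carrier (Aut M)"
  then show "x \<otimes>\<^bsub>Aut M\<^esub> y \<otimes>\<^bsub>Aut M\<^esub> z = x \<otimes>\<^bsub>Aut M\<^esub> (y \<otimes>\<^bsub>Aut M\<^esub> z)"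
    by (intro rho_inj) (simp_all add: rho_hom add.assoc)
qed (simp_all add: rho_hom rho_one)

lemma rho_inv: assumes "p \<in> carrier (Aut M)" shows "rho (inv\<^bsub>Aut M\<^esub> p) = - rho p"
proof -
  have "rho (inv\<^bsub>Aut M\<^esub> p \<otimes>\<^bsub>Aut M\<^esub> p) = 0" using group.l_inv[OF group_Aut assms] rho_one(2) by simp
  then have "rho (inv\<^bsub>Aut M\<^esub> p) + rho p = 0" using rho_hom(2)[OF group.inv_closed[OF group_Aut assms] assms] by simp
  then show ?thesis by (simp add: eq_neg_iff_add_eq_0)
qed

definition subbasic :: "'x set \<Rightarrow> 'x set \<Rightarrow> real \<Rightarrow> ('x \<Rightarrow> 'x) set set" where
  "subbasic A B e = {p \<in> carrier (Aut M). \<forall>T\<in>p. measure M (sym_diff (T -` A \<inter> space M) B) < e}"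

lemma openin_subbasic: "A \<in> sets M \<Longrightarrow> B \<in> sets M \<Longrightarrow> 0 < e \<Longrightarrow> openin (weak_topology M) (subbasic A B e)"
  unfolding weak_topology_def openin_topology_generated_by_iff subbasic_def
  by (rule generate_topology_on.Basis) blast

lemma topspace_weak: "topspace (weak_topology M) = carrier (Aut M)"
proof
  show "topspace (weak_topology M) \<subseteq> carrier (Aut M)"
    unfolding weak_topology_def topology_generated_by_topspace by blast
  have "measure M X < 2" for X using prob_space.prob_le_1[OF prob, of X] by simp
  then have "carrier (Aut M) = subbasic {} {} 2" by (auto simp: subbasic_def)
  then show "carrier (Aut M) \<subseteq> topspace (weak_topology M)"
    using openin_subset[OF openin_subbasic[of "{}" "{}" 2]] by simp
qed

lemma weak_neighbourhood:
  assumes p: "p \<in> carrier (Aut M)" and \<delta>: "0 < \<delta>"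
  obtains O' where "openin (weak_topology M) O'" "p \<in> O'"
    "\<And>q. q \<in> O' \<Longrightarrow> q \<in> carrier (Aut M) \<and> dist (act (- rho q) a) (act (- rho p) a) < \<delta>"
proof -
  obtain A where A: "A \<in> sets borel" "a = cls A" by (rule cls_cases)
  obtain T where T: "T \<in> mp_transformations M" "p = ae_eq M `` {T}" using p by (auto simp: carrier_Aut)
  let ?A = "u -` A \<inter> space M"
  let ?B = "T -` ?A \<inter> space M"
  have uA: "?A \<in> sets M" by (rule measurable_sets[OF u A(1)])
  have d: "dist (act (- aut S) a) (act (- rho p) a) = measure M (sym_diff (S -` ?A \<inter> space M) ?B)"
    if "S \<in> mp_transformations M" for S
    using aut_dist[OF that T(1) A(1)] by (simp add: A(2) T rho_class)
  show thesis
  proof (rule that[of "subbasic ?A ?B \<delta>"])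
    show "openin (weak_topology M) (subbasic ?A ?B \<delta>)"
      by (rule openin_subbasic[OF uA measurable_sets[OF mpD(1)[OF T(1)] uA] \<delta>])
    have "measure M (sym_diff (S -` ?A \<inter> space M) ?B) < \<delta>" if "S \<in> p" for S
    proof -
      have S: "S \<in> mp_transformations M" "aut S = rho p"
        using that rho_class[OF T(1)] unfolding T(2) ae_class[OF T(1)] by auto
      show ?thesis unfolding d[OF S(1), symmetric] S(2) using \<delta> by simp
    qed
    then show "p \<in> subbasic ?A ?B \<delta>" using p by (simp add: subbasic_def)
    fix q assume q: "q \<in> subbasic ?A ?B \<delta>"
    then have qc: "q \<in> carrier (Aut M)" by (simp add: subbasic_def)
    then obtain S where S: "S \<in> mp_transformations M" "q = ae_eq M `` {S}" by (auto simp: carrier_Aut)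
    then have "S \<in> q" by (simp add: ae_class)
    then have "measure M (sym_diff (S -` ?A \<inter> space M) ?B) < \<delta>" using q by (simp add: subbasic_def)
    then show "q \<in> carrier (Aut M) \<and> dist (act (- rho q) a) (act (- rho p) a) < \<delta>"
      using qc d[OF S(1)] S by (simp add: rho_class)
  qed
qed

end

section \<open>Automatic continuity, small index and cofinality\<close>

lemma topological_group_mult:
  fixes G (structure)
  assumes G: "topological_group G \<sigma>" and U: "openin \<sigma> U" "\<one> \<in> U"
  obtains V where "openin \<sigma> V" "\<one> \<in> V" "\<And>x y. x \<in> V \<Longrightarrow> y \<in> V \<Longrightarrow> x \<otimes> y \<in> U"
proof -
  have grp: "group G" and top: "topspace \<sigma> = carrier G"
    and cont: "continuous_map (prod_topology \<sigma> \<sigma>) \<sigma> (\<lambda>(x, y). x \<otimes> y)"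
    using G by (auto simp: topological_group_def)
  have "openin (prod_topology \<sigma> \<sigma>) {z \<in> topspace (prod_topology \<sigma> \<sigma>). (\<lambda>(x, y). x \<otimes> y) z \<in> U}"
    by (rule openin_continuous_map_preimage[OF cont U(1)])
  moreover have one: "\<one> \<in> carrier G" using group.is_monoid[OF grp] monoid.one_closed by blast
  then have "(\<one>, \<one>) \<in> {z \<in> topspace (prod_topology \<sigma> \<sigma>). (\<lambda>(x, y). x \<otimes> y) z \<in> U}"
    using U(2) monoid.l_one[OF group.is_monoid[OF grp] one] by (simp add: top)
  ultimately obtain V1 V2 where V: "openin \<sigma> V1" "openin \<sigma> V2" "\<one> \<in> V1" "\<one> \<in> V2"
    "V1 \<times> V2 \<subseteq> {z \<in> topspace (prod_topology \<sigma> \<sigma>). (\<lambda>(x, y). x \<otimes> y) z \<in> U}"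
    unfolding openin_prod_topology_alt by meson
  show thesis by (rule that[of "V1 \<inter> V2"]) (use V in auto)
qed

lemma topological_group_div:
  fixes G (structure)
  assumes G: "topological_group G \<sigma>" and U: "openin \<sigma> U" "\<one> \<in> U"
  obtains V where "openin \<sigma> V" "\<one> \<in> V" "\<And>x y. x \<in> V \<Longrightarrow> y \<in> V \<Longrightarrow> inv x \<otimes> y \<in> U"
proof -
  have grp: "group G" and top: "topspace \<sigma> = carrier G" and cont: "continuous_map \<sigma> \<sigma> (\<lambda>x. inv x)"
    using G by (auto simp: topological_group_def)
  obtain V where V: "openin \<sigma> V" "\<one> \<in> V" "\<And>x y. x \<in> V \<Longrightarrow> y \<in> V \<Longrightarrow> x \<otimes> y \<in> U"
    by (rule topological_group_mult[OF G U]) blast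
  have "openin \<sigma> {x \<in> topspace \<sigma>. inv x \<in> V}" by (rule openin_continuous_map_preimage[OF cont V(1)])
  then have "openin \<sigma> (V \<inter> {x \<in> topspace \<sigma>. inv x \<in> V})" using V(1) by (rule openin_Int[rotated])
  moreover have "inv \<one> = \<one>" by (rule monoid.inv_one[OF group.is_monoid[OF grp]]) 
  then have "\<one> \<in> V \<inter> {x \<in> topspace \<sigma>. inv x \<in> V}" using V(2) openin_subset[OF V(1)] by auto
  ultimately show thesis by (rule that) (use V(3) in auto)
qed

lemma continuous_translations:
  fixes G (structure)
  assumes G: "topological_group G \<sigma>" and x: "x \<in> carrier G"
  shows "continuous_map \<sigma> \<sigma> (\<lambda>y. inv y \<otimes> x)" "continuous_map \<sigma> \<sigma> (\<lambda>y. y \<otimes> x)"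
proof -
  have top: "topspace \<sigma> = carrier G" and inv: "continuous_map \<sigma> \<sigma> (\<lambda>x. inv x)"
    and cont: "continuous_map (prod_topology \<sigma> \<sigma>) \<sigma> (\<lambda>(x, y). x \<otimes> y)"
    using G by (auto simp: topological_group_def)
  have const: "continuous_map \<sigma> \<sigma> (\<lambda>y. x)" using x top by simp
  show "continuous_map \<sigma> \<sigma> (\<lambda>y. inv y \<otimes> x)"
    using continuous_map_compose[OF continuous_map_pairedI[OF inv const] cont] by (simp add: comp_def)
  show "continuous_map \<sigma> \<sigma> (\<lambda>y. y \<otimes> x)"
    using continuous_map_compose[OF continuous_map_pairedI[OF continuous_map_id[unfolded id_def] const] cont] by (simp add: comp_def)
qed

text \<open>Continuity of the multiplication at the identity, applied \<open>n\<close> times.\<close>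

lemma homomorphism_small_on_nfold:
  fixes G (structure) and \<phi> :: "'g::group_add \<Rightarrow> 'h"
  assumes G: "topological_group G \<sigma>" and hom: "\<And>g h. \<phi> (g + h) = \<phi> g \<otimes> \<phi> h" and one: "\<phi> 0 = \<one>"
    and U: "openin \<sigma> U" "\<one> \<in> U"
  shows "\<exists>V. openin \<sigma> V \<and> \<one> \<in> V \<and> (\<forall>g\<in>nfold {g. \<phi> g \<in> V} n. \<phi> g \<in> U)"
  using U
proof (induction n arbitrary: U)
  case 0
  then show ?case using one by (intro exI[of _ U]) simp
next
  case (Suc n)
  obtain V1 where V1: "openin \<sigma> V1" "\<one> \<in> V1" "\<And>x y. x \<in> V1 \<Longrightarrow> y \<in> V1 \<Longrightarrow> x \<otimes> y \<in> U"
    by (rule topological_group_mult[OF G Suc.prems]) blast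
  obtain V2 where V2: "openin \<sigma> V2" "\<one> \<in> V2" "\<forall>g\<in>nfold {g. \<phi> g \<in> V2} n. \<phi> g \<in> V1"
    using Suc.IH[OF V1(1,2)] by blast
  have "\<phi> g \<in> U" if gn: "g \<in> nfold {g. \<phi> g \<in> V1 \<inter> V2} (Suc n)" for g
  proof -
    obtain a b where ab: "g = a + b" "\<phi> a \<in> V1" "b \<in> nfold {g. \<phi> g \<in> V1 \<inter> V2} n" using gn by auto
    have "b \<in> nfold {g. \<phi> g \<in> V2} n" using ab(3) nfold_mono[of "{g. \<phi> g \<in> V1 \<inter> V2}" "{g. \<phi> g \<in> V2}"] by blast
    then show ?thesis using V1(3)[OF ab(2)] V2(3) by (simp add: ab(1) hom)
  qed
  then show ?case using openin_Int[OF V1(1) V2(1)] V1(2) V2(2) by blast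
qed

context standard_space
begin

lemma rho_minus:
  assumes "p \<in> carrier (Aut M)" "q \<in> carrier (Aut M)"
  shows "rho (q \<otimes>\<^bsub>Aut M\<^esub> inv\<^bsub>Aut M\<^esub> p) = rho q - rho p"
  using assms group.inv_closed[OF group_Aut] by (simp add: rho_hom rho_inv)

text \<open>For a neighbourhood \<open>V'\<close> of the identity in the target let \<open>W\<close> consist of the automorphisms with
  image of the form \<open>inv x \<otimes> y\<close> for \<open>x\<close> and \<open>y\<close> in \<open>V'\<close>. A countable dense subset of the target shows
  that countably many translates of \<open>W\<close> cover the group, so a weak neighbourhood of the identity is
  mapped into the products of 92 such elements. Right translation, which acts isometrically on the
  inverses, transfers this from the identity to every point.\<close>

theorem automatic_continuity_Aut: "automatic_continuity TYPE('h) (Aut M) (weak_topology M)"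
  unfolding automatic_continuity_def
proof (intro allI impI ballI, elim conjE)
  fix H :: "'h monoid" and \<sigma> f
  assume H: "topological_group H \<sigma>" and sep: "separable_space \<sigma>" and f: "f \<in> hom (Aut M) H"
  have grp: "group H" and top: "topspace \<sigma> = carrier H" using H by (auto simp: topological_group_def)
  interpret H: group H by (rule grp)
  interpret fh: group_hom "Aut M" H f using f group_Aut grp by (simp add: group_hom_def group_hom_axioms_def)
  define r where "r = the_inv_into (carrier (Aut M)) rho"
  have r: "r g \<in> carrier (Aut M)" "rho (r g) = g" for g
    using the_inv_into_into[of rho "carrier (Aut M)" g] f_the_inv_into_f[of rho "carrier (Aut M)" g] rho_bij
    by (auto simp: r_def bij_betw_def)
  have rr: "r (rho p) = p" if "p \<in> carrier (Aut M)" for p using rho_inj[OF r(1) that] r(2) by blast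
  define \<phi> where "\<phi> g = f (r g)" for g
  have \<phi>c: "\<phi> g \<in> carrier H" for g using r(1) by (simp add: \<phi>_def)
  have hom: "\<phi> (g + h) = \<phi> g \<otimes>\<^bsub>H\<^esub> \<phi> h" for g h
  proof -
    have "r (g + h) = r g \<otimes>\<^bsub>Aut M\<^esub> r h" by (rule rho_inj) (simp_all add: r rho_hom)
    then show ?thesis using r(1) by (simp add: \<phi>_def)
  qed
  have one: "\<phi> 0 = \<one>\<^bsub>H\<^esub>" using hom[of 0 0] \<phi>c[of 0] by (simp add: H.r_cancel_one')
  have inv: "\<phi> (- g) = inv\<^bsub>H\<^esub> \<phi> g" for g
    using hom[of "- g" g] one \<phi>c by (intro H.inv_equality[symmetric]) auto
  have near: "\<exists>N \<delta>. 0 < \<delta> \<and> (\<forall>g. (\<forall>i<2^N. dist (act g (ucell N i)) (ucell N i) < \<delta>) \<longrightarrow> \<phi> g \<in> U)"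
    if U: "openin \<sigma> U" "\<one>\<^bsub>H\<^esub> \<in> U" for U
  proof -
    from homomorphism_small_on_nfold[where n = 92, OF H hom one U]
    obtain V where V: "openin \<sigma> V" "\<one>\<^bsub>H\<^esub> \<in> V" "\<forall>g\<in>nfold {g. \<phi> g \<in> V} 92. \<phi> g \<in> U"
      by (elim exE conjE)
    obtain V' where V': "openin \<sigma> V'" "\<one>\<^bsub>H\<^esub> \<in> V'" "\<And>x y. x \<in> V' \<Longrightarrow> y \<in> V' \<Longrightarrow> inv\<^bsub>H\<^esub> x \<otimes>\<^bsub>H\<^esub> y \<in> V"
      by (rule topological_group_div[OF H V(1,2)]) blast
    have V'c: "x \<in> carrier H" if "x \<in> V'" for x using openin_subset[OF V'(1)] that top by blast
    define W where "W = {g. \<exists>x\<in>V'. \<exists>y\<in>V'. \<phi> g = inv\<^bsub>H\<^esub> x \<otimes>\<^bsub>H\<^esub> y}"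
    have sym: "- w \<in> W" if w: "w \<in> W" for w
    proof -
      obtain x y where xy: "x \<in> V'" "y \<in> V'" "\<phi> w = inv\<^bsub>H\<^esub> x \<otimes>\<^bsub>H\<^esub> y" using w by (auto simp: W_def)
      have "\<phi> (- w) = inv\<^bsub>H\<^esub> y \<otimes>\<^bsub>H\<^esub> x" using xy V'c by (simp add: inv H.inv_mult_group)
      then show ?thesis using xy(1,2) unfolding W_def by blast
    qed
    obtain C where C: "countable C" "C \<subseteq> topspace \<sigma>" "\<sigma> closure_of C = topspace \<sigma>"
      using sep unfolding separable_space_def by blast
    have meets: "\<exists>c\<in>C. inv\<^bsub>H\<^esub> c \<otimes>\<^bsub>H\<^esub> x \<in> V'" if x: "x \<in> carrier H" for x
    proof -
      have "openin \<sigma> {y \<in> topspace \<sigma>. inv\<^bsub>H\<^esub> y \<otimes>\<^bsub>H\<^esub> x \<in> V'}"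
        by (rule openin_continuous_map_preimage[OF continuous_translations(1)[OF H x] V'(1)])
      moreover have "x \<in> {y \<in> topspace \<sigma>. inv\<^bsub>H\<^esub> y \<otimes>\<^bsub>H\<^esub> x \<in> V'}" using x V'(2) top by simp
      moreover have "x \<in> \<sigma> closure_of C" using x C(3) top by simp
      then have "\<forall>T. x \<in> T \<and> openin \<sigma> T \<longrightarrow> (\<exists>y. y \<in> C \<and> y \<in> T)" unfolding in_closure_of by (rule conjunct2)
      ultimately have "\<exists>y. y \<in> C \<and> y \<in> {y \<in> topspace \<sigma>. inv\<^bsub>H\<^esub> y \<otimes>\<^bsub>H\<^esub> x \<in> V'}" by (elim allE impE) (intro conjI)
      then show ?thesis by blast
    qed
    then have "C \<noteq> {}" using H.one_closed by blast
    define c where "c = from_nat_into C"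
    have c: "c n \<in> carrier H" for n using from_nat_into[OF \<open>C \<noteq> {}\<close>, of n] C(2) top by (auto simp: c_def)
    define k where "k n = (SOME g. inv\<^bsub>H\<^esub> c n \<otimes>\<^bsub>H\<^esub> \<phi> g \<in> V')" for n
    have cover: "\<exists>n. \<exists>w\<in>W. g = k n + w" for g
    proof -
      obtain x where "x \<in> C" "inv\<^bsub>H\<^esub> x \<otimes>\<^bsub>H\<^esub> \<phi> g \<in> V'" using meets[OF \<phi>c] by blast
      then obtain n where n: "inv\<^bsub>H\<^esub> c n \<otimes>\<^bsub>H\<^esub> \<phi> g \<in> V'"
        using from_nat_into_surj[OF C(1)] unfolding c_def by metis
      then have kn: "inv\<^bsub>H\<^esub> c n \<otimes>\<^bsub>H\<^esub> \<phi> (k n) \<in> V'" unfolding k_def by (rule someI)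
      have "inv\<^bsub>H\<^esub> (inv\<^bsub>H\<^esub> c n \<otimes>\<^bsub>H\<^esub> \<phi> (k n)) \<otimes>\<^bsub>H\<^esub> (inv\<^bsub>H\<^esub> c n \<otimes>\<^bsub>H\<^esub> \<phi> g) = \<phi> (- k n + g)"
      proof -
        have "inv\<^bsub>H\<^esub> (inv\<^bsub>H\<^esub> c n \<otimes>\<^bsub>H\<^esub> \<phi> (k n)) \<otimes>\<^bsub>H\<^esub> (inv\<^bsub>H\<^esub> c n \<otimes>\<^bsub>H\<^esub> \<phi> g) =
            inv\<^bsub>H\<^esub> \<phi> (k n) \<otimes>\<^bsub>H\<^esub> (c n \<otimes>\<^bsub>H\<^esub> (inv\<^bsub>H\<^esub> c n \<otimes>\<^bsub>H\<^esub> \<phi> g))"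
          using c \<phi>c by (simp add: H.inv_mult_group H.m_assoc)
        also have "c n \<otimes>\<^bsub>H\<^esub> (inv\<^bsub>H\<^esub> c n \<otimes>\<^bsub>H\<^esub> \<phi> g) = \<phi> g" using c \<phi>c by (simp add: H.m_assoc[symmetric])
        finally show ?thesis by (simp add: hom inv del: add_uminus_conv_diff)
      qed
      then have "- k n + g \<in> W" using n kn unfolding W_def by force
      then show ?thesis by (intro exI[of _ n] bexI[of _ "- k n + g"]) (simp_all flip: add.assoc)
    qed
    from unit_interval.weak_neighbourhood_in_nfold[of W k, OF cover sym] obtain N \<delta> where N: "0 < \<delta>"
      "\<And>g. \<forall>i<2^N. dist (act g (ucell N i)) (ucell N i) < \<delta> \<Longrightarrow> g \<in> nfold W 92" by blast
    have "W \<subseteq> {g. \<phi> g \<in> V}" using V'(3) by (auto simp: W_def)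
    then have "nfold W 92 \<subseteq> nfold {g. \<phi> g \<in> V} 92" by (rule nfold_mono)
    then show ?thesis using N V(3) by blast
  qed
  show "continuous_map (weak_topology M) \<sigma> f"
    unfolding continuous_map
  proof (intro conjI allI impI)
    show "f ` topspace (weak_topology M) \<subseteq> topspace \<sigma>" using fh.hom_closed by (auto simp: topspace_weak top)
    fix U assume U: "openin \<sigma> U"
    show "openin (weak_topology M) {p \<in> topspace (weak_topology M). f p \<in> U}"
    proof (subst openin_subopen, safe)
      fix p assume "p \<in> topspace (weak_topology M)" and fp: "f p \<in> U"
      then have p: "p \<in> carrier (Aut M)" by (simp add: topspace_weak)
      have fpc: "f p \<in> carrier H" using p by simp
      have "openin \<sigma> {y \<in> topspace \<sigma>. y \<otimes>\<^bsub>H\<^esub> f p \<in> U}"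
        by (rule openin_continuous_map_preimage[OF continuous_translations(2)[OF H fpc] U])
      moreover have "\<one>\<^bsub>H\<^esub> \<in> {y \<in> topspace \<sigma>. y \<otimes>\<^bsub>H\<^esub> f p \<in> U}" using fp fpc top by simp
      ultimately obtain N \<delta> where N: "0 < \<delta>"
        "\<And>g. \<forall>i<2^N. dist (act g (ucell N i)) (ucell N i) < \<delta> \<Longrightarrow> \<phi> g \<in> {y \<in> topspace \<sigma>. y \<otimes>\<^bsub>H\<^esub> f p \<in> U}"
        using near by blast
      have "\<exists>O'. openin (weak_topology M) O' \<and> p \<in> O' \<and>
          (\<forall>q\<in>O'. q \<in> carrier (Aut M) \<and> dist (act (- rho q) (ucell N i)) (act (- rho p) (ucell N i)) < \<delta>)" for i
        using weak_neighbourhood[OF p N(1), of "ucell N i"] by metis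
      then obtain O' where O': "\<And>i. openin (weak_topology M) (O' i)" "\<And>i. p \<in> O' i"
        "\<And>i q. q \<in> O' i \<Longrightarrow> q \<in> carrier (Aut M) \<and> dist (act (- rho q) (ucell N i)) (act (- rho p) (ucell N i)) < \<delta>" by metis
      define Q where "Q = (\<Inter>i\<in>{..<2^N}. O' i)"
      have "openin (weak_topology M) Q" 
      proof -
        have "(0::nat) \<in> {..<2^N}" by simp
        then show ?thesis unfolding Q_def using O'(1) by (intro openin_INT2) blast+
      qed
      moreover have "p \<in> Q" using O'(2) by (simp add: Q_def)
      moreover have "q \<in> topspace (weak_topology M) \<and> f q \<in> U" if q: "q \<in> Q" for q
      proof -
        have qi: "q \<in> O' i" if "i < 2^N" for i using q that by (simp add: Q_def)
        have qc: "q \<in> carrier (Aut M)" using O'(3)[OF qi[of 0]] by simp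
        have "dist (act (rho q - rho p) (ucell N i)) (ucell N i) < \<delta>" if "i < 2^N" for i
        proof -
          have "dist (act (rho q) (act (- rho q) (ucell N i))) (act (rho q) (act (- rho p) (ucell N i))) < \<delta>"
            unfolding act_dist using O'(3)[OF qi[OF that]] by blast
          then have "dist (ucell N i) (act (rho q - rho p) (ucell N i)) < \<delta>"
            by (simp only: act_minus2 act_plus diff_conv_add_uminus)
          then show ?thesis by (simp only: dist_commute)
        qed
        then have "\<phi> (rho q - rho p) \<otimes>\<^bsub>H\<^esub> f p \<in> U" using N(2)[of "rho q - rho p"] by blast
        moreover have "\<phi> (rho q - rho p) = f (q \<otimes>\<^bsub>Aut M\<^esub> inv\<^bsub>Aut M\<^esub> p)"
          unfolding \<phi>_def rho_minus[OF p qc, symmetric] using p qc group.inv_closed[OF group_Aut] rho_hom(1) by (subst rr) auto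
        moreover have "f (q \<otimes>\<^bsub>Aut M\<^esub> inv\<^bsub>Aut M\<^esub> p) \<otimes>\<^bsub>H\<^esub> f p = f q"
          using p qc fpc by (simp add: H.m_assoc)
        ultimately show ?thesis using qc by (simp add: topspace_weak)
      qed
      ultimately show "\<exists>T. openin (weak_topology M) T \<and> p \<in> T \<and> T \<subseteq> {p \<in> topspace (weak_topology M). f p \<in> U}" by blast
    qed
  qed
qed

lemma rho_subgroup:
  assumes "subgroup K (Aut M)"
  shows "0 \<in> rho ` K" "a \<in> rho ` K \<Longrightarrow> - a \<in> rho ` K" "a \<in> rho ` K \<Longrightarrow> b \<in> rho ` K \<Longrightarrow> a + b \<in> rho ` K"
proof -
  have c: "p \<in> carrier (Aut M)" if "p \<in> K" for p using subgroup.mem_carrier[OF assms that] .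
  show "0 \<in> rho ` K" using rho_one(2) subgroup.one_closed[OF assms] by (metis imageI)
  show "a \<in> rho ` K \<Longrightarrow> - a \<in> rho ` K"
  proof -
    assume "a \<in> rho ` K"
    then obtain p where "p \<in> K" "a = rho p" by blast
    then show "- a \<in> rho ` K"
      using rho_inv[OF c, of p] subgroup.m_inv_closed[OF assms, of p] by (intro image_eqI[of _ _ "inv\<^bsub>Aut M\<^esub> p"]) auto
  qed
  show "a \<in> rho ` K \<Longrightarrow> b \<in> rho ` K \<Longrightarrow> a + b \<in> rho ` K"
  proof -
    assume "a \<in> rho ` K" "b \<in> rho ` K"
    then obtain p q where "p \<in> K" "a = rho p" "q \<in> K" "b = rho q" by blast
    then show "a + b \<in> rho ` K"
      using rho_hom(2)[OF c c, of p q] subgroup.m_closed[OF assms, of p q] by (intro image_eqI[of _ _ "p \<otimes>\<^bsub>Aut M\<^esub> q"]) auto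
  qed
qed

lemma rho_image_UNIV:
  assumes K: "subgroup K (Aut M)" and full: "rho ` K = UNIV" shows "K = carrier (Aut M)"
proof
  show "K \<subseteq> carrier (Aut M)" by (rule subgroup.subset[OF K])
  show "carrier (Aut M) \<subseteq> K"
  proof
    fix p assume p: "p \<in> carrier (Aut M)"
    have "rho p \<in> rho ` K" using full by simp
    then obtain q where "q \<in> K" "rho q = rho p" by auto
    then show "p \<in> K" using rho_inj[OF p] subgroup.mem_carrier[OF K] by metis
  qed
qed

text \<open>A family of automorphisms whose differences avoid the subgroup would give continuum many cosets.
  So the constant sequence is large, the subgroup is the whole group, and it is open for that
  reason.\<close>

theorem small_index_property_Aut: "small_index_property (Aut M) (weak_topology M)"
  unfolding small_index_property_def
proof (intro allI impI, elim conjE)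
  fix K assume K: "subgroup K (Aut M)" and idx: "rcosets\<^bsub>Aut M\<^esub> K \<prec> (UNIV :: nat set set)"
  interpret G: group "Aut M" by (rule group_Aut)
  have "\<exists>\<alpha> \<beta>. \<alpha> \<noteq> \<beta> \<and> - t \<alpha> + t \<beta> \<in> rho ` K" for t :: "(nat \<Rightarrow> bool) \<Rightarrow> malg maut"
  proof (rule ccontr)
    assume no: "\<not> ?thesis"
    have "\<forall>\<alpha>. \<exists>p. p \<in> carrier (Aut M) \<and> rho p = t \<alpha>" using rho_surj by metis
    from choice[OF this] obtain p where p: "\<And>\<alpha>. p \<alpha> \<in> carrier (Aut M)" "\<And>\<alpha>. rho (p \<alpha>) = t \<alpha>" by blast
    let ?c = "\<lambda>X :: nat set. K #>\<^bsub>Aut M\<^esub> inv\<^bsub>Aut M\<^esub> p (\<lambda>n. n \<in> X)"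
    have "inj ?c"
    proof (rule injI)
      fix X Y assume eq: "?c X = ?c Y"
      let ?\<alpha> = "\<lambda>n. n \<in> X" and ?\<beta> = "\<lambda>n. n \<in> Y"
      have "inv\<^bsub>Aut M\<^esub> p ?\<alpha> \<in> ?c X" by (rule G.rcos_self[OF _ K]) (simp add: p)
      then have "inv\<^bsub>Aut M\<^esub> p ?\<alpha> \<in> ?c Y" unfolding eq .
      then obtain h where h: "h \<in> K" "inv\<^bsub>Aut M\<^esub> p ?\<alpha> = h \<otimes>\<^bsub>Aut M\<^esub> inv\<^bsub>Aut M\<^esub> p ?\<beta>" unfolding r_coset_def by blast
      have hc: "h \<in> carrier (Aut M)" by (rule subgroup.mem_carrier[OF K h(1)])
      have "- t ?\<alpha> = rho h + - t ?\<beta>"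
        using arg_cong[OF h(2), of rho] p hc by (simp add: rho_inv rho_hom del: add_uminus_conv_diff)
      then have "- t ?\<alpha> + t ?\<beta> = rho h" by (simp add: add.assoc)
      then have "?\<alpha> = ?\<beta>" using no h(1) by (metis imageI)
      then show "X = Y" by (auto simp: fun_eq_iff)
    qed
    moreover have "range ?c \<subseteq> rcosets\<^bsub>Aut M\<^esub> K" using p by (auto simp: RCOSETS_def)
    ultimately have "(UNIV :: nat set set) \<lesssim> rcosets\<^bsub>Aut M\<^esub> K" unfolding lepoll_def by blast
    then show False using idx lesspoll_def lepoll_antisym by blast
  qed
  then have "\<exists>\<alpha> \<beta> n. \<alpha> \<noteq> \<beta> \<and> - t \<alpha> + t \<beta> \<in> rho ` K" for t :: "(nat \<Rightarrow> bool) \<Rightarrow> malg maut" by simp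
  then have "large (\<lambda>_. rho ` K)"
    unfolding large_def using rho_subgroup(1,2)[OF K] by (intro conjI allI ballI order_refl)
  from unit_interval.large_subgroup_everything[OF this] have "rho ` K = UNIV" using rho_subgroup(3)[OF K] by blast
  then have "K = topspace (weak_topology M)" using rho_image_UNIV[OF K] topspace_weak by simp
  then show "openin (weak_topology M) K" by simp
qed

text \<open>Any two elements have a difference in some member of an exhausting chain, so such a chain is
  large.\<close>

theorem uncountable_cofinality_Aut: "uncountable_cofinality (Aut M)"
  unfolding uncountable_cofinality_def
proof (rule notI, elim exE conjE)
  fix K assume K: "\<forall>n. subgroup (K n) (Aut M) \<and> K n \<noteq> carrier (Aut M)" "\<forall>n. K n \<subseteq> K (Suc n)" "carrier (Aut M) = (\<Union>n::nat. K n)"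
  have sub: "subgroup (K n) (Aut M)" for n using K(1) by blast
  have all: "\<exists>n. g \<in> rho ` K n" for g
  proof -
    obtain p where "p \<in> carrier (Aut M)" "rho p = g" by (rule rho_surj)
    then show ?thesis using K(3) by blast
  qed
  have "large (\<lambda>n. rho ` K n)"
    unfolding large_def
  proof (intro conjI allI ballI)
    show "\<exists>\<alpha> \<beta> n. \<alpha> \<noteq> \<beta> \<and> - t \<alpha> + t \<beta> \<in> rho ` K n" for t :: "(nat \<Rightarrow> bool) \<Rightarrow> malg maut"
    proof -
      have "(\<lambda>_. True) \<noteq> (\<lambda>_::nat. False)" by (simp add: fun_eq_iff)
      then show ?thesis using all by blast
    qed
    show "rho ` K n \<subseteq> rho ` K (Suc n)" for n using K(2) by (intro image_mono) blast
  qed (use rho_subgroup[OF sub] in auto)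
  then obtain n where "rho ` K n = UNIV" using unit_interval.large_subgroup_everything[of "\<lambda>n. rho ` K n"] rho_subgroup(3)[OF sub] by blast
  then have "K n = carrier (Aut M)" by (rule rho_image_UNIV[OF sub])
  then show False using K(1) by blast
qed

end

theorem theorem12:
  fixes M :: "'a measure"
  assumes "standard_nonatomic_prob_space M"
  shows "automatic_continuity TYPE('h) (Aut M) (weak_topology M) \<and>
         small_index_property (Aut M) (weak_topology M) \<and>
         uncountable_cofinality (Aut M)"
proof -
  obtain u v where uv: "u \<in> borel_measurable M" "v \<in> measurable borel M" "distr M uni u = uni" "distr uni M v = M"
    "AE x in M. v (u x) = x" "AE x in uni. u (v x) = x"
    by (rule isomorphic_to_unit_interval[OF assms])
  interpret standard_space M u v
    using assms uv by (simp add: standard_space_def standard_nonatomic_prob_space_def)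
  show ?thesis
    using automatic_continuity_Aut small_index_property_Aut uncountable_cofinality_Aut by blast
qed

end
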